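(* Let $F^2$ be a punctured surface. If diagonal flips are added to the 4-reductions as admissible operations in the family $\mathcal{F}^2(4)$ of triangulations of $F^2$, then every $4$-minimal triangulation of $F^2$ reduces, by such operations within $\mathcal{F}^2(4)$, to an irreducible triangulation in $\mathcal{F}^2(4)$.
   Context: A triangulation of a compact connected surface $F^2$ is a simple graph $G$ embedded in $F^2$ with every face bounded by a 3-cycle and any two faces sharing at most one edge; $\partial G$ triangulates $\partial F^2$ (boundary vertices/edges; others inner). A punctured surface is a closed surface minus the interior of a disk. Contracting $e=uv$ identifies $u,v$ and deletes multiple edges; $e$ is contractible if $G/e$ is a triangulation of $F^2$; $G$ is irreducible if it has no contractible edge. $\mathcal{F}^2(4)$: triangulations of $F^2$ with all degrees $\ge4$. A diagonal flip replaces an inner edge $uv$ lying in faces $uvw,uvz$ by the edge $wz$ (admissible when the result is a triangulation in $\mathcal{F}^2(4)$). Octahedron component: $v_1v_2v_3$ a cycle with $\deg v_i=4$, $a_1,a_2,a_3$ the only vertices with $a_i$ adjacent to $v_j,v_k$, $H$ induced by $\{a_i,v_i\}$; octahedron component if cycle $a_1a_2a_3$ exists and either no $v_i\in\partial G$, or exactly one $v_i\in\partial G$ and $\partial G=v_ia_ja_k$, or exactly $v_i,v_j\in\partial G$ and $\partial G=v_iv_ja_k$, or $\partial G=v_1v_2v_3$; external if two edges $a_ia_j,a_ja_k\in\partial G$. Quasi-octahedron component: either cycle $a_1a_2a_3$ exists but bounds no face, exactly one $v_i\in\partial G$, $a_ja_k\notin\partial G$; or exactly one edge $a_ia_j$ among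 $a_1a_2,a_2a_3,a_1a_3$ is missing, $v_k\in\partial G$, and all 3-cycles of $H$ are faces. 4-reductions (operations whose result is a triangulation of $F^2$ in $\mathcal{F}^2(4)$): $R_1$ edge contraction; $R_2$ deleting $v_1,v_2,v_3$ of an octahedron component, or $a_j,v_1,v_2,v_3$ of an external one with $a_ia_j,a_ja_k\in\partial G$; $R_3$ for an external octahedron with $\deg a_3=4$, $\deg a_i=6$ ($i=1$ or $2$) and face $a_1a_2v$: delete $a_3,v_1,v_2,v_3$ and insert an octahedron into face $a_1a_2v$; $R_4$ replace $G$ by $G-\{v_1,v_2,v_3\}$ or $(G-\{v_i,v_j\})/a_iv_k$ ($v_k\in\partial G$) for a quasi-octahedron component; $R_5$ for an octahedron component whose only boundary edge is $a_1a_2$ with $\deg a_2=5$, $v$ the unique neighbour of $a_2$ outside it: delete edge $a_1a_2$ (and its face) and contract $a_2v$; $R_6$ for faces $xzy,xzv$ with $xy,vz$ contractible, at least one in $\partial G$, and both in $\partial G$ or some inner vertex of the configuration of degree $\ge5$: contract $xy,vz$ simultaneously. $G$ is $4$-minimal if it admits no 4-reduction.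
   Formalization: The punctured surface is assumed not to be a closed disc (sphere minus a disk), where the claim fails: the octahedron minus a face is 4-minimal, but the disc's only irreducible triangulation is a single triangle, which is not in the family with all degrees at least 4. *)

theory Defs
  imports "HOL-Analysis.Analysis"
begin

section \<open>Punctured surfaces\<close>

text \<open>Second countability is not listed because it follows from compactness.\<close>

definition closed_surface :: "'a topology \<Rightarrow> bool" where
  "closed_surface S \<longleftrightarrow>
     topspace S \<noteq> {} \<and> compact_space S \<and> connected_space S \<and> Hausdorff_space S \<and>
     (\<forall>x\<in>topspace S. \<exists>U. openin S U \<and> x \<in> U \<and>
        subtopology S U homeomorphic_space (euclidean :: (real^2) topology))"

text \<open>
  The closed disc is a punctured surface (take a sphere for \<open>S\<close>).  Its only irreducible
  triangulation is a single triangle, so none has all degrees at least 4, although the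
  octahedron without one face triangulates it with all degrees equal to 4.
\<close>

definition punctured_surface :: "'a topology \<Rightarrow> bool" where
  "punctured_surface F \<longleftrightarrow>
     (\<exists>S d. closed_surface S \<and>
        embedding_map (top_of_set (cball 0 1 :: (real^2) set)) S d \<and>
        F = subtopology S (topspace S - d ` ball 0 1))"

section \<open>Triangulations\<close>

text \<open>
  A triangulation of a surface is given by its set \<open>T\<close> of faces, a face being the set of its
  three vertices; the graph is the 1-skeleton of \<open>T\<close>.  In a simple graph, two triangular faces
  with the same vertices would share three edges, so when any two faces share at most one edge
  the faces are determined by their vertex sets and form an abstract simplicial complex.
  That the graph is embedded in \<open>F\<close> with exactly these faces is expressed by requiring that
  the geometric realization of this complex is homeomorphic to \<open>F\<close>.  Points of the
  realization are written in barycentric coordinates.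
\<close>

definition realization :: "'v set set \<Rightarrow> ('v \<Rightarrow> real) set" where
  "realization T =
     {x. \<exists>t\<in>T. (\<forall>p. 0 \<le> x p) \<and> (\<forall>p. p \<notin> t \<longrightarrow> x p = 0) \<and> (\<Sum>p\<in>t. x p) = 1}"

definition triangulates :: "'v set set \<Rightarrow> 'a topology \<Rightarrow> bool" where
  "triangulates T F \<longleftrightarrow>
     finite T \<and> (\<forall>t\<in>T. card t = 3) \<and> top_of_set (realization T) homeomorphic_space F"

definition verts :: "'v set set \<Rightarrow> 'v set" where
  "verts T = \<Union>T"

definition edges :: "'v set set \<Rightarrow> 'v set set" where
  "edges T = {e. card e = 2 \<and> (\<exists>t\<in>T. e \<subseteq> t)}"

abbreviation adj :: "'v set set \<Rightarrow> 'v \<Rightarrow> 'v \<Rightarrow> bool" where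
  "adj T x y \<equiv> {x, y} \<in> edges T"

definition deg :: "'v set set \<Rightarrow> 'v \<Rightarrow> nat" where
  "deg T x = card {e \<in> edges T. x \<in> e}"

text \<open>The edges and the vertices of \<open>\<partial>G\<close>.\<close>

definition bd_edges :: "'v set set \<Rightarrow> 'v set set" where
  "bd_edges T = {e \<in> edges T. card {t \<in> T. e \<subseteq> t} = 1}"

definition bd_verts :: "'v set set \<Rightarrow> 'v set" where
  "bd_verts T = \<Union>(bd_edges T)"

definition triangulation4 :: "'a topology \<Rightarrow> 'v set set \<Rightarrow> bool" where
  "triangulation4 F T \<longleftrightarrow> triangulates T F \<and> (\<forall>x\<in>verts T. 4 \<le> deg T x)"

section \<open>Contractions and flips\<close>

text \<open>
  Identifying vertices by a map \<open>f\<close>: faces with two identified vertices collapse to edges and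
  parallel edges are merged.  Distinct faces that do not collapse remain distinct faces of the
  contracted graph, so if two of them receive the same vertices the result is not a
  triangulation.
\<close>

definition collapse :: "('v \<Rightarrow> 'v) \<Rightarrow> 'v set set \<Rightarrow> 'v set set" where
  "collapse f T = {s. card s = 3 \<and> (\<exists>t\<in>T. s = f ` t)}"

definition simple_collapse :: "('v \<Rightarrow> 'v) \<Rightarrow> 'v set set \<Rightarrow> bool" where
  "simple_collapse f T \<longleftrightarrow> inj_on ((`) f) {t \<in> T. card (f ` t) = 3}"

text \<open>The vertex obtained by contracting \<open>xy\<close> keeps the name \<open>x\<close>.\<close>

definition contractible_edge :: "'a topology \<Rightarrow> 'v set set \<Rightarrow> 'v \<Rightarrow> 'v \<Rightarrow> bool" where
  "contractible_edge F T x y \<longleftrightarrow>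
     adj T x y \<and> simple_collapse (id(y := x)) T \<and> triangulates (collapse (id(y := x)) T) F"

definition irreducible_triangulation :: "'a topology \<Rightarrow> 'v set set \<Rightarrow> bool" where
  "irreducible_triangulation F T \<longleftrightarrow>
     triangulates T F \<and> (\<nexists>x y. contractible_edge F T x y)"

definition diagonal_flip :: "'a topology \<Rightarrow> 'v set set \<Rightarrow> 'v set set \<Rightarrow> bool" where
  "diagonal_flip F T T' \<longleftrightarrow>
     (\<exists>x y w z. {x,y,w} \<in> T \<and> {x,y,z} \<in> T \<and> adj T x y \<and> w \<noteq> z \<and> \<not> adj T w z \<and>
        T' = (T - {{x,y,w}, {x,y,z}}) \<union> {{x,w,z}, {y,w,z}}) \<and>
     triangulation4 F T'"

section \<open>Octahedron and quasi-octahedron components\<close>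

text \<open>
  The vertices \<open>a\<^sub>1, a\<^sub>2, a\<^sub>3\<close> and \<open>v\<^sub>1, v\<^sub>2, v\<^sub>3\<close> are
  given by functions \<open>a, v\<close> restricted to the indices 1, 2, 3.
\<close>

abbreviation indices :: "nat \<Rightarrow> nat \<Rightarrow> nat \<Rightarrow> bool" where
  "indices i j k \<equiv> {i, j, k} = {1, 2, 3}"

definition cycle3 :: "'v \<Rightarrow> 'v \<Rightarrow> 'v \<Rightarrow> 'v set set" where
  "cycle3 x y z = {{x,y}, {y,z}, {x,z}}"

definition config :: "'v set set \<Rightarrow> (nat \<Rightarrow> 'v) \<Rightarrow> (nat \<Rightarrow> 'v) \<Rightarrow> bool" where
  "config T a v \<longleftrightarrow>
     distinct [a 1, a 2, a 3, v 1, v 2, v 3] \<and>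
     cycle3 (v 1) (v 2) (v 3) \<subseteq> edges T \<and>
     (\<forall>i\<in>{1,2,3}. deg T (v i) = 4) \<and>
     (\<forall>i j k. indices i j k \<longrightarrow>
        {x. x \<noteq> v i \<and> adj T x (v j) \<and> adj T x (v k)} = {a i})"

abbreviation config_verts :: "(nat \<Rightarrow> 'v) \<Rightarrow> (nat \<Rightarrow> 'v) \<Rightarrow> 'v set" where
  "config_verts a v \<equiv> {a 1, a 2, a 3, v 1, v 2, v 3}"

definition bd_indices :: "'v set set \<Rightarrow> (nat \<Rightarrow> 'v) \<Rightarrow> nat set" where
  "bd_indices T v = {i \<in> {1,2,3}. v i \<in> bd_verts T}"

definition octahedron_component :: "'v set set \<Rightarrow> (nat \<Rightarrow> 'v) \<Rightarrow> (nat \<Rightarrow> 'v) \<Rightarrow> bool" where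
  "octahedron_component T a v \<longleftrightarrow>
     config T a v \<and> cycle3 (a 1) (a 2) (a 3) \<subseteq> edges T \<and>
     (bd_indices T v = {} \<or>
      (\<exists>i j k. indices i j k \<and> bd_indices T v = {i} \<and>
         bd_edges T = cycle3 (v i) (a j) (a k)) \<or>
      (\<exists>i j k. indices i j k \<and> bd_indices T v = {i, j} \<and>
         bd_edges T = cycle3 (v i) (v j) (a k)) \<or>
      bd_edges T = cycle3 (v 1) (v 2) (v 3))"

text \<open>External octahedron component whose two boundary edges meet in \<open>a\<^sub>j\<close>.\<close>

definition external_octahedron ::
    "'v set set \<Rightarrow> (nat \<Rightarrow> 'v) \<Rightarrow> (nat \<Rightarrow> 'v) \<Rightarrow> nat \<Rightarrow> bool" where
  "external_octahedron T a v j \<longleftrightarrow>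
     octahedron_component T a v \<and>
     (\<exists>i k. indices i j k \<and> {a i, a j} \<in> bd_edges T \<and> {a j, a k} \<in> bd_edges T)"

definition quasi_octahedron_component ::
    "'v set set \<Rightarrow> (nat \<Rightarrow> 'v) \<Rightarrow> (nat \<Rightarrow> 'v) \<Rightarrow> bool" where
  "quasi_octahedron_component T a v \<longleftrightarrow>
     config T a v \<and>
     ((cycle3 (a 1) (a 2) (a 3) \<subseteq> edges T \<and> {a 1, a 2, a 3} \<notin> T \<and>
       (\<exists>i j k. indices i j k \<and> bd_indices T v = {i} \<and> {a j, a k} \<notin> bd_edges T)) \<or>
      (\<exists>i j k. indices i j k \<and>
         \<not> adj T (a i) (a j) \<and> adj T (a j) (a k) \<and> adj T (a i) (a k) \<and>
         v k \<in> bd_verts T \<and>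
         (\<forall>x\<in>config_verts a v. \<forall>y\<in>config_verts a v. \<forall>z\<in>config_verts a v.
            cycle3 x y z \<subseteq> edges T \<longrightarrow> {x,y,z} \<in> T)))"

section \<open>The 4-reductions\<close>

definition delete_verts :: "'v set \<Rightarrow> 'v set set \<Rightarrow> 'v set set" where
  "delete_verts X T = {t \<in> T. t \<inter> X = {}}"

definition red1 :: "'a topology \<Rightarrow> 'v set set \<Rightarrow> 'v set set \<Rightarrow> bool" where
  "red1 F T T' \<longleftrightarrow> (\<exists>x y. contractible_edge F T x y \<and> T' = collapse (id(y := x)) T)"

text \<open>
  If no \<open>v\<^sub>i\<close> is a boundary vertex, deleting the \<open>v\<^sub>i\<close> leaves a new face
  \<open>a\<^sub>1a\<^sub>2a\<^sub>3\<close>; otherwise the hole of the surface lies inside the cycle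
  \<open>a\<^sub>1a\<^sub>2a\<^sub>3\<close>, which becomes the boundary.
\<close>

definition red2 :: "'v set set \<Rightarrow> 'v set set \<Rightarrow> bool" where
  "red2 T T' \<longleftrightarrow>
     (\<exists>a v. octahedron_component T a v \<and>
        T' = delete_verts {v 1, v 2, v 3} T \<union>
             (if bd_indices T v = {} then {{a 1, a 2, a 3}} else {})) \<or>
     (\<exists>a v j. external_octahedron T a v j \<and>
        T' = delete_verts {a j, v 1, v 2, v 3} T)"

text \<open>The seven triangles of an octahedron inserted into the triangle \<open>b\<^sub>1b\<^sub>2b\<^sub>3\<close>.\<close>

definition octahedron_faces :: "(nat \<Rightarrow> 'v) \<Rightarrow> (nat \<Rightarrow> 'v) \<Rightarrow> 'v set set" where
  "octahedron_faces b w =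
     {{w 1, w 2, w 3}} \<union>
     {s. \<exists>i j k. indices i j k \<and> (s = {w i, w j, b k} \<or> s = {w i, b j, b k})}"

definition red3 :: "'v set set \<Rightarrow> 'v set set \<Rightarrow> bool" where
  "red3 T T' \<longleftrightarrow>
     (\<exists>a v x w. external_octahedron T a v 3 \<and>
        deg T (a 3) = 4 \<and> (deg T (a 1) = 6 \<or> deg T (a 2) = 6) \<and>
        {a 1, a 2, x} \<in> T \<and> x \<notin> config_verts a v \<and>
        distinct [w 1, w 2, w 3] \<and>
        {w 1, w 2, w 3} \<inter> (verts T - {a 3, v 1, v 2, v 3}) = {} \<and>
        T' = (delete_verts {a 3, v 1, v 2, v 3} T - {{a 1, a 2, x}}) \<union>
             octahedron_faces (a(3 := x)) w)"

text \<open>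
  Deleting \<open>v\<^sub>i\<close> and \<open>v\<^sub>j\<close> leaves the quadrilateral
  \<open>v\<^sub>ka\<^sub>ja\<^sub>ka\<^sub>i\<close>, on which \<open>v\<^sub>k\<close> has no neighbours besides
  \<open>a\<^sub>i\<close> and \<open>a\<^sub>j\<close>; contracting \<open>a\<^sub>iv\<^sub>k\<close> then turns it into the
  face \<open>a\<^sub>1a\<^sub>2a\<^sub>3\<close>.
\<close>

definition red4 :: "'v set set \<Rightarrow> 'v set set \<Rightarrow> bool" where
  "red4 T T' \<longleftrightarrow>
     (\<exists>a v. quasi_octahedron_component T a v \<and>
        (T' = delete_verts {v 1, v 2, v 3} T \<or>
         T' = delete_verts {v 1, v 2, v 3} T \<union> {{a 1, a 2, a 3}}))"

text \<open>The face at the boundary edge \<open>a\<^sub>1a\<^sub>2\<close> is \<open>a\<^sub>1a\<^sub>2v\<^sub>3\<close>.\<close>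

definition red5 :: "'v set set \<Rightarrow> 'v set set \<Rightarrow> bool" where
  "red5 T T' \<longleftrightarrow>
     (\<exists>a v x. octahedron_component T a v \<and>
        {e \<in> bd_edges T. e \<subseteq> config_verts a v} = {{a 1, a 2}} \<and>
        deg T (a 2) = 5 \<and> adj T (a 2) x \<and> x \<notin> config_verts a v \<and>
        simple_collapse (id(a 2 := x)) (T - {{a 1, a 2, v 3}}) \<and>
        T' = collapse (id(a 2 := x)) (T - {{a 1, a 2, v 3}}))"

definition red6 :: "'a topology \<Rightarrow> 'v set set \<Rightarrow> 'v set set \<Rightarrow> bool" where
  "red6 F T T' \<longleftrightarrow>
     (\<exists>x y z v. {x,z,y} \<in> T \<and> {x,z,v} \<in> T \<and> y \<noteq> v \<and>
        contractible_edge F T x y \<and> contractible_edge F T z v \<and>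
        ({x,y} \<in> bd_edges T \<or> {v,z} \<in> bd_edges T) \<and>
        ({x,y} \<in> bd_edges T \<and> {v,z} \<in> bd_edges T \<or>
         (\<exists>p\<in>{x,y,z,v}. p \<notin> bd_verts T \<and> 5 \<le> deg T p)) \<and>
        simple_collapse (id(y := x, v := z)) T \<and>
        T' = collapse (id(y := x, v := z)) T)"

definition reduction4 :: "'a topology \<Rightarrow> 'v set set \<Rightarrow> 'v set set \<Rightarrow> bool" where
  "reduction4 F T T' \<longleftrightarrow>
     (red1 F T T' \<or> red2 T T' \<or> red3 T T' \<or> red4 T T' \<or> red5 T T' \<or> red6 F T T') \<and>
     triangulation4 F T'"

definition minimal4 :: "'a topology \<Rightarrow> 'v set set \<Rightarrow> bool" where
  "minimal4 F T \<longleftrightarrow> triangulation4 F T \<and> (\<nexists>T'. reduction4 F T T')"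

end

theory Submission
  imports Defs
begin

text \<open>
  Call a triangulation with all degrees at least 4 stuck if flips and 4-reductions never lead from
  it to such a triangulation with fewer vertices.  It suffices to show that a stuck triangulation
  is irreducible, and then to induct on the number of vertices.

  Say that an edge \<open>xy\<close> satisfies the link condition if every common neighbour of \<open>x\<close> and \<open>y\<close>
  spans a face with it, and \<open>xy\<close> is a boundary edge if both of its ends are boundary vertices.
  Contracting such an edge always gives a triangulation of the surface (a bistellar argument), so
  when the triangulation is stuck a third vertex of a face at \<open>xy\<close> has degree 4.  The possible
  neighbourhoods of vertices of degree 4 are eliminated one after the other, by contracting another
  edge, by flipping an edge first, or by contracting two boundary edges simultaneously
  (\<open>R\<^sub>6\<close>); what remains is an octahedron without one face, which is a disc.  Hence a
  stuck triangulation has no edge satisfying the link condition.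

  Conversely every contractible edge satisfies the link condition.  Contraction of \<open>xy\<close> changes
  the Euler characteristic by the number of common neighbours minus the number of faces at \<open>xy\<close>,
  and the Euler characteristic of a punctured surface is determined by its first cohomology modulo
  2, which is a topological invariant because it can be computed by Alexander--Spanier cochains.
\<close>

section \<open>Bistellar exchanges\<close>

text \<open>The obstacle is the degree bound. Contracting an edge that satisfies the link condition
  costs degree only at the third vertices of its faces, one unit each, and the merged vertex keeps
  at least 3 + 3 - 2 neighbours; so it is blocked only by a third vertex of degree 4. A flip of
  \<open>xy\<close> into \<open>wz\<close> keeps the vertex set and gives \<open>w\<close> and
  \<open>z\<close> one more neighbour. It serves to lift a blocking vertex from 4 to 5, at the price
  that \<open>x\<close> and \<open>y\<close> have degree at least 5 before.

  Topology enters the case analysis through a short list of incidence facts: an edge lies in at most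
  two faces, links and the graph are connected, the boundary is nonempty and connected. They come
  from invariance of domain and hold for every triangulation of the surface, hence again after each
  flip or contraction. The links of all vertices are then paths or cycles, and the case analysis is
  finite.

  For the converse an inequality of Euler characteristics is enough: a common neighbour without a
  face would make the Euler characteristic grow under contraction, which an injection of first
  cohomology forbids.\<close>

definition minc :: "'v set \<Rightarrow> ('v \<Rightarrow> real) \<Rightarrow> real" where
  "minc A x = Min (x ` A)"

lemma continuous_minc:
  assumes "finite A" "A \<noteq> {}"
  shows "continuous_on UNIV (minc A)"
  using assms
proof (induction rule: finite_ne_induct)
  case (singleton a)
  have "minc {a} = (\<lambda>x. x a)" by (auto simp: minc_def)
  then show ?case by (simp add: continuous_on_product_coordinates)
next
  case (insert a A)
  have "minc (insert a A) = (\<lambda>x. min (x a) (minc A x))"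
    using insert by (intro ext) (simp add: minc_def)
  moreover have "continuous_on UNIV (\<lambda>x. min (x a) (minc A x))"
    using insert by (intro continuous_on_min continuous_on_product_coordinates) auto
  ultimately show ?case by simp
qed

text \<open>
  On the join of \<open>A\<close> with \<open>\<partial>B\<close> this map slides the points of the simplex \<open>A\<close>
  towards the barycentre of \<open>B\<close>; its inverse is the same map with \<open>A\<close> and \<open>B\<close> exchanged.
\<close>

definition shift :: "'v set \<Rightarrow> 'v set \<Rightarrow> ('v \<Rightarrow> real) \<Rightarrow> 'v \<Rightarrow> real" where
  "shift A B x = (\<lambda>p. x p - (if p \<in> A then minc A x else 0) +
                       (if p \<in> B then minc A x * (card A / card B) else 0))"

lemma continuous_shift:
  assumes "finite A" "A \<noteq> {}"
  shows "continuous_on S (shift A B)"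
proof -
  have m: "continuous_on UNIV (minc A)" using continuous_minc[OF assms] .
  have "continuous_on UNIV (shift A B)"
  proof (rule continuous_on_coordinatewise_then_product)
    fix i
    show "continuous_on UNIV (\<lambda>x. shift A B x i)"
      unfolding shift_def using m
      by (cases "i \<in> A"; cases "i \<in> B")
        (simp_all add: continuous_on_add continuous_on_diff continuous_on_mult_right
          continuous_on_product_coordinates divide_inverse)
  qed
  then show ?thesis using continuous_on_subset by blast
qed

lemma realizationI:
  assumes "t \<in> T" "\<And>p. 0 \<le> x p" "\<And>p. p \<notin> t \<Longrightarrow> x p = 0" "(\<Sum>p\<in>t. x p) = 1"
  shows "x \<in> realization T"
  using assms by (auto simp: realization_def)

lemma realizationE:
  assumes "x \<in> realization T"
  obtains t where "t \<in> T" "\<And>p. 0 \<le> x p" "\<And>p. p \<notin> t \<Longrightarrow> x p = 0" "(\<Sum>p\<in>t. x p) = 1"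
  using assms by (auto simp: realization_def)

lemma minc_zero:
  assumes "finite A" "A \<noteq> {}" "\<And>p. 0 \<le> x p" "a \<in> A" "x a = 0"
  shows "minc A x = 0"
  unfolding minc_def using assms by (intro Min_eqI) (auto simp: rev_image_eqI)

lemma shift_zero:
  assumes "minc A x = 0"
  shows "shift A B x = x"
  using assms by (auto simp: shift_def)

text \<open>The minimum over \<open>A\<close> is attained at some \<open>a\<close>, whose coordinate
  becomes 0, so the support moves from \<open>t\<close> to \<open>(t - {a}) \<union> B\<close>. The
  factor \<open>card A / card B\<close> in \<open>shift\<close> makes the mass taken from
  \<open>A\<close> reappear on \<open>B\<close>.\<close>

lemma shift_realization:
  assumes A: "finite A" "A \<noteq> {}" and B: "finite B" "B \<noteq> {}" and AB: "A \<inter> B = {}"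
    and fin: "\<And>t. t \<in> T \<Longrightarrow> finite t"
    and in_A: "\<And>t a. t \<in> T \<Longrightarrow> A \<subseteq> t \<Longrightarrow> a \<in> A \<Longrightarrow> (t - {a}) \<union> B \<in> T'"
    and out_A: "\<And>t. t \<in> T \<Longrightarrow> \<not> A \<subseteq> t \<Longrightarrow> t \<in> T'"
    and x: "x \<in> realization T"
  shows "shift A B x \<in> realization T'"
proof -
  obtain t where t: "t \<in> T" and x0: "\<And>p. 0 \<le> x p" and xt: "\<And>p. p \<notin> t \<Longrightarrow> x p = 0"
    and xs: "(\<Sum>p\<in>t. x p) = 1" using realizationE[OF x] by metis
  show ?thesis
  proof (cases "A \<subseteq> t")
    case False
    then obtain a where "a \<in> A" "a \<notin> t" by blast
    then have "minc A x = 0" using minc_zero[of A x, OF A x0] xt by blast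
    then have "shift A B x = x" by (rule shift_zero)
    then show ?thesis using x0 xt xs out_A[OF t False] by (auto intro!: realizationI)
  next
    case True
    let ?m = "minc A x"
    have "?m \<in> x ` A" using A by (auto simp: minc_def)
    then obtain a where a: "a \<in> A" "x a = ?m" by auto
    let ?s = "(t - {a}) \<union> B"
    have mle: "?m \<le> x p" if "p \<in> A" for p using that A by (auto simp: minc_def)
    have m0: "0 \<le> ?m" using a x0 by metis
    have aB: "a \<notin> B" using a AB by blast
    have fint: "finite t" using fin t by blast
    have "(\<Sum>p\<in>?s. shift A B x p) = (\<Sum>p\<in>t \<union> B. shift A B x p)"
      using a aB fint B by (intro sum.mono_neutral_left) (auto simp: shift_def)
    also have "\<dots> = (\<Sum>p\<in>t\<union>B. x p) - (\<Sum>p\<in>t\<union>B. if p \<in> A then ?m else 0)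
       + (\<Sum>p\<in>t\<union>B. if p \<in> B then ?m * (card A / card B) else 0)"
      by (simp add: shift_def sum.distrib sum_subtractf)
    also have "(\<Sum>p\<in>t\<union>B. x p) = 1"
      using xs xt fint B sum.mono_neutral_right[of "t \<union> B" t x] by auto
    also have "(\<Sum>p\<in>t\<union>B. if p \<in> A then ?m else 0) = card A * ?m"
    proof -
      have "(t \<union> B) \<inter> A = A" using True by blast
      then show ?thesis using fint B sum.inter_restrict[of "t \<union> B" "\<lambda>_. ?m" A] by simp
    qed
    also have "(\<Sum>p\<in>t\<union>B. if p \<in> B then ?m * (card A / card B) else 0) = card B * (?m * (card A / card B))"
    proof -
      have "(t \<union> B) \<inter> B = B" by blast
      then show ?thesis
        using fint B sum.inter_restrict[of "t \<union> B" "\<lambda>_. ?m * (card A / card B)" B] by simp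
    qed
    also have "1 - card A * ?m + card B * (?m * (card A / card B)) = 1"
      using B by simp
    finally have "(\<Sum>p\<in>?s. shift A B x p) = 1" .
    moreover have "0 \<le> shift A B x p" for p
      using x0[of p] mle[of p] m0 AB by (auto simp: shift_def)
    moreover have "shift A B x p = 0" if "p \<notin> ?s" for p
      using that xt[of p] a aB True by (auto simp: shift_def)
    ultimately show ?thesis using in_A[OF t True a(1)] by (intro realizationI) auto
  qed
qed

text \<open>No face contains \<open>B\<close>, so some \<open>b\<close> in \<open>B\<close> has
  coordinate 0 before the shift. Afterwards the minimum over \<open>B\<close> is exactly the amount
  that was added, and the reverse shift subtracts exactly this amount.\<close>

lemma shift_inverse:
  assumes A: "finite A" "A \<noteq> {}" and B: "finite B" "B \<noteq> {}" and AB: "A \<inter> B = {}"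
    and noB: "\<And>t. t \<in> T \<Longrightarrow> \<not> B \<subseteq> t"
    and x: "x \<in> realization T"
  shows "shift B A (shift A B x) = x"
proof -
  obtain t where t: "t \<in> T" and x0: "\<And>p. 0 \<le> x p" and xt: "\<And>p. p \<notin> t \<Longrightarrow> x p = 0"
    using realizationE[OF x] by metis
  obtain b where b: "b \<in> B" "b \<notin> t" using noB[OF t] by blast
  let ?k = "minc A x * (card A / card B)"
  have *: "shift A B x p = x p + ?k" if "p \<in> B" for p
    using that AB by (auto simp: shift_def)
  have "minc B (shift A B x) = ?k"
    unfolding minc_def[of B]
  proof (rule Min_eqI)
    show "finite (shift A B x ` B)" using B by simp
    show "?k \<le> y" if "y \<in> shift A B x ` B" for y using that * x0 by auto
    show "?k \<in> shift A B x ` B" using *[OF b(1)] xt[OF b(2)] b(1) by (metis add_0 image_eqI)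
  qed
  moreover have "real (card A) \<noteq> 0" "real (card B) \<noteq> 0" using A B by auto
  ultimately show ?thesis using AB by (auto simp: shift_def[of B] shift_def[of A] fun_eq_iff)
qed

text \<open>The faces containing \<open>A\<close> form the join of \<open>A\<close>, the boundary of
  \<open>B\<close> and possibly a further link; they are exchanged for the join of the boundary of
  \<open>A\<close>, \<open>B\<close> and the same link. The sizes of \<open>A\<close> and
  \<open>B\<close> are left open, so the same lemma gives a diagonal flip (two edges), the removal
  of an inner vertex of degree 3 (\<open>B\<close> a triangle) and the removal of a boundary vertex
  of degree 3 (\<open>B\<close> an edge).\<close>

lemma exchange_homeomorphic:
  assumes "finite A" "A \<noteq> {}" "finite B" "B \<noteq> {}" "A \<inter> B = {}"
    and "\<And>t. t \<in> T \<Longrightarrow> finite t" "\<And>t. t \<in> T' \<Longrightarrow> finite t"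
    and "\<And>t a. t \<in> T \<Longrightarrow> A \<subseteq> t \<Longrightarrow> a \<in> A \<Longrightarrow> (t - {a}) \<union> B \<in> T'"
    and "\<And>t. t \<in> T \<Longrightarrow> \<not> A \<subseteq> t \<Longrightarrow> t \<in> T'"
    and "\<And>t b. t \<in> T' \<Longrightarrow> B \<subseteq> t \<Longrightarrow> b \<in> B \<Longrightarrow> (t - {b}) \<union> A \<in> T"
    and "\<And>t. t \<in> T' \<Longrightarrow> \<not> B \<subseteq> t \<Longrightarrow> t \<in> T"
    and "\<And>t. t \<in> T \<Longrightarrow> \<not> B \<subseteq> t" "\<And>t. t \<in> T' \<Longrightarrow> \<not> A \<subseteq> t"
  shows "top_of_set (realization T) homeomorphic_space top_of_set (realization T')"
proof -
  have BA: "B \<inter> A = {}" using assms(5) by blast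
  have "homeomorphic_maps (top_of_set (realization T)) (top_of_set (realization T'))
          (shift A B) (shift B A)"
    unfolding homeomorphic_maps_def
    using shift_realization[OF assms(1-5) assms(6) assms(8,9)]
      shift_realization[OF assms(3,4,1,2) BA assms(7) assms(10,11)]
      shift_inverse[OF assms(1-5) assms(12)] shift_inverse[OF assms(3,4,1,2) BA assms(13)]
      continuous_shift[OF assms(1,2)] continuous_shift[OF assms(3,4)]
    by (auto simp: continuous_map_in_subtopology)
  then show ?thesis unfolding homeomorphic_space_def by blast
qed

abbreviation star :: "'v set set \<Rightarrow> 'v \<Rightarrow> 'v set set" where
  "star T y \<equiv> {t \<in> T. y \<in> t}"

lemma finite_card3: "card t = 3 \<Longrightarrow> finite t"
  by (metis card.infinite zero_neq_numeral)

lemma card3_distinct: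
  assumes "card {x, y, z} = 3"
  shows "x \<noteq> y" "y \<noteq> z" "x \<noteq> z"
  using assms by (auto simp: card_insert_if split: if_splits)

lemma homeomorphic_flip:
  assumes T3: "\<And>t. t \<in> T \<Longrightarrow> card t = 3" and d: "distinct [x, y, w, z]"
    and xyw: "{x,y,w} \<in> T" and xyz: "{x,y,z} \<in> T"
    and only: "\<And>t. t \<in> T \<Longrightarrow> x \<in> t \<Longrightarrow> y \<in> t \<Longrightarrow> t = {x,y,w} \<or> t = {x,y,z}"
    and nwz: "\<And>t. t \<in> T \<Longrightarrow> w \<in> t \<Longrightarrow> z \<in> t \<Longrightarrow> False"
  shows "top_of_set (realization T) homeomorphic_space
         top_of_set (realization ((T - {{x,y,w}, {x,y,z}}) \<union> {{x,w,z}, {y,w,z}}))"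
    (is "_ homeomorphic_space top_of_set (realization ?T')")
proof (rule exchange_homeomorphic[of "{x,y}" "{w,z}"])
  show "\<And>t. t \<in> T \<Longrightarrow> finite t" using T3 finite_card3 by blast
  then show "\<And>t. t \<in> ?T' \<Longrightarrow> finite t" by blast
  have e1: "{x,y,w} - {x} \<union> {w,z} = {y,w,z}" "{x,y,w} - {y} \<union> {w,z} = {x,w,z}"
    "{x,y,z} - {x} \<union> {w,z} = {y,w,z}" "{x,y,z} - {y} \<union> {w,z} = {x,w,z}"
    using d by auto
  have e2: "{x,w,z} - {w} \<union> {x,y} = {x,y,z}" "{x,w,z} - {z} \<union> {x,y} = {x,y,w}"
    "{y,w,z} - {w} \<union> {x,y} = {x,y,z}" "{y,w,z} - {z} \<union> {x,y} = {x,y,w}"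
    using d by auto
  show "t - {a} \<union> {w,z} \<in> ?T'" if "t \<in> T" "{x,y} \<subseteq> t" "a \<in> {x,y}" for t a
  proof -
    have "t = {x,y,w} \<or> t = {x,y,z}" using that only by blast
    then have "t - {a} \<union> {w,z} \<in> {{x,w,z}, {y,w,z}}" using that(3) e1 by auto
    then show ?thesis by (rule UnI2)
  qed
  show "t - {b} \<union> {x,y} \<in> T" if "t \<in> ?T'" "{w,z} \<subseteq> t" "b \<in> {w,z}" for t b
  proof -
    have "t = {x,w,z} \<or> t = {y,w,z}" using that nwz by blast
    then have *: "t - {b} \<union> {x,y} \<in> {{x,y,w}, {x,y,z}}" using that(3) e2 by auto
    show ?thesis by (rule subsetD[OF _ *]) (simp add: xyw xyz)
  qed
  show "\<not> {x,y} \<subseteq> t" if "t \<in> ?T'" for t using that only d by auto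
  show "t \<in> T" if "t \<in> ?T'" "\<not> {w,z} \<subseteq> t" for t using that by auto
qed (use d only nwz in auto)

section \<open>Contractions\<close>

text \<open>Links of inner and of boundary vertices share this encoding: a closed link is a list
  whose first vertex is repeated at the end, and a list of fewer than two vertices spans no
  face.\<close>

fun fan :: "'v \<Rightarrow> 'v list \<Rightarrow> 'v set set" where
  "fan y (a # b # r) = insert {y, a, b} (fan y (b # r))"
| "fan y _ = {}"

lemma fan_mem: "t \<in> fan y ns \<Longrightarrow> y \<in> t"
  by (induction y ns rule: fan.induct) auto

lemma fan_sub: "t \<in> fan y ns \<Longrightarrow> t \<subseteq> insert y (set ns)"
  by (induction y ns rule: fan.induct) auto

lemma fan_card: "distinct (y # ns) \<Longrightarrow> t \<in> fan y ns \<Longrightarrow> card t = 3"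
  by (induction y ns rule: fan.induct) auto

text \<open>Contraction of the boundary edge \<open>ys\<close> as a sequence of exchanges: each flip
  of \<open>y n1\<close> into \<open>s n2\<close> shortens the link of \<open>y\<close> by one
  vertex, and the last step removes a boundary vertex of degree 3. The final hypothesis makes every
  flip admissible, since the new edge \<open>s n2\<close> must not lie in a face already.\<close>

lemma homeomorphic_contract_path:
  assumes "\<And>t. t \<in> T \<Longrightarrow> card t = 3"
    and "star T y = fan y (s # n1 # n2 # r)"
    and "distinct (y # s # n1 # n2 # r)"
    and "\<And>t n. t \<in> T \<Longrightarrow> s \<in> t \<Longrightarrow> n \<in> t \<Longrightarrow> n \<in> set (n2 # r) \<Longrightarrow> False"
  shows "top_of_set (realization T) homeomorphic_space
         top_of_set (realization ((T - star T y) \<union> fan s (n1 # n2 # r)))"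
  using assms
proof (induction r arbitrary: n1 n2 T)
  case Nil
  have d: "distinct [y,s,n1,n2]" using Nil.prems(3) by simp
  have st: "star T y = {{y,s,n1}, {y,n1,n2}}" using Nil.prems(2) by auto
  then have yT: "t = {y,s,n1} \<or> t = {y,n1,n2}" if "t \<in> T" "y \<in> t" for t
  proof -
    have "t \<in> star T y" using that by simp
    then show ?thesis unfolding st by simp
  qed
  have yT': "{y,s,n1} \<in> T" "{y,n1,n2} \<in> T"
  proof -
    have "{{y,s,n1}, {y,n1,n2}} \<subseteq> T" unfolding st[symmetric] by auto
    then show "{y,s,n1} \<in> T" "{y,n1,n2} \<in> T" by simp_all
  qed
  have nos: False if "t \<in> T" "s \<in> t" "n2 \<in> t" for t using Nil.prems(4)[OF that] by simp
  let ?T' = "(T - star T y) \<union> {{s,n1,n2}}"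
  have "top_of_set (realization T) homeomorphic_space top_of_set (realization ?T')"
  proof (rule exchange_homeomorphic[of "{y}" "{s,n2}"])
    show "\<And>t. t \<in> T \<Longrightarrow> finite t" using Nil.prems(1) finite_card3 by blast
    then show "\<And>t. t \<in> ?T' \<Longrightarrow> finite t" by blast
    have e1: "{y,s,n1} - {y} \<union> {s,n2} = {s,n1,n2}" "{y,n1,n2} - {y} \<union> {s,n2} = {s,n1,n2}"
      using d by auto
    have e2: "{s,n1,n2} - {s} \<union> {y} = {y,n1,n2}" "{s,n1,n2} - {n2} \<union> {y} = {y,s,n1}"
      using d by auto
    show "t - {a} \<union> {s,n2} \<in> ?T'" if "t \<in> T" "{y} \<subseteq> t" "a \<in> {y}" for t a
      using yT[of t] that e1 by auto
    show "t - {b} \<union> {y} \<in> T" if "t \<in> ?T'" "{s,n2} \<subseteq> t" "b \<in> {s,n2}" for t b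
    proof -
      have "t = {s,n1,n2}" using that nos by blast
      then have *: "t - {b} \<union> {y} \<in> {{y,n1,n2}, {y,s,n1}}" using that(3) e2 by auto
      show ?thesis by (rule subsetD[OF _ *]) (simp add: yT')
    qed
    show "\<not> {y} \<subseteq> t" if "t \<in> ?T'" for t using that d by auto
    show "t \<in> T" if "t \<in> ?T'" "\<not> {s,n2} \<subseteq> t" for t using that by auto
  qed (use d nos in auto)
  then show ?case by simp
next
  case (Cons n3 r)
  have d: "distinct [y,s,n1,n2,n3]" and dr: "{y,s,n1,n2,n3} \<inter> set r = {}" "distinct r"
    using Cons.prems(3) by auto
  let ?R = "fan y (n2 # n3 # r)"
  have st: "star T y = {{y,s,n1}, {y,n1,n2}} \<union> ?R"
    using Cons.prems(2) by auto
  have Rsub: "t \<subseteq> insert y (set (n2 # n3 # r))" if "t \<in> ?R" for t using that fan_sub by fastforce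
  have yT: "t = {y,s,n1} \<or> t = {y,n1,n2} \<or> t \<in> ?R" if "t \<in> T" "y \<in> t" for t
  proof -
    have "t \<in> star T y" using that by simp
    then show ?thesis unfolding st by (simp only: Un_iff insert_iff empty_iff HOL.simp_thms disj_assoc)
  qed
  have yT': "{y,n1,s} \<in> T" "{y,n1,n2} \<in> T"
  proof -
    have "{{y,s,n1}, {y,n1,n2}} \<union> ?R \<subseteq> T" unfolding st[symmetric] by auto
    then show "{y,n1,s} \<in> T" "{y,n1,n2} \<in> T" by (simp_all add: insert_commute)
  qed
  have nos: False if "t \<in> T" "s \<in> t" "n2 \<in> t" for t using Cons.prems(4)[OF that] by simp
  let ?T1 = "(T - {{y,n1,s}, {y,n1,n2}}) \<union> {{y,s,n2}, {n1,s,n2}}"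
  have h1: "top_of_set (realization T) homeomorphic_space top_of_set (realization ?T1)"
  proof (rule homeomorphic_flip)
    show "distinct [y,n1,s,n2]" using d by auto
    show "t = {y,n1,s} \<or> t = {y,n1,n2}" if "t \<in> T" "y \<in> t" "n1 \<in> t" for t
      using yT[OF that(1,2)] Rsub[of t] that(3) d dr by (auto simp: insert_commute)
  qed (use Cons.prems(1) yT' nos in auto)
  have st1: "star ?T1 y = fan y (s # n2 # n3 # r)"
  proof -
    have "star ?T1 y = (star T y - {{y,n1,s}, {y,n1,n2}}) \<union> {{y,s,n2}}" using d by auto
    also have "\<dots> = (?R - {{y,n1,s}, {y,n1,n2}}) \<union> {{y,s,n2}}"
      unfolding st by (auto simp: insert_commute)
    also have "?R - {{y,n1,s}, {y,n1,n2}} = ?R"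
    proof -
      have "n1 \<notin> t" if "t \<in> ?R" for t using Rsub[OF that] d dr by auto
      then have "{y,n1,s} \<notin> ?R" "{y,n1,n2} \<notin> ?R" by (meson insertCI)+
      then show ?thesis by (simp only: Diff_insert0 Diff_empty simp_thms)
    qed
    finally show ?thesis by simp
  qed
  have h2: "top_of_set (realization ?T1) homeomorphic_space
         top_of_set (realization ((?T1 - star ?T1 y) \<union> fan s (n2 # n3 # r)))"
  proof (rule Cons.IH)
    show "card t = 3" if "t \<in> ?T1" for t using that Cons.prems(1) d by auto
    show "star ?T1 y = fan y (s # n2 # n3 # r)" by (rule st1)
    show "distinct (y # s # n2 # n3 # r)" using Cons.prems(3) by auto
    show False if "t \<in> ?T1" "s \<in> t" "n \<in> t" "n \<in> set (n3 # r)" for t n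
      using that Cons.prems(4)[of t n] d dr by auto
  qed
  have eq: "(?T1 - star ?T1 y) \<union> fan s (n2 # n3 # r) = (T - star T y) \<union> fan s (n1 # n2 # n3 # r)"
  proof -
    have "?T1 - star ?T1 y = (T - star T y) \<union> {{s,n1,n2}}" using d by (auto simp: insert_commute)
    then show ?thesis by auto
  qed
  then show ?case using homeomorphic_space_trans[OF h1 h2] by (simp only:)
qed

text \<open>Here the link of \<open>y\<close> is a cycle through \<open>s\<close>, and the same
  flips reduce \<open>y\<close> to an inner vertex of degree 3. The last link vertex is joined to
  \<open>s\<close> by a face at \<open>y\<close>, hence the \<open>butlast\<close>. The final
  hypothesis excludes that the triangle replacing \<open>y\<close> is already present, in which case
  the faces at \<open>y\<close> and this triangle would bound a tetrahedron.\<close>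

lemma homeomorphic_contract_cycle:
  assumes "\<And>t. t \<in> T \<Longrightarrow> card t = 3"
    and "star T y = fan y (s # n1 # n2 # r @ [s])"
    and "distinct (y # s # n1 # n2 # r)"
    and "\<And>t n. t \<in> T \<Longrightarrow> s \<in> t \<Longrightarrow> n \<in> t \<Longrightarrow> n \<in> set (butlast (n2 # r)) \<Longrightarrow> False"
    and "r = [] \<Longrightarrow> {s,n1,n2} \<notin> T"
  shows "top_of_set (realization T) homeomorphic_space
         top_of_set (realization ((T - star T y) \<union> fan s (n1 # n2 # r)))"
  using assms
proof (induction r arbitrary: n1 n2 T)
  case Nil
  have d: "distinct [y,s,n1,n2]" using Nil.prems(3) by simp
  have st: "star T y = {{y,s,n1}, {y,n1,n2}, {y,n2,s}}" using Nil.prems(2) by auto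
  then have yT: "t = {y,s,n1} \<or> t = {y,n1,n2} \<or> t = {y,n2,s}" if "t \<in> T" "y \<in> t" for t
    using that by blast
  have yT': "{y,s,n1} \<in> T" "{y,n1,n2} \<in> T" "{y,n2,s} \<in> T" using st by blast+
  have nos: "{s,n1,n2} \<notin> T" using Nil.prems(5) by simp
  have sub3: "t = {s,n1,n2}" if "t \<in> T" "{s,n1,n2} \<subseteq> t" for t
  proof -
    have "card t = 3" using Nil.prems(1) that by blast
    moreover have "card {s,n1,n2} = 3" using d by simp
    ultimately show ?thesis using that finite_card3 card_subset_eq by metis
  qed
  let ?T' = "(T - star T y) \<union> {{s,n1,n2}}"
  have "top_of_set (realization T) homeomorphic_space top_of_set (realization ?T')"
  proof (rule exchange_homeomorphic[of "{y}" "{s,n1,n2}"])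
    show "\<And>t. t \<in> T \<Longrightarrow> finite t" using Nil.prems(1) finite_card3 by blast
    then show "\<And>t. t \<in> ?T' \<Longrightarrow> finite t" by blast
    show "t - {a} \<union> {s,n1,n2} \<in> ?T'" if "t \<in> T" "{y} \<subseteq> t" "a \<in> {y}" for t a
    proof -
      have "t - {a} \<union> {s,n1,n2} = {s,n1,n2}" using yT[of t] that d by auto
      then show ?thesis by simp
    qed
    show "t - {b} \<union> {y} \<in> T" if "t \<in> ?T'" "{s,n1,n2} \<subseteq> t" "b \<in> {s,n1,n2}" for t b
    proof -
      have "t = {s,n1,n2}" using that sub3 by blast
      moreover have "{s,n1,n2} - {s} \<union> {y} = {y,n1,n2}" "{s,n1,n2} - {n1} \<union> {y} = {y,n2,s}"
        "{s,n1,n2} - {n2} \<union> {y} = {y,s,n1}" using d by auto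
      ultimately show ?thesis using that(3) yT' by auto
    qed
    show "\<not> {y} \<subseteq> t" if "t \<in> ?T'" for t using that d by auto
    show "t \<in> T" if "t \<in> ?T'" "\<not> {s,n1,n2} \<subseteq> t" for t using that by auto
    show "\<not> {s,n1,n2} \<subseteq> t" if "t \<in> T" for t using that sub3 nos by blast
  qed (use d in auto)
  then show ?case by simp
next
  case (Cons n3 r)
  have d: "distinct [y,s,n1,n2,n3]" and dr: "{y,s,n1,n2,n3} \<inter> set r = {}" "distinct r"
    using Cons.prems(3) by auto
  let ?R = "fan y (n2 # n3 # r @ [s])"
  have st: "star T y = {{y,s,n1}, {y,n1,n2}} \<union> ?R"
    using Cons.prems(2) by auto
  have Rsub: "t \<subseteq> insert y (set (n2 # n3 # r @ [s]))" if "t \<in> ?R" for t using that fan_sub by fastforce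
  have yT: "t = {y,s,n1} \<or> t = {y,n1,n2} \<or> t \<in> ?R" if "t \<in> T" "y \<in> t" for t
  proof -
    have "t \<in> star T y" using that by simp
    then show ?thesis unfolding st by (simp only: Un_iff insert_iff empty_iff HOL.simp_thms disj_assoc)
  qed
  have yT': "{y,n1,s} \<in> T" "{y,n1,n2} \<in> T"
  proof -
    have "{{y,s,n1}, {y,n1,n2}} \<union> ?R \<subseteq> T" unfolding st[symmetric] by auto
    then show "{y,n1,s} \<in> T" "{y,n1,n2} \<in> T" by (simp_all add: insert_commute)
  qed
  have nos: False if "t \<in> T" "s \<in> t" "n2 \<in> t" for t using Cons.prems(4)[OF that] by simp
  let ?T1 = "(T - {{y,n1,s}, {y,n1,n2}}) \<union> {{y,s,n2}, {n1,s,n2}}"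
  have h1: "top_of_set (realization T) homeomorphic_space top_of_set (realization ?T1)"
  proof (rule homeomorphic_flip)
    show "distinct [y,n1,s,n2]" using d by auto
    show "t = {y,n1,s} \<or> t = {y,n1,n2}" if "t \<in> T" "y \<in> t" "n1 \<in> t" for t
      using yT[OF that(1,2)] Rsub[of t] that(3) d dr by (auto simp: insert_commute)
  qed (use Cons.prems(1) yT' nos in auto)
  have st1: "star ?T1 y = fan y (s # n2 # n3 # r @ [s])"
  proof -
    have "star ?T1 y = (star T y - {{y,n1,s}, {y,n1,n2}}) \<union> {{y,s,n2}}" using d by auto
    also have "\<dots> = (?R - {{y,n1,s}, {y,n1,n2}}) \<union> {{y,s,n2}}"
      unfolding st by (auto simp: insert_commute)
    also have "?R - {{y,n1,s}, {y,n1,n2}} = ?R"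
    proof -
      have "n1 \<notin> t" if "t \<in> ?R" for t using Rsub[OF that] d dr by auto
      then have "{y,n1,s} \<notin> ?R" "{y,n1,n2} \<notin> ?R" by (meson insertCI)+
      then show ?thesis by (simp only: Diff_insert0 Diff_empty simp_thms)
    qed
    finally show ?thesis by simp
  qed
  have h2: "top_of_set (realization ?T1) homeomorphic_space
         top_of_set (realization ((?T1 - star ?T1 y) \<union> fan s (n2 # n3 # r)))"
  proof (rule Cons.IH)
    show "card t = 3" if "t \<in> ?T1" for t using that Cons.prems(1) d by auto
    show "star ?T1 y = fan y (s # n2 # n3 # r @ [s])" by (rule st1)
    show "distinct (y # s # n2 # n3 # r)" using Cons.prems(3) by auto
    show False if "t \<in> ?T1" "s \<in> t" "n \<in> t" "n \<in> set (butlast (n3 # r))" for t n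
    proof -
      have "n \<in> set (n3 # r)" using that(4) in_set_butlastD by fastforce
      then have "t \<in> T" using that d dr by auto
      moreover have "n \<in> set (butlast (n2 # n3 # r))" using that(4) by simp
      ultimately show False using that Cons.prems(4) by blast
    qed
    have *: "t \<in> T" if "t \<in> ?T1" "n3 \<in> t" for t using that d by auto
    show "{s,n2,n3} \<notin> ?T1"
    proof
      assume "{s,n2,n3} \<in> ?T1"
      then have "{s,n2,n3} \<in> T" by (rule *) simp
      then show False by (rule nos) simp_all
    qed
  qed
  have eq: "(?T1 - star ?T1 y) \<union> fan s (n2 # n3 # r) = (T - star T y) \<union> fan s (n1 # n2 # n3 # r)"
  proof -
    have "?T1 - star ?T1 y = (T - star T y) \<union> {{s,n1,n2}}" using d by (auto simp: insert_commute)
    then show ?thesis by auto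
  qed
  then show ?case using homeomorphic_space_trans[OF h1 h2] by (simp only:)
qed

section \<open>Charts and invariance of domain\<close>

text \<open>The model space is passed as a type because two dimensions occur: the plane for the
  surface and the line for the boundary circle without a point.\<close>

definition charted :: "'e::euclidean_space itself \<Rightarrow> 'a topology \<Rightarrow> bool" where
  "charted E M \<longleftrightarrow> (\<forall>x\<in>topspace M. \<exists>U. openin M U \<and> x \<in> U \<and>
     subtopology M U homeomorphic_space (euclidean :: 'e topology))"

text \<open>In a chart the map goes between open sets of the same Euclidean space, where invariance
  of domain applies; openness is then transported back through the chart.\<close>

lemma openin_image_charted:
  fixes f :: "'e::euclidean_space \<Rightarrow> 'a"
  assumes ch: "charted TYPE('e) M" and Q: "open Q"
    and f: "continuous_map (top_of_set Q) M f" and inj: "inj_on f Q"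
  shows "openin M (f ` Q)"
proof (subst openin_subopen, intro ballI)
  fix y assume "y \<in> f ` Q"
  then obtain q where q: "q \<in> Q" "y = f q" by auto
  have yM: "y \<in> topspace M" using q f by (auto simp: continuous_map_def)
  obtain U where U: "openin M U" "y \<in> U"
    and "subtopology M U homeomorphic_space (euclidean :: 'e topology)"
    using ch yM by (auto simp: charted_def)
  then obtain h where h: "homeomorphic_map (subtopology M U) (euclidean :: 'e topology) h"
    using homeomorphic_space by blast
  have UM: "U \<subseteq> topspace M" using U openin_subset by blast
  have tU: "topspace (subtopology M U) = U" using UM by auto
  have hc: "continuous_map (subtopology M U) euclidean h"
    using h homeomorphic_imp_continuous_map by blast
  have hinj: "inj_on h U" using h tU by (metis homeomorphic_imp_injective_map)
  define Q' where "Q' = {x \<in> Q. f x \<in> U}"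
  have "openin (top_of_set Q) Q'"
    using openin_continuous_map_preimage[OF f U(1)] by (simp add: Q'_def)
  then have oQ': "open Q'" using Q openin_open_trans by blast
  have fQ': "continuous_map (top_of_set Q') (subtopology M U) f"
  proof -
    have "continuous_map (top_of_set Q') M f"
      using continuous_map_from_subtopology_mono[OF f[unfolded], of Q'] by (auto simp: Q'_def)
    then show ?thesis by (auto simp: continuous_map_in_subtopology Q'_def)
  qed
  have "continuous_map (top_of_set Q') euclidean (h \<circ> f)"
    using continuous_map_compose[OF fQ' hc] .
  then have "continuous_on Q' (h \<circ> f)" by simp
  moreover have "inj_on (h \<circ> f) Q'"
  proof (rule comp_inj_on)
    show "inj_on f Q'" using inj by (auto simp: Q'_def inj_on_def)
    show "inj_on h (f ` Q')" using hinj by (rule inj_on_subset) (auto simp: Q'_def)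
  qed
  ultimately have oi: "open ((h \<circ> f) ` Q')" using oQ' invariance_of_domain by blast
  define V where "V = {z \<in> U. h z \<in> (h \<circ> f) ` Q'}"
  have "openin (subtopology M U) V"
    using openin_continuous_map_preimage[OF hc, of "(h \<circ> f) ` Q'", unfolded tU] oi
    by (simp add: V_def)
  then have oV: "openin M V" using U(1) openin_trans_full by blast
  have "V \<subseteq> f ` Q"
  proof
    fix z assume "z \<in> V"
    then obtain x where x: "x \<in> Q'" "h z = h (f x)" and z: "z \<in> U" by (auto simp: V_def)
    have "z = f x" using hinj x z by (auto simp: Q'_def inj_on_def)
    then show "z \<in> f ` Q" using x by (auto simp: Q'_def)
  qed
  moreover have "y \<in> V" using q U by (auto simp: V_def Q'_def)
  ultimately show "\<exists>T. openin M T \<and> y \<in> T \<and> T \<subseteq> f ` Q" using oV by blast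
qed

text \<open>\<open>X\<close> sits injectively in the manifold \<open>M\<close>. A Euclidean patch
  inside \<open>X\<close> has open image in \<open>M\<close>, and pulling this image back along
  \<open>g\<close> shows that the patch is open in \<open>X\<close>, so that it leaves no room for
  further points of \<open>X\<close> nearby. The exclusion of a third face at an edge and of a third
  boundary edge at a vertex rests on the second conclusion.\<close>

lemma openin_charted_embedding:
  fixes \<phi> :: "'e::euclidean_space \<Rightarrow> 'b"
  assumes "charted TYPE('e) M" and g: "continuous_map X M g" "inj_on g (topspace X)"
    and "open Q" and phi: "continuous_map (top_of_set Q) X \<phi>" "inj_on \<phi> Q"
  shows "openin M (g ` \<phi> ` Q)" "openin X (\<phi> ` Q)"
proof -
  have sub: "\<phi> ` Q \<subseteq> topspace X" using phi by (auto simp: continuous_map_def)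
  have "continuous_map (top_of_set Q) M (g \<circ> \<phi>)" using continuous_map_compose[OF phi(1) g(1)] .
  moreover have "inj_on (g \<circ> \<phi>) Q" using phi(2) g(2) sub comp_inj_on inj_on_subset by blast
  ultimately have "openin M ((g \<circ> \<phi>) ` Q)" using openin_image_charted assms(1,4) by blast
  then show o: "openin M (g ` \<phi> ` Q)" by (simp add: image_comp)
  have "{x \<in> topspace X. g x \<in> g ` \<phi> ` Q} = \<phi> ` Q"
    using sub g(2) by (auto simp: inj_on_def)
  then show "openin X (\<phi> ` Q)" using openin_continuous_map_preimage[OF g(1) o] by simp
qed

section \<open>Coordinates on a realization\<close>

definition vpt :: "'v \<Rightarrow> 'v \<Rightarrow> real" where
  "vpt v = (\<lambda>p. if p = v then 1 else 0)"

definition seg :: "('v \<Rightarrow> real) \<Rightarrow> ('v \<Rightarrow> real) \<Rightarrow> real \<Rightarrow> 'v \<Rightarrow> real" where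
  "seg x y s = (\<lambda>p. (1 - s) * x p + s * y p)"

lemma continuous_seg: "continuous_on S (seg x y)"
  unfolding seg_def by (intro continuous_on_coordinatewise_then_product continuous_intros)

lemma seg_0: "seg x y 0 = x" by (simp add: seg_def)
lemma seg_1: "seg x y 1 = y" by (simp add: seg_def)

text \<open>The way in which openness is contradicted later: a set open in the realization cannot
  avoid the beginning of a segment that leaves one of its points inside the realization.\<close>

lemma openin_meets_seg:
  assumes W: "openin (top_of_set X) W" and x: "x \<in> W"
    and s: "\<And>s. 0 < s \<Longrightarrow> s < 1 \<Longrightarrow> seg x y s \<in> X"
  shows "\<exists>s. 0 < s \<and> s < 1 \<and> seg x y s \<in> W"
proof -
  obtain G where G: "open G" "W = X \<inter> G" using W by (metis openin_open)
  have "open (seg x y -` G)"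
    using continuous_seg[of UNIV x y] G(1) open_vimage by blast
  moreover have "0 \<in> seg x y -` G" using x G by (simp add: seg_0)
  ultimately obtain e where e: "e > 0" "\<And>z. dist z 0 < e \<Longrightarrow> z \<in> seg x y -` G"
    by (metis open_dist)
  define z where "z = min (e/2) (1/2)"
  have "0 < z" "z < 1" "dist z 0 < e" using e by (auto simp: z_def dist_real_def)
  then show ?thesis using e(2)[of z] s[of z] G by auto
qed

lemma seg_realization:
  assumes "x \<in> realization {t}" "y \<in> realization {t}" "0 \<le> s" "s \<le> 1"
  shows "seg x y s \<in> realization {t}"
  using assms
  by (auto simp: realization_def seg_def sum.distrib simp flip: sum_distrib_left)

lemma realization_mono: "T \<subseteq> T' \<Longrightarrow> realization T \<subseteq> realization T'"
  by (auto simp: realization_def)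

lemma vpt_realization: "finite t \<Longrightarrow> v \<in> t \<Longrightarrow> vpt v \<in> realization {t}"
  by (auto simp: realization_def vpt_def)

definition facechart :: "'v \<Rightarrow> 'v \<Rightarrow> 'v \<Rightarrow> real \<times> real \<Rightarrow> 'v \<Rightarrow> real" where
  "facechart a b c q = (\<lambda>p. if p = a then fst q else if p = b then snd q
     else if p = c then 1 - fst q - snd q else 0)"

lemma facechart_image:
  assumes "distinct [a,b,c]"
  shows "facechart a b c ` {q. 0 < fst q \<and> 0 < snd q \<and> fst q + snd q < 1}
    = {x \<in> realization {{a,b,c}}. 0 < x a \<and> 0 < x b \<and> 0 < x c}" (is "?f ` ?Q = ?D")
proof
  show "?f ` ?Q \<subseteq> ?D" using assms by (auto simp: facechart_def realization_def)
  show "?D \<subseteq> ?f ` ?Q"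
  proof
    fix x assume "x \<in> ?D"
    then have x: "\<And>p. p \<notin> {a,b,c} \<Longrightarrow> x p = 0" "x a + x b + x c = 1" "0 < x a" "0 < x b" "0 < x c"
      using assms by (auto simp: realization_def)
    have "x = ?f (x a, x b)" using x assms by (auto simp: facechart_def fun_eq_iff)
    moreover have "(x a, x b) \<in> ?Q" using x by auto
    ultimately show "x \<in> ?f ` ?Q" by blast
  qed
qed

lemma facechart_inj:
  assumes "distinct [a,b,c]"
  shows "inj_on (facechart a b c) Q"
proof (intro inj_onI prod_eqI)
  fix q r assume e: "facechart a b c q = facechart a b c r"
  show "fst q = fst r" using fun_cong[OF e, of a] by (simp add: facechart_def)
  show "snd q = snd r" using fun_cong[OF e, of b] assms by (auto simp: facechart_def)
qed

lemma facechart_continuous: "continuous_on Q (facechart a b c)"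
proof (rule continuous_on_coordinatewise_then_product)
  fix i
  show "continuous_on Q (\<lambda>q. facechart a b c q i)"
    unfolding facechart_def
    by (cases "i = a"; cases "i = b"; cases "i = c"; simp; intro continuous_intros)
qed

text \<open>Two triangles with common edge \<open>ab\<close>, unfolded into the plane: the absolute
  value of the second coordinate is the barycentric coordinate opposite to \<open>ab\<close>, and
  its sign chooses between \<open>c\<close> and \<open>d\<close>.\<close>

definition edgechart :: "'v \<Rightarrow> 'v \<Rightarrow> 'v \<Rightarrow> 'v \<Rightarrow> real \<times> real \<Rightarrow> 'v \<Rightarrow> real" where
  "edgechart a b c d q = (\<lambda>p. if p = a then fst q else if p = b then 1 - fst q - \<bar>snd q\<bar>
     else if p = c then max (snd q) 0 else if p = d then max (- snd q) 0 else 0)"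

lemma edgechart_image:
  assumes "distinct [a,b,c,d]"
  shows "edgechart a b c d ` {q. 0 < fst q \<and> fst q + \<bar>snd q\<bar> < 1}
    = {x \<in> realization {{a,b,c},{a,b,d}}. 0 < x a \<and> 0 < x b}" (is "?f ` ?Q = ?D")
proof
  have 1: "?f q \<in> realization {{a,b,c}}" if "q \<in> ?Q" "0 \<le> snd q" for q
    using that assms by (auto simp: edgechart_def realization_def)
  have 2: "?f q \<in> realization {{a,b,d}}" if "q \<in> ?Q" "\<not> 0 \<le> snd q" for q
    using that assms by (auto simp: edgechart_def realization_def)
  have "?f q \<in> realization {{a,b,c},{a,b,d}}" if "q \<in> ?Q" for q
    using 1[OF that] 2[OF that] by (auto simp: realization_def)
  then show "?f ` ?Q \<subseteq> ?D" using assms by (auto simp: edgechart_def)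
  show "?D \<subseteq> ?f ` ?Q"
  proof
    fix x assume xD: "x \<in> ?D"
    then have x0: "0 < x a" "0 < x b" by auto
    have "(\<forall>p. p \<notin> {a,b,c} \<longrightarrow> x p = 0) \<and> 0 \<le> x c \<and> x a + x b + x c = 1 \<or>
      (\<forall>p. p \<notin> {a,b,d} \<longrightarrow> x p = 0) \<and> 0 \<le> x d \<and> x a + x b + x d = 1"
      using xD assms by (auto simp: realization_def)
    then show "x \<in> ?f ` ?Q"
    proof
      assume x: "(\<forall>p. p \<notin> {a,b,c} \<longrightarrow> x p = 0) \<and> 0 \<le> x c \<and> x a + x b + x c = 1"
      have "x = ?f (x a, x c)" using x x0 assms by (auto simp: edgechart_def fun_eq_iff)
      moreover have "(x a, x c) \<in> ?Q" using x x0 by auto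
      ultimately show ?thesis by blast
    next
      assume x: "(\<forall>p. p \<notin> {a,b,d} \<longrightarrow> x p = 0) \<and> 0 \<le> x d \<and> x a + x b + x d = 1"
      have "x = ?f (x a, - x d)" using x x0 assms by (auto simp: edgechart_def fun_eq_iff)
      moreover have "(x a, - x d) \<in> ?Q" using x x0 by auto
      ultimately show ?thesis by blast
    qed
  qed
qed

lemma edgechart_inj:
  assumes "distinct [a,b,c,d]"
  shows "inj_on (edgechart a b c d) Q"
proof (intro inj_onI prod_eqI)
  fix q r assume e: "edgechart a b c d q = edgechart a b c d r"
  show "fst q = fst r" using fun_cong[OF e, of a] by (simp add: edgechart_def)
  have "max (snd q) 0 = max (snd r) 0" using fun_cong[OF e, of c] assms by (auto simp: edgechart_def)
  moreover have "max (- snd q) 0 = max (- snd r) 0"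
    using fun_cong[OF e, of d] assms by (auto simp: edgechart_def)
  ultimately show "snd q = snd r" by (auto simp: max_def split: if_splits)
qed

lemma edgechart_continuous: "continuous_on Q (edgechart a b c d)"
proof (rule continuous_on_coordinatewise_then_product)
  fix i
  show "continuous_on Q (\<lambda>q. edgechart a b c d q i)"
    unfolding edgechart_def
    by (cases "i = a"; cases "i = b"; cases "i = c"; cases "i = d"; simp; intro continuous_intros)
qed

lemma open_facechart: "open {q::real\<times>real. 0 < fst q \<and> 0 < snd q \<and> fst q + snd q < 1}"
  by (intro open_Collect_conj open_Collect_less continuous_intros)

lemma open_edgechart: "open {q::real\<times>real. 0 < fst q \<and> fst q + \<bar>snd q\<bar> < 1}"
  by (intro open_Collect_conj open_Collect_less continuous_intros)

section \<open>Boundary edges and the boundary of a punctured surface\<close>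

text \<open>The surface is charted by \<open>real^2\<close>, while the explicit charts of faces and
  edges use pairs.\<close>

lemma charted_cong_dim:
  assumes "charted TYPE('e::euclidean_space) M" "DIM('e) = DIM('f::euclidean_space)"
  shows "charted TYPE('f) M"
proof -
  obtain f :: "'e \<Rightarrow> 'f" and g where "homeomorphism UNIV UNIV f g"
    using homeomorphic_UNIV_UNIV[where 'a='e and 'b='f] assms(2) homeomorphic_def by blast
  then have "homeomorphic_maps (euclidean :: 'e topology) (euclidean :: 'f topology) f g"
    by (auto simp: homeomorphic_maps_def homeomorphism_def)
  then have "(euclidean :: 'e topology) homeomorphic_space (euclidean :: 'f topology)"
    using homeomorphic_maps_imp_homeomorphic_space by blast
  then show ?thesis using assms(1) unfolding charted_def by (meson homeomorphic_space_trans)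
qed

locale triangle_complex =
  fixes T :: "'v set set"
  assumes fin: "finite T" and c3: "\<And>t. t \<in> T \<Longrightarrow> card t = 3"
begin

lemma face_distinct: "{a,b,c} \<in> T \<Longrightarrow> distinct [a,b,c]"
  using card3_distinct[OF c3] by simp

lemma face_at: "t \<in> T \<Longrightarrow> a \<in> t \<Longrightarrow> b \<in> t \<Longrightarrow> a \<noteq> b \<Longrightarrow> \<exists>c. t = {a,b,c} \<and> c \<noteq> a \<and> c \<noteq> b"
proof -
  assume a: "t \<in> T" "a \<in> t" "b \<in> t" "a \<noteq> b"
  have "card (t - {a,b}) = 1" using a c3[of t] finite_card3[of t] by (simp add: card_Diff_subset)
  then obtain c where "t - {a,b} = {c}" by (meson card_1_singletonE)
  then show ?thesis using a by blast
qed

lemma edge_faces: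
  assumes "{a,b} \<in> edges T"
  obtains c where "{a,b,c} \<in> T" "a \<noteq> b" "c \<noteq> a" "c \<noteq> b"
proof -
  obtain t where t: "t \<in> T" "{a,b} \<subseteq> t" "card {a,b} = 2" using assms by (auto simp: edges_def)
  then have "a \<noteq> b" by auto
  moreover obtain c where "t = {a,b,c} \<and> c \<noteq> a \<and> c \<noteq> b"
    using face_at[of t a b] t \<open>a \<noteq> b\<close> by auto
  ultimately show ?thesis using that[of c] t(1) by simp
qed

lemma face_edge: "{a,b,c} \<in> T \<Longrightarrow> {a,b} \<in> edges T"
  using face_distinct[of a b c] by (auto simp: edges_def)

lemma bd_edgeI:
  assumes "{a,b,c} \<in> T" "\<And>e. {a,b,e} \<in> T \<Longrightarrow> e = c"
  shows "{a,b} \<in> bd_edges T"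
proof -
  have di: "distinct [a,b,c]" using face_distinct[OF assms(1)] .
  have "t = {a,b,c}" if t: "t \<in> T" "{a,b} \<subseteq> t" for t
  proof -
    obtain e where e: "t = {a,b,e}" using face_at[of t a b] t di by auto
    then have "e = c" using assms(2)[of e] t(1) by simp
    then show ?thesis using e by simp
  qed
  then have "{t \<in> T. {a,b} \<subseteq> t} \<subseteq> {{a,b,c}}" by blast
  moreover have "{a,b,c} \<in> {t \<in> T. {a,b} \<subseteq> t}" using assms(1) by simp
  ultimately have "{t \<in> T. {a,b} \<subseteq> t} = {{a,b,c}}" by blast
  then show ?thesis using face_edge[OF assms(1)] by (simp add: bd_edges_def)
qed

lemma bd_edgeD:
  assumes "{a,b} \<in> bd_edges T" "{a,b,c} \<in> T" "{a,b,e} \<in> T"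
  shows "c = e"
proof -
  obtain t where "{t \<in> T. {a,b} \<subseteq> t} = {t}"
    using assms(1) by (auto simp: bd_edges_def card_1_singleton_iff)
  moreover have "{a,b,c} \<in> {t \<in> T. {a,b} \<subseteq> t}" "{a,b,e} \<in> {t \<in> T. {a,b} \<subseteq> t}"
    using assms by auto
  ultimately have "{a,b,c} = {a,b,e}" by simp
  then show ?thesis using face_distinct[OF assms(2)] face_distinct[OF assms(3)]
    by (auto simp: insert_eq_iff)
qed

lemma bd_edge_distinct: "{a,b} \<in> bd_edges T \<Longrightarrow> a \<noteq> b"
  by (auto simp: bd_edges_def edges_def)

lemma bd_edge_edge: "e \<in> bd_edges T \<Longrightarrow> e \<in> edges T"
  by (simp add: bd_edges_def)

end

locale punctured_triangulation = triangle_complex T for T :: "'v set set" +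
  fixes S :: "'a topology" and d :: "real^2 \<Rightarrow> 'a" and d'
    and g :: "('v \<Rightarrow> real) \<Rightarrow> 'a" and g'
  assumes surface: "closed_surface S"
    and dhom: "homeomorphic_maps (top_of_set (cball 0 1)) (subtopology S (d ` cball 0 1)) d d'"
    and ghom: "homeomorphic_maps (top_of_set (realization T))
                 (subtopology S (topspace S - d ` ball 0 1)) g g'"
begin

lemma chartS: "charted TYPE(real\<times>real) S"
proof -
  have "charted TYPE(real^2) S" using surface by (simp add: closed_surface_def charted_def)
  then show ?thesis by (rule charted_cong_dim) simp
qed

lemma hausdorff: "Hausdorff_space S"
  using surface by (simp add: closed_surface_def)

lemma g_cont: "continuous_map (top_of_set (realization T)) S g"
  using ghom by (simp add: homeomorphic_maps_def continuous_map_in_subtopology)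

lemma g_in: "x \<in> realization T \<Longrightarrow> g x \<in> topspace S - d ` ball 0 1"
  using ghom by (auto simp: homeomorphic_maps_def continuous_map_def)

lemma g'_g: "x \<in> realization T \<Longrightarrow> g' (g x) = x"
  using ghom by (simp add: homeomorphic_maps_def)

lemma g_g': "y \<in> topspace S \<Longrightarrow> y \<notin> d ` ball 0 1 \<Longrightarrow> g (g' y) = y"
  using ghom by (simp add: homeomorphic_maps_def)

lemma g'_in: "y \<in> topspace S \<Longrightarrow> y \<notin> d ` ball 0 1 \<Longrightarrow> g' y \<in> realization T"
  using ghom by (auto simp: homeomorphic_maps_def continuous_map_def)

lemma g_inj: "inj_on g (realization T)"
  by (rule inj_on_inverseI[of _ g']) (rule g'_g)

lemma d_cont: "continuous_map (top_of_set (cball 0 1)) S d"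
  using dhom by (simp add: homeomorphic_maps_def continuous_map_in_subtopology)

lemma d_inj: "inj_on d (cball 0 1)"
  by (rule inj_on_inverseI[of _ d']) (use dhom in \<open>simp add: homeomorphic_maps_def\<close>)

lemma d_in: "z \<in> cball 0 1 \<Longrightarrow> d z \<in> topspace S"
  using d_cont by (auto simp: continuous_map_def)

lemma closed_disc: "closedin S (d ` cball 0 1)"
proof -
  have "compactin S (d ` cball 0 1)"
    using image_compactin[OF _ d_cont, of "cball 0 1"] by (simp add: compactin_subtopology)
  then show ?thesis by (rule compactin_imp_closedin[OF hausdorff])
qed

lemma closed_sphere: "closedin S (d ` sphere 0 1)"
proof -
  have "compactin S (d ` sphere 0 1)"
    using image_compactin[OF _ d_cont, of "sphere 0 1"] by (simp add: compactin_subtopology)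
  then show ?thesis by (rule compactin_imp_closedin[OF hausdorff])
qed

text \<open>A point of the boundary circle is a limit of points of the removed open disc, which
  \<open>g\<close> does not reach, so no neighbourhood of it lies in the image of
  \<open>g\<close>.\<close>

lemma open_not_sphere:
  assumes D: "D \<subseteq> realization T" "openin S (g ` D)" and x: "x \<in> D"
  shows "g x \<notin> d ` sphere 0 1"
proof
  assume "g x \<in> d ` sphere 0 1"
  then obtain z where z: "z \<in> sphere 0 1" "g x = d z" by auto
  have "openin (top_of_set (cball 0 1)) {w \<in> cball 0 1. d w \<in> g ` D}"
    using openin_continuous_map_preimage[OF d_cont D(2)] by simp
  then obtain G where G: "open G" "{w \<in> cball 0 1. d w \<in> g ` D} = cball 0 1 \<inter> G"
    by (auto simp only: openin_open)
  have "z \<in> {w \<in> cball 0 1. d w \<in> g ` D}" using z(1) imageI[OF x, of g] by (simp add: z(2))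
  then have "z \<in> G" unfolding G(2) by simp
  moreover have "z \<in> closure (ball 0 1)" using z by (simp add: closure_ball)
  ultimately have "G \<inter> closure (ball 0 1) \<noteq> {}" by auto
  then have "G \<inter> ball 0 1 \<noteq> {}" by (simp only: open_Int_closure_eq_empty[OF G(1)] simp_thms)
  then obtain w where w: "w \<in> ball 0 1" "w \<in> G" by auto
  then have "w \<in> {w \<in> cball 0 1. d w \<in> g ` D}" unfolding G(2) by auto
  then obtain u where u: "u \<in> D" "d w = g u" by auto
  have "g u \<notin> d ` ball 0 1" using g_in[of u] D(1) u(1) by auto
  moreover have "g u \<in> d ` ball 0 1" using imageI[OF w(1), of d] unfolding u(2) .
  ultimately show False by contradiction
qed

text \<open>The boundary circle as seen in the realization. \<open>C_edge\<close> and
  \<open>bd_edge_C\<close> show that, apart from vertices, it consists of the open boundary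
  edges.\<close>

definition C where "C = {x \<in> realization T. g x \<in> d ` sphere 0 1}"

lemma cont_in:
  "continuous_on Q \<phi> \<Longrightarrow> \<phi> ` Q \<subseteq> X \<Longrightarrow> continuous_map (top_of_set Q) (top_of_set X) \<phi>"
  by (auto simp: continuous_map_in_subtopology)

lemma face_open:
  assumes "{a,b,c} \<in> T"
  defines "D \<equiv> {x \<in> realization {{a,b,c}}. 0 < x a \<and> 0 < x b \<and> 0 < x c}"
  shows "openin S (g ` D)" "D \<subseteq> realization T"
proof -
  let ?Q = "{q::real\<times>real. 0 < fst q \<and> 0 < snd q \<and> fst q + snd q < 1}"
  have di: "distinct [a,b,c]" using face_distinct[OF assms(1)] .
  have D: "facechart a b c ` ?Q = D" using facechart_image[OF di] D_def by simp
  show sub: "D \<subseteq> realization T" using assms(1) realization_mono[of "{{a,b,c}}" T] by (auto simp: D_def)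
  have "openin S (g ` facechart a b c ` ?Q)"
  proof (rule openin_charted_embedding(1)[OF chartS g_cont])
    show "inj_on g (topspace (top_of_set (realization T)))" using g_inj by simp
    show "open ?Q" by (rule open_facechart)
    show "continuous_map (top_of_set ?Q) (top_of_set (realization T)) (facechart a b c)"
      by (rule cont_in[OF facechart_continuous]) (simp only: D sub)
    show "inj_on (facechart a b c) ?Q" by (rule facechart_inj[OF di])
  qed
  then show "openin S (g ` D)" by (simp only: D)
qed

lemma edge_open:
  assumes "{a,b,c} \<in> T" "{a,b,e} \<in> T" "c \<noteq> e"
  defines "D \<equiv> {x \<in> realization {{a,b,c},{a,b,e}}. 0 < x a \<and> 0 < x b}"
  shows "openin S (g ` D)" "openin (top_of_set (realization T)) D"
proof -
  let ?Q = "{q::real\<times>real. 0 < fst q \<and> fst q + \<bar>snd q\<bar> < 1}"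
  have di: "distinct [a,b,c,e]" using assms(3) face_distinct[OF assms(1)] face_distinct[OF assms(2)] by auto
  have D: "edgechart a b c e ` ?Q = D" using edgechart_image[OF di] D_def by simp
  have sub: "D \<subseteq> realization T" using assms(1,2) realization_mono[of "{{a,b,c},{a,b,e}}" T] by (auto simp: D_def)
  have i: "inj_on g (topspace (top_of_set (realization T)))" using g_inj by simp
  have c: "continuous_map (top_of_set ?Q) (top_of_set (realization T)) (edgechart a b c e)"
    by (rule cont_in[OF edgechart_continuous]) (simp only: D sub)
  note * = openin_charted_embedding[OF chartS g_cont i open_edgechart c edgechart_inj[OF di]]
  show "openin S (g ` D)" using *(1) by (simp only: D)
  show "openin (top_of_set (realization T)) D" using *(2) by (simp only: D)
qed

text \<open>Two faces at \<open>ab\<close> already fill a neighbourhood of the midpoint of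
  \<open>ab\<close> in the realization, but the segment from there towards \<open>f\<close> leaves
  both at once.\<close>

lemma edge_le2:
  assumes "{a,b,c} \<in> T" "{a,b,e} \<in> T" "{a,b,f} \<in> T" "c \<noteq> e" "f \<noteq> c" "f \<noteq> e"
  shows False
proof -
  let ?D = "{x \<in> realization {{a,b,c},{a,b,e}}. 0 < x a \<and> 0 < x b}"
  let ?m = "seg (vpt a) (vpt b) (1/2)"
  have di: "distinct [a,b,f]" using face_distinct assms by blast
  have m1: "?m \<in> realization {{a,b,f}}" "?m \<in> realization {{a,b,c}}" 
    by (auto intro!: seg_realization vpt_realization)
  then have m: "?m \<in> ?D" using realization_mono[of "{{a,b,c}}" "{{a,b,c},{a,b,e}}"] di
    by (auto simp: seg_def vpt_def)
  have "\<exists>s>0. s < 1 \<and> seg ?m (vpt f) s \<in> ?D"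
  proof (rule openin_meets_seg[OF edge_open(2)[OF assms(1,2,4)] m])
    fix s :: real assume "0 < s" "s < 1"
    then have "seg ?m (vpt f) s \<in> realization {{a,b,f}}"
      by (intro seg_realization m1 vpt_realization) auto
    then show "seg ?m (vpt f) s \<in> realization T"
      using realization_mono[of "{{a,b,f}}" T] assms(3) by auto
  qed
  then obtain s where s: "0 < s" "seg ?m (vpt f) s \<in> ?D" by blast
  have "f \<notin> {a,b,c}" "f \<notin> {a,b,e}" using di assms by auto
  then have "seg ?m (vpt f) s f = 0" using s(2) by (auto simp: realization_def)
  then show False using s(1) di by (auto simp: seg_def vpt_def)
qed

text \<open>The interior of a face, and the interior of an edge together with the interiors of two
  faces at it, are mapped to open subsets of \<open>S\<close> and therefore avoid the
  circle.\<close>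

lemma C_edge:
  assumes x: "x \<in> C" and ab: "0 < x a" "0 < x b" "a \<noteq> b"
  shows "{a,b} \<in> bd_edges T" "p \<notin> {a,b} \<Longrightarrow> x p = 0"
proof -
  have xT: "x \<in> realization T" and gx: "g x \<in> d ` sphere 0 1" using x by (auto simp: C_def)
  obtain t where t: "t \<in> T" and x0: "\<And>p. 0 \<le> x p" and xt: "\<And>p. p \<notin> t \<Longrightarrow> x p = 0"
    and xs: "(\<Sum>p\<in>t. x p) = 1" using realizationE[OF xT] by metis
  have "a \<in> t" "b \<in> t" using ab xt by (metis less_irrefl)+
  then obtain c where c: "t = {a,b,c}" "c \<noteq> a" "c \<noteq> b" using face_at t ab by blast
  have xc: "x \<in> realization {{a,b,c}}" using x0 xt xs c by (auto simp: realization_def)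
  have c0: "x c = 0"
  proof (rule ccontr)
    assume "x c \<noteq> 0"
    then have "x \<in> {x \<in> realization {{a,b,c}}. 0 < x a \<and> 0 < x b \<and> 0 < x c}"
      using xc ab x0[of c] by simp
    moreover have "{a,b,c} \<in> T" using t unfolding c(1) .
    ultimately show False using open_not_sphere[OF face_open(2,1)] gx by blast
  qed
  show "p \<notin> {a,b} \<Longrightarrow> x p = 0" using c0 c xt by blast
  have "card {t \<in> T. {a,b} \<subseteq> t} = 1"
  proof -
    have "u = t" if u: "u \<in> T" "{a,b} \<subseteq> u" for u
    proof (rule ccontr)
      assume "u \<noteq> t"
      obtain e where e: "u = {a,b,e}" using face_at[of u a b] u ab by auto
      then have "x \<in> {x \<in> realization {{a,b,c},{a,b,e}}. 0 < x a \<and> 0 < x b}"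
        using xc ab by (auto simp: realization_def)
      moreover have "{a,b,c} \<in> T" "{a,b,e} \<in> T" "c \<noteq> e" using t c e u \<open>u \<noteq> t\<close> by auto
      ultimately show False
        using open_not_sphere[OF openin_imp_subset[OF edge_open(2)] edge_open(1)] gx by blast
    qed
    then have "{t \<in> T. {a,b} \<subseteq> t} \<subseteq> {t}" by blast
    moreover have "t \<in> {t \<in> T. {a,b} \<subseteq> t}" using t \<open>a \<in> t\<close> \<open>b \<in> t\<close> by simp
    ultimately have "{t \<in> T. {a,b} \<subseteq> t} = {t}" by blast
    then show ?thesis by simp
  qed
  then show "{a,b} \<in> bd_edges T"
    using ab(3) t \<open>a \<in> t\<close> \<open>b \<in> t\<close> by (auto simp: bd_edges_def edges_def)
qed

text \<open>If the point were off the circle, a neighbourhood of its image in \<open>S\<close> would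
  lie in the image of the single face at \<open>ab\<close>. In the barycentric coordinates of
  \<open>b\<close> and \<open>c\<close> this would be an open subset of the plane containing a point
  with second coordinate 0, hence also points where the coordinate of \<open>c\<close> is
  negative.\<close>

lemma bd_edge_C:
  assumes bd: "{a,b} \<in> bd_edges T" and x: "x \<in> realization {{a,b}}" "0 < x a" "0 < x b"
  shows "x \<in> C"
proof (rule ccontr)
  assume nC: "x \<notin> C"
  have card2: "card {a,b} = 2" and card1: "card {t \<in> T. {a,b} \<subseteq> t} = 1"
    using bd by (auto simp: bd_edges_def edges_def)
  have ab: "a \<noteq> b" using card2 by auto
  obtain t where t: "{t \<in> T. {a,b} \<subseteq> t} = {t}" using card1 by (meson card_1_singletonE)
  then have tT: "t \<in> T" "a \<in> t" "b \<in> t" by blast+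
  obtain c where c: "t = {a,b,c}" "c \<noteq> a" "c \<noteq> b" using face_at[OF tT ab] by blast
  have xT: "x \<in> realization T"
  proof (rule realizationI[OF tT(1)])
    have x0: "x p = 0" if "p \<notin> {a,b}" for p using x(1) that by (auto simp: realization_def)
    show "x p = 0" if "p \<notin> t" for p using x0 that c(1) by simp
    show "0 \<le> x p" for p using x(1) by (simp add: realization_def)
    show "(\<Sum>p\<in>t. x p) = 1" using x(1) ab c x0[of c] by (auto simp: realization_def)
  qed
  let ?R = "realization T"
  define U where "U = {y \<in> ?R. 0 < y a \<and> 0 < y b}"
  have Uc: "y p = 0" if "y \<in> U" "p \<notin> {a,b,c}" for y p
  proof -
    have yR: "y \<in> ?R" and ya: "0 < y a" "0 < y b" using that by (auto simp: U_def)
    obtain u where u: "u \<in> T" "\<And>p. p \<notin> u \<Longrightarrow> y p = 0"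
      using realizationE[OF yR] by metis
    have "{a,b} \<subseteq> u" using u(2)[of a] u(2)[of b] ya by fastforce
    then have "u = t" using t u(1) by blast
    then show ?thesis using u(2) that(2) c(1) by simp
  qed
  have Us: "y a + y b + y c = 1" if "y \<in> U" for y
  proof -
    have "y \<in> ?R" using that by (auto simp: U_def)
    then obtain u where u: "u \<in> T" "\<And>p. p \<notin> u \<Longrightarrow> y p = 0" "(\<Sum>p\<in>u. y p) = 1"
      using realizationE by metis
    have "{a,b} \<subseteq> u" using u(2)[of a] u(2)[of b] that by (force simp: U_def)
    then have "u = t" using t u(1) by blast
    then show ?thesis using u(3) c ab by (auto simp: add.assoc)
  qed
  have oU: "openin (top_of_set ?R) U"
  proof -
    have "open {y::'v\<Rightarrow>real. 0 < y a \<and> 0 < y b}"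
      by (intro open_Collect_conj open_Collect_less continuous_intros continuous_on_product_coordinates)
    moreover have "U = ?R \<inter> {y. 0 < y a \<and> 0 < y b}" by (auto simp: U_def)
    ultimately show ?thesis unfolding openin_open by (intro exI conjI)
  qed
  let ?F = "topspace S - d ` ball 0 1"
  have "openin (subtopology S ?F) (g ` U)"
    using ghom oU homeomorphic_maps_imp_map homeomorphic_imp_open_map open_map_def by metis
  then obtain V where V: "openin S V" "g ` U = V \<inter> ?F" by (auto simp: openin_subtopology)
  \<comment> \<open>Removing the closed disc from \<open>V\<close> gives an open subset of
    \<open>S\<close> inside the image of \<open>U\<close>. It contains \<open>g x\<close> because
    \<open>x\<close> is assumed to be off the circle.\<close>
  define W where "W = V - d ` cball 0 1"
  have oW: "openin S W" unfolding W_def using V(1) closed_disc by (rule openin_diff)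
  have WF: "W \<subseteq> g ` U"
    using V openin_subset[OF V(1)] by (auto simp: W_def)
  have gxW: "g x \<in> W"
  proof -
    have "x \<in> U" using x xT by (simp add: U_def)
    moreover have "g x \<notin> d ` cball 0 1"
    proof
      assume "g x \<in> d ` cball 0 1"
      then obtain z where z: "z \<in> cball 0 1" "g x = d z" by auto
      then have "z \<in> ball 0 1 \<or> z \<in> sphere 0 1" by auto
      then show False using g_in[OF xT] nC xT z(2) by (auto simp: C_def)
    qed
    ultimately show ?thesis using V(2) by (auto simp: W_def)
  qed
  obtain U1 where U1: "openin S U1" "g x \<in> U1"
    "subtopology S U1 homeomorphic_space (euclidean :: (real\<times>real) topology)"
    using chartS gxW openin_subset[OF oW] by (auto simp: charted_def)
  then obtain h k where hk: "homeomorphic_maps (subtopology S U1) (euclidean :: (real\<times>real) topology) h k"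
    by (auto simp: homeomorphic_space_def)
  have U1t: "U1 \<subseteq> topspace S" using U1(1) openin_subset by blast
  have kc: "continuous_map euclidean S k" and hk': "\<And>y. y \<in> U1 \<Longrightarrow> k (h y) = y" "\<And>r. h (k r) = r"
    using hk U1t by (auto simp: homeomorphic_maps_def continuous_map_in_subtopology)
  define Q where "Q = {r. k r \<in> W}"
  have oQ: "open Q" using openin_continuous_map_preimage[OF kc oW] by (simp add: Q_def)
  \<comment> \<open>On \<open>U\<close> the coordinates of \<open>b\<close> and \<open>c\<close>
    determine the point: that of \<open>a\<close> is the rest of the sum, and all others
    vanish.\<close>
  define \<psi> where "\<psi> = (\<lambda>r. (g' (k r) b, g' (k r) c))"
  have g'U: "g' y \<in> U" "g (g' y) = y" if yW: "y \<in> W" for y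
  proof -
    obtain u where "u \<in> U" "y = g u" using subsetD[OF WF yW] by auto
    moreover have "u \<in> ?R" using \<open>u \<in> U\<close> by (simp add: U_def)
    ultimately show "g' y \<in> U" "g (g' y) = y" using g'_g by auto
  qed
  have "continuous_map (top_of_set Q) S k" using kc by (rule continuous_map_from_subtopology)
  then have "continuous_map (top_of_set Q) (subtopology S ?F) k"
    using WF V(2) by (auto simp: continuous_map_in_subtopology Q_def)
  moreover have "continuous_map (subtopology S ?F) euclidean g'"
    using ghom by (auto simp: homeomorphic_maps_def continuous_map_in_subtopology)
  ultimately have "continuous_map (top_of_set Q) euclidean (g' \<circ> k)"
    using continuous_map_compose by blast
  then have gk: "continuous_on Q (g' \<circ> k)" by simp
  have "continuous_on Q (\<lambda>r. g' (k r) p)" for p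
    using continuous_on_compose2[where g="\<lambda>x. x p", OF continuous_on_product_coordinates gk] by simp
  then have "continuous_on Q \<psi>" unfolding \<psi>_def by (intro continuous_on_Pair) auto
  moreover have "inj_on \<psi> Q"
  proof (rule inj_onI)
    fix r s assume r: "r \<in> Q" "s \<in> Q" "\<psi> r = \<psi> s"
    have u: "g' (k r) \<in> U" "g' (k s) \<in> U" using r g'U by (auto simp: Q_def)
    have "g' (k r) p = g' (k s) p" for p
      using r(3) Uc[OF u(1), of p] Uc[OF u(2), of p] Us[OF u(1)] Us[OF u(2)]
      by (cases "p \<in> {a,b,c}") (auto simp: \<psi>_def)
    then have "g' (k r) = g' (k s)" by auto
    then have "k r = k s" using r g'U(2) by (metis Q_def mem_Collect_eq)
    then show "r = s" using hk'(2) by metis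
  qed
  ultimately have "open (\<psi> ` Q)" using oQ invariance_of_domain by blast
  moreover have hQ: "h (g x) \<in> Q" using hk' U1 gxW by (simp add: Q_def)
  ultimately obtain e where e: "e > 0" "ball (\<psi> (h (g x))) e \<subseteq> \<psi> ` Q"
    by (meson image_eqI open_contains_ball)
  have px: "\<psi> (h (g x)) = (x b, 0)"
    using hk' U1 g'_g[OF xT] x(1) c by (auto simp: \<psi>_def realization_def)
  have "(x b, - (e/2)) \<in> ball (\<psi> (h (g x))) e" using e(1) by (simp add: px dist_Pair_Pair dist_real_def)
  then obtain r where r: "r \<in> Q" "\<psi> r = (x b, - (e/2))" using e(2) by (metis (no_types, lifting) imageE subsetD)
  have "g' (k r) \<in> ?R" using r g'U by (auto simp: Q_def U_def)
  then have "0 \<le> g' (k r) c" by (auto simp: realization_def)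
  then show False using r(2) e(1) by (simp add: \<psi>_def)
qed

end

text \<open>The one-dimensional analogue of \<open>edgechart\<close>: two edges at \<open>v\<close>,
  distinguished by the sign of the parameter.\<close>

definition pathchart :: "'v \<Rightarrow> 'v \<Rightarrow> 'v \<Rightarrow> real \<Rightarrow> 'v \<Rightarrow> real" where
  "pathchart v x y s = (\<lambda>p. if p = v then 1 - \<bar>s\<bar> else if p = x then max s 0
     else if p = y then max (- s) 0 else 0)"

lemma pathchart_continuous: "continuous_on Q (pathchart v x y)"
proof (rule continuous_on_coordinatewise_then_product)
  fix i
  show "continuous_on Q (\<lambda>q. pathchart v x y q i)"
    unfolding pathchart_def
    by (cases "i = v"; cases "i = x"; cases "i = y"; simp; intro continuous_intros)
qed

lemma pathchart_inj:
  assumes "distinct [v,x,y]"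
  shows "inj_on (pathchart v x y) Q"
proof (rule inj_onI)
  fix q r assume e: "pathchart v x y q = pathchart v x y r"
  have "max q 0 = max r 0" using fun_cong[OF e, of x] assms by (auto simp: pathchart_def)
  moreover have "max (- q) 0 = max (- r) 0"
    using fun_cong[OF e, of y] assms by (auto simp: pathchart_def)
  ultimately show "q = r" by (auto simp: max_def split: if_splits)
qed

context punctured_triangulation
begin

lemma open_not_C:
  assumes D: "openin (top_of_set (realization T)) D" "D \<inter> C = {}"
  shows "openin S (g ` D)"
proof -
  let ?F = "topspace S - d ` ball 0 1"
  have DR: "D \<subseteq> realization T" using D(1) openin_imp_subset by blast
  have "openin (subtopology S ?F) (g ` D)"
    using homeomorphic_imp_open_map[OF homeomorphic_maps_imp_map[OF ghom]] D(1)
    by (simp add: open_map_def)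
  then obtain V where V: "openin S V" "g ` D = V \<inter> ?F" unfolding openin_subtopology by blast
  have ns: "y \<notin> d ` sphere 0 1" if "y \<in> g ` D" for y
    using that D(2) DR by (auto simp: C_def)
  have cb: "cball (0::real^2) 1 = ball 0 1 \<union> sphere 0 1" by auto
  have VS: "V \<subseteq> topspace S" using V(1) openin_subset by blast
  have "g ` D = V - d ` cball 0 1"
  proof (intro equalityI subsetI)
    fix y assume y: "y \<in> g ` D"
    then have "y \<in> V" "y \<notin> d ` ball 0 1" unfolding V(2) by auto
    then show "y \<in> V - d ` cball 0 1" using ns[OF y] unfolding cb image_Un by simp
  next
    fix y assume "y \<in> V - d ` cball 0 1"
    then show "y \<in> g ` D" unfolding V(2) cb image_Un using VS by auto
  qed
  then show ?thesis using openin_diff[OF V(1) closed_disc] by simp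
qed

lemma edge_realization: "{a,b} \<in> edges T \<Longrightarrow> realization {{a,b}} \<subseteq> realization T"
proof
  fix x assume e: "{a,b} \<in> edges T" and x: "x \<in> realization {{a,b}}"
  obtain c where c: "{a,b,c} \<in> T" "a \<noteq> b" "c \<noteq> a" "c \<noteq> b" using edge_faces[OF e] .
  have x0: "x p = 0" if "p \<notin> {a,b}" for p using x that by (auto simp: realization_def)
  show "x \<in> realization T"
  proof (rule realizationI[OF c(1)])
    show "x p = 0" if "p \<notin> {a,b,c}" for p using x0 that by simp
    show "0 \<le> x p" for p using x by (simp add: realization_def)
    show "(\<Sum>p\<in>{a,b,c}. x p) = 1" using x c x0[of c] by (auto simp: realization_def)
  qed
qed

lemma seg_edge:
  assumes "{a,b} \<in> edges T" "0 < s" "s < 1"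
  shows "seg (vpt a) (vpt b) s \<in> realization {{a,b}}" "seg (vpt a) (vpt b) s \<in> realization T"
    "seg (vpt a) (vpt b) s a = 1 - s" "seg (vpt a) (vpt b) s b = s"
proof -
  show 1: "seg (vpt a) (vpt b) s \<in> realization {{a,b}}"
    using assms by (intro seg_realization vpt_realization) auto
  then show "seg (vpt a) (vpt b) s \<in> realization T" using edge_realization[OF assms(1)] by blast
  have "a \<noteq> b" using assms by (auto simp: edges_def)
  then show "seg (vpt a) (vpt b) s a = 1 - s" "seg (vpt a) (vpt b) s b = s"
    by (auto simp: seg_def vpt_def)
qed

lemma vpt_T: "{a,b} \<in> edges T \<Longrightarrow> vpt a \<in> realization T"
  using edge_realization vpt_realization[of "{a,b}" a] by blast

text \<open>The circle is closed, and the vertex is a limit of interior points of its boundary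
  edge.\<close>

lemma vpt_C:
  assumes "{v,x} \<in> bd_edges T"
  shows "vpt v \<in> C"
proof (rule ccontr)
  assume nC: "vpt v \<notin> C"
  have e: "{v,x} \<in> edges T" using assms bd_edge_edge by blast
  let ?W = "{y \<in> realization T. g y \<in> topspace S - d ` sphere 0 1}"
  have "openin (top_of_set (realization T)) ?W"
    using openin_continuous_map_preimage[OF g_cont openin_diff[OF openin_topspace closed_sphere]] by simp
  moreover have "vpt v \<in> ?W" using nC vpt_T[OF e] g_in[OF vpt_T[OF e]] by (simp add: C_def)
  ultimately obtain s where s: "0 < s" "s < 1" "seg (vpt v) (vpt x) s \<in> ?W"
    using openin_meets_seg[where y="vpt x"] seg_edge(2)[OF e] by blast
  have "seg (vpt v) (vpt x) s \<in> C"
    by (rule bd_edge_C[OF assms]) (use seg_edge[OF e s(1,2)] s in auto)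
  then show False using s(3) by (simp add: C_def)
qed

lemma seg_C:
  assumes "{v,x} \<in> bd_edges T" "0 < s" "s < 1"
  shows "seg (vpt v) (vpt x) s \<in> C"
  using bd_edge_C[OF assms(1)] seg_edge[OF bd_edge_edge[OF assms(1)] assms(2,3)] assms by simp

lemma C_sphere:
  assumes "x \<in> C"
  shows "d' (g x) \<in> sphere 0 1" "d (d' (g x)) = g x"
proof -
  obtain z where z: "z \<in> sphere 0 1" "g x = d z" using assms by (auto simp: C_def)
  have "d' (d z) = z" using dhom z(1) by (simp add: homeomorphic_maps_def)
  then show "d' (g x) \<in> sphere 0 1" "d (d' (g x)) = g x" using z by simp_all
qed

text \<open>Three boundary edges at \<open>v\<close> would embed a tripod in the circle. Two of them
  form an interval, which is open in the circle by invariance of domain in dimension 1, yet points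
  of the third edge converge to \<open>v\<close>.\<close>

lemma bd_deg_le2:
  assumes "{v,x} \<in> bd_edges T" "{v,y} \<in> bd_edges T" "{v,z} \<in> bd_edges T"
    and di: "x \<noteq> y" "z \<noteq> x" "z \<noteq> y"
  shows False
proof -
  let ?m = "seg (vpt v) (vpt z) (1/2)"
  have vz: "v \<noteq> z" "v \<noteq> x" "v \<noteq> y" by (rule bd_edge_distinct, rule assms)+
  have ez: "{v,x} \<in> edges T" "{v,y} \<in> edges T" "{v,z} \<in> edges T" using assms(1-3)[THEN bd_edge_edge] .
  have mC: "?m \<in> C" by (rule seg_C[OF assms(3)]) simp_all
  let ?k = "\<lambda>w. d' (g w)"
  \<comment> \<open>The midpoint of the third edge is removed so that the circle becomes a line,
    which is a single chart.\<close>
  let ?M = "top_of_set (sphere (0::real^2) 1 - {?k ?m})"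
  let ?X = "top_of_set (C - {?m})"
  have kinj: "inj_on ?k C"
  proof (rule inj_onI)
    fix a b assume a: "a \<in> C" "b \<in> C" "?k a = ?k b"
    have "g a = d (?k a)" by (rule C_sphere(2)[OF a(1), symmetric])
    also have "\<dots> = d (?k b)" by (simp only: a(3))
    also have "\<dots> = g b" by (rule C_sphere(2)[OF a(2)])
    finally show "a = b" by (rule inj_onD[OF g_inj]) (use a(1,2) in \<open>simp_all add: C_def\<close>)
  qed
  have "?M homeomorphic_space (euclidean :: real topology)"
  proof -
    have "(sphere (0::real^2) 1 - {?k ?m}) homeomorphic (UNIV :: real set)"
      by (rule homeomorphic_punctured_sphere_affine) (use C_sphere[OF mC] in auto)
    then obtain f h where "homeomorphism (sphere (0::real^2) 1 - {?k ?m}) (UNIV :: real set) f h"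
      by (auto simp: homeomorphic_def)
    then have "homeomorphic_maps ?M (euclidean :: real topology) f h"
      by (auto simp: homeomorphic_maps_def homeomorphism_def continuous_map_in_subtopology)
    then show ?thesis by (rule homeomorphic_maps_imp_homeomorphic_space)
  qed
  then have ch: "charted TYPE(real) ?M"
    unfolding charted_def using subtopology_topspace[of ?M] openin_topspace[of ?M] by fastforce
  have kc: "continuous_map ?X ?M ?k"
  proof -
    have CR: "C - {?m} \<subseteq> realization T" by (auto simp: C_def)
    have "continuous_map ?X (top_of_set (realization T)) id"
      using CR by (auto simp: continuous_map_in_subtopology)
    then have "continuous_map ?X S (g \<circ> id)" using g_cont continuous_map_compose by blast
    moreover have "g x \<in> d ` cball 0 1" if "x \<in> C" for x
      using that sphere_cball by (fastforce simp: C_def)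
    ultimately have "continuous_map ?X (subtopology S (d ` cball 0 1)) g"
      by (auto simp: continuous_map_in_subtopology)
    moreover have "continuous_map (subtopology S (d ` cball 0 1)) euclidean d'"
      using dhom by (simp add: homeomorphic_maps_def continuous_map_in_subtopology)
    ultimately have "continuous_map ?X euclidean (d' \<circ> g)" using continuous_map_compose by blast
    moreover have "?k w \<in> sphere 0 1 - {?k ?m}" if "w \<in> C - {?m}" for w
      using C_sphere(1)[of w] that inj_onD[OF kinj, of w ?m] mC by auto
    ultimately show ?thesis by (auto simp: continuous_map_in_subtopology o_def)
  qed
  let ?Q = "{s::real. \<bar>s\<bar> < 1}"
  have oQ: "open ?Q" by (intro open_Collect_less continuous_intros)
  have phi0: "pathchart v x y s \<in> realization {{v,x}}" if "0 < s" "s < 1" for s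
    using that vz di by (auto simp: pathchart_def realization_def)
  have phi1: "pathchart v x y s \<in> realization {{v,y}}" if "s < 0" "- s < 1" for s
    using that vz di by (auto simp: pathchart_def realization_def)
  have phi: "pathchart v x y s \<in> C - {?m}" if s: "s \<in> ?Q" for s
  proof -
    have "pathchart v x y s z \<noteq> ?m z" using vz di by (auto simp: pathchart_def seg_def vpt_def)
    then have "pathchart v x y s \<noteq> ?m" by (rule contrapos_nn) (rule fun_cong)
    moreover have "pathchart v x y s \<in> C"
    proof (cases "s > 0")
      case True
      show ?thesis
        by (rule bd_edge_C[OF assms(1)]) (use True s phi0 vz in \<open>auto simp: pathchart_def\<close>)
    next
      case False
      show ?thesis
      proof (cases "s = 0")
        case True
        have "pathchart v x y s = vpt v" using True by (auto simp: pathchart_def vpt_def)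
        then show ?thesis using vpt_C[OF assms(1)] by simp
      next
        case s0: False
        show ?thesis
          by (rule bd_edge_C[OF assms(2)]) (use False s0 s phi1 vz di in \<open>auto simp: pathchart_def\<close>)
      qed
    qed
    ultimately show ?thesis by blast
  qed
  have pc: "continuous_map (top_of_set ?Q) ?X (pathchart v x y)"
    by (rule cont_in[OF pathchart_continuous]) (rule image_subsetI, rule phi)
  have ki: "inj_on ?k (topspace ?X)" by (rule inj_on_subset[OF kinj]) simp
  have dv: "distinct [v,x,y]" using vz di by simp
  have o1: "openin ?X (pathchart v x y ` ?Q)"
    by (rule openin_charted_embedding(2)[OF ch kc ki oQ pc pathchart_inj[OF dv]])
  have v1: "vpt v \<in> pathchart v x y ` ?Q"
    by (rule image_eqI[of _ _ 0]) (auto simp: pathchart_def vpt_def)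
  have s1: "seg (vpt v) ?m s \<in> C - {?m}" if s: "0 < s" "s < 1" for s
  proof -
    have e: "seg (vpt v) ?m s = seg (vpt v) (vpt z) (s/2)"
      by (auto simp: seg_def fun_eq_iff algebra_simps)
    have "seg (vpt v) (vpt z) (s/2) \<in> C" by (rule seg_C[OF assms(3)]) (use s in simp_all)
    moreover have "seg (vpt v) (vpt z) (s/2) \<noteq> ?m"
    proof
      assume "seg (vpt v) (vpt z) (s/2) = ?m"
      from fun_cong[OF this, of z] show False using vz s by (auto simp: seg_def vpt_def)
    qed
    ultimately show ?thesis unfolding e by simp
  qed
  obtain s where s: "0 < s" "s < 1" "seg (vpt v) ?m s \<in> pathchart v x y ` ?Q"
    using openin_meets_seg[OF o1 v1 s1] by auto
  then obtain q where "seg (vpt v) ?m s = pathchart v x y q" by auto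
  then have "seg (vpt v) ?m s z = pathchart v x y q z" by simp
  then show False using s(1) vz di by (auto simp: seg_def vpt_def pathchart_def)
qed

end

section \<open>Openness of stars and links without boundary edges\<close>

context punctured_triangulation
begin

lemma coord_open: "openin (top_of_set X) {x \<in> X. 0 < x p}" for X :: "('v \<Rightarrow> real) set"
proof -
  have "open {x::'v\<Rightarrow>real. 0 < x p}"
    by (intro open_Collect_less continuous_intros continuous_on_product_coordinates)
  moreover have "{x \<in> X. 0 < x p} = X \<inter> {x. 0 < x p}" by auto
  ultimately show ?thesis unfolding openin_open by (intro exI conjI)
qed

lemma coords_open: "openin (top_of_set X) {x \<in> X. \<exists>p\<in>A. 0 < x p}" for X :: "('v \<Rightarrow> real) set"
proof -
  have "{x \<in> X. \<exists>p\<in>A. 0 < x p} = (\<Union>p\<in>A. {x \<in> X. 0 < x p})" by auto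
  then show ?thesis using coord_open by (simp only:) (intro openin_Union, auto)
qed

lemma nonneg: "x \<in> realization T \<Longrightarrow> 0 \<le> x p"
  by (auto simp: realization_def)

lemma face_of_point:
  assumes "x \<in> realization T"
  obtains t where "t \<in> T" "\<And>p. 0 < x p \<Longrightarrow> p \<in> t" "\<exists>p\<in>t. 0 < x p"
proof -
  obtain t where t: "t \<in> T" "\<And>p. 0 \<le> x p" "\<And>p. p \<notin> t \<Longrightarrow> x p = 0" "(\<Sum>p\<in>t. x p) = 1"
    using realizationE[OF assms] by metis
  have "\<exists>p\<in>t. 0 < x p"
  proof (rule ccontr)
    assume "\<not> ?thesis"
    then have "(\<Sum>p\<in>t. x p) = 0" using t(2) by (intro sum.neutral) (metis less_eq_real_def)
    then show False using t(4) by simp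
  qed
  then show ?thesis using that[of t] t by (metis less_irrefl)
qed

lemma inner_edge_open:
  assumes e: "{a,b} \<in> edges T" "{a,b} \<notin> bd_edges T"
  shows "openin S (g ` {x \<in> realization T. 0 < x a \<and> 0 < x b})"
proof (rule open_not_C)
  have "{x \<in> realization T. 0 < x a \<and> 0 < x b}
      = {x \<in> realization T. 0 < x a} \<inter> {x \<in> realization T. 0 < x b}" by auto
  then show "openin (top_of_set (realization T)) {x \<in> realization T. 0 < x a \<and> 0 < x b}"
    using openin_Int[OF coord_open coord_open] by (simp only:)
  have "a \<noteq> b" using e(1) by (auto simp: edges_def)
  have False if "x \<in> C" "0 < x a" "0 < x b" for x using C_edge(1)[OF that \<open>a \<noteq> b\<close>] e(2) by simp
  then show "{x \<in> realization T. 0 < x a \<and> 0 < x b} \<inter> C = {}" by blast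
qed

lemma closed_F: "closedin S (topspace S - d ` ball 0 1)"
proof -
  have "charted TYPE(real^2) S" using surface by (simp add: closed_surface_def charted_def)
  moreover have "continuous_map (top_of_set (ball 0 1)) S d"
    using continuous_map_from_subtopology_mono[OF d_cont ball_subset_cball] .
  moreover have "inj_on d (ball 0 1)" using d_inj inj_on_subset ball_subset_cball by blast
  ultimately have "openin S (d ` ball 0 1)" using openin_image_charted open_ball by blast
  then show ?thesis by blast
qed

lemma closed_image:
  assumes "closedin (top_of_set (realization T)) L"
  shows "closedin S (g ` L)"
proof -
  have "closedin (subtopology S (topspace S - d ` ball 0 1)) (g ` L)"
    using homeomorphic_imp_closed_map[OF homeomorphic_maps_imp_map[OF ghom]] assms
    by (simp add: closed_map_def)
  then show ?thesis using closed_F closedin_trans_full by blast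
qed

text \<open>
  Otherwise the open cone from \<open>v\<close> over \<open>N\<close>, without its apex, would be a proper nonempty
  clopen part of a punctured disc about \<open>v\<close>.
\<close>

lemma link_bd_free:
  assumes N: "N \<noteq> {}" "\<And>n. n \<in> N \<Longrightarrow> {v,n} \<in> edges T" "\<And>n. n \<in> N \<Longrightarrow> {v,n} \<notin> bd_edges T"
    and cl: "\<And>n m. n \<in> N \<Longrightarrow> {v,n,m} \<in> T \<Longrightarrow> m \<in> N"
    and m: "{v,m} \<in> edges T"
  shows "m \<in> N"
proof (rule ccontr)
  assume mN: "m \<notin> N"
  let ?R = "realization T"
  let ?F = "topspace S - d ` ball 0 1"
  have vN: "v \<notin> N" using N(2) by (fastforce simp: edges_def)
  have vm: "v \<noteq> m" using m by (auto simp: edges_def)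
  define K where "K = {x \<in> ?R. 0 < x v \<and> (\<exists>n\<in>N. 0 < x n)}"
  \<comment> \<open>\<open>L\<close> is closed, and within the open star of \<open>v\<close> it is
    \<open>K\<close> together with the apex (\<open>LK\<close>, \<open>KL\<close>). So the open set
    \<open>K\<close> and the complement of \<open>L\<close> separate a punctured neighbourhood of
    \<open>v\<close>.\<close>
  define L where "L = ?R - ({x \<in> ?R. 0 < x v} \<inter> {x \<in> ?R. \<exists>p\<in>- insert v N. 0 < x p})"
  have "g ` K = (\<Union>n\<in>N. g ` {x \<in> ?R. 0 < x v \<and> 0 < x n})" by (auto simp: K_def)
  moreover have "openin S (\<Union>n\<in>N. g ` {x \<in> ?R. 0 < x v \<and> 0 < x n})"
    by (intro openin_Union) (use inner_edge_open N in auto)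
  ultimately have oK: "openin S (g ` K)" by simp
  have "closedin (top_of_set ?R) L"
  proof -
    have "closedin (top_of_set ?R) (topspace (top_of_set ?R) -
        ({x \<in> ?R. 0 < x v} \<inter> {x \<in> ?R. \<exists>p\<in>- insert v N. 0 < x p}))"
      by (intro closedin_diff closedin_topspace openin_Int coord_open coords_open)
    then show ?thesis by (simp add: L_def)
  qed
  then have cL: "closedin S (g ` L)" by (rule closed_image)
  have "openin (subtopology S ?F) (g ` {x \<in> ?R. 0 < x v})"
    using homeomorphic_imp_open_map[OF homeomorphic_maps_imp_map[OF ghom]] coord_open[of ?R v]
    by (simp add: open_map_def)
  then obtain V where V: "openin S V" "g ` {x \<in> ?R. 0 < x v} = V \<inter> ?F"
    unfolding openin_subtopology by blast
  have vR: "vpt v \<in> ?R" using vpt_T[OF m] .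
  have v1: "vpt v v = (1::real)" by (simp add: vpt_def)
  have gvV: "g (vpt v) \<in> V"
  proof -
    have "g (vpt v) \<in> g ` {x \<in> ?R. 0 < x v}" by (rule imageI) (simp add: vR v1)
    then show ?thesis unfolding V(2) by simp
  qed
  have gvS: "g (vpt v) \<in> topspace S" using g_in[OF vR] by simp
  have LK: "x \<in> K" if "x \<in> L" "0 < x v" "x \<noteq> vpt v" for x
  proof -
    have xR: "x \<in> ?R" and x0: "\<And>p. p \<notin> insert v N \<Longrightarrow> x p = 0"
      using that nonneg[of x] by (auto simp: L_def order_less_le)
    have "\<exists>n\<in>N. 0 < x n"
    proof (rule ccontr)
      assume n: "\<not> (\<exists>n\<in>N. 0 < x n)"
      then have xn: "x p = 0" if "p \<noteq> v" for p
        using x0[of p] nonneg[OF xR, of p] that by (cases "p \<in> N") force+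
      obtain t where t: "t \<in> T" "\<And>p. p \<notin> t \<Longrightarrow> x p = 0" "(\<Sum>p\<in>t. x p) = 1"
        using realizationE[OF xR] by metis
      have "v \<in> t" using t(2)[of v] that(2) by auto
      then have "(\<Sum>p\<in>t. x p) = x v"
        using xn finite_card3[OF c3[OF t(1)]] sum.remove[of t v x] by simp
      then have "x = vpt v" using t(3) xn by (auto simp: vpt_def)
      then show False using that(3) by simp
    qed
    then show ?thesis using xR that(2) by (simp add: K_def)
  qed
  have KL: "x \<in> L" "x \<noteq> vpt v" if xK: "x \<in> K" for x
  proof -
    have xR: "x \<in> ?R" and "0 < x v" using xK by (auto simp: K_def)
    obtain n where n: "n \<in> N" "0 < x n" using xK by (auto simp: K_def)
    obtain t where t: "t \<in> T" "\<And>p. 0 < x p \<Longrightarrow> p \<in> t" using face_of_point[OF xR] by metis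
    have "v \<in> t" "n \<in> t" "v \<noteq> n" using t n \<open>0 < x v\<close> vN by auto
    then obtain q where q: "t = {v,n,q}" using face_at t(1) by blast
    then have "q \<in> N" using cl[of n q] n t(1) by simp
    have "p \<in> insert v N" if "0 < x p" for p using t(2)[OF that] q \<open>q \<in> N\<close> n by auto
    then show "x \<in> L" using xR by (auto simp: L_def)
    show "x \<noteq> vpt v" using n vN by (auto simp: vpt_def split: if_splits)
  qed
  have KV: "g ` K \<subseteq> V"
  proof -
    have "g ` K \<subseteq> g ` {x \<in> ?R. 0 < x v}" by (rule image_mono) (auto simp: K_def)
    then show ?thesis unfolding V(2) by simp
  qed
  obtain U1 where U1: "openin S U1" "g (vpt v) \<in> U1"
    "subtopology S U1 homeomorphic_space (euclidean :: (real\<times>real) topology)"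
    using chartS gvS by (auto simp: charted_def)
  then obtain h k where hk: "homeomorphic_maps (subtopology S U1) (euclidean :: (real\<times>real) topology) h k"
    by (auto simp: homeomorphic_space_def)
  have U1t: "U1 \<subseteq> topspace S" using U1(1) openin_subset by blast
  have kc: "continuous_map euclidean S k" and hk': "\<And>y. y \<in> U1 \<Longrightarrow> k (h y) = y" "\<And>r. h (k r) = r"
    using hk U1t by (auto simp: homeomorphic_maps_def continuous_map_in_subtopology)
  have "open {r. k r \<in> V}" using openin_continuous_map_preimage[OF kc V(1)] by simp
  moreover have "h (g (vpt v)) \<in> {r. k r \<in> V}" using hk'(1)[OF U1(2)] gvV by simp
  ultimately obtain e where e: "e > 0" "ball (h (g (vpt v))) e \<subseteq> {r. k r \<in> V}"
    by (meson open_contains_ball)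
  define c where "c = h (g (vpt v))"
  define P where "P = k ` (ball c e - {c})"
  define W where "W = k ` ball c e"
  have kinj: "inj k" by (rule inj_on_inverseI) (rule hk'(2))
  have kcc: "k c = g (vpt v)" using hk'(1)[OF U1(2)] by (simp add: c_def)
  have PW: "P = W - {g (vpt v)}"
    using image_set_diff[OF kinj, of "ball c e" "{c}"] kcc by (simp add: P_def W_def)
  have WV: "W \<subseteq> V" unfolding W_def c_def using e(2) by auto
  have oW: "openin S W" unfolding W_def
  proof (rule openin_image_charted[OF chartS open_ball])
    show "continuous_map (top_of_set (ball c e)) S k" using kc by (rule continuous_map_from_subtopology)
    show "inj_on k (ball c e)" using kinj inj_on_subset by blast
  qed
  have "connected (ball c e - {c})" by (rule connected_punctured_ball) simp
  then have Pcon: "connectedin S P" unfolding P_def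
    using connectedin_continuous_map_image[OF kc] by simp
  have oVL: "openin S (V - g ` L)" by (rule openin_diff[OF V(1) cL])
  have cover: "P \<subseteq> g ` K \<union> (V - g ` L)"
  proof
    fix y assume y: "y \<in> P"
    show "y \<in> g ` K \<union> (V - g ` L)"
    proof (cases "y \<in> g ` L")
      case False
      then show ?thesis using y PW WV by blast
    next
      case True
      then obtain x where x: "x \<in> L" "y = g x" by auto
      have xR: "x \<in> ?R" using x(1) by (simp add: L_def)
      have "y \<in> V \<inter> ?F" using y PW WV g_in[OF xR] x(2) by auto
      then obtain x' where x': "x' \<in> ?R" "0 < x' v" "y = g x'" unfolding V(2)[symmetric] by auto
      then have "x' = x" using x xR g_inj by (metis inj_onD)
      then have "x \<in> K" using LK[OF x(1)] x' y PW x(2) by auto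
      then show ?thesis using x(2) by simp
    qed
  qed
  have disj: "g ` K \<inter> (V - g ` L) \<inter> P = {}" using KL(1) by auto
  have oWR: "openin (top_of_set ?R) {x \<in> ?R. g x \<in> W}"
    using openin_continuous_map_preimage[OF g_cont oW] by simp
  have vW: "vpt v \<in> {x \<in> ?R. g x \<in> W}"
    using vR kcc e(1) unfolding W_def by (auto intro!: image_eqI[of _ _ c])
  \<comment> \<open>Every edge at \<open>v\<close>, whether it leads into \<open>N\<close> or not,
    meets the punctured disc, so both parts of the separation are nonempty.\<close>
  have near: "\<exists>s. 0 < s \<and> s < 1 \<and> g (seg (vpt v) (vpt n) s) \<in> P" if n: "{v,n} \<in> edges T" for n
  proof -
    obtain s where s: "0 < s" "s < 1" "seg (vpt v) (vpt n) s \<in> {x \<in> ?R. g x \<in> W}"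
      using openin_meets_seg[OF oWR vW seg_edge(2)[OF n]] by auto
    have "seg (vpt v) (vpt n) s \<noteq> vpt v"
    proof
      assume "seg (vpt v) (vpt n) s = vpt v"
      then have "seg (vpt v) (vpt n) s v = vpt v v" by simp
      then show False using seg_edge(3)[OF n s(1,2)] s(1) by (simp add: vpt_def)
    qed
    then have "g (seg (vpt v) (vpt n) s) \<noteq> g (vpt v)"
      using inj_onD[OF g_inj, of "seg (vpt v) (vpt n) s" "vpt v"] s(3) vR by blast
    then show ?thesis using s PW by auto
  qed
  obtain n where n: "n \<in> N" using N(1) by blast
  obtain s where s: "0 < s" "s < 1" "g (seg (vpt v) (vpt n) s) \<in> P" using near[OF N(2)[OF n]] by blast
  have "seg (vpt v) (vpt n) s \<in> K"
    unfolding K_def using seg_edge(2,3,4)[OF N(2)[OF n] s(1,2)] s n by (auto intro!: bexI[of _ n])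
  then have KP: "g ` K \<inter> P \<noteq> {}" using s(3) by blast
  obtain s' where s': "0 < s'" "s' < 1" "g (seg (vpt v) (vpt m) s') \<in> P" using near[OF m] by blast
  let ?y = "seg (vpt v) (vpt m) s'"
  have yR: "?y \<in> ?R" using seg_edge(2)[OF m s'(1,2)] .
  have "?y \<notin> L" using seg_edge(2,3,4)[OF m s'(1,2)] s' vm mN by (auto simp: L_def intro!: bexI[of _ m])
  then have "g ?y \<notin> g ` L"
    using inj_onD[OF g_inj _ yR] by (auto simp: L_def)
  moreover have "g ?y \<in> V" using s'(3) PW WV by blast
  ultimately have "(V - g ` L) \<inter> P \<noteq> {}" using s'(3) by blast
  then show False using Pcon oK oVL cover disj KP unfolding connectedin by blast
qed

end

section \<open>Connectedness of the boundary, of the graph and of links\<close>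

context punctured_triangulation
begin

lemma pos_coord: "x \<in> realization T \<Longrightarrow> \<exists>p. 0 < x p"
  by (erule face_of_point) blast

lemma d_sphere_F:
  assumes z: "z \<in> sphere 0 1"
  shows "d z \<in> topspace S - d ` ball 0 1"
proof -
  have zc: "z \<in> cball 0 1" using z by auto
  have "d z \<notin> d ` ball 0 1"
  proof
    assume "d z \<in> d ` ball 0 1"
    then obtain w where w: "w \<in> ball 0 1" "d z = d w" by auto
    then have "z = w" using inj_onD[OF d_inj w(2) zc] by auto
    then show False using z w(1) by auto
  qed
  then show ?thesis using d_in[OF zc] by simp
qed

lemma C_image: "C = (g' \<circ> d) ` sphere 0 1"
proof (intro equalityI subsetI)
  fix x assume "x \<in> C"
  then obtain z where z: "z \<in> sphere 0 1" "g x = d z" "x \<in> realization T" by (auto simp: C_def)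
  then have "x = g' (d z)" using g'_g[of x] by simp
  then show "x \<in> (g' \<circ> d) ` sphere 0 1" using z(1) by auto
next
  fix x assume "x \<in> (g' \<circ> d) ` sphere 0 1"
  then obtain z where z: "z \<in> sphere 0 1" "x = g' (d z)" by auto
  have "x \<in> realization T" "g x = d z"
    unfolding z(2) using d_sphere_F[OF z(1)] g'_in g_g' by blast+
  then show "x \<in> C" using z(1) by (auto simp: C_def)
qed

lemma g'd_continuous: "continuous_on (sphere 0 1) (g' \<circ> d)"
proof -
  have "continuous_map (top_of_set (sphere 0 1)) S d"
    using continuous_map_from_subtopology_mono[OF d_cont sphere_cball] .
  then have "continuous_map (top_of_set (sphere 0 1)) (subtopology S (topspace S - d ` ball 0 1)) d"
    using d_sphere_F by (auto simp: continuous_map_in_subtopology)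
  moreover have "continuous_map (subtopology S (topspace S - d ` ball 0 1)) euclidean g'"
    using ghom by (auto simp: homeomorphic_maps_def continuous_map_in_subtopology)
  ultimately have "continuous_map (top_of_set (sphere 0 1)) euclidean (g' \<circ> d)"
    by (rule continuous_map_compose)
  then show ?thesis by simp
qed

lemma C_connected: "connected C"
  unfolding C_image
  by (rule connected_continuous_image[OF g'd_continuous connected_sphere]) simp

text \<open>The circle is connected, so its points cannot be divided into those supported in
  \<open>A\<close> and those supported outside. The rule is used once with boundary edges and once
  with arbitrary edges providing the closure condition.\<close>

lemma C_separation:
  assumes cl: "\<And>x a b. x \<in> C \<Longrightarrow> 0 < x a \<Longrightarrow> 0 < x b \<Longrightarrow> a \<in> A \<Longrightarrow> b \<in> A"
    and x: "x \<in> C" "a \<in> A" "0 < x a" and y: "y \<in> C" "0 < y b"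
  shows "b \<in> A"
proof (rule ccontr)
  assume b: "b \<notin> A"
  let ?E1 = "{x \<in> C. \<exists>p\<in>A. 0 < x p}" and ?E2 = "{x \<in> C. \<exists>p\<in>-A. 0 < x p}"
  have "openin (top_of_set C) ?E1" "openin (top_of_set C) ?E2" by (rule coords_open)+
  moreover have "C \<subseteq> ?E1 \<union> ?E2"
  proof
    fix x assume x: "x \<in> C"
    then have "x \<in> realization T" by (simp add: C_def)
    from pos_coord[OF this] obtain p where "0 < x p" by blast
    then show "x \<in> ?E1 \<union> ?E2" using x by auto
  qed
  moreover have "?E1 \<inter> ?E2 = {}"
  proof -
    have False if u: "u \<in> ?E1" "u \<in> ?E2" for u
    proof -
      obtain p q where "p \<in> A" "0 < u p" "q \<notin> A" "0 < u q" "u \<in> C" using u by auto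
      then show False using cl[of u p q] by simp
    qed
    then show ?thesis by blast
  qed
  moreover have "?E1 \<noteq> {}" using x by (auto intro: bexI[of _ a])
  moreover have "?E2 \<noteq> {}" using y b by (auto intro: bexI[of _ b])
  ultimately have "\<not> connected C" unfolding connected_openin not_not by (intro exI conjI)
  then show False using C_connected by contradiction
qed

lemma boundary_connected:
  assumes A: "a \<in> A" "a \<in> bd_verts T" and cl: "\<And>a b. a \<in> A \<Longrightarrow> {a,b} \<in> bd_edges T \<Longrightarrow> b \<in> A"
    and b: "b \<in> bd_verts T"
  shows "b \<in> A"
proof -
  have *: "vpt p \<in> C" if p: "p \<in> bd_verts T" for p
  proof -
    obtain e where e: "e \<in> bd_edges T" "p \<in> e" using p by (auto simp: bd_verts_def)
    then have "card e = 2" by (simp add: bd_edges_def edges_def)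
    then obtain q where "e = {p,q}" using e(2) by (auto simp: card_2_iff)
    then show ?thesis using vpt_C e(1) by blast
  qed
  have p1: "0 < vpt p p" for p :: 'v by (simp add: vpt_def)
  show ?thesis
  proof (rule C_separation[OF _ *[OF A(2)] A(1) p1 *[OF b] p1])
    fix x a b assume x: "x \<in> C" "0 < x a" "0 < x b" and a: "a \<in> A"
    show "b \<in> A"
    proof (cases "a = b")
      case False
      then show ?thesis using C_edge(1)[OF x] cl[OF a] by blast
    qed (use a in simp)
  qed
qed

text \<open>Without boundary edges the circle would consist of vertices by \<open>C_edge\<close> and
  be finite, but a finite connected set has at most one point.\<close>

lemma boundary_nonempty: "bd_edges T \<noteq> {}"
proof
  assume e: "bd_edges T = {}"
  have "C \<subseteq> vpt ` verts T"
  proof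
    fix x assume x: "x \<in> C"
    then have xR: "x \<in> realization T" by (simp add: C_def)
    obtain t where t: "t \<in> T" "\<And>p. 0 \<le> x p" "\<And>p. p \<notin> t \<Longrightarrow> x p = 0" "(\<Sum>p\<in>t. x p) = 1"
      using realizationE[OF xR] by metis
    obtain v where v: "0 < x v" using pos_coord[OF xR] by blast
    have x0: "x p = 0" if "p \<noteq> v" for p
    proof (rule ccontr)
      assume "x p \<noteq> 0"
      then have "0 < x p" using t(2)[of p] by simp
      then show False using C_edge(1)[OF x v] that e by auto
    qed
    have "v \<in> t" using v t(3)[of v] by auto
    then have "(\<Sum>p\<in>t. x p) = x v"
      using x0 finite_card3[OF c3[OF t(1)]] sum.remove[of t v x] by simp
    then have "x = vpt v" using t(4) x0 by (auto simp: vpt_def)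
    then show "x \<in> vpt ` verts T" using \<open>v \<in> t\<close> t(1) by (auto simp: verts_def)
  qed
  moreover have "finite (verts T)" using fin finite_card3[OF c3] by (auto simp: verts_def)
  ultimately have "finite C" by (meson finite_imageI finite_subset)
  moreover have "inj_on (g' \<circ> d) (sphere 0 1)"
  proof (rule inj_onI)
    fix z w assume z: "z \<in> sphere 0 1" "w \<in> sphere 0 1" "(g' \<circ> d) z = (g' \<circ> d) w"
    have "d z = d w" using g_g' d_sphere_F[OF z(1)] d_sphere_F[OF z(2)] z(3)
      by (metis DiffE comp_apply)
    then show "z = w" using inj_onD[OF d_inj, of z w] z(1,2) by auto
  qed
  ultimately have f: "finite (sphere (0::real^2) 1)" unfolding C_image by (rule finite_imageD)
  have "connected (sphere (0::real^2) 1)" by (rule connected_sphere) simp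
  then have "sphere (0::real^2) 1 = {} \<or> (\<exists>z. sphere (0::real^2) 1 = {z})"
    using f connected_finite_iff_sing by blast
  moreover have "axis 1 1 \<in> sphere (0::real^2) 1" "- axis 1 1 \<in> sphere (0::real^2) 1"
    using norm_Basis[of "axis 1 1 :: real^2"] by (simp_all add: axis_in_Basis_iff)
  ultimately have "(axis 1 1 :: real^2) = - axis 1 1" by (metis empty_iff singletonD)
  then have "(axis 1 1 :: real^2) $ 1 = (- axis 1 1 :: real^2) $ 1" by (rule arg_cong)
  then show False by (simp add: axis_def)
qed

text \<open>Connectedness is known for \<open>S\<close> and for the circle. The circle meets at most
  one side of a separation of the realization, and the other side would be clopen in
  \<open>S\<close>.\<close>

lemma connected_graph:
  assumes A: "a \<in> A" "a \<in> verts T" and cl: "\<And>a b. a \<in> A \<Longrightarrow> {a,b} \<in> edges T \<Longrightarrow> b \<in> A"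
    and b: "b \<in> verts T"
  shows "b \<in> A"
proof (rule ccontr)
  assume bA: "b \<notin> A"
  have p1: "0 < vpt p p" for p :: 'v by (simp add: vpt_def)
  have vR: "vpt p \<in> realization T" if p: "p \<in> verts T" for p
  proof -
    obtain t where t: "t \<in> T" "p \<in> t" using p by (auto simp: verts_def)
    then have "card t = 3" using c3 by simp
    then have "t \<noteq> {p}" by auto
    then obtain q where q: "q \<in> t" "q \<noteq> p" using t(2) by blast
    then have "{p,q} \<in> edges T" using t by (auto simp: edges_def)
    then show ?thesis by (rule vpt_T)
  qed
  have cl': "q \<in> A" if xR: "x \<in> realization T" and xp: "0 < x p" "0 < x q" "p \<in> A" for x p q
  proof (cases "p = q")
    case False
    obtain t where t: "t \<in> T" "\<And>p. 0 < x p \<Longrightarrow> p \<in> t" by (rule face_of_point[OF xR]) blast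
    then have "{p,q} \<in> edges T" using t(1) t(2)[OF xp(1)] t(2)[OF xp(2)] False
      by (auto simp: edges_def)
    then show ?thesis using cl xp(3) by blast
  qed (use xp in simp)
  let ?R = "realization T"
  define E where "E A = {x \<in> ?R. \<exists>p\<in>A. 0 < x p}" for A :: "'v set"
  have oE: "openin (top_of_set ?R) (E B)" for B unfolding E_def by (rule coords_open)
  have cover: "?R \<subseteq> E A \<union> E (-A)"
  proof
    fix x assume x: "x \<in> ?R"
    from pos_coord[OF this] obtain p where "0 < x p" by blast
    then show "x \<in> E A \<union> E (-A)" using x by (auto simp: E_def)
  qed
  have disj: "E A \<inter> E (-A) = {}"
  proof -
    have False if u: "u \<in> E A" "u \<in> E (-A)" for u
    proof -
      obtain p q where "p \<in> A" "0 < u p" "q \<notin> A" "0 < u q" "u \<in> ?R" using u by (auto simp: E_def)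
      then show False using cl'[of u p q] by simp
    qed
    then show ?thesis by blast
  qed
  have whole: False if B: "E B \<inter> C = {}" "E B \<inter> E (-B) = {}" "?R \<subseteq> E B \<union> E (-B)"
      and x: "x \<in> E B" and y: "y \<in> E (-B)" for B x y
  proof -
    have "openin S (g ` E B)" by (rule open_not_C[OF oE B(1)])
    moreover have "closedin S (g ` E B)"
    proof (rule closed_image)
      have "E B = ?R - E (-B)" using B(2,3) by (auto simp: E_def)
      then show "closedin (top_of_set ?R) (E B)"
        using closedin_diff[OF closedin_topspace[of "top_of_set ?R"] oE[of "-B"]] by simp
    qed
    moreover have "connected_space S" using surface by (simp add: closed_surface_def)
    ultimately have "g ` E B = {} \<or> g ` E B = topspace S" by (auto simp: connected_space_clopen_in)
    then have gE: "g ` E B = topspace S" using x by auto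
    have yR: "y \<in> ?R" using y by (simp add: E_def)
    then have "g y \<in> g ` E B" unfolding gE using g_in by blast
    then obtain u where u: "u \<in> E B" "g y = g u" by auto
    then have "y = u" using inj_onD[OF g_inj _ yR] by (auto simp: E_def)
    then show False using u(1) y B(2) by blast
  qed
  have a1: "vpt a \<in> E A" using A vR[OF A(2)] p1 by (auto simp: E_def)
  have b1: "vpt b \<in> E (-A)" using b bA vR[OF b] p1 by (auto simp: E_def)
  show False
  proof (cases "E A \<inter> C = {}")
    case True
    then show ?thesis using whole[OF True disj cover a1 b1] by simp
  next
    case False
    then obtain x p where x: "x \<in> C" "p \<in> A" "0 < x p" by (auto simp: E_def)
    have "E (-A) \<inter> C = {}"
    proof (rule ccontr)
      assume "E (-A) \<inter> C \<noteq> {}"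
      then obtain y q where y: "y \<in> C" "q \<notin> A" "0 < y q" by (auto simp: E_def)
      have "q \<in> A"
      proof (rule C_separation[OF _ x y(1,3)])
        fix u a b assume "u \<in> C" "0 < u a" "0 < u b" "a \<in> A"
        then show "b \<in> A" using cl'[of u a b] by (simp add: C_def)
      qed
      then show False using y(2) by simp
    qed
    then show ?thesis using whole[of "-A" "vpt b" "vpt a"] disj cover a1 b1 by (simp add: Int_commute Un_commute)
  qed
qed

text \<open>Double counting of the pairs of a vertex in \<open>N\<close> and a face at
  \<open>v\<close> containing it: each such face has two vertices in \<open>N\<close>, while a
  vertex of \<open>N\<close> lies in one face if its edge to \<open>v\<close> is a boundary edge and
  in two otherwise.\<close>

lemma even_bd_closed:
  assumes cl: "\<And>n m. n \<in> N \<Longrightarrow> {v,n,m} \<in> T \<Longrightarrow> m \<in> N"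
    and N: "\<And>n. n \<in> N \<Longrightarrow> {v,n} \<in> edges T"
  shows "even (card {n \<in> N. {v,n} \<in> bd_edges T})"
proof -
  have vN: "v \<notin> N" using N by (fastforce simp: edges_def)
  have "N \<subseteq> verts T"
  proof
    fix n assume "n \<in> N"
    then have "{v,n} \<in> edges T" by (rule N)
    then show "n \<in> verts T" by (auto simp: edges_def verts_def)
  qed
  moreover have "finite (verts T)" using fin finite_card3[OF c3] by (auto simp: verts_def)
  ultimately have fN: "finite N" by (rule finite_subset)
  define R where "R = {t \<in> T. v \<in> t \<and> (\<exists>n\<in>N. n \<in> t)}"
  have fR: "finite R" using fin by (simp add: R_def)
  have "(\<Sum>n\<in>N. card {t \<in> R. n \<in> t}) = (\<Sum>t\<in>R. 2)"
  proof (rule sum_multicount_gen[OF fN fR], intro ballI)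
    fix t assume t: "t \<in> R"
    then obtain n where n: "n \<in> N" "n \<in> t" "v \<in> t" "t \<in> T" by (auto simp: R_def)
    have "v \<noteq> n" using n vN by auto
    then obtain m where m: "t = {v,n,m}" "m \<noteq> v" "m \<noteq> n" using face_at[OF n(4,3,2)] by auto
    have "{v,n,m} \<in> T" using n(4) unfolding m(1) .
    then have "m \<in> N" using cl n(1) by blast
    then have "{i \<in> N. i \<in> t} = {n,m}" using m(1) n(1) vN by auto
    then show "card {i \<in> N. i \<in> t} = 2" using m by simp
  qed
  then have ev: "even (\<Sum>n\<in>N. card {t \<in> R. n \<in> t})" by simp
  have cnt: "card {t \<in> R. n \<in> t} = (if {v,n} \<in> bd_edges T then 1 else 2)" if n: "n \<in> N" for n
  proof -
    have Rn: "{t \<in> R. n \<in> t} = {t \<in> T. {v,n} \<subseteq> t}" using n by (auto simp: R_def)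
    have e: "{v,n} \<in> edges T" using N[OF n] .
    show ?thesis
    proof (cases "{v,n} \<in> bd_edges T")
      case True
      then show ?thesis unfolding Rn by (simp add: bd_edges_def)
    next
      case False
      obtain c where c: "{v,n,c} \<in> T" "v \<noteq> n" "c \<noteq> v" "c \<noteq> n" using edge_faces[OF e] .
      obtain f where f: "{v,n,f} \<in> T" "f \<noteq> c" using bd_edgeI[OF c(1)] False by blast
      have df: "distinct [v,n,f]" using face_distinct[OF f(1)] .
      have "{t \<in> T. {v,n} \<subseteq> t} \<subseteq> {{v,n,c},{v,n,f}}"
      proof
        fix t assume "t \<in> {t \<in> T. {v,n} \<subseteq> t}"
        then have t: "t \<in> T" "v \<in> t" "n \<in> t" by auto
        obtain q where q: "t = {v,n,q}" using face_at[OF t c(2)] by auto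
        have "{v,n,q} \<in> T" using t(1) unfolding q .
        then have "q = c \<or> q = f" using edge_le2[OF c(1) f(1)] f(2) by metis
        then show "t \<in> {{v,n,c},{v,n,f}}" unfolding q by auto
      qed
      moreover have "{{v,n,c},{v,n,f}} \<subseteq> {t \<in> T. {v,n} \<subseteq> t}" using c(1) f(1) by simp
      ultimately have "{t \<in> T. {v,n} \<subseteq> t} = {{v,n,c},{v,n,f}}" by (rule equalityI)
      moreover have "{v,n,c} \<noteq> {v,n,f}"
      proof
        assume "{v,n,c} = {v,n,f}"
        then have "c \<in> {v,n,f}" by blast
        then show False using c f(2) by simp
      qed
      ultimately show ?thesis unfolding Rn using False by simp
    qed
  qed
  let ?B = "{n \<in> N. {v,n} \<in> bd_edges T}" and ?I = "{n \<in> N. {v,n} \<notin> bd_edges T}"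
  have "(\<Sum>n\<in>N. card {t \<in> R. n \<in> t}) = (\<Sum>n\<in>N. if {v,n} \<in> bd_edges T then 1 else 2)"
    by (rule sum.cong) (simp_all add: cnt)
  also have "\<dots> = card ?B + 2 * card ?I"
    using fN by (simp add: sum.If_cases Int_def)
  finally show ?thesis using ev by simp
qed

text \<open>
  By parity, every union of components of the link that meets the boundary accounts for at least
  two boundary edges at \<open>v\<close>, and there are at most two.
\<close>

lemma link_connected:
  assumes N: "N \<noteq> {}" "\<And>n. n \<in> N \<Longrightarrow> {v,n} \<in> edges T"
    and cl: "\<And>n m. n \<in> N \<Longrightarrow> {v,n,m} \<in> T \<Longrightarrow> m \<in> N"
    and m: "{v,m} \<in> edges T"
  shows "m \<in> N"
proof (rule ccontr)
  assume mN: "m \<notin> N"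
  have two: "\<exists>x y. x \<in> N \<and> y \<in> N \<and> x \<noteq> y \<and> {v,x} \<in> bd_edges T \<and> {v,y} \<in> bd_edges T"
    if N: "N \<noteq> {}" "\<And>n. n \<in> N \<Longrightarrow> {v,n} \<in> edges T"
      and cl: "\<And>n m. n \<in> N \<Longrightarrow> {v,n,m} \<in> T \<Longrightarrow> m \<in> N" and m: "{v,m} \<in> edges T" "m \<notin> N" for N m
  proof -
    have "\<exists>x\<in>N. {v,x} \<in> bd_edges T"
    proof (rule ccontr)
      assume nb: "\<not> (\<exists>x\<in>N. {v,x} \<in> bd_edges T)"
      have "m \<in> N"
      proof (rule link_bd_free[OF N(1) _ _ _ m(1)])
        show "{v,n} \<in> edges T" if "n \<in> N" for n using N(2)[OF that] .
        show "{v,n} \<notin> bd_edges T" if "n \<in> N" for n using nb that by simp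
        show "q \<in> N" if "n \<in> N" "{v,n,q} \<in> T" for n q using cl[OF that] .
      qed
      then show False using m(2) by contradiction
    qed
    then obtain x where x: "x \<in> N" "{v,x} \<in> bd_edges T" by (rule bexE)
    let ?B = "{n \<in> N. {v,n} \<in> bd_edges T}"
    have "?B \<noteq> {x}"
    proof
      assume "?B = {x}"
      then have "card ?B = 1" by simp
      moreover have "even (card ?B)"
        by (rule even_bd_closed) (fact cl, fact N(2))
      ultimately show False by (simp only:) simp
    qed
    moreover have "x \<in> ?B" using x by simp
    ultimately obtain y where y: "y \<in> ?B" "y \<noteq> x" by blast
    show ?thesis 
      by (rule exI[of _ x], rule exI[of _ y]) (use x y in simp)
  qed
  let ?M = "{m. {v,m} \<in> edges T} - N"
  have "\<exists>x y. x \<in> N \<and> y \<in> N \<and> x \<noteq> y \<and> {v,x} \<in> bd_edges T \<and> {v,y} \<in> bd_edges T"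
    by (rule two[of N m]) (fact N(1), fact N(2), fact cl, fact m, fact mN)
  then obtain x y where xy: "x \<in> N" "y \<in> N" "x \<noteq> y" "{v,x} \<in> bd_edges T" "{v,y} \<in> bd_edges T"
    by (elim exE conjE)
  obtain n0 where n0: "n0 \<in> N" using N(1) by blast
  have clM: "q \<in> ?M" if n: "n \<in> ?M" "{v,n,q} \<in> T" for n q
  proof -
    have "{v,q,n} \<in> T" using n(2) by (simp add: insert_commute)
    then have "{v,q} \<in> edges T" "q \<notin> N" using face_edge[of v q n] cl[of q n] n(1) by auto
    then show ?thesis by simp
  qed
  have "\<exists>x y. x \<in> ?M \<and> y \<in> ?M \<and> x \<noteq> y \<and> {v,x} \<in> bd_edges T \<and> {v,y} \<in> bd_edges T"
  proof (rule two[of ?M n0])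
    show "?M \<noteq> {}" using m mN by blast
    show "{v,n} \<in> edges T" if "n \<in> ?M" for n using that by simp
    show "{v,n0} \<in> edges T" using N(2)[OF n0] .
    show "n0 \<notin> ?M" using n0 by simp
  qed (rule clM)
  then obtain z where z: "z \<in> ?M" "{v,z} \<in> bd_edges T" by (elim exE conjE)
  have "z \<notin> N" using z(1) by simp
  then have "z \<noteq> x" "z \<noteq> y" using xy(1,2) by metis+
  then show False by (rule bd_deg_le2[OF xy(4,5) z(2) xy(3)])
qed

end

section \<open>Triangulated surfaces combinatorially\<close>

text \<open>Faces and edges become opaque relations, so that permutations of the vertices are
  controlled by explicit rules instead of the rewriting of set expressions. \<open>bv\<close> speaks
  of vertices on the boundary, \<open>bd\<close> of edges.\<close>

definition fc :: "'v set set \<Rightarrow> 'v \<Rightarrow> 'v \<Rightarrow> 'v \<Rightarrow> bool" where "fc T a b c \<longleftrightarrow> {a,b,c} \<in> T"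
definition ed :: "'v set set \<Rightarrow> 'v \<Rightarrow> 'v \<Rightarrow> bool" where "ed T a b \<longleftrightarrow> {a,b} \<in> edges T"
definition bd :: "'v set set \<Rightarrow> 'v \<Rightarrow> 'v \<Rightarrow> bool" where "bd T a b \<longleftrightarrow> {a,b} \<in> bd_edges T"
definition nb :: "'v set set \<Rightarrow> 'v \<Rightarrow> 'v set" where "nb T a = {b. ed T a b}"
definition bv :: "'v set set \<Rightarrow> 'v \<Rightarrow> bool" where "bv T a \<longleftrightarrow> (\<exists>b. bd T a b)"

lemma fc_swap: "fc T a b c \<Longrightarrow> fc T a c b" by (simp add: fc_def insert_commute)
lemma fc_rot: "fc T a b c \<Longrightarrow> fc T b c a" by (simp add: fc_def insert_commute)
lemma ed_sym: "ed T a b \<Longrightarrow> ed T b a" by (simp add: ed_def insert_commute)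
lemma bd_sym: "bd T a b \<Longrightarrow> bd T b a" by (simp add: bd_def insert_commute)
lemma ed_neq: "ed T a b \<Longrightarrow> a \<noteq> b" by (auto simp: ed_def edges_def)
lemma bd_ed: "bd T a b \<Longrightarrow> ed T a b" by (simp add: bd_def ed_def bd_edges_def)
lemma bd_bv: "bd T a b \<Longrightarrow> bv T a" by (auto simp: bv_def)
lemma nb_iff: "b \<in> nb T a \<longleftrightarrow> ed T a b" by (simp add: nb_def)

lemma deg_nb: "deg T a = card (nb T a)"
proof -
  have "{e \<in> edges T. a \<in> e} = (\<lambda>b. {a,b}) ` nb T a"
  proof (intro equalityI subsetI)
    fix e assume e: "e \<in> {e \<in> edges T. a \<in> e}"
    then have "card e = 2" by (simp add: edges_def)
    then obtain b where "e = {a,b}" using e by (auto simp: card_2_iff)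
    then show "e \<in> (\<lambda>b. {a,b}) ` nb T a" using e by (auto simp: nb_def ed_def)
  qed (auto simp: nb_def ed_def)
  moreover have "inj_on (\<lambda>b. {a,b}) (nb T a)" by (auto simp: inj_on_def doubleton_eq_iff)
  ultimately show ?thesis by (simp add: deg_def card_image)
qed

lemma fan_nth: "t \<in> fan y p \<longleftrightarrow> (\<exists>i. Suc i < length p \<and> t = {y, p ! i, p ! Suc i})"
proof (induction y p rule: fan.induct)
  case (1 y a b r)
  show ?case (is "?L \<longleftrightarrow> ?R")
  proof
    assume ?L
    then consider "t = {y,a,b}" | "t \<in> fan y (b # r)" by auto
    then show ?R
    proof cases
      case 1
      then show ?thesis by (intro exI[of _ 0]) simp
    next
      case 2
      then obtain i where "Suc i < length (b # r)" "t = {y, (b # r) ! i, (b # r) ! Suc i}"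
        using 1 by blast
      then show ?thesis by (intro exI[of _ "Suc i"]) simp
    qed
  next
    assume ?R
    then obtain i where i: "Suc i < length (a # b # r)" "t = {y, (a # b # r) ! i, (a # b # r) ! Suc i}"
      by blast
    show ?L
    proof (cases i)
      case 0
      then show ?thesis using i by simp
    next
      case (Suc j)
      then have "Suc j < length (b # r)" "t = {y, (b # r) ! j, (b # r) ! Suc j}" using i by auto
      then have "t \<in> fan y (b # r)" using 1 by blast
      then show ?thesis by simp
    qed
  qed
qed auto

lemma fan_append: "p \<noteq> [] \<Longrightarrow> fan y (p @ [m]) = insert {y, last p, m} (fan y p)"
  by (induction y p rule: fan.induct) auto

text \<open>What the combinatorial part uses of the topology. By \<open>triangulates_csurf\<close>
  every triangulation of a punctured surface is an instance, in particular the result of a flip or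
  contraction, so these properties are never carried through an operation by hand.\<close>

locale csurf = triangle_complex T for T :: "'v set set" +
  assumes edge_le2:
      "\<And>a b c e f. {a,b,c} \<in> T \<Longrightarrow> {a,b,e} \<in> T \<Longrightarrow> {a,b,f} \<in> T \<Longrightarrow> c \<noteq> e \<Longrightarrow> f \<noteq> c \<Longrightarrow> f \<noteq> e \<Longrightarrow> False"
    and link_connected:
      "\<And>N v m. N \<noteq> {} \<Longrightarrow> (\<And>n. n \<in> N \<Longrightarrow> {v,n} \<in> edges T) \<Longrightarrow>
        (\<And>n m. n \<in> N \<Longrightarrow> {v,n,m} \<in> T \<Longrightarrow> m \<in> N) \<Longrightarrow> {v,m} \<in> edges T \<Longrightarrow> m \<in> N"
    and bd_deg_le2:
      "\<And>v x y z. {v,x} \<in> bd_edges T \<Longrightarrow> {v,y} \<in> bd_edges T \<Longrightarrow> {v,z} \<in> bd_edges T \<Longrightarrow>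
        x \<noteq> y \<Longrightarrow> z \<noteq> x \<Longrightarrow> z \<noteq> y \<Longrightarrow> False"
    and connected_graph:
      "\<And>a b A. a \<in> A \<Longrightarrow> a \<in> verts T \<Longrightarrow> (\<And>a b. a \<in> A \<Longrightarrow> {a,b} \<in> edges T \<Longrightarrow> b \<in> A) \<Longrightarrow>
        b \<in> verts T \<Longrightarrow> b \<in> A"
    and boundary_connected:
      "\<And>a b A. a \<in> A \<Longrightarrow> a \<in> bd_verts T \<Longrightarrow> (\<And>a b. a \<in> A \<Longrightarrow> {a,b} \<in> bd_edges T \<Longrightarrow> b \<in> A) \<Longrightarrow>
        b \<in> bd_verts T \<Longrightarrow> b \<in> A"
    and boundary_nonempty: "bd_edges T \<noteq> {}"

context punctured_triangulation
begin

sublocale csurf T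
proof unfold_locales
  show "{a,b,c} \<in> T \<Longrightarrow> {a,b,e} \<in> T \<Longrightarrow> {a,b,f} \<in> T \<Longrightarrow> c \<noteq> e \<Longrightarrow> f \<noteq> c \<Longrightarrow> f \<noteq> e \<Longrightarrow> False"
    for a b c e f by (rule edge_le2)
  show "{v,x} \<in> bd_edges T \<Longrightarrow> {v,y} \<in> bd_edges T \<Longrightarrow> {v,z} \<in> bd_edges T \<Longrightarrow>
        x \<noteq> y \<Longrightarrow> z \<noteq> x \<Longrightarrow> z \<noteq> y \<Longrightarrow> False" for v x y z by (rule bd_deg_le2)
  show "bd_edges T \<noteq> {}" by (rule boundary_nonempty)
  show "m \<in> N" if "N \<noteq> {}" "\<And>n. n \<in> N \<Longrightarrow> {v,n} \<in> edges T"
    "\<And>n m. n \<in> N \<Longrightarrow> {v,n,m} \<in> T \<Longrightarrow> m \<in> N" "{v,m} \<in> edges T" for N v m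
    using that by (rule link_connected)
  show "b \<in> A" if "a \<in> A" "a \<in> verts T" "\<And>a b. a \<in> A \<Longrightarrow> {a,b} \<in> edges T \<Longrightarrow> b \<in> A"
    "b \<in> verts T" for a b A using that by (rule connected_graph)
  show "b \<in> A" if "a \<in> A" "a \<in> bd_verts T" "\<And>a b. a \<in> A \<Longrightarrow> {a,b} \<in> bd_edges T \<Longrightarrow> b \<in> A"
    "b \<in> bd_verts T" for a b A using that by (rule boundary_connected)
qed

end

theorem triangulates_csurf:
  assumes F: "punctured_surface F" and T: "triangulates T F"
  shows "csurf T"
proof -
  obtain S d where S: "closed_surface S" and d: "embedding_map (top_of_set (cball 0 1 :: (real^2) set)) S d"
    and FS: "F = subtopology S (topspace S - d ` ball 0 1)"
    using F by (auto simp: punctured_surface_def)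
  obtain d' where d': "homeomorphic_maps (top_of_set (cball 0 1)) (subtopology S (d ` cball 0 1)) d d'"
    using d by (auto simp: embedding_map_def homeomorphic_map_maps)
  have "top_of_set (realization T) homeomorphic_space F" using T by (simp add: triangulates_def)
  then obtain g g' where "homeomorphic_maps (top_of_set (realization T)) F g g'"
    by (auto simp: homeomorphic_space_def)
  then have "punctured_triangulation T S d d' g g'"
    using T S d' unfolding FS by unfold_locales (simp_all add: triangulates_def)
  then interpret punctured_triangulation T S d d' g g' .
  show ?thesis by unfold_locales
qed

section \<open>Links as paths and cycles\<close>

context csurf
begin

lemma fc_neq: "fc T a b c \<Longrightarrow> a \<noteq> b \<and> b \<noteq> c \<and> a \<noteq> c"
  using face_distinct[of a b c] by (simp add: fc_def)

lemma fc_ed: "fc T a b c \<Longrightarrow> ed T a b \<and> ed T b c \<and> ed T a c"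
  using face_edge[of a b c] face_edge[of b c a] face_edge[of a c b]
  by (simp add: fc_def ed_def insert_commute)

lemma ed_fc: "ed T a b \<Longrightarrow> \<exists>c. fc T a b c"
  unfolding ed_def fc_def by (erule edge_faces) blast

lemma fc_le2: "fc T a b c \<Longrightarrow> fc T a b e \<Longrightarrow> c \<noteq> e \<Longrightarrow> fc T a b f \<Longrightarrow> f = c \<or> f = e"
  by (rule ccontr, rule edge_le2[of a b c e f]) (auto simp: fc_def)

lemma bd_unique: "bd T a b \<Longrightarrow> fc T a b c \<Longrightarrow> fc T a b e \<Longrightarrow> c = e"
  using bd_edgeD[of a b c e] by (simp add: bd_def fc_def)

lemma fc_bdI:
  assumes "fc T a b c" "\<And>e. fc T a b e \<Longrightarrow> e = c"
  shows "bd T a b"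
  unfolding bd_def
proof (rule bd_edgeI)
  show "{a,b,c} \<in> T" using assms(1) by (simp add: fc_def)
  show "e = c" if "{a,b,e} \<in> T" for e using that assms(2)[of e] unfolding fc_def by blast
qed

lemma inner_other: "fc T a b c \<Longrightarrow> \<not> bd T a b \<Longrightarrow> \<exists>e. fc T a b e \<and> e \<noteq> c"
  using fc_bdI[of a b c] by blast

lemma bd_le2: "bd T v x \<Longrightarrow> bd T v y \<Longrightarrow> x \<noteq> y \<Longrightarrow> bd T v z \<Longrightarrow> z = x \<or> z = y"
  by (rule ccontr, rule bd_deg_le2[of v x y z]) (auto simp: bd_def)

lemma face_star: "t \<in> T \<Longrightarrow> y \<in> t \<Longrightarrow> \<exists>a b. t = {y,a,b} \<and> fc T y a b"
proof -
  assume t: "t \<in> T" "y \<in> t"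
  have "t \<noteq> {y}" using c3[OF t(1)] by auto
  then obtain a where a: "a \<in> t" "y \<noteq> a" using t(2) by blast
  obtain b where b: "t = {y,a,b}" using face_at[OF t a] by auto
  have "fc T y a b" using t(1) unfolding fc_def b .
  then show ?thesis using b by blast
qed

text \<open>The form in which connectedness of links is applied: as soon as a nonempty set of
  neighbours is closed under the faces at \<open>v\<close>, it is the whole neighbourhood.\<close>

lemma link_closed:
  assumes "n0 \<in> N" "\<And>n. n \<in> N \<Longrightarrow> ed T v n" "\<And>n m. n \<in> N \<Longrightarrow> fc T v n m \<Longrightarrow> m \<in> N"
  shows "nb T v = N"
proof (intro equalityI subsetI)
  fix m assume m: "m \<in> nb T v"
  show "m \<in> N"
  proof (rule link_connected[of N v m])
    show "N \<noteq> {}" using assms(1) by auto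
    show "{v,n} \<in> edges T" if "n \<in> N" for n using assms(2)[OF that] by (simp add: ed_def)
    show "q \<in> N" if "n \<in> N" "{v,n,q} \<in> T" for n q using assms(3)[of n q] that by (simp add: fc_def)
    show "{v,m} \<in> edges T" using m by (simp add: nb_def ed_def)
  qed
next
  fix n assume "n \<in> N"
  then show "n \<in> nb T v" using assms(2) by (simp add: nb_def)
qed

lemma finite_verts: "finite (verts T)"
  using fin finite_card3[OF c3] by (auto simp: verts_def)

lemma ed_verts: "ed T a b \<Longrightarrow> a \<in> verts T \<and> b \<in> verts T"
  by (auto simp: ed_def edges_def verts_def)

lemma finite_nb: "finite (nb T a)"
  by (rule finite_subset[OF _ finite_verts]) (use ed_verts in \<open>auto simp: nb_def\<close>)

text \<open>A longest fan of faces starting with \<open>s n1\<close> is taken. Its last vertex can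
  only continue to a vertex already used, and since every edge lies in at most two faces this is
  \<open>s\<close> or the predecessor. So the vertices of the fan are closed under faces at
  \<open>y\<close> and exhaust its link. Starting at a boundary edge yields a path, starting at an
  inner vertex a cycle.\<close>

lemma fan_exists:
  assumes f: "fc T y s n1" and b: "bd T y s \<or> \<not> bv T y"
  obtains r where "distinct (y # s # n1 # r)" "nb T y = set (s # n1 # r)"
    "bd T y s \<Longrightarrow> star T y = fan y (s # n1 # r) \<and> bd T y (last (s # n1 # r))"
    "\<not> bv T y \<Longrightarrow> star T y = fan y (s # n1 # r @ [s]) \<and> r \<noteq> []"
proof -
  define P where "P r \<longleftrightarrow> distinct (y # s # n1 # r) \<and> fan y (s # n1 # r) \<subseteq> T" for r
  have P0: "P []" using fc_neq[OF f] f by (auto simp: P_def fc_def)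
  have bound: "length r \<le> card (verts T)" if "P r" for r
  proof -
    have "set r \<subseteq> verts T"
    proof
      fix m assume "m \<in> set r"
      then obtain i where i: "i < length r" "r ! i = m" by (auto simp: in_set_conv_nth)
      then have "{y, (s # n1 # r) ! Suc i, (s # n1 # r) ! Suc (Suc i)} \<in> fan y (s # n1 # r)"
        unfolding fan_nth by (intro exI[of _ "Suc i"]) simp
      then have "{y, (s # n1 # r) ! Suc i, m} \<in> T" using that i(2) unfolding P_def by auto
      then show "m \<in> verts T" unfolding verts_def by (rule UnionI) simp
    qed
    moreover have "distinct r" using that by (simp add: P_def)
    ultimately show ?thesis using card_mono[OF finite_verts] distinct_card by metis
  qed
  have "\<exists>r. P r \<and> (\<forall>r'. P r' \<longrightarrow> length r' \<le> length r)"
    by (rule ex_has_greatest_nat[where P=P and b="Suc (card (verts T))", OF P0]) (use bound in \<open>auto simp: less_Suc_eq_le\<close>)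
  then obtain r where r: "P r" "\<And>r'. P r' \<Longrightarrow> length r' \<le> length r" by blast
  define p where "p = s # n1 # r"
  define k where "k = length p"
  have k2: "2 \<le> k" by (simp add: k_def p_def)
  have dp: "distinct p" "y \<notin> set p" and fanT: "fan y p \<subseteq> T" using r(1) by (auto simp: P_def p_def)
  have p0: "p ! 0 = s" "p ! Suc 0 = n1" by (simp_all add: p_def)
  have pl: "last p = p ! (k - 1)" using k2 by (simp add: k_def last_conv_nth p_def)
  have fcp: "fc T y (p ! i) (p ! Suc i)" if "Suc i < k" for i
  proof -
    have "{y, p ! i, p ! Suc i} \<in> fan y p" unfolding fan_nth using that k_def by blast
    then show ?thesis using fanT unfolding fc_def by blast
  qed
  have pinj: "i = j" if "p ! i = p ! j" "i < k" "j < k" for i j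
    using that dp(1) nth_eq_iff_index_eq[of p i j] by (simp add: k_def)
  have maxm: "m \<in> set p" if m: "fc T y (last p) m" for m
  proof (rule ccontr)
    assume mp: "m \<notin> set p"
    have "fan y (p @ [m]) \<subseteq> T"
      using fan_append[of p y m] fanT m by (auto simp: p_def fc_def)
    moreover have "distinct (y # p @ [m])" using dp mp fc_neq[OF m] by auto
    ultimately have "P (r @ [m])" by (simp add: P_def p_def)
    from r(2)[OF this] show False by simp
  qed
  have mid: "m = p ! (i - 1) \<or> m = p ! Suc i" if i: "0 < i" "Suc i < k" "fc T y (p ! i) m" for i m
  proof -
    have "fc T y (p ! i) (p ! (i - 1))" using fcp[of "i - 1"] i by (auto dest: fc_swap)
    moreover have "p ! (i - 1) \<noteq> p ! Suc i" using pinj[of "i - 1" "Suc i"] i by linarith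
    ultimately show ?thesis using fc_le2[OF _ fcp[OF i(2)] _ i(3)] by blast
  qed
  have lst: "m = p ! 0 \<or> m = p ! (k - 2)" if m: "fc T y (p ! (k - 1)) m" for m
  proof -
    have "m \<in> set p" using maxm m pl by simp
    then obtain j where j: "j < k" "m = p ! j" by (auto simp: in_set_conv_nth k_def)
    have "j \<noteq> k - 1" using fc_neq[OF m] j by auto
    show ?thesis
    proof (cases "j = 0")
      case False
      have "fc T y (p ! j) (p ! (k - 1))" using m j(2) by (auto dest: fc_swap)
      then have "p ! (k - 1) = p ! (j - 1) \<or> p ! (k - 1) = p ! Suc j"
        using mid[of j "p ! (k - 1)"] False j \<open>j \<noteq> k - 1\<close> by auto
      moreover have "Suc j < k" "k - 1 < k" "j - 1 < k" using j \<open>j \<noteq> k - 1\<close> by linarith+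
      ultimately have "k - 1 = j - 1 \<or> k - 1 = Suc j"
        using pinj[of "k - 1" "j - 1"] pinj[of "k - 1" "Suc j"] by blast
      then have "j = k - 2" using j(1) k2 False by linarith
      then show ?thesis using j(2) by simp
    qed (use j in simp)
  qed
  have fcl: "fc T y (p ! (k - 1)) (p ! (k - 2))"
    using fcp[of "k - 2"] k2 by (auto dest: fc_swap simp: numeral_2_eq_2 Suc_diff_Suc)
  have s_bd: "m = p ! Suc 0" if "bd T y s" "fc T y s m" for m
    using bd_unique[OF that(1) that(2) f] p0 by simp
  \<comment> \<open>At an inner vertex the last edge has a second face, and by maximality it closes
    the cycle; a link of only two vertices is excluded because the second face is different from the
    first.\<close>
  have inner: "2 < k \<and> fc T y (p ! (k - 1)) s" if nb: "\<not> bv T y"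
  proof -
    have "\<not> bd T y (p ! (k - 1))" using nb by (auto simp: bv_def)
    then obtain m where m: "fc T y (p ! (k - 1)) m" "m \<noteq> p ! (k - 2)" using inner_other[OF fcl] by blast
    then have "m = p ! 0" using lst by blast
    then show ?thesis using m k2 p0 by (cases "k = 2") auto
  qed
  have s_in: "m = p ! Suc 0 \<or> m = p ! (k - 1)" if nb: "\<not> bv T y" and m: "fc T y s m" for m
  proof -
    have 1: "fc T y s (p ! (k - 1))" and k: "2 < k" using inner[OF nb] by (auto dest: fc_swap)
    have "p ! Suc 0 \<noteq> p ! (k - 1)" using pinj[of "Suc 0" "k - 1"] k by linarith
    then show ?thesis using fc_le2[OF _ 1 _ m, of "p ! Suc 0"] f p0 by auto
  qed
  have next_in: "{y, p ! i, m} \<in> fan y p \<or> (\<not> bv T y \<and> {y, p ! i, m} = {y, last p, s})"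
    if i: "i < k" and m: "fc T y (p ! i) m" for i m
  proof -
    consider "i = 0" | "0 < i" "Suc i < k" | "i = k - 1" using i by linarith
    then show ?thesis
    proof cases
      case 1
      have "m = p ! Suc 0 \<or> (\<not> bv T y \<and> m = p ! (k - 1))"
        using s_bd s_in b m 1 p0 by auto
      then show ?thesis
      proof
        assume "m = p ! Suc 0"
        then have "{y, p ! i, m} \<in> fan y p"
          unfolding fan_nth using 1 k2 k_def by (intro exI[of _ 0]) auto
        then show ?thesis by blast
      next
        assume "\<not> bv T y \<and> m = p ! (k - 1)"
        then show ?thesis using 1 pl p0 by (auto simp: insert_commute)
      qed
    next
      case 2
      from mid[OF this m] show ?thesis
      proof
        assume "m = p ! (i - 1)"
        then have "{y, p ! i, m} \<in> fan y p" unfolding fan_nth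
          using 2 k_def by (intro exI[of _ "i - 1"]) (auto simp: insert_commute)
        then show ?thesis by blast
      next
        assume "m = p ! Suc i"
        then have "{y, p ! i, m} \<in> fan y p" unfolding fan_nth using 2 k_def by blast
        then show ?thesis by blast
      qed
    next
      case 3
      have *: "{y, p ! i, p ! (k - 2)} \<in> fan y p" unfolding fan_nth
        using 3 k2 k_def by (intro exI[of _ "k - 2"]) (auto simp: insert_commute numeral_2_eq_2 Suc_diff_Suc)
      from lst[of m] m 3 consider "m = p ! (k - 2)" | "m = s" using p0 by auto
      then show ?thesis
      proof cases
        case 1 then show ?thesis using * by simp
      next
        case 2
        show ?thesis
        proof (cases "bv T y")
          case True
          then have "p ! (k - 1) = p ! Suc 0" using b s_bd[of "p ! (k - 1)"] m 2 3 by (auto dest: fc_swap)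
          then have "k - 1 = Suc 0" using pinj[of "k - 1" "Suc 0"] k2 by simp
          then show ?thesis using * 2 p0 by (simp add: numeral_2_eq_2)
        next
          case False
          then show ?thesis using 2 3 pl by simp
        qed
      qed
    qed
  qed
  have fan_sub_p: "m \<in> set p" if "{y, p ! i, m} \<in> fan y p" "fc T y (p ! i) m" for i m
    using fan_sub[OF that(1)] fc_neq[OF that(2)] by auto
  have lp: "last p \<in> set p" "s \<in> set p" by (simp_all add: p_def)
  have nbp: "nb T y = set p"
  proof (rule link_closed[of s])
    show "s \<in> set p" by (simp add: p_def)
    show "ed T y n" if n: "n \<in> set p" for n
    proof -
      obtain i where i: "i < k" "n = p ! i" using n by (auto simp: in_set_conv_nth k_def)
      show ?thesis
      proof (cases "Suc i < k")
        case True then show ?thesis using fc_ed[OF fcp[OF True]] i by simp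
      next
        case False
        then have "i = k - 1" using i by linarith
        then show ?thesis using fc_ed[OF fcl] i by simp
      qed
    qed
    show "m \<in> set p" if n: "n \<in> set p" and m: "fc T y n m" for n m
    proof -
      obtain i where i: "i < k" "n = p ! i" using n by (auto simp: in_set_conv_nth k_def)
      have m': "fc T y (p ! i) m" using m i by simp
      from next_in[OF i(1) m'] show ?thesis
      proof
        assume "{y, p ! i, m} \<in> fan y p"
        then show ?thesis using fan_sub_p m' by blast
      next
        assume "\<not> bv T y \<and> {y, p ! i, m} = {y, last p, s}"
        then have "m \<in> {y, last p, s}" by blast
        then show ?thesis using lp fc_neq[OF m'] by auto
      qed
    qed
  qed
  have star_sub: "t \<in> fan y p \<or> (\<not> bv T y \<and> t = {y, last p, s})" if t: "t \<in> star T y" for t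
  proof -
    obtain a c where ac: "t = {y,a,c}" "fc T y a c" using face_star[of t y] t by auto
    have "a \<in> set p" using fc_ed[OF ac(2)] nbp by (auto simp: nb_def)
    then obtain i where i: "i < k" "a = p ! i" by (auto simp: in_set_conv_nth k_def)
    show ?thesis using next_in[OF i(1), of c] ac i(2) by simp
  qed
  have fan_star: "fan y p \<subseteq> star T y" using fanT fan_mem by fastforce
  show ?thesis
  proof (rule that[of r])
    show "distinct (y # s # n1 # r)" using r(1) by (simp add: P_def)
    show "nb T y = set (s # n1 # r)" using nbp by (simp add: p_def)
    show "star T y = fan y (s # n1 # r) \<and> bd T y (last (s # n1 # r))" if bs: "bd T y s"
    proof
      have "bv T y" using bs by (rule bd_bv)
      then have "star T y \<subseteq> fan y p" using star_sub by blast
      then show "star T y = fan y (s # n1 # r)" using fan_star unfolding p_def by (rule equalityI)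
      have "bd T y (p ! (k - 1))"
      proof (rule fc_bdI[OF fcl])
        fix e assume e: "fc T y (p ! (k - 1)) e"
        from lst[OF this] show "e = p ! (k - 2)"
        proof
          assume e0: "e = p ! 0"
          then have "p ! (k - 1) = p ! Suc 0" using s_bd[OF bs, of "p ! (k - 1)"] e p0 by (auto dest: fc_swap)
          then have "k - 1 = Suc 0" using pinj[of "k - 1" "Suc 0"] k2 by simp
          then show ?thesis using e0 by (simp add: numeral_2_eq_2)
        qed
      qed
      then show "bd T y (last (s # n1 # r))" using pl by (simp add: p_def)
    qed
    show "star T y = fan y (s # n1 # r @ [s]) \<and> r \<noteq> []" if nb: "\<not> bv T y"
    proof
      have fa: "fan y (p @ [s]) = insert {y, last p, s} (fan y p)" by (rule fan_append) (simp add: p_def)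
      have "{y, last p, s} \<in> star T y" using inner[OF nb] pl by (simp add: fc_def)
      then have sub: "fan y (p @ [s]) \<subseteq> star T y" using fan_star unfolding fa by (simp only: insert_subset)
      have "star T y = fan y (p @ [s])"
      proof (rule equalityI[OF subsetI sub])
        fix t assume t: "t \<in> star T y"
        have "t \<in> insert {y, last p, s} (fan y p)" using star_sub[OF t] by (elim disjE) simp_all
        then show "t \<in> fan y (p @ [s])" unfolding fa .
      qed
      then show "star T y = fan y (s # n1 # r @ [s])" by (simp add: p_def)
      show "r \<noteq> []" using inner[OF nb] by (auto simp: k_def p_def)
    qed
  qed
qed

end

text \<open>\<open>E\<close> holds the faces at the contracted edge, which disappear; the rest of
  the star is a cone whose apex is renamed. So the contraction as a vertex map agrees with the
  result of the exchanges.\<close>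

lemma collapse_fan:
  assumes c3: "\<And>t. t \<in> T \<Longrightarrow> card t = 3"
    and st: "star T y = E \<union> fan y ns" and E: "\<And>e. e \<in> E \<Longrightarrow> s \<in> e \<and> y \<in> e"
    and ns: "distinct (y # s # ns)"
  shows "collapse (id(y := s)) T = (T - star T y) \<union> fan s ns"
proof (intro equalityI subsetI)
  let ?f = "id(y := s)"
  have fa: "?f ` {y,a,b} = {s,a,b}" if "a \<noteq> y" "b \<noteq> y" for a b using that by auto
  have fansn: "a \<in> set ns" "b \<in> set ns" if "a = ns ! i" "b = ns ! Suc i" "Suc i < length ns" for a b i
    using that by auto
  {
    fix u assume "u \<in> collapse ?f T"
    then obtain t where t: "t \<in> T" "u = ?f ` t" "card u = 3" by (auto simp: collapse_def)
    show "u \<in> (T - star T y) \<union> fan s ns"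
    proof (cases "y \<in> t")
      case False
      then have "?f ` t = t" by (auto simp: image_def)
      then show ?thesis using t False by simp
    next
      case True
      then have "t \<in> E \<union> fan y ns" using t(1) st by blast
      then show ?thesis
      proof
        assume "t \<in> E"
        then have st': "s \<in> t" using E by blast
        have "u \<subseteq> t - {y}" using t(2) st' ns by auto
        moreover have "card (t - {y}) = 2" using c3[OF t(1)] True by simp
        moreover have "finite (t - {y})" using c3[OF t(1)] finite_card3 by blast
        ultimately have "card u \<le> 2" by (metis card_mono)
        then show ?thesis using t(3) by simp
      next
        assume "t \<in> fan y ns"
        then obtain i where i: "Suc i < length ns" "t = {y, ns ! i, ns ! Suc i}" unfolding fan_nth by blast
        have "ns ! i \<noteq> y" "ns ! Suc i \<noteq> y" using ns i(1) nth_mem[of i ns] nth_mem[of "Suc i" ns] by auto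
        then have "u = {s, ns ! i, ns ! Suc i}" using t(2) i(2) fa by simp
        then have "u \<in> fan s ns" unfolding fan_nth using i(1) by blast
        then show ?thesis by simp
      qed
    qed
  next
    fix u assume "u \<in> (T - star T y) \<union> fan s ns"
    then show "u \<in> collapse ?f T"
    proof
      assume u: "u \<in> T - star T y"
      then have "y \<notin> u" "u \<in> T" by auto
      then have "u = ?f ` u" by (auto simp: image_def)
      then show ?thesis using c3 \<open>u \<in> T\<close> unfolding collapse_def by blast
    next
      assume u: "u \<in> fan s ns"
      then obtain i where i: "Suc i < length ns" "u = {s, ns ! i, ns ! Suc i}" unfolding fan_nth by blast
      have ne: "ns ! i \<noteq> y" "ns ! Suc i \<noteq> y" using ns i(1) nth_mem[of i ns] nth_mem[of "Suc i" ns] by auto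
      have "{y, ns ! i, ns ! Suc i} \<in> fan y ns" unfolding fan_nth using i(1) by blast
      then have "{y, ns ! i, ns ! Suc i} \<in> T" using st by blast
      moreover have "u = ?f ` {y, ns ! i, ns ! Suc i}" using fa[OF ne] i(2) by simp
      moreover have "card u = 3" using fan_card[OF _ u] ns by simp
      ultimately show ?thesis unfolding collapse_def by blast
    qed
  }
qed

lemma fc_ed_gen: "fc T a b c \<Longrightarrow> a \<noteq> b \<Longrightarrow> ed T a b"
  unfolding fc_def ed_def edges_def by (auto intro!: bexI[of _ "{a,b,c}"])

section \<open>Contractibility under the link condition\<close>

context csurf
begin

text \<open>The map changes only \<open>y\<close>, so two distinct surviving faces with the same
  image are a face at \<open>y\<close> and the face obtained from it by putting \<open>s\<close> for
  \<open>y\<close>.\<close>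

lemma simple_collapseI:
  assumes ys: "y \<noteq> s" and nq: "\<And>a b. fc T y a b \<Longrightarrow> fc T s a b \<Longrightarrow> False"
  shows "simple_collapse (id(y := s)) T"
  unfolding simple_collapse_def
proof (rule inj_onI)
  let ?f = "id(y := s)"
  fix t u assume "t \<in> {t \<in> T. card (?f ` t) = 3}" "u \<in> {t \<in> T. card (?f ` t) = 3}" and e: "?f ` t = ?f ` u"
  then have t: "t \<in> T" "card (?f ` t) = 3" and u: "u \<in> T" "card (?f ` u) = 3" by auto
  have im: "?f ` t = t" if "y \<notin> t" for t using that by (auto simp: image_def)
  have im': "?f ` t = insert s (t - {y})" if "y \<in> t" for t using that ys by auto
  have ns: "s \<notin> t" if tt: "t \<in> T" "card (?f ` t) = 3" "y \<in> t" for t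
  proof
    assume "s \<in> t"
    then have "?f ` t = t - {y}" using im'[OF tt(3)] ys by auto
    moreover have "card (t - {y}) = 2" using c3[OF tt(1)] tt(3) by simp
    ultimately show False using tt(2) by simp
  qed
  have mixed: False if tt: "t \<in> T" "card (?f ` t) = 3" "y \<in> t" "u \<in> T" "y \<notin> u" "?f ` t = ?f ` u" for t u
  proof -
    obtain a b where ab: "t = {y,a,b}" "fc T y a b" using face_star[OF tt(1,3)] by blast
    have "u = insert s (t - {y})" using im[OF tt(5)] im'[OF tt(3)] tt(6) by simp
    also have "t - {y} = {a,b}" using ab fc_neq[OF ab(2)] by auto
    finally have "{s,a,b} \<in> T" using tt(4) by simp
    then show False using nq[OF ab(2)] by (simp add: fc_def)
  qed
  show "t = u"
  proof (cases "y \<in> t"; cases "y \<in> u")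
    assume yt: "y \<in> t" and yu: "y \<in> u"
    have "t - {y} = ?f ` t - {s}" using im'[OF yt] ns[OF t yt] by auto
    moreover have "u - {y} = ?f ` u - {s}" using im'[OF yu] ns[OF u yu] by auto
    ultimately have "t - {y} = u - {y}" using e by simp
    then show ?thesis using yt yu by blast
  next
    assume "y \<in> t" "y \<notin> u" then show ?thesis using mixed[OF t _ u(1) _ e] by blast
  next
    assume "y \<notin> t" "y \<in> u" then show ?thesis using mixed[OF u _ t(1) _ e[symmetric]] by blast
  next
    assume "y \<notin> t" "y \<notin> u" then show ?thesis using e im by simp
  qed
qed

lemma triangulatesI:
  assumes "triangulates T F" "top_of_set (realization T) homeomorphic_space top_of_set (realization T')"
    "finite T'" "\<And>t. t \<in> T' \<Longrightarrow> card t = 3"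
  shows "triangulates T' F"
  using assms unfolding triangulates_def
  by (metis homeomorphic_space_sym homeomorphic_space_trans)

lemma finite_collapse: "finite (collapse f T)"
  by (rule finite_subset[of _ "(`) f ` T"]) (use fin in \<open>auto simp: collapse_def\<close>)

text \<open>Only the third vertex \<open>p\<close> of the face at \<open>ys\<close> is adjacent to
  both ends, which is what the exchange sequence for a path asks for. Three neighbours of
  \<open>y\<close> guarantee that a link vertex remains beyond \<open>p\<close>.\<close>

lemma contractible_path:
  assumes T: "triangulates T F" and b: "bd T y s" and p: "fc T y s p"
    and co: "\<And>z. ed T z s \<Longrightarrow> ed T z y \<Longrightarrow> z = p" and c: "3 \<le> card (nb T y)"
  shows "contractible_edge F T s y"
proof -
  obtain r where d: "distinct (y # s # p # r)" and n: "nb T y = set (s # p # r)"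
    and st: "star T y = fan y (s # p # r)"
    by (rule fan_exists[OF p disjI1[OF b]]) (use b in blast)
  have "r \<noteq> []"
  proof
    assume "r = []"
    then have "nb T y = {s,p}" using n by simp
    then have "card (nb T y) \<le> 2" by (simp add: card_insert_if)
    then show False using c by simp
  qed
  then obtain n2 r' where r: "r = n2 # r'" by (cases r) auto
  have ys: "y \<noteq> s" using d by simp
  let ?T' = "(T - star T y) \<union> fan s (p # r)"
  have h: "top_of_set (realization T) homeomorphic_space top_of_set (realization ?T')"
    unfolding r
  proof (rule homeomorphic_contract_path)
    show "card t = 3" if "t \<in> T" for t using c3 that .
    show "star T y = fan y (s # p # n2 # r')" using st r by simp
    show "distinct (y # s # p # n2 # r')" using d r by simp
    show False if t: "t \<in> T" "s \<in> t" "n \<in> t" and nn: "n \<in> set (n2 # r')" for t n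
    proof -
      have "n \<noteq> s" using nn d r by auto
      then have "ed T n s" using t by (auto simp: ed_def edges_def)
      moreover have "ed T n y" using nn n r by (auto simp: nb_def dest: ed_sym)
      ultimately have "n = p" by (rule co)
      then show False using nn d r by auto
    qed
  qed
  have ce: "collapse (id(y := s)) T = ?T'"
    by (rule collapse_fan[where E="{{y,s,p}}"]) (use c3 st d in auto)
  have "triangulates ?T' F"
  proof (rule triangulatesI[OF T h])
    show "finite ?T'" using finite_collapse[of "id(y := s)"] unfolding ce .
    show "card t = 3" if "t \<in> ?T'" for t using that unfolding ce[symmetric] by (auto simp: collapse_def)
  qed
  moreover have "simple_collapse (id(y := s)) T"
  proof (rule simple_collapseI[OF ys])
    fix a b assume a: "fc T y a b" "fc T s a b"
    have "a = p" using co[of a] fc_ed[OF a(1)] fc_ed[OF a(2)] by (auto dest: ed_sym)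
    moreover have "b = p" using co[of b] fc_ed[OF a(1)] fc_ed[OF a(2)] by (auto dest: ed_sym)
    ultimately show False using fc_neq[OF a(1)] by simp
  qed
  moreover have "{s,y} \<in> edges T" using ed_sym[OF bd_ed[OF b]] by (simp add: ed_def)
  ultimately show ?thesis unfolding contractible_edge_def ce by simp
qed

text \<open>With four neighbours the flips start from a link of length at least four, so the
  tetrahedron case of the exchange sequence does not arise. The link vertex on the other side of
  \<open>s\<close> is \<open>q\<close>, the one vertex besides \<open>p\<close> that may be adjacent
  to \<open>s\<close>.\<close>

lemma contractible_cycle:
  assumes T: "triangulates T F" and b: "\<not> bv T y" and p: "fc T y s p" "fc T y s q" "p \<noteq> q"
    and co: "\<And>z. ed T z s \<Longrightarrow> ed T z y \<Longrightarrow> z = p \<or> z = q" and c: "4 \<le> card (nb T y)"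
  shows "contractible_edge F T s y"
proof -
  obtain r where d: "distinct (y # s # p # r)" and n: "nb T y = set (s # p # r)"
    and st: "star T y = fan y (s # p # r @ [s])"
    by (rule fan_exists[OF p(1) disjI2[OF b]]) (use b in blast)
  have r2: "2 \<le> length r"
  proof -
    have "card (set (s # p # r)) = length (s # p # r)" using d by (intro distinct_card) simp
    then have "card (nb T y) = Suc (Suc (length r))" unfolding n by simp
    then show ?thesis using c by simp
  qed
  then obtain n2 n3 r' where r: "r = n2 # n3 # r'" by (cases r; cases "tl r") auto
  have ys: "y \<noteq> s" using d by simp
  define l where "l = last r"
  have lr: "l \<in> set r" using r by (simp add: l_def)
  have fl: "fc T y s l"
  proof -
    have "{y, l, s} \<in> fan y ((s # p # r) @ [s])" using fan_append[of "s # p # r" y s] r by (simp add: l_def)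
    then have "{y,l,s} \<in> star T y" using st by simp
    then show ?thesis by (simp add: fc_def insert_commute)
  qed
  have "l \<noteq> p" using lr d by auto
  then have lq: "l = q" using fc_le2[OF p(1,2,3) fl] by blast
  have bl: "n \<noteq> l" if "n \<in> set (butlast r)" for n
  proof -
    have "r = butlast r @ [l]" using r by (simp add: l_def)
    moreover have "distinct r" using d by simp
    ultimately have "l \<notin> set (butlast r)" by (metis distinct_append disjoint_iff list.set_intros(1))
    then show ?thesis using that by blast
  qed
  let ?T' = "(T - star T y) \<union> fan s (p # r)"
  have h: "top_of_set (realization T) homeomorphic_space top_of_set (realization ?T')"
    unfolding r
  proof (rule homeomorphic_contract_cycle)
    show "card t = 3" if "t \<in> T" for t using c3 that .
    show "star T y = fan y (s # p # n2 # (n3 # r') @ [s])" using st r by simp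
    show "distinct (y # s # p # n2 # (n3 # r'))" using d r by simp
    show False if t: "t \<in> T" "s \<in> t" "n \<in> t" and nn: "n \<in> set (butlast (n2 # (n3 # r')))" for t n
    proof -
      have nr: "n \<in> set r" using nn r in_set_butlastD by metis
      then have "n \<noteq> s" using d by auto
      then have "ed T n s" using t by (auto simp: ed_def edges_def)
      moreover have "ed T n y" using nr n by (auto simp: nb_def dest: ed_sym)
      ultimately have "n = p \<or> n = q" by (rule co)
      then show False using nr d bl[of n] lq nn r by auto
    qed
  qed simp
  have ce: "collapse (id(y := s)) T = ?T'"
  proof (rule collapse_fan[where E="{{y,s,p},{y,l,s}}"])
    have "fan y ((p # r) @ [s]) = insert {y, l, s} (fan y (p # r))"
      using fan_append[of "p # r" y s] r by (simp add: l_def)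
    then show "star T y = {{y,s,p},{y,l,s}} \<union> fan y (p # r)" using st by simp
  qed (use c3 d in auto)
  have "triangulates ?T' F"
  proof (rule triangulatesI[OF T h])
    show "finite ?T'" using finite_collapse[of "id(y := s)"] unfolding ce .
    show "card t = 3" if "t \<in> ?T'" for t using that unfolding ce[symmetric] by (auto simp: collapse_def)
  qed
  moreover have "simple_collapse (id(y := s)) T"
  proof (rule simple_collapseI[OF ys])
    fix a b assume a: "fc T y a b" "fc T s a b"
    have "a = p \<or> a = q" using co[of a] fc_ed[OF a(1)] fc_ed[OF a(2)] by (auto dest: ed_sym)
    moreover have "b = p \<or> b = q" using co[of b] fc_ed[OF a(1)] fc_ed[OF a(2)] by (auto dest: ed_sym)
    ultimately have pq: "fc T y p q" using fc_neq[OF a(1)] a(1) by (auto dest: fc_swap)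
    have "nb T y = {s,p,q}"
    proof (rule link_closed[of s])
      show "ed T y n" if "n \<in> {s,p,q}" for n using that fc_ed[OF p(1)] fc_ed[OF p(2)] by auto
      have 1: "fc T y p s" "fc T y q s" "fc T y q p" using p pq by (auto dest: fc_swap)
      have ne: "s \<noteq> q" "s \<noteq> p" using fc_neq[OF p(1)] fc_neq[OF p(2)] by auto
      show "m \<in> {s,p,q}" if "n \<in> {s,p,q}" "fc T y n m" for n m
        using that fc_le2[OF p(1,2,3), of m] fc_le2[OF 1(1) pq ne(1), of m] fc_le2[OF 1(2,3) ne(2), of m] by blast
    qed simp
    then have "card (nb T y) \<le> 3" by (simp add: card_insert_if)
    then show False using c by simp
  qed
  moreover have "{s,y} \<in> edges T" using ed_sym[OF conjunct1[OF fc_ed[OF p(1)]]] by (simp add: ed_def)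
  ultimately show ?thesis unfolding contractible_edge_def ce by simp
qed

lemma collapse_fc:
  assumes "fc T a b c" "card {f a, f b, f c} = 3"
  shows "fc (collapse f T) (f a) (f b) (f c)"
  using assms unfolding fc_def collapse_def by (auto intro!: bexI[of _ "{a,b,c}"])

text \<open>An edge from \<open>y\<close> or \<open>s\<close> to \<open>b\<close> can only be lost
  if the face chosen at it contains \<open>ys\<close> and collapses. Then \<open>yb\<close> or
  \<open>sb\<close> lies in a second face, which survives; the hypothesis excludes that both are
  boundary edges.\<close>

lemma collapse_ed:
  assumes ys: "y \<noteq> s" and nb: "\<And>b. fc T y s b \<Longrightarrow> bd T y b \<Longrightarrow> bd T s b \<Longrightarrow> False"
    and ab: "ed T a b" "(id(y := s)) a \<noteq> (id(y := s)) b"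
  shows "ed (collapse (id(y := s)) T) ((id(y := s)) a) ((id(y := s)) b)"
proof -
  let ?f = "id(y := s)" and ?T' = "collapse (id(y := s)) T"
  have edI: "ed ?T' (?f a) (?f b)" if "fc T a b c" "\<not> (y \<in> {a,b,c} \<and> s \<in> {a,b,c})" for a b c
  proof -
    have n: "a \<noteq> b \<and> b \<noteq> c \<and> a \<noteq> c" using fc_neq[OF that(1)] .
    then have ne: "?f a \<noteq> ?f b" "?f b \<noteq> ?f c" "?f a \<noteq> ?f c" using that(2) by auto
    then have "card {?f a, ?f b, ?f c} = 3" by simp
    from fc_ed_gen[OF collapse_fc[OF that(1) this] ne(1)] show ?thesis .
  qed
  have main: "ed ?T' (?f a) (?f b)" if ab: "ed T a b" "?f a \<noteq> ?f b" "b \<noteq> y" "b \<noteq> s" for a b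
  proof -
    obtain c where c: "fc T a b c" using ed_fc[OF ab(1)] by blast
    show ?thesis
    proof (cases "y \<in> {a,b,c} \<and> s \<in> {a,b,c}")
      case False
      then show ?thesis using edI[OF c] by blast
    next
      case True
      then have "{a,c} = {y,s}" using ab(3,4) fc_neq[OF c] ys by auto
      then have ac: "a = y \<and> c = s \<or> a = s \<and> c = y" by (auto simp: doubleton_eq_iff)
      have ysb: "fc T y s b" using ac c by (auto dest: fc_swap fc_rot)
      then have yb: "fc T y b s" "fc T s b y" by (auto dest: fc_swap fc_rot)
      have fab: "?f a = s" "?f b = b" using ac ab(3) by auto
      from nb[OF ysb] have "\<not> bd T y b \<or> \<not> bd T s b" by blast
      then show ?thesis
      proof
        assume "\<not> bd T y b"
        then obtain e where e: "fc T y b e" "e \<noteq> s" using inner_other[OF yb(1)] by blast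
        have "ed ?T' (?f y) (?f b)" by (rule edI[OF e(1)]) (use e(2) ab(4) ys in auto)
        then show ?thesis using fab by simp
      next
        assume "\<not> bd T s b"
        then obtain e where e: "fc T s b e" "e \<noteq> y" using inner_other[OF yb(2)] by blast
        have "ed ?T' (?f s) (?f b)" by (rule edI[OF e(1)]) (use e(2) ab(3) ys in auto)
        then show ?thesis using fab ys by simp
      qed
    qed
  qed
  show ?thesis
  proof (cases "b = y \<or> b = s")
    case False
    then show ?thesis using main[OF ab] by blast
  next
    case True
    then have "a \<noteq> y" "a \<noteq> s" using ab ys ed_neq[OF ab(1)] by (auto split: if_splits)
    then show ?thesis using main[OF ed_sym[OF ab(1)] ab(2)[symmetric]] by (blast intro: ed_sym)
  qed
qed

lemma collapse_verts:
  assumes "y \<noteq> s" "s \<in> verts T"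
  shows "verts (collapse (id(y := s)) T) \<subseteq> verts T - {y}"
proof
  fix z assume "z \<in> verts (collapse (id(y := s)) T)"
  then obtain t p where "t \<in> T" "p \<in> t" "z = (id(y := s)) p" by (auto simp: verts_def collapse_def)
  then show "z \<in> verts T - {y}" using assms by (auto simp: verts_def)
qed

end

section \<open>Stuck triangulations and their moves\<close>

abbreviation step :: "'a topology \<Rightarrow> 'v set set \<Rightarrow> 'v set set \<Rightarrow> bool" where
  "step F \<equiv> \<lambda>G G'. reduction4 F G G' \<or> diagonal_flip F G G'"

definition reducible :: "'a topology \<Rightarrow> 'v set set \<Rightarrow> bool" where
  "reducible F T \<longleftrightarrow> (\<exists>T'. (step F)\<^sup>*\<^sup>* T T' \<and> triangulation4 F T' \<and> card (verts T') < card (verts T))"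

context csurf
begin

text \<open>Here and in the following lemmas, faces that close up around \<open>a\<close>, or run
  between two boundary edges at \<open>a\<close>, exhaust its link. In a stuck triangulation the
  patterns with two or three neighbours contradict the degree bound.\<close>

lemma closed3:
  assumes "fc T a x y" "fc T a y z" "fc T a z x"
  shows "nb T a = {x,y,z}"
proof (rule link_closed[of x])
  have r: "fc T a y x" "fc T a z y" "fc T a x z" using assms by (auto dest: fc_swap)
  have ne: "x \<noteq> y" "y \<noteq> z" "x \<noteq> z" using fc_neq assms by blast+
  show "ed T a n" if "n \<in> {x,y,z}" for n using that fc_ed[OF assms(1)] fc_ed[OF assms(2)] by auto
  show "m \<in> {x,y,z}" if "n \<in> {x,y,z}" "fc T a n m" for n m
    using that fc_le2[OF assms(1) r(3) ne(2), of m] fc_le2[OF r(1) assms(2) ne(3), of m]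
      fc_le2[OF assms(3) r(2) ne(1), of m] by blast
qed simp

lemma path2:
  assumes "bd T a x" "fc T a x y" "bd T a y"
  shows "nb T a = {x,y}"
proof (rule link_closed[of x])
  have r: "fc T a y x" using assms(2) by (rule fc_swap)
  show "ed T a n" if "n \<in> {x,y}" for n using that fc_ed[OF assms(2)] by auto
  show "m \<in> {x,y}" if "n \<in> {x,y}" "fc T a n m" for n m
    using that bd_unique[OF assms(1,2), of m] bd_unique[OF assms(3) r, of m] by blast
qed simp

lemma path3:
  assumes "bd T a x" "fc T a x y" "fc T a y z" "bd T a z" "x \<noteq> z"
  shows "nb T a = {x,y,z}"
proof (rule link_closed[of x])
  have r: "fc T a y x" "fc T a z y" using assms by (auto dest: fc_swap)
  show "ed T a n" if "n \<in> {x,y,z}" for n using that fc_ed[OF assms(2)] fc_ed[OF assms(3)] by auto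
  show "m \<in> {x,y,z}" if "n \<in> {x,y,z}" "fc T a n m" for n m
    using that bd_unique[OF assms(1,2), of m] bd_unique[OF assms(4) r(2), of m]
      fc_le2[OF r(1) assms(3,5), of m] by blast
qed simp

lemma closed4:
  assumes "fc T a x y" "fc T a y z" "fc T a z w" "fc T a w x" "x \<noteq> z" "y \<noteq> w"
  shows "nb T a = {x,y,z,w}" "\<not> bv T a"
proof -
  have r: "fc T a y x" "fc T a z y" "fc T a w z" "fc T a x w" using assms by (auto dest: fc_swap)
  show n: "nb T a = {x,y,z,w}"
  proof (rule link_closed[of x])
    show "ed T a n" if "n \<in> {x,y,z,w}" for n
      using that fc_ed[OF assms(1)] fc_ed[OF assms(3)] by auto
    show "m \<in> {x,y,z,w}" if "n \<in> {x,y,z,w}" "fc T a n m" for n m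
      using that fc_le2[OF assms(1) r(4) assms(6), of m] fc_le2[OF r(1) assms(2,5), of m]
        fc_le2[OF r(2) assms(3,6), of m] fc_le2[OF r(3) assms(4) assms(5)[symmetric], of m] by blast
  qed simp
  have "\<not> bd T a x" "\<not> bd T a y" "\<not> bd T a z" "\<not> bd T a w"
    using bd_unique[OF _ assms(1) r(4)] bd_unique[OF _ r(1) assms(2)] bd_unique[OF _ r(2) assms(3)]
      bd_unique[OF _ r(3) assms(4)] assms(5,6) by auto
  moreover have "b \<in> {x,y,z,w}" if "bd T a b" for b
    using bd_ed[OF that] unfolding n[symmetric] nb_iff .
  ultimately show "\<not> bv T a" unfolding bv_def by blast
qed

lemma path4:
  assumes "bd T a x" "fc T a x y" "fc T a y z" "fc T a z w" "bd T a w" "x \<noteq> z" "y \<noteq> w"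
  shows "nb T a = {x,y,z,w}"
proof (rule link_closed[of x])
  have r: "fc T a y x" "fc T a z y" "fc T a w z" using assms by (auto dest: fc_swap)
  show "ed T a n" if "n \<in> {x,y,z,w}" for n
    using that fc_ed[OF assms(2)] fc_ed[OF assms(4)] by auto
  show "m \<in> {x,y,z,w}" if "n \<in> {x,y,z,w}" "fc T a n m" for n m
    using that bd_unique[OF assms(1,2), of m] fc_le2[OF r(1) assms(3,6), of m]
      fc_le2[OF r(2) assms(4,7), of m] bd_unique[OF assms(5) r(3), of m] by blast
qed simp

lemma inner4:
  assumes i: "\<not> bv T w" and c: "deg T w = 4" and f: "fc T w x y"
  obtains p q where "fc T w y p" "fc T w p q" "fc T w q x" "distinct [w,x,y,p,q]" "nb T w = {x,y,p,q}"
proof -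
  obtain r where r: "distinct (w # x # y # r)" "nb T w = set (x # y # r)"
    "star T w = fan w (x # y # r @ [x])"
    by (rule fan_exists[OF f disjI2[OF i]]) (use i in blast)
  have "card (set (x # y # r)) = length (x # y # r)" using r(1) by (intro distinct_card) simp
  then have "length r = 2" using c r(2) by (simp add: deg_nb)
  then obtain p q where pq: "r = [p,q]" by (auto simp: length_Suc_conv numeral_2_eq_2)
  have "{w,y,p} \<in> star T w" "{w,p,q} \<in> star T w" "{w,q,x} \<in> star T w" unfolding r(3) pq by simp_all
  then show ?thesis using that[of p q] r(1,2) pq by (auto simp: fc_def)
qed

lemma bd4:
  assumes b: "bd T w u1" and c: "deg T w = 4"
  obtains u2 u3 u4 where "fc T w u1 u2" "fc T w u2 u3" "fc T w u3 u4" "bd T w u4"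
    "distinct [w,u1,u2,u3,u4]" "nb T w = {u1,u2,u3,u4}"
proof -
  obtain u2 where f: "fc T w u1 u2" using ed_fc[OF bd_ed[OF b]] by blast
  obtain r where r: "distinct (w # u1 # u2 # r)" "nb T w = set (u1 # u2 # r)"
    "star T w = fan w (u1 # u2 # r) \<and> bd T w (last (u1 # u2 # r))"
    by (rule fan_exists[OF f disjI1[OF b]]) (use b in blast)
  have "card (set (u1 # u2 # r)) = length (u1 # u2 # r)" using r(1) by (intro distinct_card) simp
  then have "length r = 2" using c r(2) by (simp add: deg_nb)
  then obtain p q where pq: "r = [p,q]" by (auto simp: length_Suc_conv numeral_2_eq_2)
  have st: "star T w = fan w (u1 # u2 # r)" using r(3) by blast
  have "{w,u2,p} \<in> star T w" "{w,p,q} \<in> star T w" unfolding st pq by simp_all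
  then show ?thesis using that[of u2 p q] r pq f by (auto simp: fc_def)
qed

end

text \<open>
  A flip of a stuck triangulation is again stuck, so a contradiction may be derived after
  finitely many flips.
\<close>

locale stuck = csurf T for T :: "'v set set" +
  fixes F :: "'a topology"
  assumes punctured: "punctured_surface F"
    and not_disc: "\<not> F homeomorphic_space top_of_set (cball 0 1 :: (real^2) set)"
    and tri4: "triangulation4 F T" and irr: "\<not> reducible F T"

lemma stuckI:
  assumes "punctured_surface F" "\<not> F homeomorphic_space top_of_set (cball 0 1 :: (real^2) set)"
    "triangulation4 F T" "\<not> reducible F T"
  shows "stuck T F"
proof -
  interpret csurf T using triangulates_csurf assms(1,3) unfolding triangulation4_def by blast
  show ?thesis using assms by unfold_locales
qed

context stuck
begin

lemma tri: "triangulates T F"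
  using tri4 by (simp add: triangulation4_def)

lemma deg_ge4: "ed T a b \<Longrightarrow> 4 \<le> deg T a"
  using tri4 ed_verts[of a b] by (simp add: triangulation4_def)

lemma no_reduction:
  assumes "reduction4 F T T'" "card (verts T') < card (verts T)"
  shows False
proof -
  have "triangulation4 F T'" using assms(1) by (simp add: reduction4_def)
  then have "reducible F T" using assms unfolding reducible_def by blast
  then show False using irr by contradiction
qed

lemma no_closed3: "fc T a x y \<Longrightarrow> fc T a y z \<Longrightarrow> fc T a z x \<Longrightarrow> False"
  using closed3[of a x y z] deg_ge4[of a x] fc_ed[of a x y] by (auto simp: deg_nb card_insert_if split: if_splits)

lemma no_path2: "bd T a x \<Longrightarrow> fc T a x y \<Longrightarrow> bd T a y \<Longrightarrow> False"
  using path2[of a x y] deg_ge4[of a x] fc_ed[of a x y] by (auto simp: deg_nb card_insert_if split: if_splits)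

lemma no_path3: "bd T a x \<Longrightarrow> fc T a x y \<Longrightarrow> fc T a y z \<Longrightarrow> bd T a z \<Longrightarrow> x \<noteq> z \<Longrightarrow> False"
  using path3[of a x y z] deg_ge4[of a x] fc_ed[of a x y] by (auto simp: deg_nb card_insert_if split: if_splits)

lemma contract_verts:
  assumes "ed T y s"
  shows "card (verts (collapse (id(y := s)) T)) < card (verts T)"
proof -
  have v: "y \<in> verts T" "s \<in> verts T" using ed_verts[OF assms] by auto
  have "verts (collapse (id(y := s)) T) \<subset> verts T"
    using collapse_verts[OF ed_neq[OF assms] v(2)] v(1) by blast
  then show ?thesis using psubset_card_mono[OF finite_verts] by blast
qed

text \<open>Inclusions suffice, since the aim is a lower bound on degrees. No edge gets lost,
  because a vertex with boundary edges to \<open>y\<close> and \<open>s\<close> and the face between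
  them would have degree 2.\<close>

lemma contract_nb:
  assumes ys: "ed T y s"
  shows "z \<noteq> y \<Longrightarrow> z \<noteq> s \<Longrightarrow> (id(y := s)) ` nb T z \<subseteq> nb (collapse (id(y := s)) T) z"
    "nb T s \<union> nb T y - {s,y} \<subseteq> nb (collapse (id(y := s)) T) s"
proof -
  let ?f = "id(y := s)" and ?T' = "collapse (id(y := s)) T"
  have ne: "y \<noteq> s" using ed_neq[OF ys] .
  have nd: False if "fc T y s b" "bd T y b" "bd T s b" for b
    using no_path2[of b y s] that by (auto dest: bd_sym fc_swap fc_rot)
  have e: "ed ?T' (?f a) (?f b)" if "ed T a b" "?f a \<noteq> ?f b" for a b
    using collapse_ed[OF ne _ that] nd by blast
  show "?f ` nb T z \<subseteq> nb ?T' z" if z: "z \<noteq> y" "z \<noteq> s"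
  proof
    fix c assume "c \<in> ?f ` nb T z"
    then obtain b where b: "ed T z b" "c = ?f b" by (auto simp: nb_def)
    have "?f z \<noteq> ?f b" using z ed_neq[OF b(1)] by auto
    then show "c \<in> nb ?T' z" using e[OF b(1)] b(2) z by (simp add: nb_def)
  qed
  show "nb T s \<union> nb T y - {s,y} \<subseteq> nb ?T' s"
  proof
    fix b assume b: "b \<in> nb T s \<union> nb T y - {s,y}"
    then have "ed T s b \<or> ed T y b" by (auto simp: nb_def)
    then show "b \<in> nb ?T' s" using e[of s b] e[of y b] b ne by (auto simp: nb_def)
  qed
qed

text \<open>The merged vertex has at least 3 + 3 - 2 neighbours, as at most the two vertices
  \<open>p\<close> and \<open>q\<close> are shared. A common neighbour loses one from a degree of at
  least 5, and for every other vertex the renaming is injective on the neighbours.\<close>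

lemma contract_tri4:
  assumes ce: "contractible_edge F T s y"
    and co: "\<And>z. ed T z s \<Longrightarrow> ed T z y \<Longrightarrow> (z = p \<or> z = q) \<and> 5 \<le> deg T z"
  shows "triangulation4 F (collapse (id(y := s)) T)"
proof -
  let ?f = "id(y := s)" and ?T' = "collapse (id(y := s)) T"
  have sy: "ed T s y" using ce by (simp add: contractible_edge_def ed_def)
  note ys = ed_sym[OF sy]
  have ne: "y \<noteq> s" using ed_neq[OF ys] .
  have t': "triangulates ?T' F" using ce by (simp add: contractible_edge_def)
  interpret T': csurf ?T' using triangulates_csurf[OF punctured t'] .
  have "4 \<le> deg ?T' z" if z: "z \<in> verts ?T'" for z
  proof (cases "z = s")
    case True
    have n: "3 \<le> card (nb T s - {y})" "3 \<le> card (nb T y - {s})"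
      using deg_ge4[OF sy] deg_ge4[OF ys] sy ys by (simp_all add: deg_nb nb_iff finite_nb)
    have "(nb T s - {y}) \<inter> (nb T y - {s}) \<subseteq> {p,q}" using co by (auto simp: nb_def dest: ed_sym)
    then have "card ((nb T s - {y}) \<inter> (nb T y - {s})) \<le> card {p,q}" by (rule card_mono[rotated]) simp
    also have "\<dots> \<le> 2" by (simp add: card_insert_if)
    finally have i: "card ((nb T s - {y}) \<inter> (nb T y - {s})) \<le> 2" .
    have "card (nb T s - {y}) + card (nb T y - {s})
        = card ((nb T s - {y}) \<union> (nb T y - {s})) + card ((nb T s - {y}) \<inter> (nb T y - {s}))"
      by (rule card_Un_Int) (simp_all add: finite_nb)
    then have "4 \<le> card ((nb T s - {y}) \<union> (nb T y - {s}))" using n i by linarith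
    moreover have "(nb T s - {y}) \<union> (nb T y - {s}) \<subseteq> nb ?T' s"
    proof -
      have "(nb T s - {y}) \<union> (nb T y - {s}) \<subseteq> nb T s \<union> nb T y - {s,y}"
        by (auto simp: nb_def dest: ed_neq)
      then show ?thesis using contract_nb(2)[OF ys] by (rule subset_trans)
    qed
    ultimately show ?thesis
      using card_mono[OF T'.finite_nb] unfolding True deg_nb by (meson order_trans)
  next
    case False
    have zy: "z \<noteq> y" "z \<in> verts T" using z collapse_verts[OF ne] ed_verts[OF sy] by blast+
    have d4: "4 \<le> deg T z" using tri4 zy(2) by (simp add: triangulation4_def)
    have sub: "?f ` nb T z \<subseteq> nb ?T' z" by (rule contract_nb(1)[OF ys zy(1) False])
    have "4 \<le> card (?f ` nb T z)"
    proof (cases "y \<in> nb T z \<and> s \<in> nb T z")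
      case True
      then have "5 \<le> deg T z" using co[of z] by (simp add: nb_iff)
      then have "4 \<le> card (nb T z - {y})" using True by (simp add: deg_nb finite_nb)
      moreover have "nb T z - {y} \<subseteq> ?f ` nb T z"
      proof
        fix b assume "b \<in> nb T z - {y}"
        then show "b \<in> ?f ` nb T z" by (intro image_eqI[of _ _ b]) auto
      qed
      ultimately show ?thesis using card_mono[of "?f ` nb T z"] finite_nb[of z]
        by (meson finite_imageI order_trans)
    next
      case c: False
      have "inj_on ?f (nb T z)" using c by (auto simp: inj_on_def)
      then show ?thesis using d4 unfolding deg_nb by (simp only: card_image)
    qed
    then show ?thesis using card_mono[OF T'.finite_nb sub] by (simp add: deg_nb)
  qed
  then show ?thesis using t' by (simp add: triangulation4_def)
qed

lemma contract_false:
  assumes ce: "contractible_edge F T s y"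
    and co: "\<And>z. ed T z s \<Longrightarrow> ed T z y \<Longrightarrow> (z = p \<or> z = q) \<and> 5 \<le> deg T z"
  shows False
proof (rule no_reduction)
  have e: "ed T s y" using ce by (simp add: contractible_edge_def ed_def)
  show "card (verts (collapse (id(y := s)) T)) < card (verts T)"
    by (rule contract_verts[OF ed_sym[OF e]])
  have "red1 F T (collapse (id(y := s)) T)"
    unfolding red1_def by (intro exI conjI, rule ce, rule refl)
  moreover have "triangulation4 F (collapse (id(y := s)) T)"
    by (rule contract_tri4[OF ce co])
  ultimately show "reduction4 F T (collapse (id(y := s)) T)"
    by (simp only: reduction4_def simp_thms)
qed

text \<open>It is \<open>y\<close>, the vertex that disappears, that is inner; \<open>s\<close> may
  lie on the boundary.\<close>

lemma contract_inner:
  assumes "\<not> bv T y" "fc T y s p" "fc T y s q" "p \<noteq> q"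
    and co: "\<And>z. ed T z s \<Longrightarrow> ed T z y \<Longrightarrow> z = p \<or> z = q"
    and "5 \<le> deg T p" "5 \<le> deg T q"
  shows False
proof (rule contract_false)
  show "contractible_edge F T s y"
    by (rule contractible_cycle[OF tri assms(1-4) co])
      (use deg_ge4[of y s] fc_ed[OF assms(2)] in \<open>simp_all add: deg_nb\<close>)
  show "(z = p \<or> z = q) \<and> 5 \<le> deg T z" if "ed T z s" "ed T z y" for z
    using co[OF that] assms(6,7) by blast
qed

lemma contract_bd:
  assumes "bd T y s" "fc T y s p"
    and co: "\<And>z. ed T z s \<Longrightarrow> ed T z y \<Longrightarrow> z = p"
    and "5 \<le> deg T p"
  shows False
proof (rule contract_false)
  show "contractible_edge F T s y"
    by (rule contractible_path[OF tri assms(1-2) co])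
      (use deg_ge4[of y s] fc_ed[OF assms(2)] in \<open>simp_all add: deg_nb\<close>)
  show "(z = p \<or> z = p) \<and> 5 \<le> deg T z" if "ed T z s" "ed T z y" for z
    using co[OF that] assms(4) by blast
qed

end

section \<open>Diagonal flips\<close>

lemma set3_eq:
  assumes "distinct [p,q,r]"
  shows "{a,b,c} = {p,q,r} \<longleftrightarrow> (a = p \<and> b = q \<and> c = r) \<or> (a = p \<and> b = r \<and> c = q) \<or>
    (a = q \<and> b = p \<and> c = r) \<or> (a = q \<and> b = r \<and> c = p) \<or>
    (a = r \<and> b = p \<and> c = q) \<or> (a = r \<and> b = q \<and> c = p)" (is "_ \<longleftrightarrow> ?R")
proof
  assume e: "{a,b,c} = {p,q,r}"
  have "a \<in> {p,q,r}" "b \<in> {p,q,r}" "c \<in> {p,q,r}" unfolding e[symmetric] by auto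
  moreover have "p \<in> {a,b,c}" "q \<in> {a,b,c}" "r \<in> {a,b,c}" unfolding e by auto
  ultimately show ?R using assms by auto
qed auto

definition flip :: "'v set set \<Rightarrow> 'v \<Rightarrow> 'v \<Rightarrow> 'v \<Rightarrow> 'v \<Rightarrow> 'v set set" where
  "flip T x y w z = (T - {{x,y,w}, {x,y,z}}) \<union> {{x,w,z}, {y,w,z}}"

context csurf
begin

lemma fc_both:
  assumes "fc T a b c" "x \<in> {a,b,c}" "y \<in> {a,b,c}" "fc T x y w" "fc T x y z" "w \<noteq> z"
  shows "{a,b,c} = {x,y,w} \<or> {a,b,c} = {x,y,z}"
proof -
  have xy: "x \<noteq> y" using fc_neq[OF assms(4)] by simp
  have "{a,b,c} \<in> T" using assms(1) by (simp add: fc_def)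
  then obtain e where e: "{a,b,c} = {x,y,e}" using face_at[OF _ assms(2,3) xy] by auto
  have "fc T x y e" using assms(1) unfolding fc_def e .
  then have "e = w \<or> e = z" using fc_le2[OF assms(4-6)] by simp
  then show ?thesis using e by blast
qed

lemma bd_iff: "bd T a b \<longleftrightarrow> ed T a b \<and> (\<forall>c e. fc T a b c \<longrightarrow> fc T a b e \<longrightarrow> c = e)"
  using bd_ed bd_unique fc_bdI ed_fc by metis

end

text \<open>The flip of \<open>xy\<close> into \<open>wz\<close>. The degrees of \<open>x\<close>
  and \<open>y\<close> drop, hence the bound 5. The gain is one more neighbour for \<open>w\<close>
  and \<open>z\<close>, which turns a vertex of degree 4 into an admissible third vertex at an edge
  to be contracted.\<close>

locale stuck_flip = stuck T F for T :: "'v set set" and F :: "'a topology" +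
  fixes x y w z :: 'v
  assumes xyw: "fc T x y w" and xyz: "fc T x y z" and wz: "w \<noteq> z" and nwz: "\<not> ed T w z"
    and dx: "5 \<le> deg T x" and dy: "5 \<le> deg T y"
begin

abbreviation "T' \<equiv> flip T x y w z"

lemma neq: "x \<noteq> y" "x \<noteq> w" "x \<noteq> z" "y \<noteq> w" "y \<noteq> z" "w \<noteq> z"
  using fc_neq[OF xyw] fc_neq[OF xyz] wz by auto

lemma fc_flip:
  "fc T' a b c \<longleftrightarrow> (fc T a b c \<and> \<not> (x \<in> {a,b,c} \<and> y \<in> {a,b,c})) \<or>
     {a,b,c} = {x,w,z} \<or> {a,b,c} = {y,w,z}"
proof -
  have "{a,b,c} = {x,y,w} \<or> {a,b,c} = {x,y,z} \<longleftrightarrow> x \<in> {a,b,c} \<and> y \<in> {a,b,c}" if "fc T a b c"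
    using fc_both[OF that _ _ xyw xyz wz] by blast
  moreover have "fc T' a b c \<longleftrightarrow> (fc T a b c \<and> \<not> ({a,b,c} = {x,y,w} \<or> {a,b,c} = {x,y,z})) \<or>
     {a,b,c} = {x,w,z} \<or> {a,b,c} = {y,w,z}"
    unfolding fc_def flip_def by (simp only: Un_iff Diff_iff insert_iff empty_iff simp_thms)
  ultimately show ?thesis by (cases "fc T a b c") simp_all
qed

lemma perm_x: "{a,b,c} = {x,w,z} \<longleftrightarrow> (a = x \<and> b = w \<and> c = z) \<or> (a = x \<and> b = z \<and> c = w) \<or>
    (a = w \<and> b = x \<and> c = z) \<or> (a = w \<and> b = z \<and> c = x) \<or>
    (a = z \<and> b = x \<and> c = w) \<or> (a = z \<and> b = w \<and> c = x)"
  by (rule set3_eq) (use neq in simp)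

lemma perm_y: "{a,b,c} = {y,w,z} \<longleftrightarrow> (a = y \<and> b = w \<and> c = z) \<or> (a = y \<and> b = z \<and> c = w) \<or>
    (a = w \<and> b = y \<and> c = z) \<or> (a = w \<and> b = z \<and> c = y) \<or>
    (a = z \<and> b = y \<and> c = w) \<or> (a = z \<and> b = w \<and> c = y)"
  by (rule set3_eq) (use neq in simp)

lemmas fc_flip' = fc_flip[unfolded perm_x perm_y]

lemma fc_new: "fc T' x w z" "fc T' y w z"
  by (simp_all add: fc_flip')

lemma fc_old: "fc T a b c \<Longrightarrow> \<not> (x \<in> {a,b,c} \<and> y \<in> {a,b,c}) \<Longrightarrow> fc T' a b c"
  by (simp add: fc_flip)

lemma tri_flip: "triangulates T' F"
  unfolding flip_def
proof (rule triangulatesI[OF tri])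
  show "top_of_set (realization T) homeomorphic_space
    top_of_set (realization (T - {{x,y,w}, {x,y,z}} \<union> {{x,w,z}, {y,w,z}}))"
  proof (rule homeomorphic_flip)
    show "card t = 3" if "t \<in> T" for t using c3[OF that] .
    show "distinct [x,y,w,z]" using neq by simp
    show "{x,y,w} \<in> T" "{x,y,z} \<in> T" using xyw xyz by (simp_all add: fc_def)
    show "t = {x,y,w} \<or> t = {x,y,z}" if t: "t \<in> T" "x \<in> t" "y \<in> t" for t
    proof -
      obtain e where e: "t = {x,y,e}" using face_at[OF t neq(1)] by blast
      have "fc T x y e" using t(1) unfolding fc_def e .
      then have "e = w \<or> e = z" using fc_le2[OF xyw xyz wz] by simp
      then show ?thesis using e by auto
    qed
    show False if t: "t \<in> T" "w \<in> t" "z \<in> t" for t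
    proof -
      obtain e where e: "t = {w,z,e}" using face_at[OF t wz] by blast
      have "fc T w z e" using t(1) unfolding fc_def e .
      then show False using fc_ed nwz by blast
    qed
  qed
  show "finite (T - {{x,y,w}, {x,y,z}} \<union> {{x,w,z}, {y,w,z}})" using fin by simp
  show "card t = 3" if "t \<in> T - {{x,y,w}, {x,y,z}} \<union> {{x,w,z}, {y,w,z}}" for t
    using that c3 neq by auto
qed

sublocale flipped: csurf T'
  using triangulates_csurf[OF punctured tri_flip] .

lemma ed_flip:
  "ed T' a b \<longleftrightarrow> (ed T a b \<and> \<not> (a = x \<and> b = y) \<and> \<not> (a = y \<and> b = x)) \<or>
     (a = w \<and> b = z) \<or> (a = z \<and> b = w)" (is "?L \<longleftrightarrow> ?R")
proof
  have e: "ed T x w" "ed T x z" "ed T y w" "ed T y z" using fc_ed[OF xyw] fc_ed[OF xyz] by auto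
  note e' = e[THEN ed_sym]
  {
    assume ?L
    then obtain c where c: "fc T' a b c" using flipped.ed_fc by blast
    then have "(fc T a b c \<and> \<not> (x \<in> {a,b,c} \<and> y \<in> {a,b,c})) \<or>
       {a,b,c} = {x,w,z} \<or> {a,b,c} = {y,w,z}" unfolding fc_flip .
    then consider "fc T a b c" "\<not> (x \<in> {a,b,c} \<and> y \<in> {a,b,c})"
      | "{a,b,c} = {x,w,z}" | "{a,b,c} = {y,w,z}" by blast
    then show ?R
    proof cases
      case 1
      then show ?thesis using fc_ed by blast
    next
      case 2
      then show ?thesis unfolding perm_x using e e' neq by auto
    next
      case 3
      then show ?thesis unfolding perm_y using e e' neq by auto
    qed
  next
    have n: "ed T' x w" "ed T' x z" "ed T' y w" "ed T' y z" "ed T' w z"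
      using flipped.fc_ed[OF fc_new(1)] flipped.fc_ed[OF fc_new(2)] by auto
    note n' = n[THEN ed_sym]
    assume ?R
    then consider "ed T a b" "\<not> (a = x \<and> b = y)" "\<not> (a = y \<and> b = x)" | "(a = w \<and> b = z) \<or> (a = z \<and> b = w)"
      by blast
    then show ?L
    proof cases
      case 1
      obtain c where c: "fc T a b c" using ed_fc[OF 1(1)] by blast
      show ?thesis
      proof (cases "x \<in> {a,b,c} \<and> y \<in> {a,b,c}")
        case False
        then show ?thesis using flipped.fc_ed[OF fc_old[OF c]] by blast
      next
        case True
        have "distinct [x,y,w]" "distinct [x,y,z]" using neq by simp_all
        moreover have "{a,b,c} = {x,y,w} \<or> {a,b,c} = {x,y,z}"
          using fc_both[OF c _ _ xyw xyz wz] True by blast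
        ultimately show ?thesis using 1(2,3) n n' by (auto simp: set3_eq)
      qed
    next
      case 2
      then show ?thesis using n n' by auto
    qed
  }
qed

lemma nb_flip:
  "nb T' x = nb T x - {y}" "nb T' y = nb T y - {x}"
  "nb T' w = insert z (nb T w)" "nb T' z = insert w (nb T z)"
  "a \<notin> {x,y,w,z} \<Longrightarrow> nb T' a = nb T a"
  using neq by (auto simp: nb_def ed_flip)

lemma deg_flip:
  "deg T' x = deg T x - 1" "deg T' y = deg T y - 1"
  "deg T' w = Suc (deg T w)" "deg T' z = Suc (deg T z)"
  "a \<notin> {x,y,w,z} \<Longrightarrow> deg T' a = deg T a"
proof -
  have "y \<in> nb T x" "x \<in> nb T y" using fc_ed[OF xyw] ed_sym by (auto simp: nb_def)
  then show "deg T' x = deg T x - 1" "deg T' y = deg T y - 1"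
    unfolding deg_nb nb_flip by (simp_all add: finite_nb)
  have "z \<notin> nb T w" "w \<notin> nb T z" using nwz ed_sym[of T z w] by (auto simp: nb_def)
  then show "deg T' w = Suc (deg T w)" "deg T' z = Suc (deg T z)"
    unfolding deg_nb nb_flip by (simp_all add: finite_nb)
  show "a \<notin> {x,y,w,z} \<Longrightarrow> deg T' a = deg T a" using nb_flip(5)[of a] by (simp add: deg_nb)
qed

text \<open>The edges \<open>xy\<close> and \<open>wz\<close> lie in two faces and are inner. At any
  other edge the flip replaces faces one by one, so the number of faces at it does not
  change.\<close>

lemma bd_flip: "bd T' a b \<longleftrightarrow> bd T a b"
proof
  have r: "fc T x w y" "fc T w x y" "fc T x z y" "fc T z x y" "fc T y w x" "fc T w y x" "fc T y z x" "fc T z y x"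
    using xyw xyz by (auto dest: fc_swap fc_rot)
  note n = neq neq[symmetric]
  {
    assume b: "bd T a b"
    then have eT: "ed T a b" by (rule bd_ed)
    have nxy: "\<not> (a = x \<and> b = y)" "\<not> (a = y \<and> b = x)"
      using bd_unique[OF _ xyw xyz] b wz bd_sym[of T a b] by auto
    have nwz': "\<not> (a = w \<and> b = z)" "\<not> (a = z \<and> b = w)" using eT nwz ed_sym[of T z w] by auto
    \<comment> \<open>Each face of the flipped triangulation at \<open>ab\<close> is old or stands
      for an old face at \<open>ab\<close> that contained \<open>xy\<close>, with its new third
      vertex determined by \<open>ab\<close>.\<close>
    have key: "fc T a b c \<and> \<not> (x \<in> {a,b,c} \<and> y \<in> {a,b,c}) \<or>
        (\<exists>e. fc T a b e \<and> (x \<in> {a,b,e} \<and> y \<in> {a,b,e}) \<and>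
          (c = z \<and> ((a = w \<or> b = w) \<and> ((a = x \<or> b = x) \<or> (a = y \<or> b = y))) \<or>
           c = w \<and> ((a = z \<or> b = z) \<and> ((a = x \<or> b = x) \<or> (a = y \<or> b = y)))))"
      if "fc T' a b c" for c
      using that r n nwz' unfolding fc_flip' by auto
    have "c = e" if c: "fc T' a b c" "fc T' a b e" for c e
    proof -
      from key[OF c(1)] key[OF c(2)] show ?thesis using bd_unique[OF b] n nwz' nxy by auto
    qed
    then show "bd T' a b" unfolding flipped.bd_iff using eT nxy by (auto simp: ed_flip)
  next
    assume b: "bd T' a b"
    then have eT': "ed T' a b" by (rule bd_ed)
    have nwz': "\<not> (a = w \<and> b = z)" "\<not> (a = z \<and> b = w)"
    proof -
      have f: "fc T' w z x" "fc T' w z y" by (simp_all add: fc_flip')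
      show "\<not> (a = w \<and> b = z)" "\<not> (a = z \<and> b = w)"
        using flipped.bd_unique[OF _ f] b bd_sym[of T' a b] n by auto
    qed
    have eT: "ed T a b" "\<not> (a = x \<and> b = y)" "\<not> (a = y \<and> b = x)" using eT' nwz' by (auto simp: ed_flip)
    have key: "fc T' a b c \<and> \<not> (w \<in> {a,b,c} \<and> z \<in> {a,b,c}) \<or>
        (\<exists>e. fc T' a b e \<and> (w \<in> {a,b,e} \<and> z \<in> {a,b,e}) \<and>
          (c = x \<and> ((a = y \<or> b = y) \<and> ((a = w \<or> b = w) \<or> (a = z \<or> b = z))) \<or>
           c = y \<and> ((a = x \<or> b = x) \<and> ((a = w \<or> b = w) \<or> (a = z \<or> b = z)))))"
      if c: "fc T a b c" for c
    proof (cases "x \<in> {a,b,c} \<and> y \<in> {a,b,c}")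
      case False
      have "ed T a b" "ed T b c" "ed T a c" using fc_ed[OF c] by auto
      moreover have "\<not> ed T z w" using nwz ed_sym[of T z w] by blast
      moreover from calculation(1-3)[THEN ed_sym] have "ed T b a" "ed T c b" "ed T c a" .
      ultimately have "\<not> (w \<in> {a,b,c} \<and> z \<in> {a,b,c})" using nwz wz by auto
      then show ?thesis using fc_old[OF c False] by (intro disjI1 conjI)
    next
      case True
      have d: "distinct [x,y,w]" "distinct [x,y,z]" using neq by simp_all
      have "{a,b,c} = {x,y,w} \<or> {a,b,c} = {x,y,z}"
        using fc_both[OF c _ _ xyw xyz wz] True by blast
      then show ?thesis unfolding set3_eq[OF d(1)] set3_eq[OF d(2)]
        by (elim disjE conjE) (insert eT(2,3), simp_all add: fc_flip' n)
    qed
    have "c = e" if c: "fc T a b c" "fc T a b e" for c e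
    proof -
      from key[OF c(1)] key[OF c(2)] show ?thesis using flipped.bd_unique[OF b] n nwz' eT(2,3) by auto
    qed
    then show "bd T a b" unfolding bd_iff using eT by blast
  }
qed

lemma bv_flip: "bv T' a \<longleftrightarrow> bv T a"
  by (simp add: bv_def bd_flip)

lemma verts_flip: "verts T' = verts T"
proof -
  have "a \<in> verts T \<longleftrightarrow> (\<exists>b. ed T a b)" for a
  proof
    assume "a \<in> verts T"
    then obtain t where "t \<in> T" "a \<in> t" by (auto simp: verts_def)
    then show "\<exists>b. ed T a b" using face_star[of t a] fc_ed by blast
  qed (use ed_verts in blast)
  moreover have "a \<in> verts T' \<longleftrightarrow> (\<exists>b. ed T' a b)" for a
  proof
    assume "a \<in> verts T'"
    then obtain t where "t \<in> T'" "a \<in> t" by (auto simp: verts_def)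
    then show "\<exists>b. ed T' a b" using flipped.face_star[of t a] flipped.fc_ed by blast
  qed (use flipped.ed_verts in blast)
  moreover have "(\<exists>b. ed T' a b) \<longleftrightarrow> (\<exists>b. ed T a b)" for a
  proof
    have "ed T x w" "ed T y w" "ed T w x" "ed T z x"
      using fc_ed[OF xyw] fc_ed[OF xyz] by (auto dest: ed_sym)
    then show "\<exists>b. ed T' a b \<Longrightarrow> \<exists>b. ed T a b" by (auto simp: ed_flip)
    have "ed T' x w" "ed T' y w" using flipped.fc_ed[OF fc_new(1)] flipped.fc_ed[OF fc_new(2)] by auto
    then show "\<exists>b. ed T a b \<Longrightarrow> \<exists>b. ed T' a b" by (metis ed_flip)
  qed
  ultimately show ?thesis by blast
qed

lemma tri4_flip: "triangulation4 F T'"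
  unfolding triangulation4_def
proof (intro conjI ballI tri_flip)
  fix a assume "a \<in> verts T'"
  then have d: "4 \<le> deg T a" using tri4 unfolding verts_flip triangulation4_def by blast
  consider "a = x" | "a = y" | "a = w" | "a = z" | "a \<notin> {x,y,w,z}" by blast
  then show "4 \<le> deg T' a" by cases (use d dx dy in \<open>simp_all add: deg_flip(1-4)\<close>, simp add: deg_flip(5))
qed

lemma stuck_flipped: "stuck T' F"
proof (rule stuckI[OF punctured not_disc tri4_flip])
  show "\<not> reducible F T'"
  proof
    assume "reducible F T'"
    then obtain U where U: "(step F)\<^sup>*\<^sup>* T' U" "triangulation4 F U" "card (verts U) < card (verts T')"
      by (auto simp: reducible_def)
    have "diagonal_flip F T T'"
      unfolding diagonal_flip_def
    proof (intro conjI exI tri4_flip)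
      show "{x,y,w} \<in> T" "{x,y,z} \<in> T" using xyw xyz by (simp_all add: fc_def)
      show "{x,y} \<in> edges T" using fc_ed[OF xyw] by (simp add: ed_def)
      show "{w,z} \<notin> edges T" using nwz by (simp add: ed_def)
    qed (simp_all add: wz flip_def)
    then have "step F T T'" by simp
    from converse_rtranclp_into_rtranclp[of "step F", OF this U(1)] have "(step F)\<^sup>*\<^sup>* T U" .
    then have "reducible F T" unfolding reducible_def using U verts_flip by auto
    then show False using irr by contradiction
  qed
qed

end

section \<open>Octahedra\<close>

text \<open>Two of the barycentric coordinates identify the simplex with a compact convex set with
  interior points in the plane.\<close>

lemma realization_triangle:
  assumes "distinct [a,b,c]"
  shows "top_of_set (realization {{a,b,c}}) homeomorphic_space top_of_set (cball 0 1 :: (real^2) set)"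
proof -
  let ?K = "{p::real^2. 0 \<le> p $ 1 \<and> 0 \<le> p $ 2 \<and> p $ 1 + p $ 2 \<le> 1}"
  let ?f = "\<lambda>x::'a \<Rightarrow> real. vector [x a, x b] :: real^2"
  let ?g = "\<lambda>(p::real^2) q. if q = a then p $ 1 else if q = b then p $ 2
     else if q = c then 1 - p $ 1 - p $ 2 else 0"
  have f: "?f x \<in> ?K" "?g (?f x) = x" if "x \<in> realization {{a,b,c}}" for x
  proof -
    have x: "0 \<le> x a" "0 \<le> x b" "0 \<le> x c" "x a + x b + x c = 1" "\<And>p. p \<notin> {a,b,c} \<Longrightarrow> x p = 0"
      using that assms by (auto simp: realization_def)
    then show "?f x \<in> ?K" by simp
    show "?g (?f x) = x" using x by (auto simp: fun_eq_iff)
  qed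
  have g: "?g p \<in> realization {{a,b,c}}" "?f (?g p) = p" if "p \<in> ?K" for p
    using that assms by (auto simp: realization_def vec_eq_iff forall_2)
  have cg: "continuous_on S ?g" for S
  proof (rule continuous_on_coordinatewise_then_product)
    fix q show "continuous_on S (\<lambda>p. ?g p q)"
      by (cases "q = a"; cases "q = b"; cases "q = c"; simp; intro continuous_intros)
  qed
  have cf: "continuous_on S ?f" for S
  proof -
    have v: "?f = (\<lambda>x. \<chi> i. if i = 1 then x a else x b)" by (simp add: fun_eq_iff vec_eq_iff forall_2)
    have "continuous_on UNIV (\<lambda>x::'a \<Rightarrow> real. if i = 1 then x a else x b)" for i :: 2
      by (cases "i = 1") (simp_all add: continuous_on_product_coordinates)
    then have "continuous_on UNIV ?f" unfolding v by (intro continuous_on_vec_lambda)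
    then show ?thesis using continuous_on_subset by blast
  qed
  have "homeomorphic_maps (top_of_set (realization {{a,b,c}})) (top_of_set ?K) ?f ?g"
    unfolding homeomorphic_maps_def using f g cf cg by (auto simp: continuous_map_in_subtopology)
  then have h1: "top_of_set (realization {{a,b,c}}) homeomorphic_space top_of_set ?K"
    by (rule homeomorphic_maps_imp_homeomorphic_space)
  have "?K homeomorphic (cball 0 1 :: (real^2) set)"
  proof (rule homeomorphic_convex_compact_cball)
    show "convex ?K" by (auto simp: convex_def algebra_simps intro!: add_nonneg_nonneg mult_nonneg_nonneg)
      (smt (verit) add_nonneg_nonneg distrib_left mult_left_mono mult.commute mult_left_le)
    have "closed ?K" by (intro closed_Collect_conj closed_Collect_le continuous_intros)
    moreover have "bounded ?K"
    proof (rule boundedI[of _ 2])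
      fix p assume "p \<in> ?K"
      then have "\<bar>p $ 1\<bar> + \<bar>p $ 2\<bar> \<le> 1" by auto
      moreover have "norm p \<le> (\<Sum>i\<in>UNIV. \<bar>p $ i\<bar>)" by (rule norm_le_l1_cart)
      ultimately show "norm p \<le> 2" by (simp add: UNIV_2)
    qed
    ultimately show "compact ?K" by (simp add: compact_eq_bounded_closed)
    have "open {p::real^2. 0 < p $ 1 \<and> 0 < p $ 2 \<and> p $ 1 + p $ 2 < 1}"
      by (intro open_Collect_conj open_Collect_less continuous_intros)
    then have "{p::real^2. 0 < p $ 1 \<and> 0 < p $ 2 \<and> p $ 1 + p $ 2 < 1} \<subseteq> interior ?K"
      by (intro interior_maximal) auto
    moreover have "vector [1/3, 1/3] \<in> {p::real^2. 0 < p $ 1 \<and> 0 < p $ 2 \<and> p $ 1 + p $ 2 < 1}" by simp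
    ultimately show "interior ?K \<noteq> {}" by blast
  qed simp
  then obtain h k where "homeomorphism ?K (cball 0 1 :: (real^2) set) h k" by (auto simp: homeomorphic_def)
  then have "homeomorphic_maps (top_of_set ?K) (top_of_set (cball 0 1 :: (real^2) set)) h k"
    by (auto simp: homeomorphic_maps_def homeomorphism_def continuous_map_in_subtopology)
  then show ?thesis using h1 homeomorphic_maps_imp_homeomorphic_space homeomorphic_space_trans by blast
qed

text \<open>Seven faces of an octahedron, with each \<open>a\<close>-vertex opposite to the
  \<open>v\<close>-vertex of the same index. The eighth triangle \<open>a1 a2 a3\<close> is left
  open: it may be a face, a hole or merely a cycle.\<close>

definition octa :: "'v set set \<Rightarrow> 'v \<Rightarrow> 'v \<Rightarrow> 'v \<Rightarrow> 'v \<Rightarrow> 'v \<Rightarrow> 'v \<Rightarrow> bool" where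
  "octa T v1 v2 v3 a1 a2 a3 \<longleftrightarrow> distinct [v1,v2,v3,a1,a2,a3] \<and> fc T v1 v2 v3 \<and>
     fc T v1 v2 a3 \<and> fc T v2 v3 a1 \<and> fc T v1 v3 a2 \<and> fc T v1 a2 a3 \<and> fc T v2 a1 a3 \<and> fc T v3 a1 a2"

lemma star_insert: "star (insert t B) y = (if y \<in> t then insert t (star B y) else star B y)"
  by auto

lemma diff_star_insert: "insert t B - star (insert t B) y
    = (if y \<in> t then B - star B y else insert t (B - star B y))"
  by auto

text \<open>\<open>v1\<close> is contracted into \<open>a2\<close>, then \<open>v3\<close> into
  \<open>v2\<close>, and finally \<open>v2\<close> into \<open>a1\<close>. The link of the vanishing
  vertex is a cycle each time, of length 4, 3 and 3, and the triangle \<open>a1 a3 a2\<close>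
  remains.\<close>

lemma realization_octahedron:
  assumes d: "distinct [v1,v2,v3,a1,a2,a3]"
    and T: "T = {{v1,v2,v3}, {v1,v2,a3}, {v2,v3,a1}, {v1,v3,a2}, {v1,a2,a3}, {v2,a1,a3}, {v3,a1,a2}}"
  shows "top_of_set (realization T) homeomorphic_space top_of_set (cball 0 1 :: (real^2) set)"
proof -
  have n0: "v1 \<noteq> v2" "v1 \<noteq> v3" "v1 \<noteq> a1" "v1 \<noteq> a2" "v1 \<noteq> a3" "v2 \<noteq> v3" "v2 \<noteq> a1" "v2 \<noteq> a2"
    "v2 \<noteq> a3" "v3 \<noteq> a1" "v3 \<noteq> a2" "v3 \<noteq> a3" "a1 \<noteq> a2" "a1 \<noteq> a3" "a2 \<noteq> a3" using d by auto
  note ne = n0 n0[symmetric]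
  have c3: "card t = 3" if "t \<in> T" for t using that ne unfolding T by auto
  let ?T1 = "{{v2,v3,a1}, {v2,a1,a3}, {v3,a1,a2}, {a2,v3,v2}, {a2,v2,a3}}"
  let ?T2 = "{{v2,a1,a3}, {a2,v2,a3}, {v2,a1,a2}}"
  let ?T3 = "{{a1,a3,a2}}"
  have s1: "T - star T v1 = {{v2,v3,a1}, {v2,a1,a3}, {v3,a1,a2}}"
    unfolding T diff_star_insert using ne by simp
  have "top_of_set (realization T) homeomorphic_space
      top_of_set (realization ((T - star T v1) \<union> fan a2 (v3 # v2 # [a3])))"
  proof (rule homeomorphic_contract_cycle[OF c3])
    show "star T v1 = fan v1 (a2 # v3 # v2 # [a3] @ [a2])"
      unfolding T star_insert using ne by (simp add: insert_commute)
    show False if "t \<in> T" "a2 \<in> t" "n \<in> t" "n \<in> set (butlast (v2 # [a3]))" for t n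
      using that ne unfolding T by auto
  qed (use ne in auto)
  also have "(T - star T v1) \<union> fan a2 (v3 # v2 # [a3]) = ?T1" unfolding s1 by (auto simp: insert_commute)
  finally have h1: "top_of_set (realization T) homeomorphic_space top_of_set (realization ?T1)" .
  have s2: "?T1 - star ?T1 v3 = {{v2,a1,a3}, {a2,v2,a3}}"
    unfolding diff_star_insert using ne by simp
  have "top_of_set (realization ?T1) homeomorphic_space
      top_of_set (realization ((?T1 - star ?T1 v3) \<union> fan v2 (a1 # a2 # [])))"
  proof (rule homeomorphic_contract_cycle)
    show "card t = 3" if "t \<in> ?T1" for t using that ne by auto
    show "star ?T1 v3 = fan v3 (v2 # a1 # a2 # [] @ [v2])"
      unfolding star_insert using ne by (simp add: insert_commute)
    show "{v2,a1,a2} \<notin> ?T1"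
      using ne by (simp add: set3_eq)
  qed (use ne in auto)
  also have "(?T1 - star ?T1 v3) \<union> fan v2 (a1 # a2 # []) = ?T2" unfolding s2 by (auto simp: insert_commute)
  finally have h2: "top_of_set (realization ?T1) homeomorphic_space top_of_set (realization ?T2)" .
  have s3: "?T2 - star ?T2 v2 = {}"
    unfolding diff_star_insert using ne by simp
  have "top_of_set (realization ?T2) homeomorphic_space
      top_of_set (realization ((?T2 - star ?T2 v2) \<union> fan a1 (a3 # a2 # [])))"
  proof (rule homeomorphic_contract_cycle)
    show "card t = 3" if "t \<in> ?T2" for t using that ne by auto
    show "star ?T2 v2 = fan v2 (a1 # a3 # a2 # [] @ [a1])"
      unfolding star_insert using ne by (simp add: insert_commute)
    show "{a1,a3,a2} \<notin> ?T2" using ne by (simp add: set3_eq)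
  qed (use ne in auto)
  also have "(?T2 - star ?T2 v2) \<union> fan a1 (a3 # a2 # []) = ?T3" unfolding s3 by simp
  finally have h3: "top_of_set (realization ?T2) homeomorphic_space top_of_set (realization ?T3)" .
  have h4: "top_of_set (realization ?T3) homeomorphic_space top_of_set (cball 0 1 :: (real^2) set)"
    by (rule realization_triangle) (use ne in simp)
  show ?thesis
    using homeomorphic_space_trans[OF h1 homeomorphic_space_trans[OF h2 homeomorphic_space_trans[OF h3 h4]]] .
qed

context csurf
begin

lemma closed4_fc:
  assumes "fc T a x y" "fc T a y z" "fc T a z w" "fc T a w x" "x \<noteq> z" "y \<noteq> w" and f: "fc T a n m"
  shows "n = x \<and> (m = y \<or> m = w) \<or> n = y \<and> (m = x \<or> m = z) \<or>
    n = z \<and> (m = y \<or> m = w) \<or> n = w \<and> (m = z \<or> m = x)"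
proof -
  have r: "fc T a y x" "fc T a z y" "fc T a w z" "fc T a x w" using assms by (auto dest: fc_swap)
  have "n \<in> nb T a" using fc_ed[OF f] by (simp add: nb_def)
  then consider "n = x" | "n = y" | "n = z" | "n = w" unfolding closed4(1)[OF assms(1-6)] by blast
  then show ?thesis
  proof cases
    case 1 then show ?thesis using fc_le2[OF assms(1) r(4) assms(6)] f by blast
  next
    case 2 then show ?thesis using fc_le2[OF r(1) assms(2,5)] f by blast
  next
    case 3 then show ?thesis using fc_le2[OF r(2) assms(3,6)] f by blast
  next
    case 4 then show ?thesis using fc_le2[OF r(3) assms(4) assms(5)[symmetric]] f by blast
  qed
qed

lemma path4_fc:
  assumes "bd T a x" "fc T a x y" "fc T a y z" "fc T a z w" "bd T a w" "x \<noteq> z" "y \<noteq> w"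
    and f: "fc T a n m"
  shows "n = x \<and> m = y \<or> n = y \<and> (m = x \<or> m = z) \<or>
    n = z \<and> (m = y \<or> m = w) \<or> n = w \<and> m = z"
proof -
  have r: "fc T a y x" "fc T a z y" "fc T a w z" using assms by (auto dest: fc_swap)
  have "n \<in> nb T a" using fc_ed[OF f] by (simp add: nb_def)
  then consider "n = x" | "n = y" | "n = z" | "n = w" unfolding path4[OF assms(1-7)] by blast
  then show ?thesis
  proof cases
    case 1 then show ?thesis using bd_unique[OF assms(1,2)] f by blast
  next
    case 2 then show ?thesis using fc_le2[OF r(1) assms(3,6)] f by blast
  next
    case 3 then show ?thesis using fc_le2[OF r(2) assms(4,7)] f by blast
  next
    case 4 then show ?thesis using bd_unique[OF assms(5) r(3)] f by blast
  qed
qed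

lemma deg5I:
  assumes "distinct [n1,n2,n3,n4,n5]" "ed T a n1" "ed T a n2" "ed T a n3" "ed T a n4" "ed T a n5"
  shows "5 \<le> deg T a"
proof -
  have "card {n1,n2,n3,n4,n5} \<le> card (nb T a)"
    using assms by (intro card_mono finite_nb) (auto simp: nb_def)
  then show ?thesis using assms(1) by (simp add: deg_nb)
qed

lemma nb4I:
  assumes "deg T a = 4" "distinct [n1,n2,n3,n4]" "ed T a n1" "ed T a n2" "ed T a n3" "ed T a n4"
  shows "nb T a = {n1,n2,n3,n4}"
proof (rule sym, rule card_subset_eq[OF finite_nb])
  show "{n1,n2,n3,n4} \<subseteq> nb T a" using assms by (auto simp: nb_def)
  show "card {n1,n2,n3,n4} = card (nb T a)" using assms(1,2) by (simp add: deg_nb)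
qed

lemma nb5I:
  assumes "deg T a = 5" "distinct [n1,n2,n3,n4,n5]" "ed T a n1" "ed T a n2" "ed T a n3" "ed T a n4" "ed T a n5"
  shows "nb T a = {n1,n2,n3,n4,n5}"
proof (rule sym, rule card_subset_eq[OF finite_nb])
  show "{n1,n2,n3,n4,n5} \<subseteq> nb T a" using assms by (auto simp: nb_def)
  show "card {n1,n2,n3,n4,n5} = card (nb T a)" using assms(1,2) by (simp add: deg_nb)
qed

lemma deg_of_nb4: "nb T a = {n1,n2,n3,n4} \<Longrightarrow> deg T a \<le> 4"
  by (simp add: deg_nb card_insert_if)

lemma octa_rot: "octa T v1 v2 v3 a1 a2 a3 \<Longrightarrow> octa T v2 v3 v1 a2 a3 a1"
  unfolding octa_def by (auto dest: fc_swap fc_rot)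

lemma octa_v1:
  assumes "octa T v1 v2 v3 a1 a2 a3"
  shows "fc T v1 v2 v3" "fc T v1 v3 a2" "fc T v1 a2 a3" "fc T v1 a3 v2" "v2 \<noteq> a2" "v3 \<noteq> a3"
    "nb T v1 = {v2,v3,a2,a3}" "\<not> bv T v1"
proof -
  show f: "fc T v1 v2 v3" "fc T v1 v3 a2" "fc T v1 a2 a3" "fc T v1 a3 v2" "v2 \<noteq> a2" "v3 \<noteq> a3"
    using assms unfolding octa_def by (auto dest: fc_swap)
  show "nb T v1 = {v2,v3,a2,a3}" "\<not> bv T v1" using closed4[OF f] by auto
qed

lemma octa_a1:
  assumes "octa T v1 v2 v3 a1 a2 a3"
  shows "fc T a1 a2 v3" "fc T a1 v3 v2" "fc T a1 v2 a3"
  using assms unfolding octa_def by (auto dest: fc_swap fc_rot)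

lemma octa_distinct:
  assumes "octa T v1 v2 v3 a1 a2 a3"
  shows "v1 \<noteq> v2" "v1 \<noteq> v3" "v1 \<noteq> a1" "v1 \<noteq> a2" "v1 \<noteq> a3" "v2 \<noteq> v3" "v2 \<noteq> a1" "v2 \<noteq> a2"
    "v2 \<noteq> a3" "v3 \<noteq> a1" "v3 \<noteq> a2" "v3 \<noteq> a3" "a1 \<noteq> a2" "a1 \<noteq> a3" "a2 \<noteq> a3"
  using assms by (auto simp: octa_def)

lemma verts_closed:
  assumes "ed T p q" "p \<in> A" "\<And>a. a \<in> A \<Longrightarrow> nb T a \<subseteq> A"
  shows "verts T \<subseteq> A"
proof
  fix b assume b: "b \<in> verts T"
  show "b \<in> A"
  proof (rule connected_graph[OF assms(2) _ _ b])
    show "p \<in> verts T" using ed_verts[OF assms(1)] by simp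
    show "d \<in> A" if "c \<in> A" "{c,d} \<in> edges T" for c d
      using assms(3)[OF that(1)] that(2) by (auto simp: nb_def ed_def)
  qed
qed

lemma ex_bv: "\<exists>a b. bd T a b"
proof -
  obtain e where e: "e \<in> bd_edges T" using boundary_nonempty by blast
  then have "card e = 2" by (simp add: bd_edges_def edges_def)
  then obtain a b where "e = {a,b}" by (auto simp: card_2_iff)
  then show ?thesis using e by (auto simp: bd_def)
qed

text \<open>With the eighth face all six vertices are inner and their set is closed under adjacency.
  By connectedness there are no others, so there would be no boundary.\<close>

lemma octa_not_closed:
  assumes o: "octa T v1 v2 v3 a1 a2 a3" and f: "fc T a1 a2 a3"
  shows False
proof -
  note o2 = octa_rot[OF o] note o3 = octa_rot[OF o2]
  note n = octa_distinct[OF o]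
  note v = octa_v1[OF o] octa_v1[OF o2] octa_v1[OF o3]
  have f': "fc T a2 a3 a1" "fc T a3 a1 a2" using f by (auto dest: fc_rot)
  note n' = n n[symmetric]
  note c = closed4[OF octa_a1[OF o] fc_swap[OF f] n'(23) n'(12)]
    closed4[OF octa_a1[OF o2] fc_swap[OF f'(1)] n'(27) n'(3)]
    closed4[OF octa_a1[OF o3] fc_swap[OF f'(2)] n'(18) n'(8)]
  let ?A = "{v1,v2,v3,a1,a2,a3}"
  have "verts T \<subseteq> ?A"
  proof (rule verts_closed)
    show "ed T v1 v2" using fc_ed[OF v(1)] by simp
    show "nb T a \<subseteq> ?A" if "a \<in> ?A" for a using that by (elim insertE emptyE; simp add: v(7,15,23) c(1,3,5))
  qed simp
  moreover obtain a b where "bd T a b" using ex_bv by (elim exE)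
  then have ab: "a \<in> verts T" "bv T a" using ed_verts[OF bd_ed] bd_bv by auto
  ultimately have "a \<in> ?A" by blast
  then show False using v(8,16,24) c(2,4,6) ab(2) by blast
qed

end

context stuck
begin

lemma deg_cases: "ed T a b \<Longrightarrow> deg T a = 4 \<or> 5 \<le> deg T a"
  using deg_ge4 by fastforce

lemma flipI:
  assumes "fc T x y w" "fc T x y z" "w \<noteq> z" "\<not> ed T w z" "5 \<le> deg T x" "5 \<le> deg T y"
  shows "stuck_flip T F x y w z"
  using assms by unfold_locales

text \<open>If the missing face is the hole, the seven faces are the whole triangulation. This is
  where \<open>not_disc\<close> is used.\<close>

lemma octa_disc:
  assumes o: "octa T v1 v2 v3 a1 a2 a3" and b: "bd T a1 a2" "bd T a2 a3" "bd T a1 a3"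
  shows False
proof -
  note o2 = octa_rot[OF o] note o3 = octa_rot[OF o2]
  note n = octa_distinct[OF o] note n' = n n[symmetric]
  note v = octa_v1[OF o] octa_v1[OF o2] octa_v1[OF o3]
  note b' = b b[THEN bd_sym]
  have p1: "nb T a1 = {a2,v3,v2,a3}"
    by (rule path4[OF b'(1) octa_a1[OF o] b'(3)]) (use n' in auto)
  have p2: "nb T a2 = {a3,v1,v3,a1}"
    by (rule path4[OF b'(2) octa_a1[OF o2] b'(4)]) (use n' in auto)
  have p3: "nb T a3 = {a1,v2,v1,a2}"
    by (rule path4[OF b'(6) octa_a1[OF o3] b'(5)]) (use n' in auto)
  let ?A = "{v1,v2,v3,a1,a2,a3}"
  have A: "verts T \<subseteq> ?A"
  proof (rule verts_closed)
    show "ed T v1 v2" using fc_ed[OF v(1)] by simp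
    show "nb T a \<subseteq> ?A" if "a \<in> ?A" for a using that by (elim insertE emptyE; simp add: v(7,15,23) p1 p2 p3)
  qed simp
  let ?T = "{{v1,v2,v3}, {v1,v2,a3}, {v2,v3,a1}, {v1,v3,a2}, {v1,a2,a3}, {v2,a1,a3}, {v3,a1,a2}}"
  have "T \<subseteq> ?T"
  proof
    fix t assume t: "t \<in> T"
    then obtain p where p: "p \<in> t" using c3[OF t] by fastforce
    obtain q r where t': "t = {p,q,r}" and f: "fc T p q r" using face_star[OF t p] by blast
    have "p \<in> verts T" using t p by (auto simp: verts_def)
    then have "p \<in> ?A" using A by blast
    then consider "p = v1" | "p = v2" | "p = v3" | "p = a1" | "p = a2" | "p = a3" by blast
    then show "t \<in> ?T"
    proof cases
      case 1
      show ?thesis unfolding t' 1 using closed4_fc[OF octa_v1(1-6)[OF o] f[unfolded 1]]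
        by (elim disjE conjE) (simp_all add: insert_commute)
    next
      case 2
      show ?thesis unfolding t' 2 using closed4_fc[OF octa_v1(1-6)[OF o2] f[unfolded 2]]
        by (elim disjE conjE) (simp_all add: insert_commute)
    next
      case 3
      show ?thesis unfolding t' 3 using closed4_fc[OF octa_v1(1-6)[OF o3] f[unfolded 3]]
        by (elim disjE conjE) (simp_all add: insert_commute)
    next
      case 4
      show ?thesis unfolding t' 4
        using path4_fc[OF b'(1) octa_a1[OF o] b'(3) n'(23) n'(12) f[unfolded 4]]
        by (elim disjE conjE) (simp_all add: insert_commute)
    next
      case 5
      show ?thesis unfolding t' 5
        using path4_fc[OF b'(2) octa_a1[OF o2] b'(4) n'(27) n'(3) f[unfolded 5]]
        by (elim disjE conjE) (simp_all add: insert_commute)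
    next
      case 6
      show ?thesis unfolding t' 6
        using path4_fc[OF b'(6) octa_a1[OF o3] b'(5) n'(18) n'(8) f[unfolded 6]]
        by (elim disjE conjE) (simp_all add: insert_commute)
    qed
  qed
  moreover have "?T \<subseteq> T" using o unfolding octa_def fc_def by simp
  ultimately have Teq: "T = ?T" by (rule equalityI)
  have d: "distinct [v1,v2,v3,a1,a2,a3]" using o by (simp add: octa_def)
  have "top_of_set (realization T) homeomorphic_space top_of_set (cball 0 1 :: (real^2) set)"
    by (rule realization_octahedron[OF d Teq])
  moreover have "top_of_set (realization T) homeomorphic_space F" using tri by (simp add: triangulates_def)
  ultimately show False using not_disc homeomorphic_space_sym homeomorphic_space_trans by blast
qed

end

lemma fc_perms: "fc T a b c \<Longrightarrow> fc T a c b \<and> fc T b a c \<and> fc T b c a \<and> fc T c a b \<and> fc T c b a"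
  by (simp add: fc_def insert_commute)

lemma nbD: "nb T a = S \<Longrightarrow> ed T a n \<Longrightarrow> n \<in> S"
  by (auto simp: nb_def)

lemma nbD': "nb T a = S \<Longrightarrow> ed T n a \<Longrightarrow> n \<in> S"
  using ed_sym[of T n a] by (auto simp: nb_def)

context csurf
begin

lemma fc_edges: "fc T a b c \<Longrightarrow> ed T a b \<and> ed T b a \<and> ed T a c \<and> ed T c a \<and> ed T b c \<and> ed T c b"
  using fc_ed[of a b c] ed_sym[of T] by blast

end

section \<open>Elimination of octahedra\<close>

context stuck
begin

text \<open>Two of the four edges at a boundary vertex of degree 4 are boundary edges, so ruling out
  two determines them.\<close>

lemma bd4_ends:
  assumes "bv T w" "deg T w = 4" "nb T w = {a,b,m,n}" "\<not> bd T w m" "\<not> bd T w n"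
  shows "bd T w a" "bd T w b"
proof -
  obtain e where e: "bd T w e" using assms(1) by (auto simp: bv_def)
  obtain u2 u3 u4 where u: "bd T w u4" "distinct [w,e,u2,u3,u4]" using bd4[OF e assms(2)] by metis
  have "e \<in> {a,b,m,n}" "u4 \<in> {a,b,m,n}" using nbD[OF assms(3)] bd_ed[OF e] bd_ed[OF u(1)] by auto
  then have "e \<in> {a,b}" "u4 \<in> {a,b}" using e u(1) assms(4,5) by auto
  then show "bd T w a" "bd T w b" using e u by auto
qed

text \<open>At a vertex of degree 4 the link condition for a boundary edge has to be tested only on
  the two neighbours off its face.\<close>

lemma contract_nb4:
  assumes "bd T y s" "fc T y s p" "nb T y = {s,p,m,n}" "\<not> ed T s m" "\<not> ed T s n" "5 \<le> deg T p"
  shows False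
proof (rule contract_bd[OF assms(1,2) _ assms(6)])
  fix z assume z: "ed T z s" "ed T z y"
  have "z \<in> {s,p,m,n}" using nbD'[OF assms(3) z(2)] .
  then show "z = p" using assms(4,5) ed_neq[OF z(1)] ed_sym[OF z(1)] by auto
qed

text \<open>Degree 4 at \<open>a1\<close> leaves no neighbours outside, so \<open>a1 a2\<close> and
  \<open>a1 a3\<close> are boundary edges, while \<open>a2 a3\<close> is not because the surface is
  no disc. Beyond it lies a face with third vertex \<open>x\<close>; flipping \<open>a2 a3\<close>
  into \<open>v1 x\<close> creates an edge that can be contracted, with third vertices
  \<open>a2\<close> and \<open>a3\<close>.\<close>

lemma octa4:
  assumes o: "octa T v1 v2 v3 a1 a2 a3" and d: "deg T a1 = 4"
  shows False
proof -
  note o2 = octa_rot[OF o] note o3 = octa_rot[OF o2]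
  note n = octa_distinct[OF o] note n' = n n[symmetric]
  note nv1 = octa_v1(7)[OF o] note nv2 = octa_v1(7)[OF o2] note nv3 = octa_v1(7)[OF o3]
  note g1 = octa_a1[OF o] note g2 = octa_a1[OF o2] note g3 = octa_a1[OF o3]
  note e1 = fc_edges[OF g1(1)] fc_edges[OF g1(3)]
  have na1: "nb T a1 = {a2,a3,v2,v3}" by (rule nb4I[OF d]) (use n' e1 in auto)
  have nf: "\<not> fc T a1 a2 a3" using octa_not_closed[OF o] by blast
  have ne: "\<not> ed T a2 v2" "\<not> ed T a3 v3" using nbD'[OF nv2, of a2] nbD'[OF nv3, of a3] n' by auto
  have b12: "bd T a1 a2"
  proof (rule ccontr)
    assume "\<not> bd T a1 a2"
    then obtain x where x: "fc T a1 a2 x" "x \<noteq> v3" using inner_other[OF g1(1)] by blast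
    have "x \<in> {a2,a3,v2,v3}" using nbD[OF na1] fc_ed[OF x(1)] by blast
    then show False using x nf ne fc_ed[OF x(1)] fc_neq[OF x(1)] by auto
  qed
  have b13: "bd T a1 a3"
  proof (rule ccontr)
    assume "\<not> bd T a1 a3"
    then obtain x where x: "fc T a1 a3 x" "x \<noteq> v2" using inner_other[OF fc_swap[OF g1(3)]] by blast
    have "x \<in> {a2,a3,v2,v3}" using nbD[OF na1] fc_ed[OF x(1)] by blast
    then show False using x nf ne fc_ed[OF x(1)] fc_neq[OF x(1)] fc_perms[OF x(1)] by auto
  qed
  have "\<not> bd T a2 a3" using octa_disc[OF o b12 _ b13] by blast
  then obtain x where x: "fc T a2 a3 x" "x \<noteq> v1" using inner_other[OF g2(1)] by blast
  note xe = fc_edges[OF x(1)]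
  have xn: "x \<noteq> a1" "x \<noteq> v2" "x \<noteq> v3" "x \<noteq> a2" "x \<noteq> a3"
    using nf ne xe fc_neq[OF x(1)] fc_perms[OF x(1)] by auto
  have nx: "\<not> ed T x a1" "\<not> ed T x v1" "\<not> ed T x v2" "\<not> ed T x v3"
    "\<not> ed T v1 x" "\<not> ed T v2 x" "\<not> ed T v3 x" "\<not> ed T a1 x"
    using nbD'[OF na1, of x] nbD'[OF nv1, of x] nbD'[OF nv2, of x] nbD'[OF nv3, of x]
      nbD[OF na1, of x] nbD[OF nv1, of x] nbD[OF nv2, of x] nbD[OF nv3, of x] xn x(2) by auto
  note e2 = fc_edges[OF g2(1)] fc_edges[OF g2(3)] note e3 = fc_edges[OF g3(1)] fc_edges[OF g3(3)]
  have d2: "5 \<le> deg T a2" by (rule deg5I[of a1 a3 v1 v3 x]) (use n' xn xn[symmetric] x(2) xe e2 in auto)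
  have d3: "5 \<le> deg T a3" by (rule deg5I[of a1 a2 v1 v2 x]) (use n' xn xn[symmetric] x(2) xe e3 in auto)
  \<comment> \<open>The flip costs \<open>a2\<close> a neighbour, so degree 5 is not enough. If the
    degree were 5, \<open>a2 x\<close> would be a boundary edge that can be contracted with third
    vertex \<open>a3\<close>.\<close>
  have c2: "deg T a2 \<noteq> 5"
  proof
    assume "deg T a2 = 5"
    then have na2: "nb T a2 = {a1,a3,v1,v3,x}"
      by (rule nb5I) (use n' xn xn[symmetric] x(2) xe e2 in auto)
    have "bd T a2 x"
    proof (rule fc_bdI[OF fc_swap[OF x(1)]])
      fix e assume e: "fc T a2 x e"
      have "e \<in> {a1,a3,v1,v3,x}" using nbD[OF na2] fc_ed[OF e] by blast
      then show "e = a3" using nx fc_ed[OF e] fc_neq[OF e] by auto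
    qed
    then show False
    proof (rule contract_bd[OF _ fc_swap[OF x(1)] _ d3])
      fix z assume z: "ed T z x" "ed T z a2"
      have "z \<in> {a1,a3,v1,v3,x}" using nbD'[OF na2 z(2)] .
      then show "z = a3" using nx z(1) ed_neq[OF z(1)] by auto
    qed
  qed
  have c3: "deg T a3 \<noteq> 5"
  proof
    note x' = fc_perms[OF x(1)]
    have fx: "fc T a3 x a2" using x' by blast
    assume "deg T a3 = 5"
    then have na3: "nb T a3 = {a1,a2,v1,v2,x}"
      by (rule nb5I) (use n' xn xn[symmetric] x(2) xe e3 in auto)
    have "bd T a3 x"
    proof (rule fc_bdI[OF fx])
      fix e assume e: "fc T a3 x e"
      have "e \<in> {a1,a2,v1,v2,x}" using nbD[OF na3] fc_ed[OF e] by blast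
      then show "e = a2" using nx fc_ed[OF e] fc_neq[OF e] by auto
    qed
    then show False
    proof (rule contract_bd[OF _ fx _ d2])
      fix z assume z: "ed T z x" "ed T z a3"
      have "z \<in> {a1,a2,v1,v2,x}" using nbD'[OF na3 z(2)] .
      then show "z = a2" using nx z(1) ed_neq[OF z(1)] by auto
    qed
  qed
  interpret fl: stuck_flip T F a2 a3 v1 x
    by (rule flipI[OF g2(1) x(1) x(2)[symmetric] nx(5) d2 d3])
  interpret fs: stuck fl.T' F by (rule fl.stuck_flipped)
  show False
  proof (rule fs.contract_inner[of v1 x a2 a3])
    show "\<not> bv fl.T' v1" using octa_v1(8)[OF o] by (simp add: fl.bv_flip)
    show "fc fl.T' v1 x a2" "fc fl.T' v1 x a3" using fc_perms[OF fl.fc_new(1)] fc_perms[OF fl.fc_new(2)] by auto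
    show "a2 \<noteq> a3" by (rule n)
    show "5 \<le> deg fl.T' a2" "5 \<le> deg fl.T' a3" using d2 d3 c2 c3 by (simp_all add: fl.deg_flip)
    fix z assume z: "ed fl.T' z x" "ed fl.T' z v1"
    have "ed T z v1 \<or> z = x" using z(2) n' unfolding fl.ed_flip by auto
    then have zv: "ed T z v1" using ed_neq[OF z(1)] by blast
    then have "z \<in> {v2,v3,a2,a3}" by (rule nbD'[OF nv1])
    moreover have "ed T z x \<or> z = v1" using z(1) xn x(2) unfolding fl.ed_flip by auto
    then have "ed T z x" using ed_neq[OF zv] by blast
    ultimately show "z = a2 \<or> z = a3" using nx by auto
  qed
qed

text \<open>Flipping \<open>a1 a2\<close> into an edge at \<open>v3\<close> raises \<open>v3\<close>
  to degree 5, after which \<open>v1 v2\<close>, with third vertices \<open>v3\<close> and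
  \<open>a3\<close>, can be contracted.\<close>

lemma octa5:
  assumes o: "octa T v1 v2 v3 a1 a2 a3" and d: "5 \<le> deg T a1" "5 \<le> deg T a2" "5 \<le> deg T a3"
    and b: "\<not> bd T a1 a2"
  shows False
proof -
  note o2 = octa_rot[OF o] note o3 = octa_rot[OF o2]
  note n = octa_distinct[OF o] note n' = n n[symmetric]
  note nv1 = octa_v1(7)[OF o] note nv2 = octa_v1(7)[OF o2] note nv3 = octa_v1(7)[OF o3]
  note g1 = octa_a1[OF o] note g2 = octa_a1[OF o2] note g3 = octa_a1[OF o3]
  have nf: "\<not> fc T a1 a2 a3" using octa_not_closed[OF o] by blast
  obtain s where s: "fc T a1 a2 s" "s \<noteq> v3" using inner_other[OF g1(1) b] by blast
  note se = fc_edges[OF s(1)]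
  have sn: "s \<noteq> a1" "s \<noteq> a2" "s \<noteq> a3" "s \<noteq> v1" "s \<noteq> v2"
    using nf s fc_neq[OF s(1)] nbD'[OF nv1, of a1] nbD'[OF nv2, of a2] se n' by auto
  have nvs: "\<not> ed T v3 s" using nbD[OF nv3, of s] sn by auto
  interpret fl: stuck_flip T F a1 a2 v3 s
    by (rule flipI[OF g1(1) s(1) s(2)[symmetric] nvs d(1,2)])
  interpret fs: stuck fl.T' F by (rule fl.stuck_flipped)
  show False
  proof (rule fs.contract_inner[of v1 v2 v3 a3])
    show "\<not> bv fl.T' v1" using octa_v1(8)[OF o] by (simp add: fl.bv_flip)
    show "fc fl.T' v1 v2 v3" by (rule fl.fc_old[OF octa_v1(1)[OF o]]) (use n' in auto)
    show "fc fl.T' v1 v2 a3" by (rule fl.fc_old[OF fc_swap[OF octa_v1(4)[OF o]]]) (use n' in auto)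
    show "v3 \<noteq> a3" by (rule n)
    have "4 \<le> deg T v3" using deg_ge4[of v3 v1] nv3 by (auto simp: nb_def)
    then show "5 \<le> deg fl.T' v3" by (simp add: fl.deg_flip)
    show "5 \<le> deg fl.T' a3" using d(3) fl.deg_flip(5)[of a3] n' sn by auto
    fix z assume z: "ed fl.T' z v2" "ed fl.T' z v1"
    have "ed T z v1" using z(2) n' sn unfolding fl.ed_flip by auto
    then have "z \<in> {v2,v3,a2,a3}" by (rule nbD'[OF nv1])
    moreover have "ed T z v2" using z(1) n' sn unfolding fl.ed_flip by auto
    then have "z \<in> {v3,v1,a3,a1}" by (rule nbD'[OF nv2])
    ultimately show "z = v3 \<or> z = a3" using n' by auto
  qed
qed

text \<open>By \<open>octa4\<close> and \<open>octa5\<close> the \<open>a\<close>-vertices have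
  degree at least 5, and \<open>a1 a2\<close> and \<open>a1 a3\<close> are boundary edges; but then
  the link of \<open>a1\<close> is a path of four vertices.\<close>

lemma no_octa:
  assumes o: "octa T v1 v2 v3 a1 a2 a3"
  shows False
proof -
  note o2 = octa_rot[OF o] note o3 = octa_rot[OF o2]
  note n = octa_distinct[OF o] note n' = n n[symmetric]
  note g1 = octa_a1[OF o] note g2 = octa_a1[OF o2] note g3 = octa_a1[OF o3]
  have d: "5 \<le> deg T a1" "5 \<le> deg T a2" "5 \<le> deg T a3"
    using deg_cases[of a1 a2] deg_cases[of a2 a3] deg_cases[of a3 a1]
      fc_ed[OF g1(1)] fc_ed[OF g2(1)] fc_ed[OF g3(1)] octa4[OF o] octa4[OF o2] octa4[OF o3] by blast+
  have b12: "bd T a1 a2" using octa5[OF o d] by blast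
  have b13: "bd T a1 a3" using octa5[OF o3 d(3,1,2)] bd_sym[of T a3 a1] by blast
  have "nb T a1 = {a2,v3,v2,a3}"
    by (rule path4[OF b12 g1 b13]) (use n' in auto)
  then have "deg T a1 \<le> 4" by (rule deg_of_nb4)
  then show False using d(1) by simp
qed

end

section \<open>Faces with three vertices of degree 4\<close>

context stuck
begin

text \<open>Each edge of the face \<open>v1 v2 v3\<close> has exactly one further face, so the links
  of the three vertices, all 4-cycles, fit together to an octahedron.\<close>

lemma inner444:
  assumes f: "fc T v1 v2 v3" and i: "\<not> bv T v1" "\<not> bv T v2" "\<not> bv T v3"
    and d: "deg T v1 = 4" "deg T v2 = 4" "deg T v3 = 4"
  shows False
proof -
  note fp = fc_perms[OF f]
  obtain a2 a3 where 1: "fc T v1 v3 a2" "fc T v1 a2 a3" "fc T v1 a3 v2" "distinct [v1,v2,v3,a2,a3]"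
    by (rule inner4[OF i(1) d(1) f]) blast
  have f2: "fc T v2 v1 v3" and f3: "fc T v3 v1 v2" using fp by auto
  obtain a1 q where 2: "fc T v2 v3 a1" "fc T v2 a1 q" "fc T v2 q v1" "distinct [v2,v1,v3,a1,q]"
    by (rule inner4[OF i(2) d(2) f2]) blast
  obtain a1' q' where 3: "fc T v3 v2 a1'" "fc T v3 a1' q'" "fc T v3 q' v1" "distinct [v3,v1,v2,a1',q']"
    by (rule inner4[OF i(3) d(3) f3]) blast
  have q: "q = a3"
    using fc_le2[of v1 v2 v3 a3 q] fc_perms[OF 1(3)] fc_perms[OF 2(3)] f 1(4) 2(4) by auto
  have q': "q' = a2"
    using fc_le2[of v1 v3 v2 a2 q'] fc_perms[OF 1(1)] fc_perms[OF 3(3)] fp 1(1,4) 3(4) by auto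
  have a1': "a1' = a1"
    using fc_le2[of v2 v3 v1 a1 a1'] fc_perms[OF 2(1)] fc_perms[OF 3(1)] fp 2(1,4) 3(4) by auto
  have "octa T v1 v2 v3 a1 a2 a3" unfolding octa_def
    using f 1 2 3 q q' a1' fc_perms[OF 1(3)] by auto
  then show False by (rule no_octa)
qed

text \<open>
  Two inner vertices and one boundary vertex of a face, all of degree 4.  The configuration is
  symmetric under exchanging the inner vertices.
\<close>

definition semi_octa :: "'v \<Rightarrow> 'v \<Rightarrow> 'v \<Rightarrow> 'v \<Rightarrow> 'v \<Rightarrow> 'v \<Rightarrow> bool" where
  "semi_octa v1 v2 v3 a1 a2 a3 \<longleftrightarrow> fc T v1 v2 v3 \<and> fc T v1 v3 a2 \<and> fc T v1 a2 a3 \<and> fc T v1 a3 v2 \<and>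
     fc T v2 v3 a1 \<and> fc T v3 a1 a2 \<and> distinct [v1,v2,v3,a1,a2,a3] \<and>
     nb T v1 = {v2,v3,a2,a3} \<and> nb T v2 = {v1,v3,a1,a3} \<and> nb T v3 = {v1,v2,a1,a2} \<and>
     bd T v2 a1 \<and> bd T v2 a3 \<and> \<not> bv T v1 \<and> \<not> bv T v3"

lemma semi_octa_sym:
  assumes S: "semi_octa v1 v2 v3 a1 a2 a3"
  shows "semi_octa v3 v2 v1 a3 a2 a1"
proof -
  note S' = S[unfolded semi_octa_def]
  have f: "fc T v1 v2 v3" "fc T v1 v3 a2" "fc T v1 a2 a3" "fc T v1 a3 v2" "fc T v2 v3 a1" "fc T v3 a1 a2"
    and n: "distinct [v1,v2,v3,a1,a2,a3]"
    and nv: "nb T v1 = {v2,v3,a2,a3}" "nb T v2 = {v1,v3,a1,a3}" "nb T v3 = {v1,v2,a1,a2}"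
    and b: "bd T v2 a1" "bd T v2 a3" "\<not> bv T v1" "\<not> bv T v3" using S' by blast+
  have nv': "nb T v1 = {v3,v2,a3,a2}" "nb T v2 = {v3,v1,a3,a1}" "nb T v3 = {v2,v1,a2,a1}"
    unfolding nv by blast+
  show ?thesis unfolding semi_octa_def
    by (intro conjI nv' b) (use f[THEN fc_perms] n in auto)
qed

text \<open>The edge \<open>a1 a2\<close> is inner, since otherwise \<open>a1\<close> would have
  degree 3. The third vertex \<open>t\<close> beyond it is not \<open>a3\<close>, since that would
  give \<open>a2\<close> degree 4. If \<open>a1\<close> had degree 4, then \<open>a1 t\<close> would
  be a boundary edge that can be contracted with third vertex \<open>a2\<close>.\<close>

lemma semi_octa_t:
  assumes S: "semi_octa v1 v2 v3 a1 a2 a3" and d: "5 \<le> deg T a2"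
  obtains t where "fc T a1 a2 t" "t \<noteq> v3" "t \<noteq> a3" "t \<notin> {v1,v2,a1,a2}"
    "\<not> ed T v3 t" "\<not> ed T v2 t" "5 \<le> deg T a1"
proof -
  note S' = S[unfolded semi_octa_def]
  have f: "fc T v1 v2 v3" "fc T v1 v3 a2" "fc T v1 a2 a3" "fc T v1 a3 v2" "fc T v2 v3 a1" "fc T v3 a1 a2"
    and n: "distinct [v1,v2,v3,a1,a2,a3]"
    and nv1: "nb T v1 = {v2,v3,a2,a3}" and nv2: "nb T v2 = {v1,v3,a1,a3}" and nv3: "nb T v3 = {v1,v2,a1,a2}"
    and b: "bd T v2 a1" "bd T v2 a3" using S' by blast+
  note fp = f[THEN fc_perms]
  have g: "fc T a1 a2 v3" "fc T a1 v2 v3" "fc T a1 v3 a2" "fc T a2 v1 v3" "fc T a2 v3 a1" "fc T a2 a3 v1"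
    using fp by auto
  have "\<not> bd T a1 a2"
  proof
    assume "bd T a1 a2"
    then show False using no_path3[OF bd_sym[OF b(1)] g(2,3)] n by auto
  qed
  then obtain t where t: "fc T a1 a2 t" "t \<noteq> v3" using inner_other[OF g(1)] by blast
  note te = fc_edges[OF t(1)] note tn = fc_neq[OF t(1)]
  have ta3: "t \<noteq> a3"
  proof
    assume "t = a3"
    then have "fc T a2 a1 a3" using fc_perms[OF t(1)] by blast
    then have "nb T a2 = {v1,v3,a1,a3}" by (rule closed4(1)[OF g(4,5) _ g(6)]) (use n in auto)
    then have "deg T a2 \<le> 4" by (rule deg_of_nb4)
    then show False using d by simp
  qed
  have t': "t \<notin> {v1,v2,a1,a2}"
    using tn nbD'[OF nv1, of a1] nbD'[OF nv2, of a2] te n by auto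
  have nt: "\<not> ed T v3 t" "\<not> ed T v2 t" using nbD[OF nv3, of t] nbD[OF nv2, of t] t' t(2) ta3 by auto
  have "deg T a1 \<noteq> 4"
  proof
    assume "deg T a1 = 4"
    then have na1: "nb T a1 = {t,a2,v2,v3}"
      by (rule nb4I) (use n t' t(2) te fc_edges[OF g(2)] in auto)
    have nt': "\<not> ed T t v2" "\<not> ed T t v3" using nt ed_sym[of T t v2] ed_sym[of T t v3] by auto
    have "bd T a1 t"
    proof (rule fc_bdI[OF fc_swap[OF t(1)]])
      fix e assume e: "fc T a1 t e"
      have "e \<in> {t,a2,v2,v3}" using nbD[OF na1] fc_ed[OF e] by blast
      then show "e = a2" using nt' fc_ed[OF e] fc_neq[OF e] by auto
    qed
    then show False by (rule contract_nb4[OF _ fc_swap[OF t(1)] na1 nt' d])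
  qed
  then have "5 \<le> deg T a1" using deg_cases[of a1 a2] te by blast
  then show ?thesis using that[of t] t ta3 t' nt by blast
qed

text \<open>As for octahedra, the flip of \<open>a1 a2\<close> into \<open>v3 t\<close> raises
  \<open>v3\<close> to degree 5, and then \<open>v1 v2\<close> is contracted. The bound for the
  other third vertex \<open>a3\<close> comes from the symmetric configuration.\<close>

lemma no_semi_octa:
  assumes S: "semi_octa v1 v2 v3 a1 a2 a3" and d: "5 \<le> deg T a2" "deg T v3 = 4"
  shows False
proof -
  note S' = S[unfolded semi_octa_def]
  have f: "fc T v1 v2 v3" "fc T v1 a3 v2" "fc T v3 a1 a2" and n: "distinct [v1,v2,v3,a1,a2,a3]"
    and nv1: "nb T v1 = {v2,v3,a2,a3}" and nv2: "nb T v2 = {v1,v3,a1,a3}" and i: "\<not> bv T v1"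
    using S' by blast+
  have a3: "5 \<le> deg T a3" by (rule semi_octa_t[OF semi_octa_sym[OF S] d(1)])
  obtain t where t: "fc T a1 a2 t" "t \<noteq> v3" "t \<noteq> a3" "t \<notin> {v1,v2,a1,a2}" "\<not> ed T v3 t" "5 \<le> deg T a1"
    by (rule semi_octa_t[OF S d(1)]) blast
  have g: "fc T a1 a2 v3" using fc_perms[OF f(3)] by blast
  interpret fl: stuck_flip T F a1 a2 v3 t
    by (rule flipI[OF g t(1) t(2)[symmetric] t(5,6) d(1)])
  interpret fs: stuck fl.T' F by (rule fl.stuck_flipped)
  show False
  proof (rule fs.contract_inner[of v1 v2 v3 a3])
    show "\<not> bv fl.T' v1" using i by (simp add: fl.bv_flip)
    show "fc fl.T' v1 v2 v3" by (rule fl.fc_old[OF f(1)]) (use n in auto)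
    show "fc fl.T' v1 v2 a3" by (rule fl.fc_old[OF fc_swap[OF f(2)]]) (use n in auto)
    show "v3 \<noteq> a3" using n by simp
    show "5 \<le> deg fl.T' v3" by (simp add: fl.deg_flip d(2))
    show "5 \<le> deg fl.T' a3" using a3 fl.deg_flip(5)[of a3] n t by auto
    fix z assume z: "ed fl.T' z v2" "ed fl.T' z v1"
    have "ed T z v1" using z(2) n t unfolding fl.ed_flip by auto
    then have "z \<in> {v2,v3,a2,a3}" by (rule nbD'[OF nv1])
    moreover have "ed T z v2" using z(1) n t unfolding fl.ed_flip by auto
    then have "z \<in> {v1,v3,a1,a3}" by (rule nbD'[OF nv2])
    ultimately show "z = v3 \<or> z = a3" using n by auto
  qed
qed

text \<open>The links of \<open>v1\<close> and \<open>v3\<close> are 4-cycles sharing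
  \<open>v2\<close> and \<open>a2\<close>, and the link of \<open>v2\<close> is a path from
  \<open>a1\<close> to \<open>a3\<close>. Degree 4 at \<open>a2\<close> is excluded by
  \<open>inner444\<close> or because \<open>a1\<close> would have degree 3, so
  \<open>no_semi_octa\<close> applies.\<close>

lemma one_bd444:
  assumes f: "fc T v1 v2 v3" and i: "\<not> bv T v1" "bv T v2" "\<not> bv T v3"
    and d: "deg T v1 = 4" "deg T v2 = 4" "deg T v3 = 4"
  shows False
proof -
  note fp = fc_perms[OF f]
  obtain a2 a3 where 1: "fc T v1 v3 a2" "fc T v1 a2 a3" "fc T v1 a3 v2" "distinct [v1,v2,v3,a2,a3]"
    and nv1: "nb T v1 = {v2,v3,a2,a3}"
    by (rule inner4[OF i(1) d(1) f]) blast
  have f3: "fc T v3 v1 v2" using fp by auto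
  obtain a1 q' where 3: "fc T v3 v2 a1" "fc T v3 a1 q'" "fc T v3 q' v1" "distinct [v3,v1,v2,a1,q']"
    and nv3: "nb T v3 = {v1,v2,a1,q'}"
    by (rule inner4[OF i(3) d(3) f3]) blast
  have q': "q' = a2"
    using fc_le2[of v1 v3 v2 a2 q'] fc_perms[OF 1(1)] fc_perms[OF 3(3)] fp 1(1,4) 3(4) by auto
  have g: "fc T v2 v1 v3" "fc T v2 v3 a1" "fc T v2 a3 v1"
    using fp fc_perms[OF 1(3)] fc_perms[OF 3(1)] by auto
  have a13: "a1 \<noteq> a3"
  proof
    assume "a1 = a3"
    then show False using no_closed3[OF g(1,2)] g(3) by simp
  qed
  have n: "distinct [v1,v2,v3,a1,a2,a3]" using 1(4) 3(4) q' a13 by auto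
  have nv2: "nb T v2 = {a1,a3,v1,v3}"
    by (rule nb4I[OF d(2)]) (use n fc_edges[OF g(1)] fc_edges[OF g(2)] fc_edges[OF g(3)] in auto)
  have nb: "\<not> bd T v2 v1" "\<not> bd T v2 v3" using i bd_bv[OF bd_sym[of T v2 v1]] bd_bv[OF bd_sym[of T v2 v3]] by auto
  have b: "bd T v2 a1" "bd T v2 a3" using bd4_ends[OF i(2) d(2) nv2 nb] by auto
  have S: "semi_octa v1 v2 v3 a1 a2 a3"
    unfolding semi_octa_def using f 1 3 g n nv1 nv2 nv3 b i q' by (auto simp: insert_commute)
  have e: "ed T a2 v1" "ed T a2 v3" "ed T a2 a1" "ed T a2 a3"
    using fc_edges[OF 1(1)] fc_edges[OF 1(2)] fc_edges[OF 3(2)] q' by auto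
  have "deg T a2 \<noteq> 4"
  proof
    assume d2: "deg T a2 = 4"
    have na2: "nb T a2 = {a1,a3,v1,v3}" by (rule nb4I[OF d2]) (use n e in auto)
    have nb2: "\<not> bd T a2 v1" "\<not> bd T a2 v3" using i bd_bv[OF bd_sym[of T a2 v1]] bd_bv[OF bd_sym[of T a2 v3]] by auto
    show False
    proof (cases "bv T a2")
      case False
      then show ?thesis using inner444[OF 1(1) i(1,3) False d(1,3) d2] by blast
    next
      case True
      have "bd T a2 a1" using bd4_ends[OF True d2 na2 nb2] by blast
      moreover have "fc T a1 v2 v3" "fc T a1 v3 a2" using fc_perms[OF 3(1)] fc_perms[OF 3(2)] q' by auto
      ultimately show False using no_path3[OF bd_sym[OF b(1)]] bd_sym[of T a2 a1] n by auto
    qed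
  qed
  then have "5 \<le> deg T a2" using deg_cases[OF e(1)] by blast
  then show False by (rule no_semi_octa[OF S _ d(3)])
qed

end

context csurf
begin

lemma nb4_ex:
  assumes "deg T a = 4" "distinct [n1,n2,n3]" "ed T a n1" "ed T a n2" "ed T a n3"
  obtains r where "nb T a = {r,n1,n2,n3}" "r \<notin> {n1,n2,n3}"
proof -
  have "{n1,n2,n3} \<subseteq> nb T a" using assms by (auto simp: nb_def)
  then have "card (nb T a - {n1,n2,n3}) = 1"
    using assms(1,2) by (simp add: card_Diff_subset deg_nb)
  then obtain r where r: "nb T a - {n1,n2,n3} = {r}" by (meson card_1_singletonE)
  then have "nb T a = {r,n1,n2,n3}" using \<open>{n1,n2,n3} \<subseteq> nb T a\<close> by blast
  moreover have "r \<notin> {n1,n2,n3}" using r by blast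
  ultimately show ?thesis by (rule that)
qed

text \<open>A boundary vertex has at most two boundary edges, so a boundary 3-cycle is closed under
  boundary adjacency; the boundary is connected, hence has no other vertices.\<close>

lemma bd_triangle:
  assumes "bd T a b" "bd T b c" "bd T a c" "bv T x"
  shows "x \<in> {a,b,c}"
proof (rule boundary_connected[of a])
  note b = assms(1-3) assms(1-3)[THEN bd_sym]
  have n: "a \<noteq> b" "b \<noteq> c" "a \<noteq> c" using assms(1-3) bd_ed ed_neq by metis+
  show "a \<in> bd_verts T" using assms(1) by (auto simp: bd_verts_def bd_def)
  show "x \<in> bd_verts T" using assms(4) by (auto simp: bd_verts_def bd_def bv_def)
  show "q \<in> {a,b,c}" if p: "p \<in> {a,b,c}" "{p,q} \<in> bd_edges T" for p q
  proof -
    have q: "bd T p q" using p(2) by (simp add: bd_def)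
    show ?thesis
      using p(1) q bd_le2[OF b(1,3) n(2)] bd_le2[OF b(4,2) n(3)] bd_le2[OF b(6,5) n(1)] by auto
  qed
qed simp

end

text \<open>Normal form of a boundary vertex of degree 4: its link is the path
  \<open>u1 u2 u3 u4\<close>, with boundary edges to both ends. The symmetry under reversal
  (\<open>pth_rev\<close>) halves the later cases.\<close>

definition pth :: "'v set set \<Rightarrow> 'v \<Rightarrow> 'v \<Rightarrow> 'v \<Rightarrow> 'v \<Rightarrow> 'v \<Rightarrow> bool" where
  "pth T w u1 u2 u3 u4 \<longleftrightarrow> bd T w u1 \<and> fc T w u1 u2 \<and> fc T w u2 u3 \<and> fc T w u3 u4 \<and> bd T w u4 \<and>
     distinct [w,u1,u2,u3,u4] \<and> nb T w = {u1,u2,u3,u4} \<and> deg T w = 4"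

lemma pth_rev: "pth T w u1 u2 u3 u4 \<Longrightarrow> pth T w u4 u3 u2 u1"
proof -
  assume p: "pth T w u1 u2 u3 u4"
  have "{u1,u2,u3,u4} = {u4,u3,u2,u1}" by blast
  then show ?thesis using p unfolding pth_def by (auto dest: fc_perms)
qed

context stuck
begin

text \<open>The edge \<open>v2 v3\<close> is a boundary edge, as otherwise the third vertex beyond
  it would have degree 2. Let \<open>p\<close> and \<open>r\<close> be the other boundary neighbours
  of \<open>v2\<close> and \<open>v3\<close>. If they differ, the contractions of
  \<open>v2 p\<close> and \<open>v3 r\<close> are blocked only by degree 4 at \<open>a3\<close> and
  \<open>a2\<close>, which leaves \<open>p\<close> with degree 2. If they agree,
  \<open>v2 v3 p\<close> is a boundary triangle.\<close>

lemma two_bd444: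
  assumes f: "fc T v1 v2 v3" and i: "\<not> bv T v1" "bv T v2" "bv T v3"
    and d: "deg T v1 = 4" "deg T v2 = 4" "deg T v3 = 4"
  shows False
proof -
  note fp = fc_perms[OF f]
  obtain a2 a3 where 1: "fc T v1 v3 a2" "fc T v1 a2 a3" "fc T v1 a3 v2" "distinct [v1,v2,v3,a2,a3]"
    and nv1: "nb T v1 = {v2,v3,a2,a3}"
    by (rule inner4[OF i(1) d(1) f]) blast
  have g: "fc T v2 v1 v3" "fc T v2 v3 v1" "fc T v2 a3 v1" "fc T v2 v1 a3"
    "fc T v3 v1 v2" "fc T v3 v2 v1" "fc T v3 a2 v1" "fc T v3 v1 a2"
    "fc T a3 v1 v2" "fc T a2 v1 v3" "fc T a2 v1 a3" "fc T a3 v1 a2" "fc T a3 a2 v1" "fc T a2 a3 v1"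
    using fp fc_perms[OF 1(1)] fc_perms[OF 1(2)] fc_perms[OF 1(3)] by auto
  note e = fc_edges[OF g(1)] fc_edges[OF g(3)] fc_edges[OF g(7)] fc_edges[OF g(13)]
  have nb1: "\<not> bd T v2 v1" "\<not> bd T v3 v1" using i bd_bv[OF bd_sym[of T v2 v1]] bd_bv[OF bd_sym[of T v3 v1]] by auto
  have b23: "bd T v2 v3"
  proof (rule ccontr)
    assume nb23: "\<not> bd T v2 v3"
    then have nb32: "\<not> bd T v3 v2" using bd_sym[of T v3 v2] by blast
    obtain b where b: "fc T v2 v3 b" "b \<noteq> v1" using inner_other[OF g(2) nb23] by blast
    note bn = fc_neq[OF b(1)] note be = fc_edges[OF b(1)] note bp = fc_perms[OF b(1)]
    have "b \<noteq> a3" using no_closed3[OF g(1), of a3] b g by auto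
    then have n2: "nb T v2 = {a3,b,v1,v3}" by (intro nb4I[OF d(2)]) (use 1(4) b(2) bn be e in auto)
    have "b \<noteq> a2" using no_closed3[OF g(5), of a2] bp g by auto
    then have n3: "nb T v3 = {a2,b,v1,v2}" by (intro nb4I[OF d(3)]) (use 1(4) b(2) bn be e in auto)
    have "bd T v2 b" using bd4_ends[OF i(2) d(2) n2 nb1(1) nb23] by blast
    moreover have "bd T v3 b" using bd4_ends[OF i(3) d(3) n3 nb1(2) nb32] by blast
    moreover have "fc T b v2 v3" using bp by blast
    ultimately show False using no_path2[of b v2 v3] bd_sym[of T v2 b] bd_sym[of T v3 b] by blast
  qed
  obtain x y p where 2: "fc T v2 v3 x" "fc T v2 x y" "fc T v2 y p" "bd T v2 p" "distinct [v2,v3,x,y,p]"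
    by (rule bd4[OF b23 d(2)]) blast
  have x: "x = v1" using bd_unique[OF b23 2(1) g(2)] .
  have y: "y = a3" using fc_le2[OF g(1,4), of y] 2(2,5) 1(4) x by auto
  note 2 = 2[unfolded x y]
  note b32 = bd_sym[OF b23]
  obtain x' y' r where 3: "fc T v3 v2 x'" "fc T v3 x' y'" "fc T v3 y' r" "bd T v3 r" "distinct [v3,v2,x',y',r]"
    by (rule bd4[OF b32 d(3)]) blast
  have x': "x' = v1" using bd_unique[OF b32 3(1) g(6)] .
  have y': "y' = a2" using fc_le2[OF g(5,8), of y'] 3(2,5) 1(4) x' by auto
  note 3 = 3[unfolded x' y']
  have nv2: "nb T v2 = {v3,v1,a3,p}"
    by (rule nb4I[OF d(2)]) (use 2(5) e fc_edges[OF 2(3)] in auto)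
  have nv3: "nb T v3 = {v2,v1,a2,r}"
    by (rule nb4I[OF d(3)]) (use 3(5) e fc_edges[OF 3(3)] in auto)
  have pa: "fc T a3 v2 p" "fc T p v2 a3" "fc T p a3 v2" "fc T a3 p v2" "fc T v2 p a3" using fc_perms[OF 2(3)] by auto
  have ra: "fc T a2 v3 r" "fc T r v3 a2" "fc T r a2 v3" "fc T a2 r v3" "fc T v3 r a2" using fc_perms[OF 3(3)] by auto
  note pe = fc_edges[OF 2(3)] note re = fc_edges[OF 3(3)]
  have pa2: "p \<noteq> a2" using no_closed3[OF g(9) pa(1)] g(13) by auto
  have ra3: "r \<noteq> a3" using no_closed3[OF g(10) ra(1)] g(14) by auto
  have n1: "\<not> ed T p v1" "\<not> ed T r v1" using nbD'[OF nv1, of p] nbD'[OF nv1, of r] 2(5) 3(5) pa2 ra3 by auto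
  show False
  proof (cases "p = r")
    case False
    have pv3: "\<not> ed T p v3" "\<not> ed T r v2"
      using nbD'[OF nv3, of p] nbD'[OF nv2, of r] False pa2 ra3 2(5) 3(5) by auto
    have "deg T a3 = 4"
    proof (rule ccontr)
      assume "deg T a3 \<noteq> 4"
      then have d5: "5 \<le> deg T a3" using deg_cases[of a3 v1] e by blast
      have "nb T v2 = {p,a3,v3,v1}" unfolding nv2 by blast
      from contract_nb4[OF 2(4) pa(5) this pv3(1) n1(1) d5] show False .
    qed
    then have na3: "nb T a3 = {v1,v2,p,a2}" by (rule nb4I) (use 1(4) 2(5) pa2 pe e in auto)
    have "deg T a2 = 4"
    proof (rule ccontr)
      assume "deg T a2 \<noteq> 4"
      then have d5: "5 \<le> deg T a2" using deg_cases[of a2 v1] e by blast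
      have "nb T v3 = {r,a2,v2,v1}" unfolding nv3 by blast
      from contract_nb4[OF 3(4) ra(5) this pv3(2) n1(2) d5] show False .
    qed
    then have na2: "nb T a2 = {v1,v3,r,a3}" by (rule nb4I) (use 1(4) 3(5) ra3 re e in auto)
    have pn: "\<not> ed T p a2" using nbD'[OF na2, of p] 2(5) False pv3 n1 pe by auto
    have "bd T a3 p"
    proof (rule fc_bdI[OF pa(4)])
      fix e assume e: "fc T a3 p e"
      have "e \<in> {v1,v2,p,a2}" using nbD[OF na3] fc_ed[OF e] by blast
      then show "e = v2" using n1 pn fc_ed[OF e] fc_neq[OF e] by auto
    qed
    then show False using no_path2[OF bd_sym[OF 2(4)] pa(2)] bd_sym[of T a3 p] by blast
  next
    case True
    note r = True[symmetric]
    note ra = ra[unfolded r] note b3p = 3(4)[unfolded r] note re = re[unfolded r] note nv3 = nv3[unfolded r]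
    note n3 = 3(5)[unfolded r]
    note bp = bd_sym[OF 2(4)] bd_sym[OF b3p]
    have inn: "\<not> bd T p a2" "\<not> bd T p a3" using bd_le2[OF bp] 1(4) by auto
    \<comment> \<open>Otherwise \<open>a2\<close> and \<open>a3\<close> would be inner of degree 4,
      and \<open>v1 a2 a3\<close> would be a face excluded by \<open>inner444\<close>. Hence
      \<open>a2\<close>, \<open>a3\<close> and \<open>p\<close> have further neighbours and degree
      at least 5, which permits the flip of \<open>p a2\<close> into \<open>v3 t\<close>.\<close>
    have nf: "\<not> fc T p a2 a3"
    proof
      assume h: "fc T p a2 a3"
      note hp = fc_perms[OF h]
      have c2: "nb T a2 = {v1,v3,p,a3}" "\<not> bv T a2"
        using closed4[OF g(10) ra(1) _ g(14)] hp 1(4) 2(5) n3 by auto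
      have c3: "nb T a3 = {v1,v2,p,a2}" "\<not> bv T a3"
        using closed4[OF g(9) pa(1) _ g(13)] hp 1(4) 2(5) n3 by auto
      have "deg T a2 = 4" "deg T a3 = 4"
        using deg_of_nb4[OF c2(1)] deg_of_nb4[OF c3(1)] deg_ge4[of a2 v1] deg_ge4[of a3 v1] e by auto
      then show False using inner444[OF 1(2) i(1) c2(2) c3(2) d(1)] by blast
    qed
    obtain t where t: "fc T p a2 t" "t \<noteq> v3" using inner_other[OF ra(3) inn(1)] by blast
    note tn = fc_neq[OF t(1)] note te = fc_edges[OF t(1)]
    have a2v2: "\<not> ed T a2 v2" using nbD'[OF nv2, of a2] 1(4) pa2 by auto
    have a3v3: "\<not> ed T a3 v3" using nbD'[OF nv3, of a3] 1(4) ra3 r by auto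
    have t': "t \<notin> {v1,v2,v3,a2,a3,p}" using tn te nf t n1 a2v2 by auto
    obtain t2 where t2: "fc T p a3 t2" "t2 \<noteq> v2" using inner_other[OF pa(3) inn(2)] by blast
    note tn2 = fc_neq[OF t2(1)] note te2 = fc_edges[OF t2(1)]
    have t2': "t2 \<notin> {v1,v2,v3,a2,a3,p}" using tn2 te2 nf t2 n1 a3v3 fc_swap[OF t2(1)] by auto
    have da2: "5 \<le> deg T a2" by (rule deg5I[of v1 v3 p a3 t]) (use t' 1(4) n3 pa2 2(5) te re e in auto)
    have da3: "5 \<le> deg T a3" by (rule deg5I[of v1 v2 p a2 t2]) (use t2' 1(4) n3 pa2 2(5) te2 pe e in auto)
    have dp: "5 \<le> deg T p" by (rule deg5I[of v2 v3 a2 a3 t]) (use t' 1(4) n3 pa2 2(5) te pe re in auto)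
    have nt: "\<not> ed T v3 t" using nbD[OF nv3, of t] t' by auto
    interpret fl: stuck_flip T F p a2 v3 t
      by (rule flipI[OF ra(3) t(1) t(2)[symmetric] nt dp da2])
    interpret fs: stuck fl.T' F by (rule fl.stuck_flipped)
    show False
    proof (rule fs.contract_inner[of v1 v2 v3 a3])
      show "\<not> bv fl.T' v1" using i by (simp add: fl.bv_flip)
      show "fc fl.T' v1 v2 v3" by (rule fl.fc_old[OF f]) (use 1(4) 2(5) in auto)
      show "fc fl.T' v1 v2 a3" by (rule fl.fc_old[OF fc_swap[OF 1(3)]]) (use 1(4) 2(5) in auto)
      show "v3 \<noteq> a3" using 1(4) by simp
      show "5 \<le> deg fl.T' v3" by (simp add: fl.deg_flip d)
      show "5 \<le> deg fl.T' a3" using da3 fl.deg_flip(5)[of a3] 1(4) 2(5) t' by auto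
      fix z assume z: "ed fl.T' z v2" "ed fl.T' z v1"
      have "ed T z v1" using z(2) 1(4) t' unfolding fl.ed_flip by auto
      then have "z \<in> {v2,v3,a2,a3}" by (rule nbD'[OF nv1])
      moreover have "ed T z v2" using z(1) 1(4) t' unfolding fl.ed_flip by auto
      then have "z \<in> {v3,v1,a3,p}" by (rule nbD'[OF nv2])
      ultimately show "z = v3 \<or> z = a3" using 1(4) 2(5) pa2 by auto
    qed
  qed
qed

lemma face444:
  assumes f: "fc T v1 v2 v3" and i: "\<not> bv T v1" and d: "deg T v1 = 4" "deg T v2 = 4" "deg T v3 = 4"
  shows False
proof (cases "bv T v2"; cases "bv T v3")
  assume "bv T v2" "bv T v3" then show False using two_bd444[OF f i] d by blast
next
  assume "bv T v2" "\<not> bv T v3" then show False using one_bd444[OF f i] d by blast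
next
  assume "\<not> bv T v2" "bv T v3" then show False using one_bd444[OF fc_swap[OF f] i] d by blast
next
  assume "\<not> bv T v2" "\<not> bv T v3" then show False using inner444[OF f i] d by blast
qed

text \<open>Without diagonals in the link, \<open>wx\<close> and \<open>wy\<close> both satisfy the
  link condition, with third vertices \<open>y\<close>, \<open>q\<close> and \<open>x\<close>,
  \<open>p\<close>. If both contractions are blocked, two consecutive link vertices have degree 4
  and form with \<open>w\<close> a face excluded by \<open>face444\<close>.\<close>

lemma no_inner4:
  assumes i: "\<not> bv T w" and d: "deg T w = 4"
    and f: "fc T w x y" "fc T w y p" "fc T w p q" "fc T w q x"
    and n: "nb T w = {x,y,p,q}" "distinct [w,x,y,p,q]" and e: "\<not> ed T x p" "\<not> ed T y q"
  shows False
proof -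
  note s = f[THEN fc_swap]
  have "\<not> (5 \<le> deg T y \<and> 5 \<le> deg T q)"
  proof
    assume h: "5 \<le> deg T y \<and> 5 \<le> deg T q"
    show False
    proof (rule contract_inner[OF i f(1) s(4) _ _ h[THEN conjunct1] h[THEN conjunct2]])
      show "y \<noteq> q" using n by simp
      fix z assume z: "ed T z x" "ed T z w"
      have "z \<in> {x,y,p,q}" using nbD'[OF n(1) z(2)] .
      then show "z = y \<or> z = q" using z(1) ed_neq[OF z(1)] e(1) ed_sym[OF z(1)] by auto
    qed
  qed
  moreover have "\<not> (5 \<le> deg T x \<and> 5 \<le> deg T p)"
  proof
    assume h: "5 \<le> deg T x \<and> 5 \<le> deg T p"
    show False
    proof (rule contract_inner[OF i s(1) f(2) _ _ h[THEN conjunct1] h[THEN conjunct2]])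
      show "x \<noteq> p" using n by simp
      fix z assume z: "ed T z y" "ed T z w"
      have "z \<in> {x,y,p,q}" using nbD'[OF n(1) z(2)] .
      then show "z = x \<or> z = p" using z(1) ed_neq[OF z(1)] e(2) ed_sym[OF z(1)] by auto
    qed
  qed
  moreover have "deg T x = 4 \<or> 5 \<le> deg T x" "deg T y = 4 \<or> 5 \<le> deg T y"
    "deg T p = 4 \<or> 5 \<le> deg T p" "deg T q = 4 \<or> 5 \<le> deg T q"
    using deg_cases[of x w] deg_cases[of y w] deg_cases[of p w] deg_cases[of q w] fc_edges[OF f(1)] fc_edges[OF f(3)] by blast+
  ultimately consider "deg T x = 4" "deg T y = 4" | "deg T y = 4" "deg T p = 4"
    | "deg T p = 4" "deg T q = 4" | "deg T q = 4" "deg T x = 4" by blast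
  then show False using face444[OF _ i d] f by cases blast+
qed

text \<open>All three vertices of the boundary triangle \<open>w u1 u4\<close> have degree 4. Let
  \<open>s\<close> be the third vertex of the face at \<open>u1 u4\<close>. If
  \<open>u2 u3 s\<close> is a face, there is an octahedron whose eighth triangle is the hole.
  Otherwise the flip of \<open>u2 u3\<close> raises \<open>w\<close> to degree 5, and
  \<open>u1 u2\<close> can be contracted, with third vertices \<open>w\<close> and
  \<open>s\<close>.\<close>

lemma no_bd_triangle4:
  assumes p: "pth T w u1 u2 u3 u4" and b: "bd T u1 u4" and d: "deg T u1 = 4" "deg T u4 = 4"
  shows False
proof -
  have bw: "bd T w u1" "bd T w u4" and f: "fc T w u1 u2" "fc T w u2 u3" "fc T w u3 u4"
    and n: "distinct [w,u1,u2,u3,u4]" and nw: "nb T w = {u1,u2,u3,u4}" and dw: "deg T w = 4"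
    using p unfolding pth_def by blast+
  note fp = f[THEN fc_perms]
  have g: "fc T u1 w u2" "fc T u2 w u3" "fc T u2 u3 w" "fc T u4 w u3" "fc T u2 u1 w" "fc T u3 w u4" "fc T u3 u4 w" using fp by auto
  note b1 = bd_sym[OF bw(1)] note b4 = bd_sym[OF bw(2)]
  obtain x s y where 1: "fc T u1 w x" "fc T u1 x s" "fc T u1 s y" "bd T u1 y" "distinct [u1,w,x,s,y]"
    and nu1: "nb T u1 = {w,x,s,y}"
    by (rule bd4[OF b1 d(1)]) blast
  have x: "x = u2" using bd_unique[OF b1 1(1) g(1)] .
  have y: "y = u4" using bd_le2[OF b1 b _ 1(4)] n 1(5) by auto
  note 1 = 1[unfolded x y] note nu1 = nu1[unfolded x y]
  obtain x' s' y' where 4: "fc T u4 w x'" "fc T u4 x' s'" "fc T u4 s' y'" "bd T u4 y'" "distinct [u4,w,x',s',y']"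
    and nu4: "nb T u4 = {w,x',s',y'}"
    by (rule bd4[OF b4 d(2)]) blast
  have x': "x' = u3" using bd_unique[OF b4 4(1) g(4)] .
  have y': "y' = u1" using bd_le2[OF b4 bd_sym[OF b] _ 4(4)] n 4(5) by auto
  have s': "s' = s" using bd_unique[OF b, of s s'] fc_perms[OF 1(3)] fc_perms[OF 4(3)] y' by auto
  note 4 = 4[unfolded x' y' s'] note nu4 = nu4[unfolded x' y' s']
  note p1 = fc_perms[OF 1(2)] fc_perms[OF 1(3)] note p4 = fc_perms[OF 4(2)]
  have nf: "\<not> fc T u2 u3 s"
  proof
    assume h: "fc T u2 u3 s"
    have "octa T u2 u3 s u4 u1 w" unfolding octa_def
      using h g p1 p4 fp fc_perms[OF h] 1(5) 4(5) n by auto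
    then show False by (rule no_octa)
  qed
  have tri: "x \<in> {w,u1,u4}" if "bv T x" for x
    using bd_triangle[OF bw(1) b bw(2) that] .
  have i: "\<not> bv T u2" "\<not> bv T u3" using tri[of u2] tri[of u3] n by auto
  have nb2: "\<not> bd T u2 u3" "\<not> bd T u2 s" using i(1) by (auto simp: bv_def)
  obtain z where z: "fc T u2 u3 z" "z \<noteq> w" using inner_other[OF g(3) nb2(1)] by blast
  note ze = fc_edges[OF z(1)] note zn = fc_neq[OF z(1)]
  have ne: "\<not> ed T u3 u1" "\<not> ed T u2 u4" "\<not> ed T u1 u3" "\<not> ed T u4 u2"
    using nbD'[OF nu1, of u3] nbD'[OF nu4, of u2] nbD[OF nu1, of u3] nbD[OF nu4, of u2] n 1(5) 4(5) by auto
  have z': "z \<notin> {w,u1,u2,u3,u4,s}" using z nf zn ze ne by auto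
  have nwz: "\<not> ed T w z" using nbD[OF nw, of z] z' by auto
  note e = fc_edges[OF f(1)] fc_edges[OF f(2)] fc_edges[OF f(3)] fc_edges[OF 1(2)] fc_edges[OF 4(2)]
  have d2: "5 \<le> deg T u2" by (rule deg5I[of w u1 s u3 z]) (use e ze z' n 1(5) 4(5) in auto)
  have d3: "5 \<le> deg T u3" by (rule deg5I[of w u4 s u2 z]) (use e ze z' n 1(5) 4(5) in auto)
  have fs2: "fc T u2 s u1" "fc T u2 u1 s" using p1 by auto
  obtain k where k: "fc T u2 s k" "k \<noteq> u1" using inner_other[OF fs2(1) nb2(2)] by blast
  note ke = fc_edges[OF k(1)] note kn = fc_neq[OF k(1)]
  have k': "k \<notin> {u1,u2,u3,u4,s}" using k kn ke ne nf fc_perms[OF k(1)] by auto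
  have ds: "5 \<le> deg T s" by (rule deg5I[of u1 u2 u3 u4 k]) (use e ke k' n 1(5) 4(5) in auto)
  interpret fl: stuck_flip T F u2 u3 w z
    by (rule flipI[OF g(3) z(1) z(2)[symmetric] nwz d2 d3])
  interpret fs: stuck fl.T' F by (rule fl.stuck_flipped)
  show False
  proof (rule fs.contract_inner[of u2 u1 w s])
    show "\<not> bv fl.T' u2" using i by (simp add: fl.bv_flip)
    show "fc fl.T' u2 u1 w" by (rule fl.fc_old[OF g(5)]) (use n in auto)
    show "fc fl.T' u2 u1 s" by (rule fl.fc_old[OF fs2(2)]) (use n 1(5) 4(5) in auto)
    show "w \<noteq> s" using 1(5) by auto
    show "5 \<le> deg fl.T' w" by (simp add: fl.deg_flip dw)
    show "5 \<le> deg fl.T' s" using ds fl.deg_flip(5)[of s] 1(5) 4(5) z' by auto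
    fix x assume x: "ed fl.T' x u1" "ed fl.T' x u2"
    have "ed T x u1" using x(1) n z' unfolding fl.ed_flip by auto
    then have "x \<in> {w,u2,s,u4}" by (rule nbD'[OF nu1])
    moreover have "ed T x u2" using x(2) n z' unfolding fl.ed_flip by auto
    ultimately show "x = w \<or> x = s" using ne ed_neq[of T x u2] by auto
  qed
qed

end

section \<open>Composition of contractions\<close>

lemma collapse_collapse:
  assumes fin: "\<And>t. t \<in> T \<Longrightarrow> card t = 3"
  shows "collapse g (collapse f T) = collapse (g \<circ> f) T"
proof (intro equalityI subsetI)
  fix s assume "s \<in> collapse g (collapse f T)"
  then obtain u t where "t \<in> T" "u = f ` t" "s = g ` u" "card s = 3" by (auto simp: collapse_def)
  then show "s \<in> collapse (g \<circ> f) T" unfolding collapse_def by (auto simp: image_comp)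
next
  fix s assume "s \<in> collapse (g \<circ> f) T"
  then obtain t where t: "t \<in> T" "s = g ` f ` t" "card s = 3" by (auto simp: collapse_def image_comp)
  have "finite t" using fin[OF t(1)] finite_card3 by blast
  then have "card s \<le> card (f ` t)" "card (f ` t) \<le> 3"
    using t(2) fin[OF t(1)] card_image_le[of t f] card_image_le[of "f ` t" g] by auto
  then have "card (f ` t) = 3" using t(3) by simp
  then have "f ` t \<in> collapse f T" unfolding collapse_def using t(1) by blast
  then show "s \<in> collapse g (collapse f T)" unfolding collapse_def using t by blast
qed

text \<open>\<open>R\<^sub>6\<close> is given by a single vertex map. Splitting it lets the
  simultaneous contraction be verified as two successive ones, here for the condition that no faces
  are merged.\<close>

lemma simple_collapse_comp:
  assumes c3: "\<And>t. t \<in> T \<Longrightarrow> card t = 3"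
    and f: "simple_collapse f T" and g: "simple_collapse g (collapse f T)"
  shows "simple_collapse (g \<circ> f) T"
  unfolding simple_collapse_def
proof (rule inj_onI)
  fix t u assume tu: "t \<in> {t \<in> T. card ((g \<circ> f) ` t) = 3}" "u \<in> {t \<in> T. card ((g \<circ> f) ` t) = 3}"
    and e: "(g \<circ> f) ` t = (g \<circ> f) ` u"
  have *: "card (f ` t) = 3 \<and> f ` t \<in> {t \<in> collapse f T. card (g ` t) = 3}"
    if "t \<in> {t \<in> T. card ((g \<circ> f) ` t) = 3}" for t
  proof -
    have t: "t \<in> T" "card (g ` f ` t) = 3" using that by (auto simp: image_comp)
    have "finite t" using c3[OF t(1)] finite_card3 by blast
    then have "card (g ` f ` t) \<le> card (f ` t)" "card (f ` t) \<le> 3"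
      using c3[OF t(1)] card_image_le[of t f] card_image_le[of "f ` t" g] by auto
    then have c: "card (f ` t) = 3" using t(2) by simp
    then have "f ` t \<in> collapse f T" unfolding collapse_def using t(1) by blast
    then show ?thesis using c t(2) by simp
  qed
  have "g ` f ` t = g ` f ` u" using e by (simp add: image_comp)
  then have fe: "f ` t = f ` u"
    using inj_onD[OF g[unfolded simple_collapse_def] _ conjunct2[OF *[OF tu(1)]] conjunct2[OF *[OF tu(2)]]] by simp
  show "t = u"
    by (rule inj_onD[OF f[unfolded simple_collapse_def] fe]) (use * tu in auto)
qed

context csurf
begin

lemma collapse_fcD:
  assumes "fc (collapse f T) a b c"
  obtains a' b' c' where "fc T a' b' c'" "f a' = a" "f b' = b" "f c' = c"
proof -
  have "{a,b,c} \<in> collapse f T" using assms by (simp add: fc_def)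
  then obtain t where t: "t \<in> T" "{a,b,c} = f ` t" "card {a,b,c} = 3" by (auto simp: collapse_def)
  have d: "a \<noteq> b" "b \<noteq> c" "a \<noteq> c" using card3_distinct[OF t(3)] by auto
  have "a \<in> f ` t" "b \<in> f ` t" "c \<in> f ` t" using t(2) by blast+
  then obtain a' b' c' where m: "a' \<in> t" "b' \<in> t" "c' \<in> t" "f a' = a" "f b' = b" "f c' = c" by blast
  have n: "a' \<noteq> b'" "b' \<noteq> c'" "a' \<noteq> c'" using m d by auto
  obtain e where e: "t = {a',b',e}" using face_at[OF t(1) m(1,2) n(1)] by blast
  then have "c' = e" using m(3) n by auto
  then have "{a',b',c'} \<in> T" using t(1) e by simp
  then show ?thesis using that[of a' b' c'] m by (simp add: fc_def)
qed

lemma collapse_edD: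
  assumes "csurf (collapse f T)" "ed (collapse f T) a b"
  obtains a' b' where "ed T a' b'" "f a' = a" "f b' = b"
proof -
  obtain c where c: "fc (collapse f T) a b c" using csurf.ed_fc[OF assms] by blast
  obtain a' b' c' where "fc T a' b' c'" "f a' = a" "f b' = b" by (rule collapse_fcD[OF c]) blast
  then show ?thesis using that fc_ed by blast
qed

end

section \<open>Boundary vertices of degree 4\<close>

context stuck
begin

text \<open>The edges at \<open>w\<close> are tried for contraction. \<open>w u2\<close> is blocked
  only by degree 4 at \<open>u1\<close>. Then \<open>u2\<close> has degree at least 5 by
  \<open>face444\<close>, so \<open>w u1\<close> is blocked only by the adjacency of
  \<open>u1\<close> and \<open>u4\<close>, which makes \<open>w u1 u4\<close> the whole boundary. So
  \<open>u3\<close> is inner, and \<open>w u3\<close> can be contracted unless \<open>u4\<close> has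
  degree 4, which \<open>no_bd_triangle4\<close> excludes.\<close>

lemma no_pth_u2_inner:
  assumes p: "pth T w u1 u2 u3 u4" and e: "\<not> ed T u1 u3" "\<not> ed T u2 u4" and i2: "\<not> bv T u2"
  shows False
proof -
  have bw: "bd T w u1" "bd T w u4" and f: "fc T w u1 u2" "fc T w u2 u3" "fc T w u3 u4"
    and n: "distinct [w,u1,u2,u3,u4]" and nw: "nb T w = {u1,u2,u3,u4}" and dw: "deg T w = 4"
    using p unfolding pth_def by blast+
  note fp = f[THEN fc_perms]
  have g: "fc T u1 w u2" "fc T u2 w u1" "fc T u2 w u3" "fc T u3 w u2" "fc T u3 w u4" "fc T u4 w u3" "fc T u3 u4 w"
    "fc T w u3 u2" "fc T w u4 u3" using fp by auto
  note ee = fc_edges[OF f(1)] fc_edges[OF f(2)] fc_edges[OF f(3)]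
  have e': "\<not> ed T u3 u1" "\<not> ed T u4 u2" using e ed_sym[of T u3 u1] ed_sym[of T u4 u2] by auto
  \<comment> \<open>On the boundary, \<open>u3\<close> of degree 4 would make \<open>u3 u4\<close> a
    boundary edge and leave \<open>u4\<close> with degree 2; as an inner vertex it falls under
    \<open>no_inner4\<close>.\<close>
  have d3: "5 \<le> deg T u3"
  proof (rule ccontr)
    assume "\<not> 5 \<le> deg T u3"
    then have d3: "deg T u3 = 4" using deg_cases[of u3 w] ee by blast
    show False
    proof (cases "bv T u3")
      case True
      obtain r where r: "nb T u3 = {r,u4,w,u2}"
        by (rule nb4_ex[OF d3, of u4 w u2]) (use n ee in auto)
      have "\<not> bd T u3 w" using bd_unique[OF _ g(4,5)] n by auto
      moreover have "\<not> bd T u3 u2" using i2 bd_bv[OF bd_sym[of T u3 u2]] by blast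
      ultimately have b: "bd T u3 u4" using bd4_ends[OF True d3 r] by blast
      show False using no_path2[OF bd_sym[OF bw(2)] g(6) bd_sym[OF b]] .
    next
      case False
      obtain x y where x: "fc T u3 u2 x" "fc T u3 x y" "fc T u3 y w" "distinct [u3,w,u2,x,y]"
        and n3: "nb T u3 = {w,u2,x,y}"
        by (rule inner4[OF False d3 g(4)]) blast
      have y: "y = u4" using fc_le2[OF g(4,5), of y] fc_swap[OF x(3)] x(4) n by auto
      have "\<not> ed T w x"
      proof
        assume "ed T w x"
        then have "x \<in> {u1,u2,u3,u4}" by (rule nbD[OF nw])
        then show False using x(4) y e(1) fc_edges[OF x(1)] by auto
      qed
      then show False
        using no_inner4[OF False d3 g(4) x(1,2,3) n3 x(4)] e(2) y by blast
    qed
  qed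
  have d1: "deg T u1 = 4"
  proof (rule ccontr)
    assume "deg T u1 \<noteq> 4"
    then have d1: "5 \<le> deg T u1" using deg_cases[of u1 w] ee by blast
    show False
    proof (rule contract_inner[OF i2 g(2,3) _ _ d1 d3])
      show "u1 \<noteq> u3" using n by auto
      fix z assume z: "ed T z w" "ed T z u2"
      have "z \<in> {u1,u2,u3,u4}" using nbD'[OF nw z(1)] .
      then show "z = u1 \<or> z = u3" using z(2) e' ed_neq[OF z(2)] by auto
    qed
  qed
  have d2: "5 \<le> deg T u2"
  proof (rule ccontr)
    assume "\<not> 5 \<le> deg T u2"
    then have "deg T u2 = 4" using deg_cases[of u2 w] ee by blast
    then show False using face444[OF g(2) i2 _ dw d1] by blast
  qed
  have e14: "ed T u1 u4"
  proof (rule ccontr)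
    assume h: "\<not> ed T u1 u4"
    show False using contract_nb4[OF bw(1) f(1) nw e(1) h d2] .
  qed
  note b1 = bd_sym[OF bw(1)]
  obtain x s y where 1: "fc T u1 w x" "fc T u1 x s" "fc T u1 s y" "bd T u1 y" "distinct [u1,w,x,s,y]"
    and nu1: "nb T u1 = {w,x,s,y}"
    by (rule bd4[OF b1 d1]) blast
  have x: "x = u2" using bd_unique[OF b1 1(1) g(1)] .
  have "u4 \<in> {w,x,s,y}" using nbD[OF nu1 e14] .
  moreover have "u4 \<noteq> s" using fc_edges[OF 1(2)] e(2) x by auto
  ultimately have y: "y = u4" using n x by auto
  have b14: "bd T u1 u4" using 1(4) y by simp
  have i3: "\<not> bv T u3" using bd_triangle[OF bw(1) b14 bw(2), of u3] n by auto
  have d4: "5 \<le> deg T u4"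
  proof (rule ccontr)
    assume "\<not> 5 \<le> deg T u4"
    then have "deg T u4 = 4" using deg_cases[of u4 w] ee by blast
    then show False using no_bd_triangle4[OF p b14 d1] by blast
  qed
  show False
  proof (rule contract_inner[OF i3 g(4,5) _ _ d2 d4])
    show "u2 \<noteq> u4" using n by auto
    fix z assume z: "ed T z w" "ed T z u3"
    have "z \<in> {u1,u2,u3,u4}" using nbD'[OF nw z(1)] .
    then show "z = u2 \<or> z = u4" using z(2) e ed_neq[OF z(2)] by auto
  qed
qed

text \<open>The link condition at \<open>u1 u2\<close> excludes the adjacency of \<open>u1\<close>
  and \<open>u3\<close>, and \<open>u2\<close> is inner, so only an edge \<open>u2 u4\<close> keeps
  \<open>no_pth_u2_inner\<close> from applying. In that case \<open>u1 u2 u4\<close> is a face, and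
  flipping \<open>u2 u4\<close> away makes the lemma applicable to the flipped
  triangulation.\<close>

lemma pth_end_edge:
  assumes p: "pth T w u1 u2 u3 u4" and l: "\<And>z. ed T z u1 \<Longrightarrow> ed T z u2 \<Longrightarrow> fc T u1 u2 z"
    and b: "bv T u2 \<Longrightarrow> bd T u1 u2"
  shows False
proof -
  have bw: "bd T w u1" "bd T w u4" and f: "fc T w u1 u2" "fc T w u2 u3" "fc T w u3 u4"
    and n: "distinct [w,u1,u2,u3,u4]" and nw: "nb T w = {u1,u2,u3,u4}" and dw: "deg T w = 4"
    using p unfolding pth_def by blast+
  note fp = f[THEN fc_perms]
  have g: "fc T u1 w u2" "fc T u1 u2 w" "fc T u2 w u1" "fc T u2 w u3" "fc T u2 u3 w" "fc T u3 w u2" "fc T u3 u4 w"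
    "fc T w u2 u1" using fp by auto
  note ee = fc_edges[OF f(1)] fc_edges[OF f(2)] fc_edges[OF f(3)]
  have i2: "\<not> bv T u2" using no_path2[OF bd_sym[OF bw(1)] g(1) b] by blast
  have e13: "\<not> ed T u1 u3"
  proof
    assume "ed T u1 u3"
    then have "fc T u1 u2 u3" using l ed_sym[of T u1 u3] ee by blast
    then show False using no_closed3[OF g(3) _ g(5)] fc_perms[of T u1 u2 u3] by blast
  qed
  have e24: "ed T u2 u4" using no_pth_u2_inner[OF p e13 _ i2] by blast
  have nb12: "\<not> bd T u1 u2" using i2 bd_bv[OF bd_sym[of T u1 u2]] by blast
  \<comment> \<open>Without this edge \<open>u2\<close> would have degree at least 5, and the
    boundary edge \<open>w u1\<close> could be contracted.\<close>
  have e14: "ed T u1 u4"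
  proof (rule ccontr)
    assume h: "\<not> ed T u1 u4"
    obtain z where z: "fc T u1 u2 z" "z \<noteq> w" using inner_other[OF g(2) nb12] by blast
    note zn = fc_neq[OF z(1)] note ze = fc_edges[OF z(1)]
    have "5 \<le> deg T u2" by (rule deg5I[of w u1 u3 u4 z]) (use n z(2) zn ze ee e24 h e13 in auto)
    then show False using contract_nb4[OF bw(1) f(1) nw e13 h] by blast
  qed
  have f4: "fc T u1 u2 u4" using l[OF ed_sym[OF e14] ed_sym[OF e24]] .
  note f4p = fc_perms[OF f4]
  have f4': "fc T u2 u4 u1" using f4p by blast
  have "\<not> bd T u2 u4" using i2 by (auto simp: bv_def)
  then obtain t where t: "fc T u2 u4 t" "t \<noteq> u1" using inner_other[OF f4'] by blast
  note tn = fc_neq[OF t(1)] note te = fc_edges[OF t(1)] note tp = fc_perms[OF t(1)]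
  have t3: "t \<noteq> u3" using no_closed3[OF g(6) _ g(7)] tp by blast
  have tw: "t \<noteq> w" using fc_le2[OF g(8) f(2), of u4] tp n by auto
  have e1t: "\<not> ed T u1 t"
  proof
    assume "ed T u1 t"
    then have "fc T u1 u2 t" using l[of t] ed_sym[of T u1 t] te by blast
    then have "t = w \<or> t = u4" using fc_le2[OF g(2) f4, of t] n by auto
    then show False using tw tn by auto
  qed
  have d2: "5 \<le> deg T u2" by (rule deg5I[of w u1 u3 u4 t]) (use n t(2) t3 tw tn te ee e24 in auto)
  have d4: "5 \<le> deg T u4" by (rule deg5I[of w u3 u2 u1 t])
    (use n t(2) t3 tw tn te ee ed_sym[OF e24] ed_sym[OF e14] in auto)
  interpret fl: stuck_flip T F u2 u4 u1 t
    by (rule flipI[OF f4' t(1) t(2)[symmetric] e1t d2 d4])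
  interpret fs: stuck fl.T' F by (rule fl.stuck_flipped)
  show False
  proof (rule fs.no_pth_u2_inner[of w u1 u2 u3 u4])
    have wn: "w \<notin> {u2,u4,u1,t}" using n tw by auto
    show "pth fl.T' w u1 u2 u3 u4" unfolding pth_def
      using bw f n nw dw fl.nb_flip(5)[OF wn] fl.deg_flip(5)[OF wn]
      by (auto simp: fl.bd_flip intro!: fl.fc_old)
    show "\<not> ed fl.T' u1 u3" using e13 n t3 unfolding fl.ed_flip by auto
    show "\<not> ed fl.T' u2 u4" using n t tn unfolding fl.ed_flip by auto
    show "\<not> bv fl.T' u2" using i2 by (simp add: fl.bv_flip)
  qed
qed

text \<open>If \<open>u2\<close> has degree 4, its second boundary edge can be contracted with third
  vertex \<open>u1\<close>. Otherwise the flip of \<open>u1 u2\<close> adds a neighbour to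
  \<open>w\<close>, and the contraction of the boundary edge \<open>u2 u3\<close> is no longer
  blocked.\<close>

lemma pth_mid_bd_u1:
  assumes p: "pth T w u1 u2 u3 u4" and e: "\<not> ed T u1 u3" "\<not> ed T u2 u4" and b: "bd T u2 u3"
    and l: "\<And>z. ed T z u2 \<Longrightarrow> ed T z u3 \<Longrightarrow> z = w" and d: "5 \<le> deg T u1"
  shows False
proof -
  have bw: "bd T w u1" "bd T w u4" and f: "fc T w u1 u2" "fc T w u2 u3" "fc T w u3 u4"
    and n: "distinct [w,u1,u2,u3,u4]" and nw: "nb T w = {u1,u2,u3,u4}" and dw: "deg T w = 4"
    using p unfolding pth_def by blast+
  note fp = f[THEN fc_perms]
  have g: "fc T u2 u3 w" "fc T u2 w u1" "fc T u2 w u3" "fc T u1 u2 w" using fp by auto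
  note ee = fc_edges[OF f(1)] fc_edges[OF f(2)] fc_edges[OF f(3)]
  show False
  proof (cases "deg T u2 = 4")
    case True
    obtain x y r where r: "fc T u2 u3 x" "fc T u2 x y" "fc T u2 y r" "bd T u2 r" "distinct [u2,u3,x,y,r]"
      and n2: "nb T u2 = {u3,x,y,r}" by (rule bd4[OF b True]) blast
    have x: "x = w" using bd_unique[OF b r(1) g(1)] .
    have y: "y = u1" using fc_le2[OF g(2,3), of y] r(2,5) x n by auto
    note re = fc_edges[OF r(3)]
    have n2': "nb T u2 = {r,u1,u3,w}" unfolding n2 x y by blast
    have "\<not> ed T r u3" using l[of r] re r(5) x by auto
    moreover have "\<not> ed T r w" using nbD'[OF nw, of r] r(5) x y re e(2) by auto
    moreover have "fc T u2 r u1" using fc_swap[OF r(3)] y by simp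
    ultimately show False using contract_nb4[OF r(4) _ n2' _ _ d] by blast
  next
    case False
    then have d2: "5 \<le> deg T u2" using deg_cases[of u2 w] ee by blast
    have "\<not> bd T u1 u2"
    proof
      assume "bd T u1 u2"
      then show False using no_path3[OF b g(1,2) bd_sym] n by auto
    qed
    then obtain t where t: "fc T u1 u2 t" "t \<noteq> w" using inner_other[OF g(4)] by blast
    note tn = fc_neq[OF t(1)] note te = fc_edges[OF t(1)]
    have t3: "t \<noteq> u3" using te e by auto
    have t4: "t \<noteq> u4" using te e by auto
    have wt: "\<not> ed T w t" using nbD[OF nw, of t] tn t3 t4 by auto
    interpret fl: stuck_flip T F u1 u2 w t
      by (rule flipI[OF g(4) t(1) t(2)[symmetric] wt d d2])
    interpret fs: stuck fl.T' F by (rule fl.stuck_flipped)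
    show False
    proof (rule fs.contract_bd[of u2 u3 w])
      show "bd fl.T' u2 u3" using b by (simp add: fl.bd_flip)
      show "fc fl.T' u2 u3 w" by (rule fl.fc_old[OF g(1)]) (use n in auto)
      show "5 \<le> deg fl.T' w" by (simp add: fl.deg_flip dw)
      fix z assume z: "ed fl.T' z u3" "ed fl.T' z u2"
      have "ed T z u3" using z(1) n t3 unfolding fl.ed_flip by auto
      moreover have "ed T z u2" using z(2) n tn unfolding fl.ed_flip by auto
      ultimately show "z = w" using l by blast
    qed
  qed
qed

end

context stuck
begin

text \<open>
  Contracting only one of \<open>w u1\<close> and \<open>u2 u3\<close> would lower the degree of \<open>u2\<close> or \<open>w\<close> to 3;
  \<open>R\<^sub>6\<close> contracts both at once.
\<close>

lemma no_red6:
  assumes p: "pth T w u1 u2 u3 u4" and e: "\<not> ed T u1 u3" "\<not> ed T u2 u4" "\<not> ed T u1 u4" and b: "bd T u2 u3"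
    and l: "\<And>z. ed T z u2 \<Longrightarrow> ed T z u3 \<Longrightarrow> z = w"
    and n1: "nb T u1 = {w,u2,s,t}" "distinct [u1,w,u2,s,t]"
    and n2: "nb T u2 = {u3,w,u1,s}" "distinct [u2,u3,w,u1,s]"
    and n3: "nb T u3 = {u2,w,u4,r}" "distinct [u3,u2,w,u4,r]"
  shows False
proof -
  have bw: "bd T w u1" "bd T w u4" and f: "fc T w u1 u2" "fc T w u2 u3" "fc T w u3 u4"
    and n: "distinct [w,u1,u2,u3,u4]" and nw: "nb T w = {u1,u2,u3,u4}"
    using p unfolding pth_def by blast+
  note fp = f[THEN fc_perms]
  have g: "fc T u1 w u2" "fc T u3 u2 w" "fc T w u2 u1" "fc T u3 w u2" "fc T u3 w u4" "fc T w u3 u2" using fp by auto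
  note ee = fc_edges[OF f(1)] fc_edges[OF f(2)] fc_edges[OF f(3)]
  have en: "ed T u1 s" "ed T u1 t" "ed T u2 s" "ed T u3 r"
    using n1(1) n2(1) n3(1) by (auto simp: nb_def)
  \<comment> \<open>Coincidences among the outer neighbours would contradict the non-adjacencies or
    give \<open>u2\<close> and \<open>u3\<close> a second common neighbour. Being distinct, they
    supply four neighbours of \<open>w\<close> and of \<open>u2\<close> after the double
    contraction.\<close>
  have sr: "s \<noteq> r" "s \<noteq> u4" "t \<noteq> u3" "t \<noteq> u4" "r \<noteq> u1"
    using l[of s] en e n1(2) n2(2) n3(2) ed_sym[OF en(3)] ed_sym[OF en(4)] ed_sym[OF en(2)] by auto
  let ?f = "id(u1 := w)" and ?g = "id(u3 := u2)" and ?h = "id(u1 := w, u3 := u2)"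
  let ?T1 = "collapse ?f T" and ?T2 = "collapse ?h T"
  have gf: "?g \<circ> ?f = ?h" using n by (auto simp: fun_eq_iff)
  have ce1: "contractible_edge F T w u1"
  proof (rule contractible_path[OF tri bd_sym[OF bw(1)] g(1)])
    fix z assume z: "ed T z w" "ed T z u1"
    have "z \<in> {u1,u2,u3,u4}" using nbD'[OF nw z(1)] .
    then show "z = u2" using z(2) e ed_neq[OF z(2)] ed_sym[OF z(2)] by auto
  next
    show "3 \<le> card (nb T u1)" using deg_ge4[of u1 w] ee by (simp add: deg_nb)
  qed
  have ce2: "contractible_edge F T u2 u3"
  proof (rule contractible_path[OF tri bd_sym[OF b] g(2) l])
    show "3 \<le> card (nb T u3)" using deg_ge4[of u3 w] ee by (simp add: deg_nb)
  qed
  have T1: "triangulates ?T1 F" "simple_collapse ?f T" using ce1 by (simp_all add: contractible_edge_def)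
  interpret T1: csurf ?T1 using triangulates_csurf[OF punctured T1(1)] .
  have ed1: "ed ?T1 (?f x) (?f y)" if "ed T x y" "?f x \<noteq> ?f y" for x y
  proof (rule collapse_ed[OF _ _ that])
    show "u1 \<noteq> w" using n by auto
    show False if h: "fc T u1 w q" "bd T u1 q" "bd T w q" for q
    proof -
      have "q = u2" using bd_unique[OF bd_sym[OF bw(1)] h(1) g(1)] .
      then show False using bd_unique[OF h(3), of u1 u3] g(3) f(2) n by auto
    qed
  qed
  have fc1: "fc ?T1 (?f x) (?f y) (?f z)" if "fc T x y z" "?f x \<noteq> ?f y" "?f y \<noteq> ?f z" "?f x \<noteq> ?f z" for x y z
    by (rule collapse_fc[OF that(1)]) (use that in auto)
  have f1: "fc ?T1 u3 u2 w" "fc ?T1 u3 w u2" "fc ?T1 u3 w u4"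
    using fc1[OF g(2)] fc1[OF g(4)] fc1[OF g(5)] n by auto
  \<comment> \<open>Neither end of \<open>u3 u2\<close> is touched by the first contraction: a face
    at this edge afterwards lifts to a face at the same edge before.\<close>
  have b1: "bd ?T1 u3 u2"
  proof (rule T1.fc_bdI[OF f1(1)])
    fix q assume "fc ?T1 u3 u2 q"
    then obtain x y z where x: "fc T x y z" "?f x = u3" "?f y = u2" "?f z = q" by (rule collapse_fcD)
    have "x = u3" "y = u2" using x(2,3) n by (auto split: if_splits)
    then have "z = w" using bd_unique[OF bd_sym[OF b] g(2)] x(1) by blast
    then show "q = w" using x(4) by auto
  qed
  have ce12: "contractible_edge F ?T1 u2 u3"
  proof (rule T1.contractible_path[OF T1(1) b1 f1(1)])
    fix z assume z: "ed ?T1 z u2" "ed ?T1 z u3"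
    obtain x y where x: "ed T x y" "?f x = z" "?f y = u2" by (rule collapse_edD[OF T1.csurf_axioms z(1)])
    have "y = u2" using x(3) n by (auto split: if_splits)
    then have "x \<in> {u3,w,u1,s}" using nbD'[OF n2(1)] x(1) by blast
    then have z1: "z \<in> {u3,w,s}" using x(2) n2(2) n by auto
    obtain x' y' where x': "ed T x' y'" "?f x' = z" "?f y' = u3" by (rule collapse_edD[OF T1.csurf_axioms z(2)])
    have "y' = u3" using x'(3) n by (auto split: if_splits)
    then have "x' \<in> {u2,w,u4,r}" using nbD'[OF n3(1)] x'(1) by blast
    then have "z \<in> {u2,w,u4,r}" using x'(2) sr n by auto
    then show "z = w" using z1 sr n n2(2) n3(2) by auto
  next
    have "{u2,w,u4} \<subseteq> nb ?T1 u3"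
      using T1.fc_ed[OF f1(1)] T1.fc_ed[OF f1(3)] by (auto simp: nb_def)
    moreover have "card {u2,w,u4} = 3" using n by auto
    ultimately show "3 \<le> card (nb ?T1 u3)" using card_mono[OF T1.finite_nb] by metis
  qed
  have c2: "collapse ?g ?T1 = ?T2"
    using collapse_collapse[of T ?g ?f, OF c3] unfolding gf .
  have T2: "triangulates ?T2 F" and s2: "simple_collapse ?g ?T1"
    using ce12 unfolding contractible_edge_def c2 by blast+
  have sh: "simple_collapse ?h T" using simple_collapse_comp[OF c3 T1(2) s2] unfolding gf .
  interpret T2: csurf ?T2 using triangulates_csurf[OF punctured T2] .
  have ed2: "ed ?T2 (?h x) (?h y)" if h: "ed T x y" "?h x \<noteq> ?h y" for x y
  proof -
    have hh: "?h q = ?g (?f q)" for q using gf by (metis comp_apply)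
    have "?f x \<noteq> ?f y" using h(2) unfolding hh by metis
    then have e1: "ed ?T1 (?f x) (?f y)" by (rule ed1[OF h(1)])
    have "ed (collapse ?g ?T1) (?g (?f x)) (?g (?f y))"
    proof (rule T1.collapse_ed[OF _ _ e1])
      show "u3 \<noteq> u2" using n by auto
      show "?g (?f x) \<noteq> ?g (?f y)" using h(2) unfolding hh .
      show False if q: "fc ?T1 u3 u2 q" "bd ?T1 u3 q" "bd ?T1 u2 q" for q
      proof -
        have "q = w" using T1.bd_unique[OF b1 q(1) f1(1)] .
        then show False using T1.bd_unique[OF _ f1(2,3)] q(2) n by auto
      qed
    qed
    then show ?thesis unfolding c2 hh .
  qed
  have vs: "verts ?T2 \<subseteq> verts T - {u1,u3}"
  proof
    fix z assume "z \<in> verts ?T2"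
    then obtain x y where "x \<in> T" "y \<in> x" "z = ?h y" by (auto simp: verts_def collapse_def)
    moreover have "w \<in> verts T" "u2 \<in> verts T" using ed_verts[of w u2] ee by auto
    ultimately show "z \<in> verts T - {u1,u3}" using n by (auto simp: verts_def)
  qed
  have "verts ?T2 \<subset> verts T" using vs ed_verts[of u1 w] ee by blast
  then have cv: "card (verts ?T2) < card (verts T)" by (rule psubset_card_mono[OF finite_verts])
  have hid: "?h x = x" if "x \<noteq> u1" "x \<noteq> u3" for x using that by simp
  have hu: "?h u1 = w" "?h u3 = u2" using n by auto
  have d4: "4 \<le> deg ?T2 z" if z: "z \<in> verts ?T2" for z
  proof -
    have zn: "z \<noteq> u1" "z \<noteq> u3" "z \<in> verts T" using z vs by blast+
    consider "z = w" | "z = u2" | "z \<noteq> w" "z \<noteq> u2" by blast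
    then show ?thesis
    proof cases
      case 1
      have "ed ?T2 w u2" "ed ?T2 w u4" "ed ?T2 w s" "ed ?T2 w t"
        using ed2[of w u2] ed2[of w u4] ed2[of u1 s] ed2[of u1 t] ee en n n1(2) n2(2) sr by auto
      then have "{u2,u4,s,t} \<subseteq> nb ?T2 w" by (auto simp: nb_def)
      from card_mono[OF T2.finite_nb this] show ?thesis
        unfolding 1 deg_nb using n n1(2) n2(2) sr by auto
    next
      case 2
      have "ed ?T2 u2 w" "ed ?T2 u2 s" "ed ?T2 u2 u4" "ed ?T2 u2 r"
        using ed2[of u2 w] ed2[of u2 s] ed2[of u3 u4] ed2[of u3 r] ee en n n2(2) n3(2) sr by auto
      then have "{w,s,u4,r} \<subseteq> nb ?T2 u2" by (auto simp: nb_def)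
      from card_mono[OF T2.finite_nb this] show ?thesis
        unfolding 2 deg_nb using n n2(2) n3(2) sr by auto
    next
      case 3
      have hz: "?h z = z" using hid[OF zn(1,2)] .
      have "?h ` nb T z \<subseteq> nb ?T2 z"
      proof
        fix q assume "q \<in> ?h ` nb T z"
        then obtain x where x: "ed T z x" "q = ?h x" by (auto simp: nb_def)
        have "?h x \<noteq> z" using ed_neq[OF x(1)] 3 by (auto split: if_splits)
        then show "q \<in> nb ?T2 z" using ed2[OF x(1)] x(2) hz by (auto simp: nb_def)
      qed
      \<comment> \<open>Apart from \<open>w\<close> and \<open>u2\<close>, no vertex is adjacent to
        both ends of a contracted edge, so no two neighbours of \<open>z\<close> are
        identified.\<close>
      moreover have "inj_on ?h (nb T z)"
      proof -
        have "\<not> (u1 \<in> nb T z \<and> w \<in> nb T z)"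
        proof
          assume h: "u1 \<in> nb T z \<and> w \<in> nb T z"
          then have "z \<in> {u1,u2,u3,u4}" "ed T z u1" using nbD'[OF nw] by (auto simp: nb_def)
          then show False using e zn 3 ed_sym[of T z u1] by auto
        qed
        moreover have "\<not> (u2 \<in> nb T z \<and> u3 \<in> nb T z)" using l[of z] 3 by (auto simp: nb_def)
        ultimately show ?thesis using n unfolding inj_on_def by auto
      qed
      ultimately have "card (nb T z) \<le> card (nb ?T2 z)"
        using card_mono[OF T2.finite_nb] card_image by metis
      moreover have "4 \<le> deg T z" using tri4 zn(3) by (simp add: triangulation4_def)
      ultimately show ?thesis by (simp add: deg_nb)
    qed
  qed
  have t4: "triangulation4 F ?T2" using T2 d4 by (simp add: triangulation4_def)
  have "red6 F T ?T2" unfolding red6_def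
  proof (intro exI conjI)
    show "{w,u2,u1} \<in> T" "{w,u2,u3} \<in> T" using g(3) f(2) by (simp_all add: fc_def)
    show "u1 \<noteq> u3" using n by auto
    show "contractible_edge F T w u1" "contractible_edge F T u2 u3" by fact+
    have bb: "{w,u1} \<in> bd_edges T" "{u3,u2} \<in> bd_edges T"
      using bw(1) bd_sym[OF b] by (simp_all add: bd_def)
    show "{w,u1} \<in> bd_edges T \<or> {u3,u2} \<in> bd_edges T" using bb(1) by (rule disjI1)
    show "{w,u1} \<in> bd_edges T \<and> {u3,u2} \<in> bd_edges T \<or>
       (\<exists>p\<in>{w,u1,u2,u3}. p \<notin> bd_verts T \<and> 5 \<le> deg T p)" using bb by (intro disjI1 conjI)
    show "simple_collapse ?h T" by fact
  qed (rule refl)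
  then have "reduction4 F T ?T2" using t4 by (simp only: reduction4_def simp_thms)
  then show False by (rule no_reduction[OF _ cv])
qed

text \<open>\<open>u1\<close> and \<open>u4\<close> have degree 4 by \<open>pth_mid_bd_u1\<close>
  and its mirror image. They are not adjacent, since otherwise \<open>w u1 u4\<close> would be the
  entire boundary, although \<open>u2\<close> lies on the boundary as well. Hence \<open>u2\<close>
  and \<open>u3\<close> have degree 4 too, as \<open>w u1\<close> and \<open>w u4\<close> cannot be
  contracted, and the situation of \<open>no_red6\<close> is reached.\<close>

lemma pth_mid_bd:
  assumes p: "pth T w u1 u2 u3 u4" and e: "\<not> ed T u1 u3" "\<not> ed T u2 u4" and b: "bd T u2 u3"
    and l: "\<And>z. ed T z u2 \<Longrightarrow> ed T z u3 \<Longrightarrow> z = w"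
  shows False
proof -
  have bw: "bd T w u1" "bd T w u4" and f: "fc T w u1 u2" "fc T w u2 u3" "fc T w u3 u4"
    and n: "distinct [w,u1,u2,u3,u4]" and nw: "nb T w = {u1,u2,u3,u4}" and dw: "deg T w = 4"
    using p unfolding pth_def by blast+
  note fp = f[THEN fc_perms]
  have g: "fc T u1 w u2" "fc T u2 u3 w" "fc T u2 w u1" "fc T u2 w u3" "fc T u3 u2 w" "fc T u3 w u2" "fc T u3 w u4"
    "fc T u1 u2 w" "fc T w u4 u3" using fp by auto
  note ee = fc_edges[OF f(1)] fc_edges[OF f(2)] fc_edges[OF f(3)]
  have e': "\<not> ed T u3 u1" "\<not> ed T u4 u2" using e ed_sym[of T u3 u1] ed_sym[of T u4 u2] by auto
  have d1: "deg T u1 = 4" using pth_mid_bd_u1[OF p e b l] deg_cases[of u1 w] ee by blast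
  have d4: "deg T u4 = 4"
    using pth_mid_bd_u1[OF pth_rev[OF p] e'(2,1) bd_sym[OF b]] l deg_cases[of u4 w] ee by blast
  note b1 = bd_sym[OF bw(1)]
  obtain x s t where 1: "fc T u1 w x" "fc T u1 x s" "fc T u1 s t" "bd T u1 t" "distinct [u1,w,x,s,t]"
    and nu1: "nb T u1 = {w,x,s,t}"
    by (rule bd4[OF b1 d1]) blast
  have x: "x = u2" using bd_unique[OF b1 1(1) g(1)] .
  note 1 = 1[unfolded x] note nu1 = nu1[unfolded x]
  have e14: "\<not> ed T u1 u4"
  proof
    assume "ed T u1 u4"
    then have "u4 \<in> {w,u2,s,t}" by (rule nbD[OF nu1])
    moreover have "u4 \<noteq> s" using fc_edges[OF 1(2)] e(2) by auto
    ultimately have "t = u4" using n by auto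
    then have "bd T u1 u4" using 1(4) by simp
    then show False using bd_triangle[OF bw(1) _ bw(2), of u2] bd_bv[OF b] n by auto
  qed
  have e41: "\<not> ed T u4 u1" using e14 ed_sym[of T u4 u1] by blast
  have d2: "deg T u2 = 4"
  proof (rule ccontr)
    assume "deg T u2 \<noteq> 4"
    then have "5 \<le> deg T u2" using deg_cases[of u2 w] ee by blast
    then show False using contract_nb4[OF bw(1) f(1) nw e(1) e14] by blast
  qed
  have d3: "deg T u3 = 4"
  proof (rule ccontr)
    assume "deg T u3 \<noteq> 4"
    then have d5: "5 \<le> deg T u3" using deg_cases[of u3 w] ee by blast
    have "nb T w = {u4,u3,u1,u2}" unfolding nw by blast
    then show False using contract_nb4[OF bw(2) g(9) _ e41 e'(2) d5] by blast
  qed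
  obtain x y s' where 2: "fc T u2 u3 x" "fc T u2 x y" "fc T u2 y s'" "distinct [u2,u3,x,y,s']"
    and nu2: "nb T u2 = {u3,x,y,s'}" by (rule bd4[OF b d2]) blast
  have x: "x = w" using bd_unique[OF b 2(1) g(2)] .
  have y: "y = u1" using fc_le2[OF g(3,4), of y] 2(2,4) x n by auto
  note 2 = 2[unfolded x y] note nu2 = nu2[unfolded x y]
  have s': "s' = s"
    using fc_le2[OF g(8) 1(2), of s'] fc_perms[OF 2(3)] 1(5) 2(4) by auto
  obtain x y r where 3: "fc T u3 u2 x" "fc T u3 x y" "fc T u3 y r" "distinct [u3,u2,x,y,r]"
    and nu3: "nb T u3 = {u2,x,y,r}" by (rule bd4[OF bd_sym[OF b] d3]) blast
  have x: "x = w" using bd_unique[OF bd_sym[OF b] 3(1) g(5)] .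
  have y: "y = u4" using fc_le2[OF g(6,7), of y] 3(2,4) x n by auto
  show False
    by (rule no_red6[OF p e e14 b l nu1 1(5) nu2[unfolded s'] 2(4)[unfolded s'] nu3[unfolded x y] 3(4)[unfolded x y]])
qed

text \<open>A diagonal of the link would, by the link condition, close the faces around
  \<open>u2\<close> or \<open>u3\<close> to a vertex of degree 3. Hence
  \<open>no_pth_u2_inner\<close>, applied in both directions, puts \<open>u2\<close> and
  \<open>u3\<close> on the boundary.\<close>

lemma pth_mid_edge:
  assumes p: "pth T w u1 u2 u3 u4" and l: "\<And>z. ed T z u2 \<Longrightarrow> ed T z u3 \<Longrightarrow> fc T u2 u3 z"
    and b: "bv T u2 \<Longrightarrow> bv T u3 \<Longrightarrow> bd T u2 u3"
  shows False
proof -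
  have f: "fc T w u1 u2" "fc T w u2 u3" "fc T w u3 u4"
    using p unfolding pth_def by blast+
  note fp = f[THEN fc_perms]
  have g: "fc T u2 w u1" "fc T u2 u3 w" "fc T u3 w u4" "fc T u3 u2 w" using fp by auto
  note ee = fc_edges[OF f(1)] fc_edges[OF f(2)] fc_edges[OF f(3)]
  have e13: "\<not> ed T u1 u3"
  proof
    assume "ed T u1 u3"
    then have "fc T u2 u3 u1" using l[of u1] ee by blast
    then show False using no_closed3[OF g(1) _ g(2)] fc_perms[of T u2 u3 u1] by blast
  qed
  have e24: "\<not> ed T u4 u2"
  proof
    assume "ed T u4 u2"
    then have "fc T u2 u3 u4" using l[of u4] ee by blast
    then show False using no_closed3[OF g(3) _ g(4)] fc_perms[of T u2 u3 u4] by blast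
  qed
  have e': "\<not> ed T u3 u1" "\<not> ed T u2 u4" using e13 e24 ed_sym[of T u3 u1] ed_sym[of T u2 u4] by auto
  have i: "bv T u2" "bv T u3"
    using no_pth_u2_inner[OF p e13 e'(2)] no_pth_u2_inner[OF pth_rev[OF p] e24 e'(1)] by blast+
  note b23 = b[OF i]
  show False
  proof (rule pth_mid_bd[OF p e13 e'(2) b23])
    fix z assume "ed T z u2" "ed T z u3"
    then have "fc T u2 u3 z" by (rule l)
    then show "z = w" using bd_unique[OF b23 _ g(2)] by blast
  qed
qed

text \<open>For inner \<open>w\<close> the link condition forbids both diagonals of the link, since
  either would create a vertex of degree 3. For \<open>w\<close> on the boundary the edge
  \<open>xy\<close> lies at an end or in the middle of the link path.\<close>

lemma no_apex4:
  assumes f: "fc T w x y" and d: "deg T w = 4"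
    and l: "\<And>z. ed T z x \<Longrightarrow> ed T z y \<Longrightarrow> fc T x y z" and b: "bv T x \<Longrightarrow> bv T y \<Longrightarrow> bd T x y"
  shows False
proof (cases "bv T w")
  case False
  obtain p q where r: "fc T w y p" "fc T w p q" "fc T w q x" "distinct [w,x,y,p,q]" "nb T w = {x,y,p,q}"
    by (rule inner4[OF False d f]) blast
  note fp = fc_perms[OF f] note rp = r(1-3)[THEN fc_perms]
  have "\<not> ed T x p"
  proof
    assume "ed T x p"
    then have h: "fc T x y p" using l[of p] ed_sym[of T x p] fc_edges[OF r(1)] by blast
    show False using no_closed3[of y w x p] fp rp fc_perms[OF h] by blast
  qed
  moreover have "\<not> ed T y q"
  proof
    assume "ed T y q"
    then have h: "fc T x y q" using l[of q] ed_sym[of T y q] fc_edges[OF r(3)] by blast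
    show False using no_closed3[of x w y q] fp rp fc_perms[OF h] h by blast
  qed
  ultimately show False by (rule no_inner4[OF False d f r(1-3) r(5) r(4)])
next
  case True
  then obtain u1 where u1: "bd T w u1" by (auto simp: bv_def)
  obtain u2 u3 u4 where u: "fc T w u1 u2" "fc T w u2 u3" "fc T w u3 u4" "bd T w u4"
    "distinct [w,u1,u2,u3,u4]" "nb T w = {u1,u2,u3,u4}"
    by (rule bd4[OF u1 d]) blast
  have p: "pth T w u1 u2 u3 u4" unfolding pth_def by (intro conjI u1 u d)
  note p' = pth_rev[OF p]
  have l': "fc T y x z" if "ed T z y" "ed T z x" for z using l[OF that(2,1)] fc_perms[of T x y z] by blast
  have b': "bd T y x" if "bv T y" "bv T x" using b[OF that(2,1)] by (rule bd_sym)
  have bv1: "bv T u1" "bv T u4" using bd_bv[OF bd_sym[OF u1]] bd_bv[OF bd_sym[OF u(4)]] by auto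
  have "u1 \<noteq> u3" "u2 \<noteq> u4" using u(5) by auto
  from path4_fc[OF u1 u(1-4) this f]
  consider "x = u1" "y = u2" | "x = u2" "y = u1" | "x = u2" "y = u3" | "x = u3" "y = u2"
    | "x = u3" "y = u4" | "x = u4" "y = u3" by blast
  then show False
  proof cases
    case 1 then show ?thesis using pth_end_edge[OF p] l b bv1 by blast
  next
    case 2 then show ?thesis using pth_end_edge[OF p] l' b' bv1 by blast
  next
    case 3 then show ?thesis using pth_mid_edge[OF p] l b by blast
  next
    case 4 then show ?thesis using pth_mid_edge[OF p] l' b' by blast
  next
    case 5 then show ?thesis using pth_end_edge[OF p'] l' b' bv1 by blast
  next
    case 6 then show ?thesis using pth_end_edge[OF p'] l b bv1 by blast
  qed
qed

text \<open>By \<open>no_apex4\<close> every third vertex has degree at least 5, so the contraction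
  stays in the family. If \<open>xy\<close> is not a boundary edge, one of its ends is inner and
  serves as the vanishing vertex.\<close>

theorem no_link_edge:
  assumes e: "ed T x y"
    and l: "\<And>z. ed T z x \<Longrightarrow> ed T z y \<Longrightarrow> fc T x y z" and b: "bv T x \<Longrightarrow> bv T y \<Longrightarrow> bd T x y"
  shows False
proof -
  have d5: "5 \<le> deg T p" if p: "fc T x y p" for p
  proof (rule ccontr)
    assume "\<not> 5 \<le> deg T p"
    then have "deg T p = 4" using deg_cases[of p x] fc_edges[OF p] by blast
    moreover have "fc T p x y" using fc_perms[OF p] by blast
    ultimately show False using no_apex4[of p x y] l b by blast
  qed
  obtain p where p: "fc T x y p" using ed_fc[OF e] by blast
  show False
  proof (cases "bd T x y")
    case True
    have yx: "fc T y x p" using fc_perms[OF p] by blast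
    show False
    proof (rule contract_bd[OF bd_sym[OF True] yx _ d5[OF p]])
      fix z assume "ed T z x" "ed T z y"
      then have "fc T x y z" by (rule l)
      then show "z = p" using bd_unique[OF True _ p] by blast
    qed
  next
    case False
    then obtain q where q: "fc T x y q" "q \<noteq> p" using inner_other[OF p] by blast
    have yx: "fc T y x p" "fc T y x q" using fc_perms[OF p] fc_perms[OF q(1)] by blast+
    have co: "z = p \<or> z = q" if "ed T z x" "ed T z y" for z
      using fc_le2[OF p q(1) q(2)[symmetric] l[OF that]] .
    show False
    proof (cases "bv T y")
      case True
      then have "\<not> bv T x" using b False by blast
      from contract_inner[OF this p q(1) q(2)[symmetric] _ d5[OF p] d5[OF q(1)]] show ?thesis using co by blast
    next
      case nb: False
      from contract_inner[OF nb yx q(2)[symmetric] _ d5[OF p] d5[OF q(1)]] show ?thesis using co by blast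
    qed
  qed
qed

end

section \<open>First cohomology modulo 2\<close>

text \<open>
  Alexander--Spanier cocycles and coboundaries of degree 1 with coefficients in the field of two
  elements, written as Boolean functions with \<open>\<noteq>\<close> as addition; both conditions are required only
  near the diagonal.
\<close>

definition cocyc :: "'p::topological_space set \<Rightarrow> ('p \<Rightarrow> 'p \<Rightarrow> bool) \<Rightarrow> bool" where
  "cocyc X \<kappa> \<longleftrightarrow> (\<forall>p\<in>X. \<exists>G. open G \<and> p \<in> G \<and>
     (\<forall>a\<in>X \<inter> G. \<forall>b\<in>X \<inter> G. \<forall>c\<in>X \<inter> G. \<kappa> a c = (\<kappa> a b \<noteq> \<kappa> b c)))"

definition cobound :: "'p::topological_space set \<Rightarrow> ('p \<Rightarrow> 'p \<Rightarrow> bool) \<Rightarrow> ('p \<Rightarrow> bool) \<Rightarrow> bool" where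
  "cobound X \<kappa> k \<longleftrightarrow> (\<forall>p\<in>X. \<exists>G. open G \<and> p \<in> G \<and>
     (\<forall>a\<in>X \<inter> G. \<forall>b\<in>X \<inter> G. \<kappa> a b = (k a \<noteq> k b)))"

lemma cocycE:
  assumes "cocyc X \<kappa>" "p \<in> X"
  obtains G where "open G" "p \<in> G"
    "\<And>a b c. a \<in> X \<Longrightarrow> a \<in> G \<Longrightarrow> b \<in> X \<Longrightarrow> b \<in> G \<Longrightarrow> c \<in> X \<Longrightarrow> c \<in> G \<Longrightarrow> \<kappa> a c = (\<kappa> a b \<noteq> \<kappa> b c)"
proof -
  obtain G where "open G" "p \<in> G" "\<forall>a\<in>X \<inter> G. \<forall>b\<in>X \<inter> G. \<forall>c\<in>X \<inter> G. \<kappa> a c = (\<kappa> a b \<noteq> \<kappa> b c)"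
    using assms unfolding cocyc_def by meson
  then show ?thesis using that[of G] by blast
qed

lemma coboundE:
  assumes "cobound X \<kappa> k" "p \<in> X"
  obtains G where "open G" "p \<in> G"
    "\<And>a b. a \<in> X \<Longrightarrow> a \<in> G \<Longrightarrow> b \<in> X \<Longrightarrow> b \<in> G \<Longrightarrow> \<kappa> a b = (k a \<noteq> k b)"
proof -
  obtain G where "open G" "p \<in> G" "\<forall>a\<in>X \<inter> G. \<forall>b\<in>X \<inter> G. \<kappa> a b = (k a \<noteq> k b)"
    using assms unfolding cobound_def by meson
  then show ?thesis using that[of G] by blast
qed

lemma coboundI:
  assumes "\<And>p. p \<in> X \<Longrightarrow> \<exists>G. open G \<and> p \<in> G \<and>
     (\<forall>a b. a \<in> X \<longrightarrow> a \<in> G \<longrightarrow> b \<in> X \<longrightarrow> b \<in> G \<longrightarrow> \<kappa> a b = (k a \<noteq> k b))"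
  shows "cobound X \<kappa> k"
  unfolding cobound_def
proof
  fix p assume "p \<in> X"
  then obtain G where "open G" "p \<in> G"
    "\<forall>a b. a \<in> X \<longrightarrow> a \<in> G \<longrightarrow> b \<in> X \<longrightarrow> b \<in> G \<longrightarrow> \<kappa> a b = (k a \<noteq> k b)"
    using assms by meson
  then show "\<exists>G. open G \<and> p \<in> G \<and> (\<forall>a\<in>X \<inter> G. \<forall>b\<in>X \<inter> G. \<kappa> a b = (k a \<noteq> k b))"
    by (intro exI[of _ G]) auto
qed

section \<open>Gluing of local primitives\<close>

lemma cobound_subset:
  assumes "cobound X \<kappa> k" "Y \<subseteq> X"
  shows "cobound Y \<kappa> k"
proof (rule coboundI)
  fix p assume "p \<in> Y"
  then have "p \<in> X" using assms(2) by blast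
  then obtain G where G: "open G" "p \<in> G"
    "\<And>a b. a \<in> X \<Longrightarrow> a \<in> G \<Longrightarrow> b \<in> X \<Longrightarrow> b \<in> G \<Longrightarrow> \<kappa> a b = (k a \<noteq> k b)"
    by (rule coboundE[OF assms(1)]) blast
  show "\<exists>G. open G \<and> p \<in> G \<and> (\<forall>a b. a \<in> Y \<longrightarrow> a \<in> G \<longrightarrow> b \<in> Y \<longrightarrow> b \<in> G \<longrightarrow> \<kappa> a b = (k a \<noteq> k b))"
    by (intro exI[of _ G] conjI allI impI G) (use assms(2) in auto)
qed

text \<open>Two primitives of the same cochain differ by a locally constant function.\<close>

lemma cobound_diff_const:
  assumes Y: "connected Y" and k: "cobound Y \<kappa> k" "cobound Y \<kappa> k'" and xy: "x \<in> Y" "y \<in> Y"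
  shows "(k x \<noteq> k' x) = (k y \<noteq> k' y)"
proof (rule connected_local_const[OF Y xy], intro ballI)
  fix p assume p: "p \<in> Y"
  obtain G where G: "open G" "p \<in> G"
    "\<And>a b. a \<in> Y \<Longrightarrow> a \<in> G \<Longrightarrow> b \<in> Y \<Longrightarrow> b \<in> G \<Longrightarrow> \<kappa> a b = (k a \<noteq> k b)"
    by (rule coboundE[OF k(1) p]) blast
  obtain G' where G': "open G'" "p \<in> G'"
    "\<And>a b. a \<in> Y \<Longrightarrow> a \<in> G' \<Longrightarrow> b \<in> Y \<Longrightarrow> b \<in> G' \<Longrightarrow> \<kappa> a b = (k' a \<noteq> k' b)"
    by (rule coboundE[OF k(2) p]) blast
  have *: "(k p \<noteq> k' p) = (k q \<noteq> k' q)" if "q \<in> Y" "q \<in> G \<inter> G'" for q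
    using G(3)[of p q] G'(3)[of p q] that p G(2) G'(2) by blast
  show "\<forall>\<^sub>F q in at p within Y. (k p \<noteq> k' p) = (k q \<noteq> k' q)"
    unfolding eventually_at_topological
  proof (intro exI[of _ "G \<inter> G'"] conjI ballI impI)
    show "open (G \<inter> G')" using G(1) G'(1) by (rule open_Int)
    show "p \<in> G \<inter> G'" using G(2) G'(2) by simp
  qed (rule *)
qed

text \<open>Mayer--Vietoris for two closed sets with connected intersection: there the primitives
  differ by a constant \<open>e\<close>, and adding \<open>e\<close> to the second one makes them
  agree.\<close>

lemma cobound_glue:
  fixes A B :: "'p::topological_space set"
  assumes c: "closed A" "closed B" and con: "connected (A \<inter> B)" and coc: "cocyc (A \<union> B) \<kappa>"
    and k: "cobound A \<kappa> k1" "cobound B \<kappa> k2"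
  shows "\<exists>k. cobound (A \<union> B) \<kappa> k"
proof -
  obtain e where e: "\<And>x. x \<in> A \<inter> B \<Longrightarrow> (k1 x \<noteq> k2 x) = e"
  proof (cases "A \<inter> B = {}")
    case True then show ?thesis using that by blast
  next
    case False
    then obtain x0 where x0: "x0 \<in> A \<inter> B" by blast
    have "(k1 x \<noteq> k2 x) = (k1 x0 \<noteq> k2 x0)" if "x \<in> A \<inter> B" for x
      by (rule cobound_diff_const[OF con _ _ that x0]) (use k cobound_subset in blast)+
    then show ?thesis using that by blast
  qed
  define k where "k x = (if x \<in> A then k1 x else (k2 x \<noteq> e))" for x
  have kA: "k x = k1 x" if "x \<in> A" for x using that by (simp add: k_def)
  have kB: "k x = (k2 x \<noteq> e)" if "x \<in> B" for x using that e[of x] by (auto simp: k_def)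
  have "cobound (A \<union> B) \<kappa> k"
  proof (rule coboundI)
    fix p assume p: "p \<in> A \<union> B"
    obtain G0 where G0: "open G0" "p \<in> G0" "\<And>a b c. a \<in> A \<union> B \<Longrightarrow> a \<in> G0 \<Longrightarrow> b \<in> A \<union> B \<Longrightarrow> b \<in> G0 \<Longrightarrow>
        c \<in> A \<union> B \<Longrightarrow> c \<in> G0 \<Longrightarrow> \<kappa> a c = (\<kappa> a b \<noteq> \<kappa> b c)"
      by (rule cocycE[OF coc p]) blast
    have HA: "\<exists>G. open G \<and> p \<in> G \<and> (p \<in> A \<longrightarrow> (\<forall>a b. a \<in> A \<longrightarrow> a \<in> G \<longrightarrow> b \<in> A \<longrightarrow> b \<in> G \<longrightarrow>
        \<kappa> a b = (k1 a \<noteq> k1 b))) \<and> (p \<notin> A \<longrightarrow> G \<inter> A = {})"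
    proof (cases "p \<in> A")
      case True
      show ?thesis by (rule coboundE[OF k(1) True]) (use True in blast)
    next
      case False
      then show ?thesis using c(1) by (intro exI[of _ "- A"]) auto
    qed
    have HB: "\<exists>G. open G \<and> p \<in> G \<and> (p \<in> B \<longrightarrow> (\<forall>a b. a \<in> B \<longrightarrow> a \<in> G \<longrightarrow> b \<in> B \<longrightarrow> b \<in> G \<longrightarrow>
        \<kappa> a b = (k2 a \<noteq> k2 b))) \<and> (p \<notin> B \<longrightarrow> G \<inter> B = {})"
    proof (cases "p \<in> B")
      case True
      show ?thesis by (rule coboundE[OF k(2) True]) (use True in blast)
    next
      case False
      then show ?thesis using c(2) by (intro exI[of _ "- B"]) auto
    qed
    obtain G1 where G1: "open G1" "p \<in> G1" "p \<in> A \<Longrightarrow> a \<in> A \<Longrightarrow> a \<in> G1 \<Longrightarrow> b \<in> A \<Longrightarrow> b \<in> G1 \<Longrightarrow>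
        \<kappa> a b = (k1 a \<noteq> k1 b)" "p \<notin> A \<Longrightarrow> G1 \<inter> A = {}" for a b using HA by blast
    obtain G2 where G2: "open G2" "p \<in> G2" "p \<in> B \<Longrightarrow> a \<in> B \<Longrightarrow> a \<in> G2 \<Longrightarrow> b \<in> B \<Longrightarrow> b \<in> G2 \<Longrightarrow>
        \<kappa> a b = (k2 a \<noteq> k2 b)" "p \<notin> B \<Longrightarrow> G2 \<inter> B = {}" for a b using HB by blast
    \<comment> \<open>A point \<open>a\<close> near \<open>p\<close> is compared with
      \<open>p\<close> itself: whichever of the closed sets contains \<open>a\<close> also contains
      \<open>p\<close>, whereas two points near \<open>p\<close> may lie in different sets.\<close>
    have *: "\<kappa> p a = (k p \<noteq> k a)" if a: "a \<in> A \<union> B" "a \<in> G1 \<inter> G2" for a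
    proof (cases "a \<in> A")
      case True
      then have "p \<in> A" using G1(4) a(2) by blast
      then show ?thesis using G1(3)[of p a] True a(2) G1(2) kA by auto
    next
      case False
      then have aB: "a \<in> B" using a(1) by blast
      then have "p \<in> B" using G2(4) a(2) by blast
      then show ?thesis using G2(3)[of p a] aB a(2) G2(2) kB by auto
    qed
    have key: "\<kappa> a b = (k a \<noteq> k b)" if "a \<in> A \<union> B" "a \<in> G0 \<inter> (G1 \<inter> G2)" "b \<in> A \<union> B" "b \<in> G0 \<inter> (G1 \<inter> G2)" for a b
      using *[of a] *[of b] that G0(3)[of p a b] p G0(2) by blast
    show "\<exists>G. open G \<and> p \<in> G \<and> (\<forall>a b. a \<in> A \<union> B \<longrightarrow> a \<in> G \<longrightarrow> b \<in> A \<union> B \<longrightarrow> b \<in> G \<longrightarrow>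
        \<kappa> a b = (k a \<noteq> k b))"
    proof (intro exI[of _ "G0 \<inter> (G1 \<inter> G2)"] conjI allI impI)
      show "open (G0 \<inter> (G1 \<inter> G2))" using G0(1) G1(1) G2(1) by (simp add: open_Int)
      show "p \<in> G0 \<inter> (G1 \<inter> G2)" using G0(2) G1(2) G2(2) by simp
    qed (rule key)
  qed
  then show ?thesis by blast
qed

lemma cocyc_subset:
  assumes "cocyc X \<kappa>" "Y \<subseteq> X"
  shows "cocyc Y \<kappa>"
  unfolding cocyc_def
proof
  fix p assume "p \<in> Y"
  then have "p \<in> X" using assms(2) by blast
  then obtain G where G: "open G" "p \<in> G" "\<And>a b c. a \<in> X \<Longrightarrow> a \<in> G \<Longrightarrow> b \<in> X \<Longrightarrow> b \<in> G \<Longrightarrow>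
      c \<in> X \<Longrightarrow> c \<in> G \<Longrightarrow> \<kappa> a c = (\<kappa> a b \<noteq> \<kappa> b c)"
    by (rule cocycE[OF assms(1)]) blast
  show "\<exists>G. open G \<and> p \<in> G \<and> (\<forall>a\<in>Y \<inter> G. \<forall>b\<in>Y \<inter> G. \<forall>c\<in>Y \<inter> G. \<kappa> a c = (\<kappa> a b \<noteq> \<kappa> b c))"
    by (intro exI[of _ G] conjI ballI G) (use assms(2) in auto)
qed

text \<open>Near \<open>p\<close> the function \<open>\<kappa> p\<close> is a primitive, by the
  cocycle condition for triples starting at \<open>p\<close>.\<close>

lemma cobound_small:
  assumes "cocyc UNIV \<kappa>"
  obtains G k where "open G" "p \<in> G" "cobound G \<kappa> k"
proof -
  obtain G where G: "open G" "p \<in> G"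
    "\<And>a b c. a \<in> G \<Longrightarrow> b \<in> G \<Longrightarrow> c \<in> G \<Longrightarrow> \<kappa> a c = (\<kappa> a b \<noteq> \<kappa> b c)"
    by (rule cocycE[OF assms UNIV_I[of p]]) blast
  have *: "\<kappa> a b = (\<kappa> p a \<noteq> \<kappa> p b)" if "a \<in> G" "b \<in> G" for a b
    using G(3)[OF G(2) that] by blast
  have "cobound G \<kappa> (\<kappa> p)"
  proof (rule coboundI)
    fix q assume q: "q \<in> G"
    show "\<exists>H. open H \<and> q \<in> H \<and> (\<forall>a b. a \<in> G \<longrightarrow> a \<in> H \<longrightarrow> b \<in> G \<longrightarrow> b \<in> H \<longrightarrow> \<kappa> a b = (\<kappa> p a \<noteq> \<kappa> p b))"
    proof (intro exI[of _ G] conjI allI impI G(1) q)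
      fix a b assume "a \<in> G" "b \<in> G"
      then show "\<kappa> a b = (\<kappa> p a \<noteq> \<kappa> p b)" by (rule *)
    qed
  qed
  then show ?thesis using that G(1,2) by blast
qed

lemma cobound_glue_sub:
  fixes A B :: "'p::topological_space set"
  assumes "cocyc UNIV \<kappa>" "closed A" "closed B" "connected (A \<inter> B)"
    "\<exists>k. cobound A \<kappa> k" "\<exists>k. cobound B \<kappa> k" "C \<subseteq> A \<union> B"
  shows "\<exists>k. cobound C \<kappa> k"
proof -
  obtain k1 k2 where k: "cobound A \<kappa> k1" "cobound B \<kappa> k2" using assms(5,6) by blast
  have "cocyc (A \<union> B) \<kappa>" using cocyc_subset[OF assms(1)] by blast
  then obtain k where "cobound (A \<union> B) \<kappa> k" using cobound_glue[OF assms(2-4) _ k] by blast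
  then show ?thesis using cobound_subset[OF _ assms(7)] by blast
qed

text \<open>Bisection is used twice: small rectangles are glued side by side to strips around a
  horizontal line, and strips of varying thickness are stacked. Consecutive pieces meet in a segment
  or a rectangle of width 0, which is connected.\<close>

lemma cobound_square:
  fixes \<kappa> :: "real \<times> real \<Rightarrow> real \<times> real \<Rightarrow> bool"
  assumes coc: "cocyc UNIV \<kappa>"
  shows "\<exists>k. cobound ({0..1} \<times> {0..1}) \<kappa> k"
proof -
  have strip: "\<exists>\<delta>>0. \<exists>k. cobound ({0..1} \<times> {y-\<delta>..y+\<delta>}) \<kappa> k" for y :: real
  proof (rule Bolzano[of 0 1 "\<lambda>a b. \<exists>\<delta>>0. \<exists>k. cobound ({a..b} \<times> {y-\<delta>..y+\<delta>}) \<kappa> k"])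
    fix a b c :: real
    assume ab: "\<exists>\<delta>>0. \<exists>k. cobound ({a..b} \<times> {y-\<delta>..y+\<delta>}) \<kappa> k"
      and bc: "\<exists>\<delta>>0. \<exists>k. cobound ({b..c} \<times> {y-\<delta>..y+\<delta>}) \<kappa> k" and le: "a \<le> b" "b \<le> c"
    obtain d1 k1 where 1: "d1 > 0" "cobound ({a..b} \<times> {y-d1..y+d1}) \<kappa> k1" using ab by blast
    obtain d2 k2 where 2: "d2 > 0" "cobound ({b..c} \<times> {y-d2..y+d2}) \<kappa> k2" using bc by blast
    define d where "d = min d1 d2"
    have d: "d > 0" "d \<le> d1" "d \<le> d2" using 1 2 by (auto simp: d_def)
    have "\<exists>k. cobound ({a..c} \<times> {y-d..y+d}) \<kappa> k"
    proof (rule cobound_glue_sub[OF coc, of "{a..b} \<times> {y-d..y+d}" "{b..c} \<times> {y-d..y+d}"])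
      show "closed ({a..b} \<times> {y-d..y+d})" "closed ({b..c} \<times> {y-d..y+d})"
        by (intro closed_Times closed_atLeastAtMost)+
      have "({a..b} \<times> {y-d..y+d}) \<inter> ({b..c} \<times> {y-d..y+d}) = {b..b} \<times> {y-d..y+d}"
        using le by auto
      then show "connected (({a..b} \<times> {y-d..y+d}) \<inter> ({b..c} \<times> {y-d..y+d}))"
        using connected_Times[OF connected_Icc connected_Icc, of b b "y-d" "y+d"] by simp
      show "\<exists>k. cobound ({a..b} \<times> {y-d..y+d}) \<kappa> k"
        by (rule exI, rule cobound_subset[OF 1(2)], use d in auto)
      show "\<exists>k. cobound ({b..c} \<times> {y-d..y+d}) \<kappa> k"
        by (rule exI, rule cobound_subset[OF 2(2)], use d in auto)
      show "{a..c} \<times> {y-d..y+d} \<subseteq> {a..b} \<times> {y-d..y+d} \<union> {b..c} \<times> {y-d..y+d}" by auto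
    qed
    then show "\<exists>\<delta>>0. \<exists>k. cobound ({a..c} \<times> {y-\<delta>..y+\<delta>}) \<kappa> k" using d(1) by blast
  next
    fix x :: real
    obtain G k where G: "open G" "(x,y) \<in> G" "cobound G \<kappa> k" by (rule cobound_small[OF coc])
    obtain U V where UV: "open U" "open V" "x \<in> U" "y \<in> V" "U \<times> V \<subseteq> G"
      using open_prod_elim[OF G(1,2)] by (metis mem_Sigma_iff)
    obtain e where e: "e > 0" "cball x e \<subseteq> U" using UV(1,3) open_contains_cball by blast
    obtain f where f: "f > 0" "cball y f \<subseteq> V" using UV(2,4) open_contains_cball by blast
    have key: "\<exists>k. cobound ({a..b} \<times> {y-f..y+f}) \<kappa> k" if "a \<le> x" "x \<le> b" "b - a < e" for a b
    proof -
      have "{a..b} \<subseteq> cball x e" using that by (auto simp: dist_real_def)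
      moreover have "{y-f..y+f} \<subseteq> cball y f" by (auto simp: dist_real_def)
      ultimately have "{a..b} \<times> {y-f..y+f} \<subseteq> G" using e f UV(5) by blast
      then show ?thesis using cobound_subset[OF G(3)] by blast
    qed
    show "\<exists>d>0. \<forall>a b. a \<le> x \<and> x \<le> b \<and> b - a < d \<longrightarrow>
        (\<exists>\<delta>>0. \<exists>k. cobound ({a..b} \<times> {y-\<delta>..y+\<delta>}) \<kappa> k)"
    proof (rule exI[of _ e], rule conjI[OF e(1)], intro allI impI)
      fix a b assume "a \<le> x \<and> x \<le> b \<and> b - a < e"
      then show "\<exists>\<delta>>0. \<exists>k. cobound ({a..b} \<times> {y-\<delta>..y+\<delta>}) \<kappa> k"
        by (intro exI[of _ f] conjI[OF f(1)] key) auto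
    qed
  qed simp
  show ?thesis
  proof (rule Bolzano[of 0 1 "\<lambda>a b. \<exists>k. cobound ({0..1} \<times> {a..b}) \<kappa> k"])
    fix a b c :: real
    assume ab: "\<exists>k. cobound ({0..1} \<times> {a..b}) \<kappa> k" "\<exists>k. cobound ({0..1} \<times> {b..c}) \<kappa> k"
      and le: "a \<le> b" "b \<le> c"
    show "\<exists>k. cobound ({0..1} \<times> {a..c}) \<kappa> k"
    proof (rule cobound_glue_sub[OF coc, of "{0..1} \<times> {a..b}" "{0..1} \<times> {b..c}"])
      show "closed ({0..1::real} \<times> {a..b})" "closed ({0..1::real} \<times> {b..c})"
        by (intro closed_Times closed_atLeastAtMost)+
      have "({0..1::real} \<times> {a..b}) \<inter> ({0..1} \<times> {b..c}) = {0..1} \<times> {b..b}"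
        using le by auto
      then show "connected (({0..1::real} \<times> {a..b}) \<inter> ({0..1} \<times> {b..c}))"
        using connected_Times[OF connected_Icc connected_Icc, of "0::real" 1 b b] by simp
      show "{0..1::real} \<times> {a..c} \<subseteq> {0..1} \<times> {a..b} \<union> {0..1} \<times> {b..c}" by auto
    qed (rule ab)+
  next
    fix y :: real
    obtain d k where d: "d > 0" "cobound ({0..1} \<times> {y-d..y+d}) \<kappa> k" using strip[of y] by blast
    have key: "\<exists>k. cobound ({0..1} \<times> {a..b}) \<kappa> k" if "a \<le> y" "y \<le> b" "b - a < d" for a b
      by (rule exI, rule cobound_subset[OF d(2)], use that in auto)
    show "\<exists>d>0. \<forall>a b. a \<le> y \<and> y \<le> b \<and> b - a < d \<longrightarrow> (\<exists>k. cobound ({0..1} \<times> {a..b}) \<kappa> k)"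
      by (rule exI[of _ d], rule conjI[OF d(1)], intro allI impI key) auto
  qed simp
qed

lemma cocyc_pullback:
  assumes "cocyc X \<kappa>" "continuous_on Y f" "f ` Y \<subseteq> X"
  shows "cocyc Y (\<lambda>a b. \<kappa> (f a) (f b))"
  unfolding cocyc_def
proof
  fix p assume p: "p \<in> Y"
  then have "f p \<in> X" using assms(3) by blast
  then obtain G where G: "open G" "f p \<in> G" "\<And>a b c. a \<in> X \<Longrightarrow> a \<in> G \<Longrightarrow> b \<in> X \<Longrightarrow> b \<in> G \<Longrightarrow>
      c \<in> X \<Longrightarrow> c \<in> G \<Longrightarrow> \<kappa> a c = (\<kappa> a b \<noteq> \<kappa> b c)"
    by (rule cocycE[OF assms(1)]) blast
  obtain H where H: "open H" "H \<inter> Y = f -` G \<inter> Y"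
    using assms(2) G(1) unfolding continuous_on_open_invariant by blast
  have m: "f a \<in> X \<and> f a \<in> G" if "a \<in> Y \<inter> H" for a
    using that H(2) assms(3) by blast
  have "p \<in> H" using H(2) p G(2) by blast
  then show "\<exists>G. open G \<and> p \<in> G \<and> (\<forall>a\<in>Y \<inter> G. \<forall>b\<in>Y \<inter> G. \<forall>c\<in>Y \<inter> G.
      \<kappa> (f a) (f c) = (\<kappa> (f a) (f b) \<noteq> \<kappa> (f b) (f c)))"
    by (intro exI[of _ H] conjI H(1) ballI allI impI G(3); (use m in blast)?)
qed

lemma cobound_pullback:
  assumes "cobound X \<kappa> k" "continuous_on Y f" "f ` Y \<subseteq> X"
  shows "cobound Y (\<lambda>a b. \<kappa> (f a) (f b)) (\<lambda>a. k (f a))"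
proof (rule coboundI)
  fix p assume p: "p \<in> Y"
  then have "f p \<in> X" using assms(3) by blast
  then obtain G where G: "open G" "f p \<in> G" "\<And>a b. a \<in> X \<Longrightarrow> a \<in> G \<Longrightarrow> b \<in> X \<Longrightarrow> b \<in> G \<Longrightarrow>
      \<kappa> a b = (k a \<noteq> k b)"
    by (rule coboundE[OF assms(1)]) blast
  obtain H where H: "open H" "H \<inter> Y = f -` G \<inter> Y"
    using assms(2) G(1) unfolding continuous_on_open_invariant by blast
  have m: "f a \<in> X \<and> f a \<in> G" if "a \<in> Y" "a \<in> H" for a
    using that H(2) assms(3) by blast
  have "p \<in> H" using H(2) p G(2) by blast
  then show "\<exists>G. open G \<and> p \<in> G \<and> (\<forall>a b. a \<in> Y \<longrightarrow> a \<in> G \<longrightarrow> b \<in> Y \<longrightarrow> b \<in> G \<longrightarrow>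
      \<kappa> (f a) (f b) = (k (f a) \<noteq> k (f b)))"
    by (intro exI[of _ H] conjI H(1) ballI allI impI G(3); (use m in blast)?)
qed

lemma closed_simplex: "closed (realization {t})" for t :: "'v set"
proof -
  have 1: "closed {x::'v \<Rightarrow> real. \<forall>p. 0 \<le> x p}"
    by (intro closed_Collect_all closed_Collect_le continuous_intros continuous_on_product_coordinates)
  have 2: "closed {x::'v \<Rightarrow> real. \<forall>p. p \<notin> t \<longrightarrow> x p = 0}"
    by (intro closed_Collect_all closed_Collect_imp open_Collect_const closed_Collect_eq
        continuous_intros continuous_on_product_coordinates)
  have 3: "closed {x::'v \<Rightarrow> real. (\<Sum>p\<in>t. x p) = 1}"
    by (intro closed_Collect_eq continuous_on_sum continuous_intros continuous_on_product_coordinates)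
  have "realization {t} = {x. \<forall>p. 0 \<le> x p} \<inter> {x. \<forall>p. p \<notin> t \<longrightarrow> x p = 0} \<inter> {x. (\<Sum>p\<in>t. x p) = 1}"
    by (auto simp: realization_def)
  also have "closed \<dots>" by (rule closed_Int[OF closed_Int[OF 1 2] 3])
  finally show ?thesis .
qed

lemma connected_simplex_Int: "connected (realization {t} \<inter> realization {u})"
  unfolding connected_iff_connected_component
  unfolding connected_component_def
proof (intro ballI)
  fix x y assume xy: "x \<in> realization {t} \<inter> realization {u}" "y \<in> realization {t} \<inter> realization {u}"
  have "connected (seg x y ` {0..1})"
    by (rule connected_continuous_image[OF continuous_seg connected_Icc])
  moreover have "seg x y ` {0..1} \<subseteq> realization {t} \<inter> realization {u}"
    using xy seg_realization[of x t y] seg_realization[of x u y] by auto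
  moreover have "x \<in> seg x y ` {0..1}" by (rule image_eqI[of _ _ 0]) (simp_all add: seg_0)
  moreover have "y \<in> seg x y ` {0..1}" by (rule image_eqI[of _ _ 1]) (simp_all add: seg_1)
  ultimately show "\<exists>c. connected c \<and> c \<subseteq> realization {t} \<inter> realization {u} \<and> x \<in> c \<and> y \<in> c"
    by (intro exI conjI)
qed

text \<open>
  A triangle is a retract of the square.
\<close>

lemma cobound_face:
  assumes d: "distinct [a,b,c]" and coc: "cocyc X \<kappa>" and sub: "realization {{a,b,c}} \<subseteq> X"
  shows "\<exists>k. cobound (realization {{a,b,c}}) \<kappa> k"
proof -
  \<comment> \<open>Retraction of the plane onto the triangle: negative coordinates are replaced by
    0, and if their sum then exceeds 1, both are divided by it.\<close>
  define m where "m q = max 1 (max 0 (fst q) + max 0 (snd q))" for q :: "real \<times> real"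
  define R where "R q = (\<lambda>p. if p = a then max 0 (fst q) / m q else if p = b then max 0 (snd q) / m q
     else if p = c then 1 - (max 0 (fst q) + max 0 (snd q)) / m q else 0)" for q :: "real \<times> real"
  have m1: "1 \<le> m q" for q by (simp add: m_def)
  have mc: "continuous_on S m" for S unfolding m_def by (intro continuous_intros)
  have m0: "m q \<noteq> 0" for q using m1[of q] by simp
  have "continuous_on UNIV R"
  proof (rule continuous_on_coordinatewise_then_product)
    fix i show "continuous_on UNIV (\<lambda>q. R q i)"
      unfolding R_def using mc m0
      by (cases "i = a"; cases "i = b"; cases "i = c"; simp; intro continuous_intros) auto
  qed
  moreover have RX: "R q \<in> realization {{a,b,c}}" for q
  proof (rule realizationI)
    have "max 0 (fst q) + max 0 (snd q) \<le> m q" by (simp add: m_def)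
    then have "(max 0 (fst q) + max 0 (snd q)) / m q \<le> 1" using m1[of q] by (simp add: field_simps)
    then show "0 \<le> R q p" for p using m1[of q] unfolding R_def by simp
    show "(\<Sum>p\<in>{a,b,c}. R q p) = 1" using d by (auto simp: R_def add_divide_distrib)
  qed (auto simp: R_def)
  moreover have "range R \<subseteq> X" using RX sub by blast
  ultimately have "cocyc UNIV (\<lambda>p q. \<kappa> (R p) (R q))" using cocyc_pullback[OF coc] by blast
  then obtain k where k: "cobound ({0..1} \<times> {0..1}) (\<lambda>p q. \<kappa> (R p) (R q)) k"
    using cobound_square by blast
  let ?i = "\<lambda>x::'a \<Rightarrow> real. (x a, x b)"
  have x: "0 \<le> x a" "0 \<le> x b" "0 \<le> x c" "x a + x b + x c = 1" "\<And>p. p \<notin> {a,b,c} \<Longrightarrow> x p = 0"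
    if "x \<in> realization {{a,b,c}}" for x using that d by (auto simp: realization_def)
  have i: "?i ` realization {{a,b,c}} \<subseteq> {0..1} \<times> {0..1}"
  proof
    fix q assume "q \<in> ?i ` realization {{a,b,c}}"
    then obtain y where "y \<in> realization {{a,b,c}}" "q = ?i y" by blast
    then show "q \<in> {0..1} \<times> {0..1}" using x[of y] by auto
  qed
  have "continuous_on (realization {{a,b,c}}) ?i"
    by (intro continuous_on_Pair continuous_on_subset[OF continuous_on_product_coordinates subset_UNIV])
  from cobound_pullback[OF k this i]
  have 1: "cobound (realization {{a,b,c}}) (\<lambda>p q. \<kappa> (R (?i p)) (R (?i q))) (\<lambda>p. k (?i p))" .
  have Ri: "R (?i y) = y" if y: "y \<in> realization {{a,b,c}}" for y
  proof -
    have "m (?i y) = 1" using x[OF y] by (simp add: m_def)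
    then show ?thesis using x[OF y] by (auto simp: R_def fun_eq_iff)
  qed
  have "cobound (realization {{a,b,c}}) \<kappa> (\<lambda>p. k (?i p))"
  proof (rule coboundI)
    fix p assume "p \<in> realization {{a,b,c}}"
    then obtain G where G: "open G" "p \<in> G" "\<And>a' b'. a' \<in> realization {{a,b,c}} \<Longrightarrow> a' \<in> G \<Longrightarrow>
       b' \<in> realization {{a,b,c}} \<Longrightarrow> b' \<in> G \<Longrightarrow> \<kappa> (R (?i a')) (R (?i b')) = (k (?i a') \<noteq> k (?i b'))"
      by (rule coboundE[OF 1]) blast
    show "\<exists>G. open G \<and> p \<in> G \<and> (\<forall>a' b'. a' \<in> realization {{a,b,c}} \<longrightarrow> a' \<in> G \<longrightarrow>
       b' \<in> realization {{a,b,c}} \<longrightarrow> b' \<in> G \<longrightarrow> \<kappa> a' b' = (k (?i a') \<noteq> k (?i b')))"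
    proof (intro exI[of _ G] conjI allI impI G(1,2))
      fix a' b' assume "a' \<in> realization {{a,b,c}}" "a' \<in> G" "b' \<in> realization {{a,b,c}}" "b' \<in> G"
      then show "\<kappa> a' b' = (k (?i a') \<noteq> k (?i b'))" using G(3)[of a' b'] Ri[of a'] Ri[of b'] by simp
    qed
  qed
  then show ?thesis by blast
qed

text \<open>A 1-cochain modulo 2 is the set of edges with value 1. The condition ranges over all
  triples of vertices of a face, repetitions included; those cases hold because a singleton is never
  an edge.\<close>

definition cocycles :: "'v set set \<Rightarrow> 'v set set set" where
  "cocycles T = {c. c \<subseteq> edges T \<and>
     (\<forall>t\<in>T. \<forall>x\<in>t. \<forall>y\<in>t. \<forall>z\<in>t. ({x,z} \<in> c) = (({x,y} \<in> c) \<noteq> ({y,z} \<in> c)))}"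

definition coboundaries :: "'v set set \<Rightarrow> 'v set set set" where
  "coboundaries T = {c. c \<subseteq> edges T \<and> (\<exists>A. \<forall>a b. {a,b} \<in> edges T \<longrightarrow> ({a,b} \<in> c) = ((a \<in> A) \<noteq> (b \<in> A)))}"

text \<open>Addition of cochains modulo 2.\<close>

definition symdiff :: "'a set \<Rightarrow> 'a set \<Rightarrow> 'a set" where
  "symdiff A B = (A - B) \<union> (B - A)"

lemma symdiff_iff: "x \<in> symdiff A B \<longleftrightarrow> (x \<in> A) \<noteq> (x \<in> B)"
  by (auto simp: symdiff_def)

lemma cocyclesD:
  assumes c: "c \<in> cocycles T" and t: "t \<in> T" and x: "x \<in> t" and y: "y \<in> t" and z: "z \<in> t"
  shows "({x,z} \<in> c) = (({x,y} \<in> c) \<noteq> ({y,z} \<in> c))"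
  by (rule bspec[OF bspec[OF bspec[OF bspec[OF conjunct2[OF CollectD[OF c[unfolded cocycles_def]]] t] x] y] z])

lemma xor_add:
  fixes A A' B B' C C' :: bool
  shows "A = (B \<noteq> C) \<Longrightarrow> A' = (B' \<noteq> C') \<Longrightarrow> (A \<noteq> A') = ((B \<noteq> B') \<noteq> (C \<noteq> C'))"
  by auto

lemma cocycles_symdiff:
  assumes "c \<in> cocycles T" "d \<in> cocycles T"
  shows "symdiff c d \<in> cocycles T"
proof -
  have "({x,z} \<in> symdiff c d) = (({x,y} \<in> symdiff c d) \<noteq> ({y,z} \<in> symdiff c d))"
    if "t \<in> T" "x \<in> t" "y \<in> t" "z \<in> t" for t x y z
    unfolding symdiff_iff by (rule xor_add[OF cocyclesD[OF assms(1) that] cocyclesD[OF assms(2) that]])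
  moreover have "symdiff c d \<subseteq> edges T" using assms by (auto simp: cocycles_def symdiff_def)
  ultimately show ?thesis unfolding cocycles_def by (intro CollectI conjI ballI)
qed

section \<open>Simplicial and Alexander--Spanier cocycles\<close>

context triangle_complex
begin

text \<open>
  A point of the realization has some barycentric coordinate at least 1/3, and the vertices chosen
  for nearby points lie in a common face.  Evaluating a simplicial cocycle at these vertices turns
  it into an Alexander--Spanier cocycle.
\<close>

definition near :: "('v \<Rightarrow> real) \<Rightarrow> 'v" where
  "near p = (SOME v. 1/3 \<le> p v)"

definition spread :: "'v set set \<Rightarrow> ('v \<Rightarrow> real) \<Rightarrow> ('v \<Rightarrow> real) \<Rightarrow> bool" where
  "spread c p q \<longleftrightarrow> {near p, near q} \<in> c"

lemma near:
  assumes "p \<in> realization T"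
  shows "1/3 \<le> p (near p)"
proof -
  obtain t where t: "t \<in> T" "(\<Sum>v\<in>t. p v) = 1" using realizationE[OF assms] by metis
  have "\<exists>v. 1/3 \<le> p v"
  proof (rule ccontr)
    assume "\<nexists>v. 1/3 \<le> p v"
    then have "(\<Sum>v\<in>t. p v) < (\<Sum>v\<in>t. 1/3)"
      using c3[OF t(1)] finite_card3[OF c3[OF t(1)]] by (intro sum_strict_mono) (auto simp: not_le)
    then show False using t c3[OF t(1)] by simp
  qed
  then show ?thesis unfolding near_def by (rule someI_ex)
qed

lemma near_local:
  assumes p: "p \<in> realization T"
  obtains G t where "open G" "p \<in> G" "t \<in> T" "\<And>q. q \<in> realization T \<Longrightarrow> q \<in> G \<Longrightarrow> near q \<in> t"
proof -
  obtain t where t: "t \<in> T" "\<And>v. v \<notin> t \<Longrightarrow> p v = 0" using realizationE[OF p] by metis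
  define G where "G = {q::'v \<Rightarrow> real. \<forall>v\<in>verts T - t. q v < 1/3}"
  have fv: "finite (verts T - t)" using fin finite_card3[OF c3] by (auto simp: verts_def)
  have "G = (\<Inter>v\<in>verts T - t. {q. q v < 1/3})" by (auto simp: G_def)
  moreover have "open (\<Inter>v\<in>verts T - t. {q::'v \<Rightarrow> real. q v < 1/3})"
    using fv by (intro open_INT ballI open_Collect_less continuous_intros continuous_on_product_coordinates)
  ultimately have "open G" by simp
  moreover have "p \<in> G" using t(2) by (auto simp: G_def)
  moreover have "near q \<in> t" if q: "q \<in> realization T" "q \<in> G" for q
  proof (rule ccontr)
    assume n: "near q \<notin> t"
    have q3: "1/3 \<le> q (near q)" by (rule near[OF q(1)])
    obtain u where u: "u \<in> T" "\<And>v. v \<notin> u \<Longrightarrow> q v = 0" using realizationE[OF q(1)] by metis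
    have "near q \<in> u" using u(2)[of "near q"] q3 by auto
    then have "near q \<in> verts T - t" using u(1) n by (auto simp: verts_def)
    then show False using q(2) q3 by (auto simp: G_def not_less[symmetric])
  qed
  ultimately show ?thesis using that t(1) by blast
qed

lemma spread_cocyc:
  assumes c: "c \<in> cocycles T"
  shows "cocyc (realization T) (spread c)"
  unfolding cocyc_def
proof
  fix p assume "p \<in> realization T"
  then obtain G t where G: "open G" "p \<in> G" "t \<in> T" "\<And>q. q \<in> realization T \<Longrightarrow> q \<in> G \<Longrightarrow> near q \<in> t"
    by (rule near_local) blast
  show "\<exists>G. open G \<and> p \<in> G \<and> (\<forall>a\<in>realization T \<inter> G. \<forall>b\<in>realization T \<inter> G. \<forall>d\<in>realization T \<inter> G.
      spread c a d = (spread c a b \<noteq> spread c b d))"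
    unfolding spread_def
    by (intro exI[of _ G] conjI ballI G(1,2) cocyclesD[OF c G(3)] G(4)) auto
qed

text \<open>On an edge \<open>ab\<close> the cochain has two primitives: the given \<open>k\<close>,
  and the function sending \<open>q\<close> to the value of \<open>c\<close> on the edge from
  \<open>a\<close> to \<open>near q\<close>. They differ by a constant, so the values of
  \<open>k\<close> at the vertices reproduce \<open>c\<close> on \<open>ab\<close>.\<close>

lemma spread_cobound:
  assumes c: "c \<in> cocycles T" and k: "cobound (realization T) (spread c) k"
  shows "c \<in> coboundaries T"
proof -
  have "({a,b} \<in> c) = ((a \<in> {a. k (vpt a)}) \<noteq> (b \<in> {a. k (vpt a)}))" if e: "{a,b} \<in> edges T" for a b
  proof -
    obtain z where z: "{a,b,z} \<in> T" "a \<noteq> b" by (rule edge_faces[OF e]) blast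
    let ?Y = "realization {{a,b}} \<inter> realization {{a,b}}"
    have YT: "?Y \<subseteq> realization T"
    proof
      fix x assume x: "x \<in> ?Y"
      then have x0: "x p = 0" if "p \<notin> {a,b}" for p using that by (auto simp: realization_def)
      have s: "x a + x b = 1" using x z(2) by (auto simp: realization_def)
      have zz: "z \<noteq> a" "z \<noteq> b" using face_distinct[OF z(1)] by auto
      show "x \<in> realization T"
      proof (rule realizationI[OF z(1)])
        show "x p = 0" if "p \<notin> {a,b,z}" for p using x0 that by simp
        show "0 \<le> x p" for p using x by (simp add: realization_def)
        show "(\<Sum>p\<in>{a,b,z}. x p) = 1" using s z(2) zz x0[of z] by (simp add: insert_absorb)
      qed
    qed
    have ny: "near x \<in> {a,b,z}" "near x \<in> {a,b}" if x: "x \<in> ?Y" for x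
    proof -
      have "1/3 \<le> x (near x)" using near YT x by blast
      moreover have "x p = 0" if "p \<notin> {a,b}" for p using x that by (auto simp: realization_def)
      ultimately show "near x \<in> {a,b}" by force
      then show "near x \<in> {a,b,z}" by blast
    qed
    have k1: "cobound ?Y (spread c) k" by (rule cobound_subset[OF k YT])
    have k2: "cobound ?Y (spread c) (\<lambda>q. {a, near q} \<in> c)"
    proof (rule coboundI)
      fix p
      have *: "spread c q r = (({a, near q} \<in> c) \<noteq> ({a, near r} \<in> c))" if "q \<in> ?Y" "r \<in> ?Y" for q r
      proof -
        have "({a, near r} \<in> c) = (({a, near q} \<in> c) \<noteq> ({near q, near r} \<in> c))"
          by (rule cocyclesD[OF c z(1)]) (use ny that in blast)+
        then show ?thesis unfolding spread_def by blast
      qed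
      show "\<exists>G. open G \<and> p \<in> G \<and> (\<forall>q r. q \<in> ?Y \<longrightarrow> q \<in> G \<longrightarrow> r \<in> ?Y \<longrightarrow> r \<in> G \<longrightarrow>
          spread c q r = (({a, near q} \<in> c) \<noteq> ({a, near r} \<in> c)))"
        by (intro exI[of _ UNIV] conjI open_UNIV UNIV_I allI impI *)
    qed
    have v: "vpt a \<in> ?Y" "vpt b \<in> ?Y" using vpt_realization[of "{a,b}"] by auto
    have nv: "near (vpt p) = p" if "p \<in> {a,b}" for p
    proof -
      have "vpt p \<in> realization T" using v YT that by blast
      then have "1/3 \<le> vpt p (near (vpt p))" by (rule near)
      then show ?thesis by (simp add: vpt_def split: if_splits)
    qed
    have "{a} \<notin> c" using c by (auto simp: cocycles_def edges_def)
    then show ?thesis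
      using cobound_diff_const[OF connected_simplex_Int k1 k2 v] nv[of a] nv[of b] by auto
  qed
  then show ?thesis using c unfolding coboundaries_def cocycles_def by blast
qed

text \<open>After adding a constant on each face, the local primitives take at every vertex the
  value prescribed by \<open>A\<close>. On the intersection of two faces they differ by a constant,
  which is 0 because intersecting faces share a vertex.\<close>

lemma cobound_patch:
  assumes coc: "cocyc (realization T) \<kappa>" and K: "\<And>t. t \<in> T \<Longrightarrow> cobound (realization {t}) \<kappa> (K t)"
    and A: "\<And>t a b. t \<in> T \<Longrightarrow> a \<in> t \<Longrightarrow> b \<in> t \<Longrightarrow> (K t (vpt a) \<noteq> K t (vpt b)) = ((a \<in> A) \<noteq> (b \<in> A))"
  shows "\<exists>k. cobound (realization T) \<kappa> k"
proof -
  \<comment> \<open>By the assumption on \<open>A\<close> the inner condition is the same for all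
    vertices \<open>a\<close> of \<open>t\<close>, so the existential is the correcting
    constant.\<close>
  define L where "L t x \<longleftrightarrow> (K t x \<noteq> (\<exists>a\<in>t. K t (vpt a) \<noteq> (a \<in> A)))" for t x
  have L: "cobound (realization {t}) \<kappa> (L t)" if t: "t \<in> T" for t
  proof (rule coboundI)
    fix p assume "p \<in> realization {t}"
    then obtain G where G: "open G" "p \<in> G" "\<And>a b. a \<in> realization {t} \<Longrightarrow> a \<in> G \<Longrightarrow> b \<in> realization {t} \<Longrightarrow>
        b \<in> G \<Longrightarrow> \<kappa> a b = (K t a \<noteq> K t b)"
      by (rule coboundE[OF K[OF t]]) blast
    have *: "(K t a \<noteq> K t b) = (L t a \<noteq> L t b)" for a b by (auto simp: L_def)
    show "\<exists>G. open G \<and> p \<in> G \<and> (\<forall>a b. a \<in> realization {t} \<longrightarrow> a \<in> G \<longrightarrow> b \<in> realization {t} \<longrightarrow>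
        b \<in> G \<longrightarrow> \<kappa> a b = (L t a \<noteq> L t b))"
      using G unfolding * by (intro exI[of _ G] conjI allI impI G(1,2)) 
  qed
  have Lv: "L t (vpt a) = (a \<in> A)" if "t \<in> T" "a \<in> t" for t a
    using A[OF that(1) that(2)] that(2) unfolding L_def by blast
  have agree: "L t x = L u x" if t: "t \<in> T" "u \<in> T" and x: "x \<in> realization {t}" "x \<in> realization {u}" for t u x
  proof -
    have "\<exists>a\<in>t. 0 < x a"
    proof (rule ccontr)
      assume h: "\<not> (\<exists>a\<in>t. 0 < x a)"
      have "(\<Sum>p\<in>t. x p) \<le> 0" by (rule sum_nonpos) (use h in \<open>auto simp: not_less\<close>)
      then show False using x(1) by (simp add: realization_def)
    qed
    then obtain a where a: "a \<in> t" "0 < x a" by blast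
    have au: "a \<in> u"
    proof (rule ccontr)
      assume "a \<notin> u"
      then have "x a = 0" using x(2) by (simp add: realization_def)
      then show False using a(2) by simp
    qed
    have v: "vpt a \<in> realization {t} \<inter> realization {u}"
      using vpt_realization[OF finite_card3[OF c3[OF t(1)]] a(1)]
        vpt_realization[OF finite_card3[OF c3[OF t(2)]] au] by blast
    have "(L t x \<noteq> L u x) = (L t (vpt a) \<noteq> L u (vpt a))"
    proof (rule cobound_diff_const[OF connected_simplex_Int])
      show "cobound (realization {t} \<inter> realization {u}) \<kappa> (L t)" by (rule cobound_subset[OF L[OF t(1)]]) blast
      show "cobound (realization {t} \<inter> realization {u}) \<kappa> (L u)" by (rule cobound_subset[OF L[OF t(2)]]) blast
    qed (use x v in blast)+
    then show ?thesis using Lv[OF t(1) a(1)] Lv[OF t(2) au] by simp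
  qed
  define k where "k x = L (SOME t. t \<in> T \<and> x \<in> realization {t}) x" for x
  have kL: "k x = L t x" if t: "t \<in> T" "x \<in> realization {t}" for t x
  proof -
    have "(SOME t. t \<in> T \<and> x \<in> realization {t}) \<in> T \<and> x \<in> realization {SOME t. t \<in> T \<and> x \<in> realization {t}}"
      by (rule someI[of _ t]) (use t in blast)
    then show ?thesis unfolding k_def using agree t by blast
  qed
  have "cobound (realization T) \<kappa> k"
  proof (rule coboundI)
    fix p assume p: "p \<in> realization T"
    obtain G0 where G0: "open G0" "p \<in> G0" "\<And>a b c. a \<in> realization T \<Longrightarrow> a \<in> G0 \<Longrightarrow> b \<in> realization T \<Longrightarrow>
        b \<in> G0 \<Longrightarrow> c \<in> realization T \<Longrightarrow> c \<in> G0 \<Longrightarrow> \<kappa> a c = (\<kappa> a b \<noteq> \<kappa> b c)"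
      by (rule cocycE[OF coc p]) blast
    have "\<exists>G. open G \<and> p \<in> G \<and> (p \<in> realization {t} \<longrightarrow> (\<forall>a b. a \<in> realization {t} \<longrightarrow> a \<in> G \<longrightarrow>
        b \<in> realization {t} \<longrightarrow> b \<in> G \<longrightarrow> \<kappa> a b = (L t a \<noteq> L t b))) \<and>
        (p \<notin> realization {t} \<longrightarrow> G \<inter> realization {t} = {})" if t: "t \<in> T" for t
    proof (cases "p \<in> realization {t}")
      case True
      show ?thesis by (rule coboundE[OF L[OF t] True]) (use True in blast)
    next
      case False
      then show ?thesis using closed_simplex[of t] by (intro exI[of _ "- realization {t}"]) auto
    qed
    then obtain G where G: "\<And>t. t \<in> T \<Longrightarrow> open (G t) \<and> p \<in> G t \<and> (p \<in> realization {t} \<longrightarrow>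
        (\<forall>a b. a \<in> realization {t} \<longrightarrow> a \<in> G t \<longrightarrow>
        b \<in> realization {t} \<longrightarrow> b \<in> G t \<longrightarrow> \<kappa> a b = (L t a \<noteq> L t b))) \<and>
        (p \<notin> realization {t} \<longrightarrow> G t \<inter> realization {t} = {})" by metis
    define H where "H = G0 \<inter> (\<Inter>t\<in>T. G t)"
    have oH: "open H" unfolding H_def using fin G G0(1) by (intro open_Int open_INT) auto
    have pH: "p \<in> H" unfolding H_def using G G0(2) by blast
    have *: "\<kappa> p a = (k p \<noteq> k a)" if a: "a \<in> realization T" "a \<in> H" for a
    proof -
      obtain t where t: "t \<in> T" "a \<in> realization {t}" using a(1) by (auto simp: realization_def)
      have aG: "a \<in> G t" using a(2) t(1) by (auto simp: H_def)
      then have pt: "p \<in> realization {t}" using G[OF t(1)] t(2) by blast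
      have "\<kappa> p a = (L t p \<noteq> L t a)" using G[OF t(1)] pt t(2) aG by blast
      then show ?thesis using kL[OF t(1) pt] kL[OF t] by simp
    qed
    show "\<exists>G. open G \<and> p \<in> G \<and> (\<forall>a b. a \<in> realization T \<longrightarrow> a \<in> G \<longrightarrow> b \<in> realization T \<longrightarrow> b \<in> G \<longrightarrow>
        \<kappa> a b = (k a \<noteq> k b))"
    proof (intro exI[of _ H] conjI allI impI oH pH)
      fix a b assume ab: "a \<in> realization T" "a \<in> H" "b \<in> realization T" "b \<in> H"
      have "a \<in> G0" "b \<in> G0" using ab by (auto simp: H_def)
      then have "\<kappa> p b = (\<kappa> p a \<noteq> \<kappa> a b)" using G0(3)[OF p G0(2)] ab by blast
      then show "\<kappa> a b = (k a \<noteq> k b)" using *[OF ab(1,2)] *[OF ab(3,4)] by blast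
    qed
  qed
  then show ?thesis by blast
qed

end

lemma cobound_xor:
  assumes "cobound X \<kappa>1 k1" "cobound X \<kappa>2 k2"
    and e: "\<And>a b. a \<in> X \<Longrightarrow> b \<in> X \<Longrightarrow> \<kappa> a b = (\<kappa>1 a b \<noteq> \<kappa>2 a b)"
  shows "cobound X \<kappa> (\<lambda>a. k1 a \<noteq> k2 a)"
proof (rule coboundI)
  fix p assume p: "p \<in> X"
  obtain G1 where G1: "open G1" "p \<in> G1" "\<And>a b. a \<in> X \<Longrightarrow> a \<in> G1 \<Longrightarrow> b \<in> X \<Longrightarrow> b \<in> G1 \<Longrightarrow> \<kappa>1 a b = (k1 a \<noteq> k1 b)"
    by (rule coboundE[OF assms(1) p]) blast
  obtain G2 where G2: "open G2" "p \<in> G2" "\<And>a b. a \<in> X \<Longrightarrow> a \<in> G2 \<Longrightarrow> b \<in> X \<Longrightarrow> b \<in> G2 \<Longrightarrow> \<kappa>2 a b = (k2 a \<noteq> k2 b)"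
    by (rule coboundE[OF assms(2) p]) blast
  show "\<exists>G. open G \<and> p \<in> G \<and> (\<forall>a b. a \<in> X \<longrightarrow> a \<in> G \<longrightarrow> b \<in> X \<longrightarrow> b \<in> G \<longrightarrow>
      \<kappa> a b = ((k1 a \<noteq> k2 a) \<noteq> (k1 b \<noteq> k2 b)))"
  proof (intro exI[of _ "G1 \<inter> G2"] conjI allI impI)
    show "open (G1 \<inter> G2)" by (rule open_Int[OF G1(1) G2(1)])
    show "p \<in> G1 \<inter> G2" using G1(2) G2(2) by simp
    fix a b assume a: "a \<in> X" "a \<in> G1 \<inter> G2" "b \<in> X" "b \<in> G1 \<inter> G2"
    show "\<kappa> a b = ((k1 a \<noteq> k2 a) \<noteq> (k1 b \<noteq> k2 b))"
      using e[OF a(1,3)] G1(3)[of a b] G2(3)[of a b] a by blast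
  qed
qed

lemma cobound_cong:
  assumes "cobound X \<kappa> k" "\<And>a b. a \<in> X \<Longrightarrow> b \<in> X \<Longrightarrow> \<kappa>' a b = \<kappa> a b"
  shows "cobound X \<kappa>' k"
  using assms unfolding cobound_def by simp

context triangle_complex
begin

text \<open>The cocycle \<open>c\<close> is spread over the realization, pulled back along
  \<open>h\<close> and integrated on each face of \<open>T'\<close>; the differences of these
  primitives at the vertices form \<open>\<Phi> c\<close>. As the primitives are chosen,
  \<open>\<Phi>\<close> is not claimed to be additive, and injectivity on classes is expressed by
  differences.\<close>

lemma cocycle_transfer:
  assumes T': "triangle_complex T'"
    and h: "continuous_on (realization T') h" "h ` realization T' \<subseteq> realization T"
    and h': "continuous_on (realization T) h'" "h' ` realization T \<subseteq> realization T'"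
    and inv: "\<And>x. x \<in> realization T \<Longrightarrow> h (h' x) = x"
  obtains \<Phi> where "\<And>c. c \<in> cocycles T \<Longrightarrow> \<Phi> c \<in> cocycles T'"
    "\<And>c d. c \<in> cocycles T \<Longrightarrow> d \<in> cocycles T \<Longrightarrow> symdiff (\<Phi> c) (\<Phi> d) \<in> coboundaries T' \<Longrightarrow> symdiff c d \<in> coboundaries T"
proof -
  interpret T': triangle_complex T' by (rule T')
  define \<kappa> where "\<kappa> c p q = spread c (h p) (h q)" for c p q
  have coc: "cocyc (realization T') (\<kappa> c)" if "c \<in> cocycles T" for c
    unfolding \<kappa>_def by (rule cocyc_pullback[OF spread_cocyc[OF that] h])
  have "\<exists>k. cobound (realization {t}) (\<kappa> c) k" if c: "c \<in> cocycles T" and t: "t \<in> T'" for c t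
  proof -
    obtain a b d where abd: "t = {a,b,d}" "a \<noteq> b" "b \<noteq> d" "a \<noteq> d"
      using T'.c3[OF t] unfolding card_3_iff by blast
    show ?thesis unfolding abd(1)
    proof (rule cobound_face[OF _ coc[OF c]])
      show "distinct [a,b,d]" using abd by simp
      show "realization {{a,b,d}} \<subseteq> realization T'" by (rule realization_mono) (use t abd(1) in simp)
    qed
  qed
  then obtain K where K: "\<And>c t. c \<in> cocycles T \<Longrightarrow> t \<in> T' \<Longrightarrow> cobound (realization {t}) (\<kappa> c) (K c t)"
    by metis
  define \<Phi> where "\<Phi> c = {e \<in> edges T'. \<exists>t\<in>T'. \<exists>a\<in>t. \<exists>b\<in>t. e = {a,b} \<and> (K c t (vpt a) \<noteq> K c t (vpt b))}" for c
  \<comment> \<open>Two faces at the same edge have primitives that differ by a constant on their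
    intersection, so the value on the edge does not depend on the face.\<close>
  have ind: "(K c t (vpt a) \<noteq> K c t (vpt b)) = (K c u (vpt a) \<noteq> K c u (vpt b))"
    if c: "c \<in> cocycles T" and t: "t \<in> T'" "a \<in> t" "b \<in> t" and u: "u \<in> T'" "a \<in> u" "b \<in> u" for c t u a b
  proof -
    have v: "vpt p \<in> realization {t} \<inter> realization {u}" if "p \<in> t" "p \<in> u" for p
      using vpt_realization[OF finite_card3[OF T'.c3[OF t(1)]] that(1)]
        vpt_realization[OF finite_card3[OF T'.c3[OF u(1)]] that(2)] by simp
    have "(K c t (vpt a) \<noteq> K c u (vpt a)) = (K c t (vpt b) \<noteq> K c u (vpt b))"
    proof (rule cobound_diff_const[OF connected_simplex_Int])
      show "cobound (realization {t} \<inter> realization {u}) (\<kappa> c) (K c t)"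
        by (rule cobound_subset[OF K[OF c t(1)] Int_lower1])
      show "cobound (realization {t} \<inter> realization {u}) (\<kappa> c) (K c u)"
        by (rule cobound_subset[OF K[OF c u(1)] Int_lower2])
    qed (rule v[OF t(2) u(2)], rule v[OF t(3) u(3)])
    then show ?thesis by argo
  qed
  have \<Phi>: "({a,b} \<in> \<Phi> c) = (K c t (vpt a) \<noteq> K c t (vpt b))"
    if c: "c \<in> cocycles T" and t: "t \<in> T'" "a \<in> t" "b \<in> t" for c t a b
  proof
    assume "{a,b} \<in> \<Phi> c"
    then obtain u x y where u: "u \<in> T'" "x \<in> u" "y \<in> u" "{a,b} = {x,y}" "K c u (vpt x) \<noteq> K c u (vpt y)"
      unfolding \<Phi>_def by (elim CollectE conjE bexE)
    then consider "a = x" "b = y" | "a = y" "b = x" unfolding doubleton_eq_iff by argo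
    then show "K c t (vpt a) \<noteq> K c t (vpt b)"
    proof cases
      case 1 then show ?thesis using ind[OF c t u(1)] u(2,3,5) by simp
    next
      case 2 then show ?thesis using ind[OF c t u(1)] u(2,3,5) by simp
    qed
  next
    assume n: "K c t (vpt a) \<noteq> K c t (vpt b)"
    then have "a \<noteq> b" by auto
    then have "{a,b} \<in> edges T'" using t by (auto simp: edges_def)
    then show "{a,b} \<in> \<Phi> c" unfolding \<Phi>_def
      by (intro CollectI conjI bexI[OF _ t(1)] bexI[OF _ t(2)] bexI[OF _ t(3)] refl n)
  qed
  have 1: "\<Phi> c \<in> cocycles T'" if c: "c \<in> cocycles T" for c
    unfolding cocycles_def
  proof (intro CollectI conjI ballI)
    show "\<Phi> c \<subseteq> edges T'" by (auto simp: \<Phi>_def)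
    fix t x y z assume t: "t \<in> T'" "x \<in> t" "y \<in> t" "z \<in> t"
    show "({x,z} \<in> \<Phi> c) = (({x,y} \<in> \<Phi> c) \<noteq> ({y,z} \<in> \<Phi> c))"
      unfolding \<Phi>[OF c t(1,2,4)] \<Phi>[OF c t(1,2,3)] \<Phi>[OF c t(1,3,4)] by argo
  qed
  have 2: "symdiff c d \<in> coboundaries T" if c: "c \<in> cocycles T" and d: "d \<in> cocycles T" and b: "symdiff (\<Phi> c) (\<Phi> d) \<in> coboundaries T'" for c d
  proof -
    have cd: "symdiff c d \<in> cocycles T" by (rule cocycles_symdiff[OF c d])
    obtain A where A: "\<And>a b. {a,b} \<in> edges T' \<Longrightarrow> ({a,b} \<in> symdiff (\<Phi> c) (\<Phi> d)) = ((a \<in> A) \<noteq> (b \<in> A))"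
      using b unfolding coboundaries_def by (elim CollectE conjE exE) (rule that, elim allE, erule mp)
    have x: "\<kappa> (symdiff c d) p q = (\<kappa> c p q \<noteq> \<kappa> d p q)" for p q
      unfolding \<kappa>_def spread_def symdiff_iff ..
    obtain k where k: "cobound (realization T') (\<kappa> (symdiff c d)) k"
    proof (rule exE[OF T'.cobound_patch[OF coc[OF cd], of "\<lambda>t a. K c t a \<noteq> K d t a" A]])
      show "cobound (realization {t}) (\<kappa> (symdiff c d)) (\<lambda>a. K c t a \<noteq> K d t a)" if "t \<in> T'" for t
        by (rule cobound_xor[OF K[OF c that] K[OF d that] x])
      fix t a b assume t: "t \<in> T'" "a \<in> t" "b \<in> t"
      show "((K c t (vpt a) \<noteq> K d t (vpt a)) \<noteq> (K c t (vpt b) \<noteq> K d t (vpt b))) = ((a \<in> A) \<noteq> (b \<in> A))"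
      proof (cases "a = b")
        case True then show ?thesis by simp
      next
        case False
        then have "{a,b} \<in> edges T'" using t by (auto simp: edges_def)
        from A[OF this] show ?thesis unfolding symdiff_iff \<Phi>[OF c t] \<Phi>[OF d t] by argo
      qed
    qed
    have "cobound (realization T) (spread (symdiff c d)) (\<lambda>a. k (h' a))"
      by (rule cobound_cong[OF cobound_pullback[OF k h']]) (simp add: \<kappa>_def inv)
    then show ?thesis by (rule spread_cobound[OF cd])
  qed
  show ?thesis by (rule that[OF 1 2])
qed

end

section \<open>Ranks of cocycles and coboundaries\<close>

lemma symdiff_cancel: "symdiff (symdiff A B) B = A" by (auto simp: symdiff_def)

lemma symdiff_subset: "A \<subseteq> C \<Longrightarrow> B \<subseteq> C \<Longrightarrow> symdiff A B \<subseteq> C" by (auto simp: symdiff_def)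

lemma symdiff_eq_empty: "symdiff A B = {} \<longleftrightarrow> A = B" by (auto simp: symdiff_def)

lemma symdiff_left_eq: "symdiff A B = symdiff A C \<Longrightarrow> B = C" unfolding set_eq_iff symdiff_iff by blast

text \<open>The coboundary map from edge sets to face sets modulo 2: a face belongs to the result
  when an odd number of its edges lies in \<open>c\<close>.\<close>

definition cobdy :: "'v set set \<Rightarrow> 'v set set \<Rightarrow> 'v set set" where
  "cobdy T c = {t\<in>T. \<not> (\<forall>x\<in>t. \<forall>y\<in>t. \<forall>z\<in>t. ({x,z} \<in> c) = (({x,y} \<in> c) \<noteq> ({y,z} \<in> c)))}"

lemma cobdy_subset: "cobdy T c \<subseteq> T" by (auto simp: cobdy_def)

lemma cocycles_cobdy: "c \<in> cocycles T \<longleftrightarrow> c \<subseteq> edges T \<and> cobdy T c = {}"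
  unfolding cocycles_def cobdy_def mem_Collect_eq Collect_empty_eq 
  by (simp only: Ball_def de_Morgan_conj not_not imp_conv_disj)

context triangle_complex
begin

lemma finite_edges: "finite (edges T)"
proof (rule finite_subset)
  show "edges T \<subseteq> Pow (\<Union>T)" by (auto simp: edges_def)
  show "finite (Pow (\<Union>T))" using fin finite_card3[OF c3] by auto
qed

lemma finite_cochains: "finite (cocycles T)" "finite (coboundaries T)"
  by (rule finite_subset[of _ "Pow (edges T)"], auto simp: cocycles_def coboundaries_def finite_edges)+

lemma cobdy_face:
  assumes t: "{x,y,z} \<in> T" and c: "c \<subseteq> edges T"
  shows "({x,y,z} \<in> cobdy T c) = (({x,y} \<in> c) \<noteq> (({y,z} \<in> c) \<noteq> ({x,z} \<in> c)))"
proof -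
  have s: "{p,p} \<in> c \<longleftrightarrow> False" for p using c by (auto simp: edges_def)
  have p: "({y,x} \<in> c) = ({x,y} \<in> c)" "({z,y} \<in> c) = ({y,z} \<in> c)" "({z,x} \<in> c) = ({x,z} \<in> c)"
    by (simp_all add: insert_commute)
  show ?thesis unfolding cobdy_def mem_Collect_eq ball_simps(5,7) s p using t by argo
qed

lemma face_cases:
  assumes "t \<in> T"
  obtains x y z where "t = {x,y,z}" "x \<noteq> y" "y \<noteq> z" "x \<noteq> z"
  using c3[OF assms] unfolding card_3_iff by blast

lemma cobdy_xd:
  assumes "c \<subseteq> edges T" "d \<subseteq> edges T"
  shows "cobdy T (symdiff c d) = symdiff (cobdy T c) (cobdy T d)"
proof (rule set_eqI)
  fix t
  show "(t \<in> cobdy T (symdiff c d)) = (t \<in> symdiff (cobdy T c) (cobdy T d))"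
  proof (cases "t \<in> T")
    case True
    obtain x y z where xyz: "t = {x,y,z}" by (rule face_cases[OF True])
    have t: "{x,y,z} \<in> T" using True xyz by (rule back_subst)
    show ?thesis
      unfolding xyz symdiff_iff cobdy_face[OF t symdiff_subset[OF assms]] cobdy_face[OF t assms(1)] cobdy_face[OF t assms(2)]
      by argo
  next
    case False
    then have "t \<notin> cobdy T e" for e using cobdy_subset[of T e] by auto
    then show ?thesis by (simp add: symdiff_iff)
  qed
qed

lemma cobdy_edge:
  assumes e: "{a,b} \<in> edges T"
  shows "cobdy T {{a,b}} = {t\<in>T. {a,b} \<subseteq> t}"
proof (rule set_eqI)
  fix t
  have ab: "a \<noteq> b" using e by (auto simp: edges_def)
  have c: "{{a,b}} \<subseteq> edges T" using e by simp
  show "(t \<in> cobdy T {{a,b}}) = (t \<in> {t\<in>T. {a,b} \<subseteq> t})"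
  proof (cases "t \<in> T")
    case True
    show ?thesis
    proof (cases "{a,b} \<subseteq> t")
      case sub: True
      then obtain d where d: "t = {a,b,d}" "d \<noteq> a" "d \<noteq> b" using face_at[OF True _ _ ab] by blast
      have t: "{a,b,d} \<in> T" using True d(1) by (rule back_subst)
      have "{b,d} \<noteq> {a,b}" "{a,d} \<noteq> {a,b}" using d(2,3) by (auto simp: doubleton_eq_iff)
      then have "{a,b,d} \<in> cobdy T {{a,b}}" unfolding cobdy_face[OF t c] singleton_iff by simp
      then show ?thesis unfolding d(1) using t by simp
    next
      case False
      obtain x y z where xyz: "t = {x,y,z}" by (rule face_cases[OF True])
      have t: "{x,y,z} \<in> T" using True xyz by (rule back_subst)
      have "{x,y} \<noteq> {a,b}" "{y,z} \<noteq> {a,b}" "{x,z} \<noteq> {a,b}"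
        using False unfolding xyz by (auto simp: doubleton_eq_iff)
      then have "{x,y,z} \<notin> cobdy T {{a,b}}" unfolding cobdy_face[OF t c] singleton_iff by simp
      then show ?thesis unfolding xyz[symmetric] using False by simp
    qed
  next
    case False
    then show ?thesis using cobdy_subset[of T "{{a,b}}"] by auto
  qed
qed

text \<open>
  The sets \<open>cocycles T\<close> and \<open>coboundaries T\<close> are vector spaces over the field of two elements, and the
  rank formulas are stated through their cardinalities.
\<close>

lemma card_cocycles_ge: "2 ^ card (edges T) \<le> card (cocycles T) * 2 ^ card T"
proof -
  \<comment> \<open>A choice of preimage under \<open>cobdy\<close>. Adding it turns each edge set
    into a cocycle, so an edge set is encoded by a cocycle and its coboundary.\<close>
  define r where "r s = (SOME c. c \<subseteq> edges T \<and> cobdy T c = s)" for s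
  have r: "r (cobdy T c) \<subseteq> edges T \<and> cobdy T (r (cobdy T c)) = cobdy T c" if "c \<subseteq> edges T" for c
    unfolding r_def by (rule someI[of _ c]) (use that in simp)
  have "card (Pow (edges T)) \<le> card (cocycles T \<times> Pow T)"
  proof (rule card_inj_on_le[of "\<lambda>c. (symdiff c (r (cobdy T c)), cobdy T c)"])
    show "inj_on (\<lambda>c. (symdiff c (r (cobdy T c)), cobdy T c)) (Pow (edges T))"
    proof (rule inj_onI)
      fix c d assume e: "(symdiff c (r (cobdy T c)), cobdy T c) = (symdiff d (r (cobdy T d)), cobdy T d)"
      then have "cobdy T d = cobdy T c" by (elim Pair_inject) (rule sym)
      with e have "symdiff c (r (cobdy T c)) = symdiff d (r (cobdy T c))" by (elim Pair_inject) (simp only:)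
      from arg_cong[OF this, of "\<lambda>u. symdiff u (r (cobdy T c))"] show "c = d" unfolding symdiff_cancel .
    qed
    show "(\<lambda>c. (symdiff c (r (cobdy T c)), cobdy T c)) ` Pow (edges T) \<subseteq> cocycles T \<times> Pow T"
    proof (rule image_subsetI)
      fix c assume "c \<in> Pow (edges T)"
      then have c: "c \<subseteq> edges T" by simp
      have "symdiff c (r (cobdy T c)) \<in> cocycles T"
        unfolding cocycles_cobdy using r[OF c] c by (simp add: cobdy_xd symdiff_subset symdiff_eq_empty)
      then show "(symdiff c (r (cobdy T c)), cobdy T c) \<in> cocycles T \<times> Pow T" using cobdy_subset[of T c] by simp
    qed
    show "finite (cocycles T \<times> Pow T)" using finite_cochains fin by simp
  qed
  then show ?thesis by (simp add: card_Pow finite_edges card_cartesian_product fin)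
qed

text \<open>A vertex set and its complement have the same coboundary and are different because there
  is a vertex, so pairs of a coboundary and a bit inject into the vertex sets.\<close>

lemma card_coboundaries_le:
  assumes "T \<noteq> {}"
  shows "2 * card (coboundaries T) \<le> 2 ^ card (verts T)"
proof -
  have fv: "finite (verts T)" using fin finite_card3[OF c3] by (auto simp: verts_def)
  have v0: "verts T \<noteq> {}" using assms c3 by (fastforce simp: verts_def)
  have "\<exists>A. A \<subseteq> verts T \<and> (\<forall>a b. {a,b} \<in> edges T \<longrightarrow> ({a,b} \<in> c) = ((a \<in> A) \<noteq> (b \<in> A)))"
    if c: "c \<in> coboundaries T" for c
  proof -
    obtain A where A: "\<And>a b. {a,b} \<in> edges T \<Longrightarrow> ({a,b} \<in> c) = ((a \<in> A) \<noteq> (b \<in> A))"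
      using c unfolding coboundaries_def by (elim CollectE conjE exE) (rule that, elim allE, erule mp)
    have "({a,b} \<in> c) = ((a \<in> A \<inter> verts T) \<noteq> (b \<in> A \<inter> verts T))" if e: "{a,b} \<in> edges T" for a b
      using A[OF e] e by (auto simp: edges_def verts_def)
    then show ?thesis by (intro exI[of _ "A \<inter> verts T"]) simp
  qed
  then obtain A where A: "\<And>c. c \<in> coboundaries T \<Longrightarrow> A c \<subseteq> verts T"
    "\<And>c a b. c \<in> coboundaries T \<Longrightarrow> {a,b} \<in> edges T \<Longrightarrow> ({a,b} \<in> c) = ((a \<in> A c) \<noteq> (b \<in> A c))" by metis
  define g where "g = (\<lambda>(c,e). if e then A c else verts T - A c)"
  have det: "c = d" if c: "c \<in> coboundaries T" "d \<in> coboundaries T"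
    and AA: "\<And>a b. a \<in> verts T \<Longrightarrow> b \<in> verts T \<Longrightarrow> ((a \<in> A c) \<noteq> (b \<in> A c)) = ((a \<in> A d) \<noteq> (b \<in> A d))" for c d
  proof (rule set_eqI)
    fix e
    show "(e \<in> c) = (e \<in> d)"
    proof (cases "e \<in> edges T")
      case True
      then obtain a b where ab: "e = {a,b}" unfolding edges_def card_2_iff by blast
      have e: "{a,b} \<in> edges T" using True ab by (rule back_subst)
      have "a \<in> verts T" "b \<in> verts T" using e by (auto simp: edges_def verts_def)
      then show ?thesis unfolding ab A(2)[OF c(1) e] A(2)[OF c(2) e] by (rule AA)
    next
      case False
      have "c \<subseteq> edges T" "d \<subseteq> edges T" using c by (simp_all add: coboundaries_def)
      then show ?thesis using False by auto
    qed
  qed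
  have "card (coboundaries T \<times> (UNIV::bool set)) \<le> card (Pow (verts T))"
  proof (rule card_inj_on_le[of g])
    show "inj_on g (coboundaries T \<times> UNIV)"
    proof (rule inj_onI)
      fix p q assume "p \<in> coboundaries T \<times> (UNIV::bool set)" "q \<in> coboundaries T \<times> (UNIV::bool set)" and g: "g p = g q"
      then obtain c e d f where p: "p = (c,e)" "q = (d,f)" and cd: "c \<in> coboundaries T" "d \<in> coboundaries T" by auto
      have gg: "(a \<in> A c) = e \<longleftrightarrow> (a \<in> A d) = f" if "a \<in> verts T" for a
        using g that A(1)[OF cd(1)] A(1)[OF cd(2)] unfolding g_def p set_eq_iff
        by (cases e; cases f) auto
      have cd': "c = d"
      proof (rule det[OF cd])
        fix a b assume "a \<in> verts T" "b \<in> verts T"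
        from gg[OF this(1)] gg[OF this(2)]
        show "((a \<in> A c) \<noteq> (b \<in> A c)) = ((a \<in> A d) \<noteq> (b \<in> A d))" by argo
      qed
      obtain v where "v \<in> verts T" using v0 by blast
      from gg[OF this] have "e = f" unfolding cd' by argo
      then show "p = q" using p cd' by simp
    qed
    show "g ` (coboundaries T \<times> UNIV) \<subseteq> Pow (verts T)"
    proof (rule image_subsetI)
      fix p assume "p \<in> coboundaries T \<times> (UNIV::bool set)"
      then obtain c e where p: "p = (c,e)" and c: "c \<in> coboundaries T" by auto
      show "g p \<in> Pow (verts T)" using A(1)[OF c] unfolding p g_def by auto
    qed
    show "finite (Pow (verts T))" using fv by simp
  qed
  then show ?thesis by (simp add: card_Pow fv card_cartesian_product card_UNIV_bool mult.commute)
qed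

end

lemma symdiff_swap: "symdiff A B = symdiff C D \<Longrightarrow> symdiff A C = symdiff B D"
  unfolding set_eq_iff symdiff_iff by blast

lemma (in triangle_complex) coboundaries_cocycles: "c \<in> coboundaries T \<Longrightarrow> c \<in> cocycles T"
proof -
  assume c: "c \<in> coboundaries T"
  then obtain A where A: "\<And>a b. {a,b} \<in> edges T \<Longrightarrow> ({a,b} \<in> c) = ((a \<in> A) \<noteq> (b \<in> A))"
    unfolding coboundaries_def by (elim CollectE conjE exE) (rule that, elim allE, erule mp)
  have sub: "c \<subseteq> edges T" using c by (simp add: coboundaries_def)
  have *: "({a,b} \<in> c) = ((a \<in> A) \<noteq> (b \<in> A))" if t: "t \<in> T" "a \<in> t" "b \<in> t" for t a b
  proof (cases "a = b")
    case True
    then show ?thesis using sub by (auto simp: edges_def)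
  next
    case False
    then have "{a,b} \<in> edges T" using t by (auto simp: edges_def)
    then show ?thesis by (rule A)
  qed
  show ?thesis unfolding cocycles_def
  proof (intro CollectI conjI sub ballI)
    fix t x y z assume "t \<in> T" "x \<in> t" "y \<in> t" "z \<in> t"
    from *[OF this(1,2,4)] *[OF this(1,2,3)] *[OF this(1,3,4)]
    show "({x,z} \<in> c) = (({x,y} \<in> c) \<noteq> ({y,z} \<in> c))" by argo
  qed
qed

context csurf
begin

text \<open>Second cohomology vanishes because there is a boundary edge: its single face is a
  coboundary, and adding the coboundary of an inner edge passes from one face at it to the other.
  Connected links carry this around a vertex, and the connected graph carries it to all
  faces.\<close>

lemma cobdy_surj:
  assumes "S \<subseteq> T"
  shows "\<exists>c\<subseteq>edges T. cobdy T c = S"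
proof -
  define P where "P t \<longleftrightarrow> (\<exists>c\<subseteq>edges T. cobdy T c = {t})" for t
  have cross: "P {a,b,e}" if p: "P {a,b,d}" and t: "{a,b,d} \<in> T" "{a,b,e} \<in> T" for a b d e
  proof (cases "d = e")
    case True then show ?thesis using p by simp
  next
    case False
    have ab: "a \<noteq> b" "e \<noteq> a" "e \<noteq> b" using face_distinct[OF t(2)] by auto
    have eq: "{t\<in>T. {a,b} \<subseteq> t} = {{a,b,d},{a,b,e}}"
    proof (intro equalityI subsetI)
      fix t assume "t \<in> {t\<in>T. {a,b} \<subseteq> t}"
      then have t': "t \<in> T" "a \<in> t" "b \<in> t" by auto
      obtain f where f: "t = {a,b,f}" using face_at[OF t' ab(1)] by blast
      have "{a,b,f} \<in> T" using t'(1) f by (rule back_subst)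
      then have "f = d \<or> f = e" using edge_le2[OF t, of f] False by blast
      then show "t \<in> {{a,b,d},{a,b,e}}" unfolding f by auto
    qed (use t in auto)
    have e: "{a,b} \<in> edges T" by (rule face_edge[OF t(1)])
    obtain c where c: "c \<subseteq> edges T" "cobdy T c = {{a,b,d}}" using p unfolding P_def by blast
    have n: "{a,b,d} \<noteq> {a,b,e}" using ab False by auto
    have "cobdy T (symdiff c {{a,b}}) = symdiff {{a,b,d}} {{a,b,d},{a,b,e}}"
      using cobdy_xd[OF c(1), of "{{a,b}}"] e unfolding c(2) cobdy_edge[OF e] eq by simp
    also have "\<dots> = {{a,b,e}}" using n by (auto simp: symdiff_def)
    finally show ?thesis unfolding P_def using c(1) e by (intro exI[of _ "symdiff c {{a,b}}"]) (simp add: symdiff_subset)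
  qed
  have around: "P u" if t: "t \<in> T" "v \<in> t" "P t" and u: "u \<in> T" "v \<in> u" for v t u
  proof -
    define N where "N = {n. \<exists>m. {v,n,m} \<in> T \<and> P {v,n,m}}"
    obtain a b where ab: "t = {v,a,b}" "fc T v a b" using face_star[OF t(1,2)] by blast
    obtain d e where de: "u = {v,d,e}" "fc T v d e" using face_star[OF u] by blast
    have "d \<in> N"
    proof (rule link_connected[of N v])
      have "a \<in> N" unfolding N_def using t(1,3) unfolding ab(1) by blast
      then show "N \<noteq> {}" by blast
      show "{v,n} \<in> edges T" if n: "n \<in> N" for n
      proof -
        obtain m where "{v,n,m} \<in> T" using n unfolding N_def by (elim CollectE exE conjE) 
        then show ?thesis by (rule face_edge)
      qed
      show "m \<in> N" if n: "n \<in> N" "{v,n,m} \<in> T" for n m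
      proof -
        obtain q where q: "{v,n,q} \<in> T" "P {v,n,q}" using n(1) unfolding N_def by (elim CollectE exE conjE)
        have "P {v,n,m}" by (rule cross[OF q(2,1) n(2)])
        then have "P {v,m,n}" "{v,m,n} \<in> T" using n(2) by (simp_all add: insert_commute)
        then show ?thesis unfolding N_def by (intro CollectI exI conjI)
      qed
      show "{v,d} \<in> edges T" by (rule face_edge) (use de(2) in \<open>simp add: fc_def\<close>)
    qed
    then obtain q where "{v,d,q} \<in> T" "P {v,d,q}" unfolding N_def by (elim CollectE exE conjE)
    then show ?thesis unfolding de(1) using cross de(2) unfolding fc_def by blast
  qed
  obtain a b where bd: "{a,b} \<in> bd_edges T"
    using boundary_nonempty unfolding bd_edges_def edges_def card_2_iff by blast
  then have e: "{a,b} \<in> edges T" and "card {t \<in> T. {a,b} \<subseteq> t} = 1" by (simp_all add: bd_edges_def)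
  then obtain t0 where t0: "{t \<in> T. {a,b} \<subseteq> t} = {t0}" by (meson card_1_singletonE)
  then have Pt0: "P t0" unfolding P_def using cobdy_edge[OF e] e by (intro exI[of _ "{{a,b}}"]) simp
  have t0': "t0 \<in> T" "a \<in> t0" using t0 by auto
  define V where "V = {v \<in> verts T. \<forall>u\<in>T. v \<in> u \<longrightarrow> P u}"
  have all: "v \<in> V" if v: "v \<in> verts T" for v
  proof (rule connected_graph[of a])
    show "a \<in> verts T" using t0' by (auto simp: verts_def)
    then show "a \<in> V" unfolding V_def using around[OF t0' Pt0] by blast
    fix p q assume p: "p \<in> V" "{p,q} \<in> edges T"
    obtain z where z: "{p,q,z} \<in> T" by (rule edge_faces[OF p(2)])
    then have "P {p,q,z}" using p(1) unfolding V_def by blast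
    then have "P u" if "u \<in> T" "q \<in> u" for u using around[OF z _ _ that] by simp
    moreover have "q \<in> verts T" unfolding verts_def by (rule UnionI[OF z]) simp
    ultimately show "q \<in> V" unfolding V_def by simp
  qed (rule v)
  have P: "P t" if t: "t \<in> T" for t
  proof -
    obtain x y z where x: "t = {x,y,z}" by (rule face_cases[OF t])
    then have "x \<in> verts T" using t by (auto simp: verts_def)
    then have "x \<in> V" by (rule all)
    then show ?thesis using t x unfolding V_def by blast
  qed
  have "finite S" using assms fin by (rule finite_subset)
  then show ?thesis using assms
  proof (induction S)
    case empty
    have "cobdy T {} = {}" by (simp add: cobdy_def)
    then show ?case by (intro exI[of _ "{}"]) simp
  next
    case (insert t S)
    then obtain c where c: "c \<subseteq> edges T" "cobdy T c = S" by auto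
    obtain d where d: "d \<subseteq> edges T" "cobdy T d = {t}" using P[of t] insert.prems unfolding P_def by auto
    have "cobdy T (symdiff c d) = symdiff S {t}" using cobdy_xd[OF c(1) d(1)] c(2) d(2) by simp
    also have "\<dots> = insert t S" using insert.hyps(2) by (auto simp: symdiff_def)
    finally show ?case using c(1) d(1) by (intro exI[of _ "symdiff c d"]) (simp add: symdiff_subset)
  qed
qed

text \<open>Surjectivity of \<open>cobdy\<close> gives the bound matching
  \<open>card_cocycles_ge\<close>: the dimension of the cocycles is the number of edges minus the
  number of faces.\<close>

lemma card_cocycles_le: "card (cocycles T) * 2 ^ card T \<le> 2 ^ card (edges T)"
proof -
  have "\<forall>S. \<exists>c. S \<subseteq> T \<longrightarrow> c \<subseteq> edges T \<and> cobdy T c = S" using cobdy_surj by meson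
  then obtain r where r: "\<And>S. S \<subseteq> T \<Longrightarrow> r S \<subseteq> edges T" "\<And>S. S \<subseteq> T \<Longrightarrow> cobdy T (r S) = S" by metis
  let ?g = "\<lambda>p. symdiff (fst p) (r (snd p))"
  have "card (cocycles T \<times> Pow T) \<le> card (Pow (edges T))"
  proof (rule card_inj_on_le[of ?g])
    have dlg: "cobdy T (symdiff c (r S)) = S" if "c \<in> cocycles T" "S \<subseteq> T" for c S
      using that cobdy_xd[OF _ r(1)[OF that(2)], of c] r(2)[OF that(2)] unfolding cocycles_cobdy by (auto simp: symdiff_def)
    show "inj_on ?g (cocycles T \<times> Pow T)"
    proof (rule inj_onI)
      fix p q assume pq: "p \<in> cocycles T \<times> Pow T" "q \<in> cocycles T \<times> Pow T" and g: "?g p = ?g q"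
      have "snd p = snd q"
        using arg_cong[OF g, of "cobdy T"] dlg[of "fst p" "snd p"] dlg[of "fst q" "snd q"] pq
        by (auto simp: mem_Times_iff)
      moreover from this have "symdiff (?g p) (r (snd p)) = symdiff (?g q) (r (snd q))" using g by simp
      then have "fst p = fst q" unfolding symdiff_cancel .
      ultimately show "p = q" by (simp add: prod_eq_iff)
    qed
    show "?g ` (cocycles T \<times> Pow T) \<subseteq> Pow (edges T)"
    proof (rule image_subsetI)
      fix p assume "p \<in> cocycles T \<times> Pow T"
      then have "fst p \<in> cocycles T" "snd p \<subseteq> T" by (simp_all add: mem_Times_iff)
      then show "?g p \<in> Pow (edges T)" unfolding cocycles_cobdy by (intro PowI symdiff_subset r(1)) simp_all
    qed
    show "finite (Pow (edges T))" using finite_edges by simp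
  qed
  then show ?thesis by (simp add: card_Pow finite_edges card_cartesian_product fin)
qed

text \<open>In a connected graph a vertex set is determined by its coboundary and its membership at
  one vertex.\<close>

lemma card_coboundaries_ge: "2 ^ card (verts T) \<le> 2 * card (coboundaries T)"
proof -
  obtain v0 where v0: "v0 \<in> verts T" using boundary_nonempty
    unfolding bd_edges_def edges_def verts_def card_2_iff by blast
  define B where "B A = {e\<in>edges T. \<exists>a\<in>A. \<exists>b. b \<notin> A \<and> e = {a,b}}" for A
  have B: "({a,b} \<in> B A) = ((a \<in> A) \<noteq> (b \<in> A))" if e: "{a,b} \<in> edges T" for a b A
    unfolding B_def using e by (auto simp: doubleton_eq_iff)
  have BB: "B A \<in> coboundaries T" for A unfolding coboundaries_def using B[of _ _ A] by (auto simp: B_def)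
  have "card (Pow (verts T)) \<le> card (coboundaries T \<times> (UNIV :: bool set))"
  proof (rule card_inj_on_le[of "\<lambda>A. (B A, v0 \<in> A)"])
    show "inj_on (\<lambda>A. (B A, v0 \<in> A)) (Pow (verts T))"
    proof (rule inj_onI)
      fix A A' assume A: "A \<in> Pow (verts T)" "A' \<in> Pow (verts T)" and e: "(B A, v0 \<in> A) = (B A', v0 \<in> A')"
      have e1: "B A = B A'" and e2: "(v0 \<in> A) = (v0 \<in> A')" using e by simp_all
      have "v \<in> {v. (v \<in> A) = (v \<in> A')}" if "v \<in> verts T" for v
      proof (rule connected_graph[of v0])
        show "v0 \<in> {v. (v \<in> A) = (v \<in> A')}" using e2 by simp
        fix a b assume ab: "a \<in> {v. (v \<in> A) = (v \<in> A')}" "{a,b} \<in> edges T"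
        show "b \<in> {v. (v \<in> A) = (v \<in> A')}"
          using ab(1) B[OF ab(2), of A] B[OF ab(2), of A'] unfolding e1 mem_Collect_eq by argo
      qed (rule v0, rule that)
      then show "A = A'" using A by auto
    qed
    show "(\<lambda>A. (B A, v0 \<in> A)) ` Pow (verts T) \<subseteq> coboundaries T \<times> UNIV" using BB by auto
    show "finite (coboundaries T \<times> (UNIV :: bool set))" using finite_cochains by simp
  qed
  then show ?thesis
    by (simp add: card_Pow finite_verts card_cartesian_product card_UNIV_bool mult.commute)
qed

end

text \<open>The cocycles have dimension edges minus faces and the coboundaries vertices minus 1; the
  injection of first cohomology compares the differences. Written without subtraction, the Euler
  characteristic of \<open>T'\<close> is at most that of \<open>T\<close>, the direction that
  restricts contractions.\<close>

theorem euler_characteristic_le: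
  assumes T: "csurf T" and T': "csurf T'"
    and hom: "top_of_set (realization T) homeomorphic_space top_of_set (realization T')"
  shows "card (edges T) + card (verts T') + card T' \<le> card T + card (edges T') + card (verts T)"
proof -
  interpret T: csurf T by (rule T)
  interpret T': csurf T' by (rule T')
  obtain h' h where hh: "homeomorphic_maps (top_of_set (realization T)) (top_of_set (realization T')) h' h"
    using hom unfolding homeomorphic_space_def by blast
  obtain \<Phi> where \<Phi>: "\<And>c. c \<in> cocycles T \<Longrightarrow> \<Phi> c \<in> cocycles T'"
    "\<And>c d. c \<in> cocycles T \<Longrightarrow> d \<in> cocycles T \<Longrightarrow> symdiff (\<Phi> c) (\<Phi> d) \<in> coboundaries T' \<Longrightarrow> symdiff c d \<in> coboundaries T"
  proof (rule T.cocycle_transfer[of T' h h'])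
    show "triangle_complex T'" by unfold_locales
  qed (use hh in \<open>auto simp: homeomorphic_maps_def image_subset_iff Pi_iff\<close>)
  define r where "r z = (SOME c. c \<in> cocycles T \<and> (\<exists>b\<in>coboundaries T'. z = symdiff (\<Phi> c) b))" for z
  \<comment> \<open>Counting without quotients: an injection of first cohomology yields an injection
    of pairs. Here \<open>r\<close> recovers a representative of the class of \<open>c\<close> from
    \<open>\<Phi> c\<close> changed by a coboundary, and the second component corrects it to
    \<open>c\<close>.\<close>
  let ?g = "\<lambda>p. (symdiff (\<Phi> (fst p)) (snd p), symdiff (fst p) (r (symdiff (\<Phi> (fst p)) (snd p))))"
  have xB: "symdiff b b' \<in> coboundaries T'" if bb: "b \<in> coboundaries T'" "b' \<in> coboundaries T'" for b b'
  proof -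
    obtain A where A: "\<And>x y. {x,y} \<in> edges T' \<Longrightarrow> ({x,y} \<in> b) = ((x \<in> A) \<noteq> (y \<in> A))"
      using bb(1) unfolding coboundaries_def by (elim CollectE conjE exE) (rule that, elim allE, erule mp)
    obtain A' where A': "\<And>x y. {x,y} \<in> edges T' \<Longrightarrow> ({x,y} \<in> b') = ((x \<in> A') \<noteq> (y \<in> A'))"
      using bb(2) unfolding coboundaries_def by (elim CollectE conjE exE) (rule that, elim allE, erule mp)
    have "({x,y} \<in> symdiff b b') = ((x \<in> symdiff A A') \<noteq> (y \<in> symdiff A A'))" if e: "{x,y} \<in> edges T'" for x y
      unfolding symdiff_iff A[OF e] A'[OF e] by argo
    moreover have "symdiff b b' \<subseteq> edges T'" using bb by (simp add: coboundaries_def symdiff_subset)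
    ultimately show ?thesis unfolding coboundaries_def by (intro CollectI conjI exI[of _ "symdiff A A'"] allI impI)
  qed
  have r: "r (symdiff (\<Phi> c) b) \<in> cocycles T \<and> symdiff c (r (symdiff (\<Phi> c) b)) \<in> coboundaries T" if c: "c \<in> cocycles T" and b: "b \<in> coboundaries T'" for c b
  proof -
    let ?z = "symdiff (\<Phi> c) b"
    have "r ?z \<in> cocycles T \<and> (\<exists>b\<in>coboundaries T'. ?z = symdiff (\<Phi> (r ?z)) b)"
      unfolding r_def by (rule someI[of _ c]) (use c b in blast)
    then obtain b' where z: "r ?z \<in> cocycles T" "b' \<in> coboundaries T'" "?z = symdiff (\<Phi> (r ?z)) b'" by blast
    have "symdiff (\<Phi> c) (\<Phi> (r ?z)) = symdiff b b'" by (rule symdiff_swap[OF z(3)])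
    then have "symdiff (\<Phi> c) (\<Phi> (r ?z)) \<in> coboundaries T'" using xB[OF b z(2)] by simp
    then show ?thesis using z(1) \<Phi>(2)[OF c z(1)] by blast
  qed
  have "card (cocycles T \<times> coboundaries T') \<le> card (cocycles T' \<times> coboundaries T)"
  proof (rule card_inj_on_le[of ?g])
    show "inj_on ?g (cocycles T \<times> coboundaries T')"
    proof (rule inj_onI)
      fix p q assume g: "?g p = ?g q"
      have z: "symdiff (\<Phi> (fst p)) (snd p) = symdiff (\<Phi> (fst q)) (snd q)" using g by (elim Pair_inject)
      have "symdiff (fst p) (r (symdiff (\<Phi> (fst p)) (snd p))) = symdiff (fst q) (r (symdiff (\<Phi> (fst q)) (snd q)))"
        using g by (elim Pair_inject)
      then have "symdiff (fst p) (r (symdiff (\<Phi> (fst p)) (snd p))) = symdiff (fst q) (r (symdiff (\<Phi> (fst p)) (snd p)))"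
        unfolding z .
      from arg_cong[OF this, of "\<lambda>u. symdiff u (r (symdiff (\<Phi> (fst p)) (snd p)))"]
      have 1: "fst p = fst q" unfolding symdiff_cancel .
      have "snd p = snd q" by (rule symdiff_left_eq) (rule z[unfolded 1])
      with 1 show "p = q" by (simp add: prod_eq_iff)
    qed
    show "?g ` (cocycles T \<times> coboundaries T') \<subseteq> cocycles T' \<times> coboundaries T"
    proof (rule image_subsetI)
      fix p assume "p \<in> cocycles T \<times> coboundaries T'"
      then have p: "fst p \<in> cocycles T" "snd p \<in> coboundaries T'" by (simp_all add: mem_Times_iff)
      show "?g p \<in> cocycles T' \<times> coboundaries T"
        using r[OF p] cocycles_symdiff[OF \<Phi>(1)[OF p(1)] T'.coboundaries_cocycles[OF p(2)]] by simp
    qed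
    show "finite (cocycles T' \<times> coboundaries T)" using T.finite_cochains T'.finite_cochains by simp
  qed
  then have 0: "card (cocycles T) * card (coboundaries T') \<le> card (cocycles T') * card (coboundaries T)"
    by (simp add: card_cartesian_product)
  have ne: "T \<noteq> {}" using T.boundary_nonempty by (auto simp: bd_edges_def edges_def)
  have "(2::nat) ^ (card (edges T) + card (verts T') + card T')
      = 2 ^ card (edges T) * 2 ^ card (verts T') * 2 ^ card T'" by (simp add: power_add)
  also have "\<dots> \<le> (card (cocycles T) * 2 ^ card T) * (2 * card (coboundaries T')) * 2 ^ card T'"
    by (intro mult_le_mono T.card_cocycles_ge T'.card_coboundaries_ge order_refl)
  also have "\<dots> = (card (cocycles T) * card (coboundaries T')) * (2 * 2 ^ card T * 2 ^ card T')" by (simp add: algebra_simps)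
  also have "\<dots> \<le> (card (cocycles T') * card (coboundaries T)) * (2 * 2 ^ card T * 2 ^ card T')"
    by (intro mult_le_mono 0 order_refl)
  also have "\<dots> = 2 ^ card T * (card (cocycles T') * 2 ^ card T') * (2 * card (coboundaries T))" by (simp add: algebra_simps)
  also have "\<dots> \<le> 2 ^ card T * 2 ^ card (edges T') * 2 ^ card (verts T)"
    by (intro mult_le_mono T'.card_cocycles_le T.card_coboundaries_le[OF ne] order_refl)
  also have "\<dots> = 2 ^ (card T + card (edges T') + card (verts T))" by (simp add: power_add)
  finally show ?thesis by (rule power_le_imp_le_exp[rotated]) simp
qed

section \<open>Contractible edges satisfy the link condition\<close>

locale contracted = stuck +
  fixes s y :: 'a
  assumes contractible: "contractible_edge F T s y"
begin

abbreviation (input) f :: "'a \<Rightarrow> 'a" where "f \<equiv> id(y := s)"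

abbreviation (input) T' :: "'a set set" where "T' \<equiv> collapse (id(y := s)) T"

lemma sy: "ed T s y" and ys: "y \<noteq> s" and simple: "simple_collapse f T" and tri': "triangulates T' F"
  using contractible unfolding contractible_edge_def by (auto simp: ed_def edges_def)

sublocale S: csurf T'
  by (rule triangulates_csurf[OF punctured tri'])

lemma collapse_adj: "ed T a b \<Longrightarrow> f a \<noteq> f b \<Longrightarrow> ed T' (f a) (f b)"
proof (rule collapse_ed[OF ys])
  fix b assume "fc T y s b" "bd T y b" "bd T s b"
  then have "bd T b y" "fc T b y s" "bd T b s" using bd_sym fc_rot by metis+
  then show False by (rule no_path2)
qed

lemma card_verts_le: "card (verts T) \<le> card (verts T') + 1"
proof -
  have "verts T - {y} \<subseteq> verts T'"
  proof
    fix z assume z: "z \<in> verts T - {y}"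
    then obtain t where t: "t \<in> T" "z \<in> t" by (auto simp: verts_def)
    obtain a b where ab: "fc T z a b" using face_star[OF t] by blast
    have "\<exists>a. ed T z a \<and> f a \<noteq> f z"
    proof (cases "f a = f z")
      case True
      then have "f b \<noteq> f z" using fc_neq[OF ab] ys by (auto split: if_splits)
      then show ?thesis using fc_ed[OF ab] by blast
    next
      case False
      then show ?thesis using fc_ed[OF ab] by blast
    qed
    then obtain a where a: "ed T z a" "f z \<noteq> f a" by metis
    show "z \<in> verts T'" using S.ed_verts[OF collapse_adj[OF a]] z by simp
  qed
  then have "card (verts T - {y}) \<le> card (verts T')" by (rule card_mono[OF S.finite_verts])
  then show ?thesis by (simp add: card_Diff_singleton_if split: if_splits)
qed

text \<open>The edges lost are \<open>ys\<close> itself and, for every common neighbour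
  \<open>z\<close>, the edge \<open>yz\<close>, which is merged with \<open>sz\<close>.\<close>

lemma card_edges_le: "card (edges T') + card {z. ed T s z \<and> ed T y z} + 1 \<le> card (edges T)"
proof -
  let ?C = "{z. ed T s z \<and> ed T y z}"
  let ?X = "insert {y,s} ((\<lambda>z. {y,z}) ` ?C)"
  have fC: "finite ?C" by (rule finite_subset[OF _ finite_nb[of s]]) (auto simp: nb_def)
  have X: "card ?X = card ?C + 1"
  proof -
    have "{y,s} \<notin> (\<lambda>z. {y,z}) ` ?C" using ys ed_neq[of T s s] by (auto simp: doubleton_eq_iff)
    moreover have "inj_on (\<lambda>z. {y,z}) ?C" by (rule inj_onI) (auto simp: doubleton_eq_iff)
    ultimately show ?thesis using fC by (simp add: card_image)
  qed
  have Xs: "?X \<subseteq> edges T" using sy by (auto simp: ed_def insert_commute)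
  have "edges T' \<subseteq> (`) f ` (edges T - ?X)"
  proof
    fix e assume e: "e \<in> edges T'"
    then obtain p q where pq: "e = {p,q}" "p \<noteq> q" unfolding edges_def card_2_iff by blast
    obtain t where t: "t \<in> T" "e \<subseteq> f ` t" using e by (auto simp: edges_def collapse_def)
    have "p \<in> f ` t" "q \<in> f ` t" using t(2) unfolding pq(1) by simp_all
    then obtain a b where ab: "a \<in> t" "b \<in> t" "p = f a" "q = f b" by blast
    have "a \<noteq> b" using pq(2) ab(3,4) by blast
    then have "ed T a b" using t(1) ab(1,2) by (auto simp: ed_def edges_def)
    have key: "e \<in> (`) f ` (edges T - ?X)" if ab: "ed T a b" "f a \<noteq> f b" "a \<noteq> y" "e = {f a, f b}" for a b
    proof (cases "b = y \<and> ed T s a")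
      case True
      have "{s,a} \<notin> ?X" using ys ab(3) by (auto simp: doubleton_eq_iff)
      moreover have "e = f ` {s,a}" using True ab ys by (simp add: insert_commute)
      moreover have "{s,a} \<in> edges T" using True by (simp add: ed_def)
      ultimately show ?thesis by (intro image_eqI[of _ _ "{s,a}"] DiffI)
    next
      case False
      have "{a,b} \<notin> ?X"
      proof
        assume "{a,b} \<in> ?X"
        then have "b = y \<and> (a = s \<or> ed T s a)" using ab(3) by (auto simp: doubleton_eq_iff)
        then show False using False ab(2) ys by auto
      qed
      moreover have "e = f ` {a,b}" using ab(4) by simp
      moreover have "{a,b} \<in> edges T" using ab(1) by (simp add: ed_def)
      ultimately show ?thesis by (intro image_eqI[of _ _ "{a,b}"] DiffI)
    qed
    show "e \<in> (`) f ` (edges T - ?X)"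
    proof (cases "a = y")
      case False
      then show ?thesis using key[of a b] \<open>ed T a b\<close> ab pq by simp
    next
      case True
      then have "b \<noteq> y" using pq(2) ab by auto
      then show ?thesis using key[of b a] ed_sym[OF \<open>ed T a b\<close>] ab pq by (simp add: insert_commute)
    qed
  qed
  then have "card (edges T') \<le> card (edges T - ?X)"
    using finite_edges by (intro surj_card_le) simp_all
  moreover have "card (edges T - ?X) = card (edges T) - card ?X"
    using Xs fC by (intro card_Diff_subset) auto
  moreover have "card ?X \<le> card (edges T)" by (rule card_mono[OF finite_edges Xs])
  ultimately show ?thesis using X by linarith
qed

text \<open>Only the faces at \<open>sy\<close> collapse, and by \<open>simple\<close> no two others
  are merged.\<close>

lemma card_faces_le: "card T \<le> card T' + card {z. fc T s y z}"
proof -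
  let ?S = "{t \<in> T. card (f ` t) = 3}"
  have fin': "finite {z. fc T s y z}"
    by (rule finite_subset[OF _ finite_nb[of s]]) (use fc_ed in \<open>auto simp: nb_def\<close>)
  have "T' = (`) f ` ?S" by (auto simp: collapse_def)
  then have 1: "card T' = card ?S"
    using card_image[OF simple[unfolded simple_collapse_def]] by (simp only:)
  have "T \<subseteq> ?S \<union> (\<lambda>z. {s,y,z}) ` {z. fc T s y z}"
  proof
    fix t assume t: "t \<in> T"
    show "t \<in> ?S \<union> (\<lambda>z. {s,y,z}) ` {z. fc T s y z}"
    proof (cases "s \<in> t \<and> y \<in> t")
      case True
      then obtain z where z: "t = {s,y,z}" using face_at[OF t, of s y] ys by blast
      then have "fc T s y z" using t by (simp add: fc_def)
      then show ?thesis using z by blast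
    next
      case False
      then have "inj_on f t" by (auto simp: inj_on_def)
      then have "card (f ` t) = 3" using c3[OF t] by (simp only: card_image)
      then show ?thesis using t by blast
    qed
  qed
  then have "card T \<le> card (?S \<union> (\<lambda>z. {s,y,z}) ` {z. fc T s y z})" using fin fin' by (intro card_mono) auto
  also have "\<dots> \<le> card ?S + card ((\<lambda>z. {s,y,z}) ` {z. fc T s y z})" by (rule card_Un_le)
  also have "\<dots> \<le> card T' + card {z. fc T s y z}" using 1 card_image_le[OF fin'] by simp
  finally show ?thesis .
qed

text \<open>
  Contracting \<open>sy\<close> increases the Euler characteristic by the number of common neighbours
  of \<open>s\<close> and \<open>y\<close> minus the number of faces at \<open>sy\<close>.
\<close>

lemma common_neighbour_face:
  assumes z: "ed T z s" "ed T z y"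
  shows "fc T s y z"
proof -
  let ?C = "{z. ed T s z \<and> ed T y z}" and ?A = "{z. fc T s y z}"
  have "top_of_set (realization T) homeomorphic_space F" using tri by (simp add: triangulates_def)
  moreover have "F homeomorphic_space top_of_set (realization T')"
    using tri' by (subst homeomorphic_space_sym) (simp add: triangulates_def)
  ultimately have "top_of_set (realization T) homeomorphic_space top_of_set (realization T')"
    by (rule homeomorphic_space_trans)
  from euler_characteristic_le[OF csurf_axioms S.csurf_axioms this]
  have "card ?C \<le> card ?A" using card_verts_le card_edges_le card_faces_le by linarith
  moreover have "?A \<subseteq> ?C" using fc_ed by blast
  moreover have "finite ?C" by (rule finite_subset[OF _ finite_nb[of s]]) (auto simp: nb_def)
  ultimately have "?A = ?C" by (intro card_seteq)
  moreover have "z \<in> ?C" using ed_sym[OF z(1)] ed_sym[OF z(2)] by simp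
  ultimately have "z \<in> ?A" by (elim equalityE) (rule subsetD)
  then show ?thesis by simp
qed

text \<open>The link of a boundary vertex is a path, and its other end gives the second boundary
  edge.\<close>

lemma bd_other: "bd T v p \<Longrightarrow> \<exists>q. q \<noteq> p \<and> bd T v q"
proof -
  assume b: "bd T v p"
  obtain n where n: "fc T v p n" using ed_fc[OF bd_ed[OF b]] by blast
  obtain r where r: "distinct (v # p # n # r)" "bd T v p \<Longrightarrow> bd T v (last (p # n # r))"
    by (rule fan_exists[OF n disjI1[OF b]]) blast
  have "last (p # n # r) \<noteq> p" using r(1) by (auto simp: last_ConsR split: if_splits)
  then show ?thesis using r(2)[OF b] by blast
qed

lemma face_lift:
  assumes e: "fc T' s p e" and p: "p \<noteq> s" "p \<noteq> y"
  shows "e \<noteq> s \<and> e \<noteq> y \<and> (fc T s p e \<or> fc T y p e)"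
proof -
  have d: "s \<noteq> p" "p \<noteq> e" "s \<noteq> e" using S.fc_neq[OF e] by auto
  obtain t where t: "t \<in> T" "{s,p,e} = f ` t" using e by (auto simp: fc_def collapse_def)
  have ey: "e \<noteq> y"
  proof
    assume "e = y"
    then have "y \<in> f ` t" using t(2) by blast
    then show False using ys by (auto split: if_splits)
  qed
  have im: "s \<in> f ` t" "p \<in> f ` t" "e \<in> f ` t" unfolding t(2)[symmetric] by simp_all
  have pt: "p \<in> t" using im(2) d(1) by (auto split: if_splits)
  have et: "e \<in> t" using im(3) d(3) by (auto split: if_splits)
  obtain x where x: "x \<in> t" "x = s \<or> x = y" using im(1) by (auto split: if_splits)
  have xp: "x \<noteq> p" "x \<noteq> e" using x(2) d ey p by auto
  obtain g where g: "t = {x,p,g}" using face_at[OF t(1) x(1) pt xp(1)] by blast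
  then have "g = e" using et xp d by auto
  then have "fc T x p e" using t(1) g by (simp add: fc_def)
  then show ?thesis using x(2) d ey by auto
qed

lemma face_push:
  assumes "fc T x p e" "x = s \<or> x = y" "p \<noteq> s" "p \<noteq> y" "e \<noteq> s" "e \<noteq> y"
  shows "fc T' s p e"
proof -
  have "fc T' (f x) (f p) (f e)"
    by (rule collapse_fc[OF assms(1)]) (use assms fc_neq[OF assms(1)] in auto)
  then show ?thesis using assms ys ys[symmetric] by auto
qed

text \<open>The boundary edge \<open>ap\<close> has one face. If this face survives,
  \<open>b\<close> is not adjacent to \<open>p\<close>, since a common neighbour would span a face
  with \<open>sy\<close>. If it collapses, \<open>bp\<close> has a further face, which becomes the
  only one at the merged edge.\<close>

lemma bd_push:
  assumes ab: "a = s \<and> b = y \<or> a = y \<and> b = s" and p: "p \<noteq> s" "p \<noteq> y" and bd: "bd T a p"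
  shows "bd T' s p"
proof -
  obtain q where q: "fc T a p q" using ed_fc[OF bd_ed[OF bd]] by blast
  have qn: "q \<noteq> a" "q \<noteq> p" using fc_neq[OF q] by auto
  have ap: "a \<noteq> p" "b \<noteq> p" using ab p by auto
  show ?thesis
  proof (cases "q = b")
    case False
    have nb: "\<not> ed T b p"
    proof
      assume bp: "ed T b p"
      have "fc T s y p" by (rule common_neighbour_face)
          (use ab ed_sym[OF bp] ed_sym[OF bd_ed[OF bd]] in auto)
      then have "fc T a p b" using ab by (auto dest: fc_swap fc_rot)
      then show False using bd_unique[OF bd q] False by simp
    qed
    show ?thesis
    proof (rule S.fc_bdI)
      show "fc T' s p q" by (rule face_push[OF q]) (use ab p qn False in auto)
      fix e assume "fc T' s p e"
      from face_lift[OF this p] have "fc T a p e \<or> fc T b p e" using ab by blast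
      then have "fc T a p e" using nb fc_ed by blast
      then show "e = q" using bd_unique[OF bd q] by simp
    qed
  next
    case True
    have bpa: "fc T b p a" using q unfolding True by (rule fc_swap[OF fc_rot[OF fc_rot]])
    have "\<not> bd T b p"
    proof
      assume "bd T b p"
      then have "bd T p a" "fc T p a b" "bd T p b"
        using bd_sym[OF bd] bd_sym[of T b p] fc_rot[OF bpa] fc_swap by blast+
      then show False by (rule no_path2)
    qed
    then obtain r where r: "fc T b p r" "r \<noteq> a" using inner_other[OF bpa] by blast
    have rn: "r \<noteq> b" using fc_neq[OF r(1)] by auto
    show ?thesis
    proof (rule S.fc_bdI)
      show "fc T' s p r" by (rule face_push[OF r(1)]) (use ab p rn r(2) in auto)
      fix e assume "fc T' s p e"
      from face_lift[OF this p] have e: "e \<noteq> a" "e \<noteq> b" "fc T a p e \<or> fc T b p e" using ab by auto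
      have "\<not> fc T a p e" using bd_unique[OF bd q, of e] e(2) True by auto
      then have "fc T b p e" using e(3) by simp
      then show "e = r" using fc_le2[OF bpa r(1) r(2)[symmetric], of e] e(1) by simp
    qed
  qed
qed

text \<open>
  If \<open>sy\<close> were an inner edge between boundary vertices, four boundary edges would meet in the
  vertex of the contracted triangulation.
\<close>

lemma boundary_edge:
  assumes "bv T s" "bv T y"
  shows "bd T s y"
proof (rule ccontr)
  assume n: "\<not> bd T s y"
  obtain p where p: "bd T s p" using assms(1) by (auto simp: bv_def)
  obtain p' where p': "p' \<noteq> p" "bd T s p'" using bd_other[OF p] by blast
  obtain q where q: "bd T y q" using assms(2) by (auto simp: bv_def)
  have ns: "u \<noteq> s \<and> u \<noteq> y" if "bd T s u" for u
    using that n ed_neq[OF bd_ed[OF that]] by auto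
  have ny: "u \<noteq> s \<and> u \<noteq> y" if "bd T y u" for u
    using that n bd_sym[OF that] ed_neq[OF bd_ed[OF that]] by auto
  \<comment> \<open>A vertex joined to both \<open>s\<close> and \<open>y\<close> by boundary edges
    would have degree 2, so the boundary edges at \<open>s\<close> and at \<open>y\<close> remain
    distinct after the contraction.\<close>
  have dj: "u \<noteq> q" if u: "bd T s u" for u
  proof
    assume uq: "u = q"
    have "ed T u s" "ed T u y"
      using ed_sym[OF bd_ed[OF u]] ed_sym[OF bd_ed[OF q]] unfolding uq by auto
    from common_neighbour_face[OF this] have "fc T u s y" by (rule fc_rot[OF fc_rot])
    moreover have "bd T u s" "bd T u y" using bd_sym[OF u] bd_sym[OF q] unfolding uq by auto
    ultimately show False using no_path2[of u s y] by blast
  qed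
  have "bd T' s p" "bd T' s p'" "bd T' s q"
    using bd_push[of s y p] bd_push[of s y p'] bd_push[of y s q] ns[OF p] ns[OF p'(2)] ny[OF q] p p' q by auto
  then have "q = p \<or> q = p'" using S.bd_le2[of s p p' q] p'(1) by auto
  then show False using dj[OF p] dj[OF p'(2)] by auto
qed

end

theorem (in stuck) irreducible: "irreducible_triangulation F T"
proof -
  have False if "contractible_edge F T s y" for s y
  proof -
    interpret contracted T F s y by unfold_locales (rule that)
    show False by (rule no_link_edge[OF sy common_neighbour_face boundary_edge])
  qed
  then show ?thesis unfolding irreducible_triangulation_def using tri by blast
qed

theorem theorem6:
  fixes F :: "'a topology" and T :: "'v set set"
  assumes "punctured_surface F"
    and not_disk: "\<not> F homeomorphic_space top_of_set (cball 0 1 :: (real^2) set)"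
    and "minimal4 F T"
  shows "\<exists>T'. (\<lambda>G G'. reduction4 F G G' \<or> diagonal_flip F G G')\<^sup>*\<^sup>* T T' \<and>
              irreducible_triangulation F T' \<and> triangulation4 F T'"
proof -
  have "triangulation4 F T" using assms(3) by (simp add: minimal4_def)
  then show ?thesis
  proof (induction "card (verts T)" arbitrary: T rule: less_induct)
    case less
    show ?case
    proof (cases "reducible F T")
      case True
      then obtain U where U: "(step F)\<^sup>*\<^sup>* T U" "triangulation4 F U" "card (verts U) < card (verts T)"
        unfolding reducible_def by blast
      obtain T' where "(step F)\<^sup>*\<^sup>* U T'" "irreducible_triangulation F T'" "triangulation4 F T'"
        using less.hyps[OF U(3,2)] by blast
      then show ?thesis using rtranclp_trans[OF U(1)] by blast
    next
      case False
      then interpret stuck T F using stuckI[OF assms(1) not_disk less.prems] by blast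
      show ?thesis using irreducible less.prems by blast
    qed
  qed
qed

end
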